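(* A complex supermanifold $\mathfrak X$ is split if and only if its Euler differential $\delta\epsilon_{\widehat{\mathfrak X}}\in H^1(X,T^{(1)}_{\mathfrak X})$ vanishes.
   Context: A complex supermanifold $\mathfrak X=(X,\mathcal O_{\mathfrak X})$ consists of a complex manifold $X$ (with sheaf of holomorphic functions $\mathcal O_X$) and a sheaf $\mathcal O_{\mathfrak X}$ of local supercommutative $\mathbb C$-algebras with an epimorphism $\mathcal O_{\mathfrak X}\to\mathcal O_X$, locally isomorphic to $\wedge^\bullet_{\mathcal O_X}\mathcal E$ for a locally free $\mathcal O_X$-module $\mathcal E$ of finite rank. Let $\mathcal J=\ker(\mathcal O_{\mathfrak X}\to\mathcal O_X)$ and $T^*_{X,-}=\mathcal J/\mathcal J^2$, with dual $T_{X,-}$. The split model is $\widehat{\mathfrak X}=(X,\wedge^\bullet_{\mathcal O_X}T^*_{X,-})$; $\mathfrak X$ is split if it is isomorphic to $\widehat{\mathfrak X}$. $T_{\mathfrak X}$ is the sheaf of $\mathbb C$-linear superderivations of $\mathcal O_{\mathfrak X}$; for $m\ge0$, $T^{(m)}_{\mathfrak X}=\{\nu\in T_{\mathfrak X}:\nu(\mathcal J^\ell)\subset\mathcal J^{\ell+m}\ \forall\ell\ge0\}$. On $\widehat{\mathfrak X}$, $T_{\widehat{\mathfrak X}}=\bigoplus_{m\ge-1}T^{\{m\}}_{\widehat{\mathfrak X}}$ where $T^{\{m\}}_{\widehat{\mathfrak X}}$ consists of derivations of $\mathbb Z$-degree $m$, and $T^{(m)}_{\mathfrak X}/T^{(m+1)}_{\mathfrak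 X}\cong T^{\{m\}}_{\widehat{\mathfrak X}}$. In particular there is an exact sequence $0\to T^{(1)}_{\mathfrak X}\to T^{(0)}_{\mathfrak X}\to T^{\{0\}}_{\widehat{\mathfrak X}}\to0$. There is an exact sequence $0\to\mathcal End_{\mathcal O_X}T^*_{X,-}\xrightarrow{i}T^{\{0\}}_{\widehat{\mathfrak X}}\to T_X\to0$. The Euler vector field is $\epsilon_{\widehat{\mathfrak X}}=i_*(\mathbf 1_{T^*_{X,-}})\in H^0(X,T^{\{0\}}_{\widehat{\mathfrak X}})$; locally $\sum_i\theta_i\partial/\partial\theta_i$. The Euler differential of $\mathfrak X$ is $\delta\epsilon_{\widehat{\mathfrak X}}$, where $\delta:H^0(X,T^{\{0\}}_{\widehat{\mathfrak X}})\to H^1(X,T^{(1)}_{\mathfrak X})$ is the connecting map of $0\to T^{(1)}_{\mathfrak X}\to T^{(0)}_{\mathfrak X}\to T^{\{0\}}_{\widehat{\mathfrak X}}\to0$. *)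

theory Defs
  imports "HOL-Analysis.Analysis" "HOL-Algebra.Module" "HOL-Algebra.AbelCoset"
    "HOL-Algebra.Ideal_Product"
begin

section \<open>Complex superalgebras\<close>

definition complex_ring :: "complex ring" where
  "complex_ring = \<lparr>carrier = UNIV, mult = (*), one = 1, zero = 0, add = (+)\<rparr>"

text \<open>Parities are Booleans, \<^term>\<open>True\<close> being odd, so that they add by exclusive or.\<close>

record 'a superalgebra = "(complex, 'a) module" +
  parity_part :: "bool \<Rightarrow> 'a set"

definition signed :: "('a, 'm) ring_scheme \<Rightarrow> bool \<Rightarrow> 'a \<Rightarrow> 'a" where
  "signed A b s = (if b then \<ominus>\<^bsub>A\<^esub> s else s)"

definition supercommutative_superalgebra :: "('a, 'm) superalgebra_scheme \<Rightarrow> bool" where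
  "supercommutative_superalgebra A \<longleftrightarrow>
     ring A \<and> Module.module complex_ring A \<and>
     (\<forall>c. \<forall>s \<in> carrier A. \<forall>t \<in> carrier A.
        (c \<odot>\<^bsub>A\<^esub> s) \<otimes>\<^bsub>A\<^esub> t = c \<odot>\<^bsub>A\<^esub> (s \<otimes>\<^bsub>A\<^esub> t) \<and>
        s \<otimes>\<^bsub>A\<^esub> (c \<odot>\<^bsub>A\<^esub> t) = c \<odot>\<^bsub>A\<^esub> (s \<otimes>\<^bsub>A\<^esub> t)) \<and>
     (\<forall>p. additive_subgroup (parity_part A p) A \<and>
        (\<forall>c. \<forall>s \<in> parity_part A p. c \<odot>\<^bsub>A\<^esub> s \<in> parity_part A p)) \<and>
     (\<forall>s \<in> carrier A. \<exists>!(u, v). u \<in> parity_part A False \<and> v \<in> parity_part A True \<and>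
        s = u \<oplus>\<^bsub>A\<^esub> v) \<and>
     (\<forall>p q. \<forall>s \<in> parity_part A p. \<forall>t \<in> parity_part A q.
        s \<otimes>\<^bsub>A\<^esub> t \<in> parity_part A (p \<noteq> q) \<and>
        s \<otimes>\<^bsub>A\<^esub> t = signed A (p \<and> q) (t \<otimes>\<^bsub>A\<^esub> s))"

definition superalgebra_hom ::
  "('a, 'm) superalgebra_scheme \<Rightarrow> ('b, 'n) superalgebra_scheme \<Rightarrow> ('a \<Rightarrow> 'b) \<Rightarrow> bool" where
  "superalgebra_hom A B f \<longleftrightarrow>
     f \<in> ring_hom A B \<and>
     (\<forall>c. \<forall>s \<in> carrier A. f (c \<odot>\<^bsub>A\<^esub> s) = c \<odot>\<^bsub>B\<^esub> f s) \<and>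
     (\<forall>p. f ` parity_part A p \<subseteq> parity_part B p)"

text \<open>A superderivation that is homogeneous of parity \<open>p\<close>.\<close>

definition homogeneous_superderivation ::
  "('a, 'm) superalgebra_scheme \<Rightarrow> bool \<Rightarrow> ('a \<Rightarrow> 'a) \<Rightarrow> bool" where
  "homogeneous_superderivation A p D \<longleftrightarrow>
     D \<in> carrier A \<rightarrow> carrier A \<and>
     (\<forall>s \<in> carrier A. \<forall>t \<in> carrier A. D (s \<oplus>\<^bsub>A\<^esub> t) = D s \<oplus>\<^bsub>A\<^esub> D t) \<and>
     (\<forall>c. \<forall>s \<in> carrier A. D (c \<odot>\<^bsub>A\<^esub> s) = c \<odot>\<^bsub>A\<^esub> D s) \<and>
     (\<forall>q. D ` parity_part A q \<subseteq> parity_part A (p \<noteq> q)) \<and>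
     (\<forall>q. \<forall>s \<in> parity_part A q. \<forall>t \<in> carrier A.
        D (s \<otimes>\<^bsub>A\<^esub> t) = (D s \<otimes>\<^bsub>A\<^esub> t) \<oplus>\<^bsub>A\<^esub> signed A (p \<and> q) (s \<otimes>\<^bsub>A\<^esub> D t))"

primrec ideal_pow :: "('a, 'm) ring_scheme \<Rightarrow> 'a set \<Rightarrow> nat \<Rightarrow> 'a set" where
  "ideal_pow A I 0 = carrier A"
| "ideal_pow A I (Suc l) = ideal_prod A (ideal_pow A I l) I"

text \<open>
  Abelian groups are written additively, hence as ring records; the multiplicative fields of such
  a record carry no meaning.
\<close>

definition additive_group :: "'a set \<Rightarrow> 'a \<Rightarrow> ('a \<Rightarrow> 'a \<Rightarrow> 'a) \<Rightarrow> 'a ring" where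
  "additive_group C z p = \<lparr>carrier = C, mult = undefined, one = undefined, zero = z, add = p\<rparr>"


section \<open>The exterior algebra of a module\<close>

text \<open>
  The exterior algebra of an \<open>R\<close>-module \<open>M\<close> is the associative unital \<open>R\<close>-algebra generated by
  the elements of \<open>M\<close>, subject to additivity and \<open>R\<close>-linearity of the generators (which yields
  the tensor algebra) and to \<open>m * m = 0\<close>.  Its elements are classes of terms in scalars and
  generators.  The relation \<open>ext_eq\<close> lists the axioms of an associative \<open>R\<close>-algebra and these
  relations.  Additive inverses need no term constructor: \<open>a + (-1) a = 0 a = 0\<close>.
\<close>

datatype (ext_scalars: 'r, ext_gens: 'm) ext_term =
    EScal 'r
  | EGen 'm
  | ESum "('r, 'm) ext_term" "('r, 'm) ext_term"
  | EProd "('r, 'm) ext_term" "('r, 'm) ext_term"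
  for map: map_ext_term

definition ext_terms ::
  "('r, 'k) ring_scheme \<Rightarrow> ('c, 'm, 'l) module_scheme \<Rightarrow> ('r, 'm) ext_term set" where
  "ext_terms R M = {e. ext_scalars e \<subseteq> carrier R \<and> ext_gens e \<subseteq> carrier M}"

inductive ext_eq ::
  "('r, 'k) ring_scheme \<Rightarrow> ('r, 'm, 'l) module_scheme \<Rightarrow>
   ('r, 'm) ext_term \<Rightarrow> ('r, 'm) ext_term \<Rightarrow> bool"
  for R M where
  ext_refl: "a \<in> ext_terms R M \<Longrightarrow> ext_eq R M a a"
| ext_sym: "ext_eq R M a b \<Longrightarrow> ext_eq R M b a"
| ext_trans: "ext_eq R M a b \<Longrightarrow> ext_eq R M b c \<Longrightarrow> ext_eq R M a c"
| ext_sum_cong: "ext_eq R M a a' \<Longrightarrow> ext_eq R M b b' \<Longrightarrow> ext_eq R M (ESum a b) (ESum a' b')"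
| ext_prod_cong: "ext_eq R M a a' \<Longrightarrow> ext_eq R M b b' \<Longrightarrow> ext_eq R M (EProd a b) (EProd a' b')"
| ext_sum_assoc: "\<lbrakk>a \<in> ext_terms R M; b \<in> ext_terms R M; c \<in> ext_terms R M\<rbrakk> \<Longrightarrow>
    ext_eq R M (ESum (ESum a b) c) (ESum a (ESum b c))"
| ext_sum_comm: "\<lbrakk>a \<in> ext_terms R M; b \<in> ext_terms R M\<rbrakk> \<Longrightarrow>
    ext_eq R M (ESum a b) (ESum b a)"
| ext_sum_zero: "a \<in> ext_terms R M \<Longrightarrow> ext_eq R M (ESum (EScal \<zero>\<^bsub>R\<^esub>) a) a"
| ext_prod_assoc: "\<lbrakk>a \<in> ext_terms R M; b \<in> ext_terms R M; c \<in> ext_terms R M\<rbrakk> \<Longrightarrow>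
    ext_eq R M (EProd (EProd a b) c) (EProd a (EProd b c))"
| ext_distrib_left: "\<lbrakk>a \<in> ext_terms R M; b \<in> ext_terms R M; c \<in> ext_terms R M\<rbrakk> \<Longrightarrow>
    ext_eq R M (EProd a (ESum b c)) (ESum (EProd a b) (EProd a c))"
| ext_distrib_right: "\<lbrakk>a \<in> ext_terms R M; b \<in> ext_terms R M; c \<in> ext_terms R M\<rbrakk> \<Longrightarrow>
    ext_eq R M (EProd (ESum a b) c) (ESum (EProd a c) (EProd b c))"
| ext_prod_one: "a \<in> ext_terms R M \<Longrightarrow> ext_eq R M (EProd (EScal \<one>\<^bsub>R\<^esub>) a) a"
| ext_prod_zero: "a \<in> ext_terms R M \<Longrightarrow> ext_eq R M (EProd (EScal \<zero>\<^bsub>R\<^esub>) a) (EScal \<zero>\<^bsub>R\<^esub>)"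
| ext_scal_central: "\<lbrakk>r \<in> carrier R; a \<in> ext_terms R M\<rbrakk> \<Longrightarrow>
    ext_eq R M (EProd a (EScal r)) (EProd (EScal r) a)"
| ext_scal_add: "\<lbrakk>r \<in> carrier R; s \<in> carrier R\<rbrakk> \<Longrightarrow>
    ext_eq R M (EScal (r \<oplus>\<^bsub>R\<^esub> s)) (ESum (EScal r) (EScal s))"
| ext_scal_mult: "\<lbrakk>r \<in> carrier R; s \<in> carrier R\<rbrakk> \<Longrightarrow>
    ext_eq R M (EScal (r \<otimes>\<^bsub>R\<^esub> s)) (EProd (EScal r) (EScal s))"
| ext_gen_add: "\<lbrakk>m \<in> carrier M; n \<in> carrier M\<rbrakk> \<Longrightarrow>
    ext_eq R M (EGen (m \<oplus>\<^bsub>M\<^esub> n)) (ESum (EGen m) (EGen n))"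
| ext_gen_smult: "\<lbrakk>r \<in> carrier R; m \<in> carrier M\<rbrakk> \<Longrightarrow>
    ext_eq R M (EGen (r \<odot>\<^bsub>M\<^esub> m)) (EProd (EScal r) (EGen m))"
| ext_gen_square: "m \<in> carrier M \<Longrightarrow>
    ext_eq R M (EProd (EGen m) (EGen m)) (EScal \<zero>\<^bsub>R\<^esub>)"

definition ext_class ::
  "('r, 'k) ring_scheme \<Rightarrow> ('r, 'm, 'l) module_scheme \<Rightarrow>
   ('r, 'm) ext_term \<Rightarrow> ('r, 'm) ext_term set" where
  "ext_class R M e = {e'. ext_eq R M e e'}"

text \<open>Terms of pure degree in \<open>\<int>\<close>; the zero scalar has every degree.\<close>

inductive ext_homogeneous :: "('r, 'k) ring_scheme \<Rightarrow> int \<Rightarrow> ('r, 'm) ext_term \<Rightarrow> bool"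
  for R where
  "ext_homogeneous R k (EScal \<zero>\<^bsub>R\<^esub>)"
| "ext_homogeneous R 0 (EScal r)"
| "ext_homogeneous R 1 (EGen m)"
| "ext_homogeneous R k a \<Longrightarrow> ext_homogeneous R k b \<Longrightarrow> ext_homogeneous R k (ESum a b)"
| "ext_homogeneous R k a \<Longrightarrow> ext_homogeneous R l b \<Longrightarrow> ext_homogeneous R (k + l) (EProd a b)"

inductive ext_parity :: "bool \<Rightarrow> ('r, 'm) ext_term \<Rightarrow> bool" where
  "ext_parity False (EScal r)"
| "ext_parity True (EGen m)"
| "ext_parity p a \<Longrightarrow> ext_parity p b \<Longrightarrow> ext_parity p (ESum a b)"
| "ext_parity p a \<Longrightarrow> ext_parity q b \<Longrightarrow> ext_parity (p \<noteq> q) (EProd a b)"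

definition ext_grade ::
  "('r, 'k) ring_scheme \<Rightarrow> ('r, 'm, 'l) module_scheme \<Rightarrow> int \<Rightarrow> ('r, 'm) ext_term set set" where
  "ext_grade R M k = ext_class R M ` {e \<in> ext_terms R M. ext_homogeneous R k e}"

definition exterior_algebra ::
  "('r, 'k) superalgebra_scheme \<Rightarrow> ('r, 'm, 'l) module_scheme \<Rightarrow>
   ('r, 'm) ext_term set superalgebra" where
  "exterior_algebra R M =
     \<lparr>carrier = ext_class R M ` ext_terms R M,
      mult = (\<lambda>a b. \<Union>d \<in> a. \<Union>e \<in> b. ext_class R M (EProd d e)),
      one = ext_class R M (EScal \<one>\<^bsub>R\<^esub>),
      zero = ext_class R M (EScal \<zero>\<^bsub>R\<^esub>),
      add = (\<lambda>a b. \<Union>d \<in> a. \<Union>e \<in> b. ext_class R M (ESum d e)),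
      smult = (\<lambda>c a. \<Union>e \<in> a. ext_class R M (EProd (EScal (c \<odot>\<^bsub>R\<^esub> \<one>\<^bsub>R\<^esub>)) e)),
      parity_part = (\<lambda>p. ext_class R M ` {e \<in> ext_terms R M. ext_parity p e})\<rparr>"

text \<open>The augmentation of the exterior algebra onto \<open>R\<close>, on terms.\<close>

primrec ext_aug :: "('r, 'k) ring_scheme \<Rightarrow> ('r, 'm) ext_term \<Rightarrow> 'r" where
  "ext_aug R (EScal r) = r"
| "ext_aug R (EGen m) = \<zero>\<^bsub>R\<^esub>"
| "ext_aug R (ESum a b) = ext_aug R a \<oplus>\<^bsub>R\<^esub> ext_aug R b"
| "ext_aug R (EProd a b) = ext_aug R a \<otimes>\<^bsub>R\<^esub> ext_aug R b"


section \<open>Sheaves\<close>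

text \<open>
  Only the values of \<open>sec\<close> at open sets and of \<open>rst U V\<close> for open \<open>V \<subseteq> U\<close> matter.
\<close>

record ('x, 'a, 's) presheaf =
  sec :: "'x set \<Rightarrow> 's"
  rst :: "'x set \<Rightarrow> 'x set \<Rightarrow> 'a \<Rightarrow> 'a"

definition is_presheaf ::
  "'x topology \<Rightarrow> ('x, 'a, ('a, 'm) partial_object_scheme) presheaf \<Rightarrow> bool" where
  "is_presheaf X F \<longleftrightarrow>
     (\<forall>U V. openin X U \<and> openin X V \<and> V \<subseteq> U \<longrightarrow>
        rst F U V \<in> carrier (sec F U) \<rightarrow> carrier (sec F V)) \<and>
     (\<forall>U. openin X U \<longrightarrow> (\<forall>s \<in> carrier (sec F U). rst F U U s = s)) \<and>
     (\<forall>U V W. openin X U \<and> openin X V \<and> openin X W \<and> W \<subseteq> V \<and> V \<subseteq> U \<longrightarrow>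
        (\<forall>s \<in> carrier (sec F U). rst F V W (rst F U V s) = rst F U W s))"

definition is_sheaf ::
  "'x topology \<Rightarrow> ('x, 'a, ('a, 'm) partial_object_scheme) presheaf \<Rightarrow> bool" where
  "is_sheaf X F \<longleftrightarrow> is_presheaf X F \<and>
     (\<forall>\<U> s. (\<forall>V \<in> \<U>. openin X V \<and> s V \<in> carrier (sec F V)) \<and>
        (\<forall>V \<in> \<U>. \<forall>W \<in> \<U>. rst F V (V \<inter> W) (s V) = rst F W (V \<inter> W) (s W)) \<longrightarrow>
        (\<exists>!t. t \<in> carrier (sec F (\<Union>\<U>)) \<and> (\<forall>V \<in> \<U>. rst F (\<Union>\<U>) V t = s V)))"

type_synonym ('x, 'a) superalgebra_sheaf = "('x, 'a, 'a superalgebra) presheaf"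
type_synonym ('x, 'a) group_sheaf = "('x, 'a, 'a ring) presheaf"
type_synonym ('x, 'r, 'a) module_sheaf = "('x, 'a, ('r, 'a) module) presheaf"

definition sheaf_of_supercommutative_algebras ::
  "'x topology \<Rightarrow> ('x, 'a) superalgebra_sheaf \<Rightarrow> bool" where
  "sheaf_of_supercommutative_algebras X F \<longleftrightarrow> is_sheaf X F \<and>
     (\<forall>U. openin X U \<longrightarrow> supercommutative_superalgebra (sec F U)) \<and>
     (\<forall>U V. openin X U \<and> openin X V \<and> V \<subseteq> U \<longrightarrow>
        superalgebra_hom (sec F U) (sec F V) (rst F U V))"

definition sheaf_of_modules ::
  "'x topology \<Rightarrow> ('x, 'r) superalgebra_sheaf \<Rightarrow> ('x, 'r, 'm) module_sheaf \<Rightarrow> bool" where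
  "sheaf_of_modules X R E \<longleftrightarrow> is_sheaf X E \<and>
     (\<forall>U. openin X U \<longrightarrow> Module.module (sec R U) (sec E U)) \<and>
     (\<forall>U V. openin X U \<and> openin X V \<and> V \<subseteq> U \<longrightarrow>
        (\<forall>s \<in> carrier (sec E U). \<forall>t \<in> carrier (sec E U).
           rst E U V (s \<oplus>\<^bsub>sec E U\<^esub> t) = rst E U V s \<oplus>\<^bsub>sec E V\<^esub> rst E U V t) \<and>
        (\<forall>f \<in> carrier (sec R U). \<forall>s \<in> carrier (sec E U).
           rst E U V (f \<odot>\<^bsub>sec E U\<^esub> s) = rst R U V f \<odot>\<^bsub>sec E V\<^esub> rst E U V s))"

definition locally_free_of_finite_rank ::
  "'x topology \<Rightarrow> ('x, 'r) superalgebra_sheaf \<Rightarrow> ('x, 'r, 'm) module_sheaf \<Rightarrow> bool" where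
  "locally_free_of_finite_rank X R E \<longleftrightarrow>
     (\<forall>x \<in> topspace X. \<exists>V (r::nat) e. openin X V \<and> x \<in> V \<and> (\<forall>i<r. e i \<in> carrier (sec E V)) \<and>
        (\<forall>W. openin X W \<and> W \<subseteq> V \<longrightarrow>
           (\<forall>t \<in> carrier (sec E W). \<exists>!f. f \<in> {..<r} \<rightarrow>\<^sub>E carrier (sec R W) \<and>
              t = (\<Oplus>\<^bsub>sec E W\<^esub>i\<in>{..<r}. f i \<odot>\<^bsub>sec E W\<^esub> rst E V W (e i)))))"

text \<open>The stalks of \<open>F\<close> are local: the non-units of each stalk form a proper additive subgroup.\<close>

definition unit_at ::
  "'x topology \<Rightarrow> ('x, 'a) superalgebra_sheaf \<Rightarrow> 'x \<Rightarrow> 'x set \<Rightarrow> 'a \<Rightarrow> bool" where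
  "unit_at X F x U s \<longleftrightarrow>
     (\<exists>V. openin X V \<and> x \<in> V \<and> V \<subseteq> U \<and> rst F U V s \<in> Units (sec F V))"

definition local_stalks :: "'x topology \<Rightarrow> ('x, 'a) superalgebra_sheaf \<Rightarrow> bool" where
  "local_stalks X F \<longleftrightarrow>
     (\<forall>U x. openin X U \<and> x \<in> U \<longrightarrow> \<not> unit_at X F x U \<zero>\<^bsub>sec F U\<^esub> \<and>
        (\<forall>s \<in> carrier (sec F U). \<forall>t \<in> carrier (sec F U).
           unit_at X F x U (s \<oplus>\<^bsub>sec F U\<^esub> t) \<longrightarrow> unit_at X F x U s \<or> unit_at X F x U t))"

definition superalgebra_sheaf_hom ::
  "'x topology \<Rightarrow> ('x, 'a) superalgebra_sheaf \<Rightarrow> ('x, 'b) superalgebra_sheaf \<Rightarrow>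
   ('x set \<Rightarrow> 'a \<Rightarrow> 'b) \<Rightarrow> bool" where
  "superalgebra_sheaf_hom X F G \<phi> \<longleftrightarrow>
     (\<forall>U. openin X U \<longrightarrow> superalgebra_hom (sec F U) (sec G U) (\<phi> U)) \<and>
     (\<forall>U V. openin X U \<and> openin X V \<and> V \<subseteq> U \<longrightarrow>
        (\<forall>s \<in> carrier (sec F U). \<phi> V (rst F U V s) = rst G U V (\<phi> U s)))"

definition sheaf_epimorphism ::
  "'x topology \<Rightarrow> ('x, 'a) superalgebra_sheaf \<Rightarrow> ('x, 'b) superalgebra_sheaf \<Rightarrow>
   ('x set \<Rightarrow> 'a \<Rightarrow> 'b) \<Rightarrow> bool" where
  "sheaf_epimorphism X F G \<phi> \<longleftrightarrow> superalgebra_sheaf_hom X F G \<phi> \<and>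
     (\<forall>U. openin X U \<longrightarrow> (\<forall>t \<in> carrier (sec G U). \<forall>x \<in> U.
        \<exists>V. openin X V \<and> x \<in> V \<and> V \<subseteq> U \<and> (\<exists>s \<in> carrier (sec F V). \<phi> V s = rst G U V t)))"

subsection \<open>Sheafification\<close>

text \<open>
  A section over \<open>U\<close> of the sheaf associated with a presheaf \<open>F\<close> is a function assigning to each
  point of \<open>U\<close> a germ of \<open>F\<close> there, and given locally by sections of \<open>F\<close>.  Operations on \<open>F\<close> are
  carried over germwise, by unions over representatives.
\<close>

type_synonym ('x, 'a) germ_fun = "'x \<Rightarrow> ('x set \<times> 'a) set"

definition germ ::
  "'x topology \<Rightarrow> ('x, 'a, ('a, 'm) partial_object_scheme) presheaf \<Rightarrow>
   'x \<Rightarrow> 'x set \<Rightarrow> 'a \<Rightarrow> ('x set \<times> 'a) set" where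
  "germ X F x U s = {(V, t). openin X V \<and> x \<in> V \<and> t \<in> carrier (sec F V) \<and>
     (\<exists>W. openin X W \<and> x \<in> W \<and> W \<subseteq> U \<inter> V \<and> rst F U W s = rst F V W t)}"

definition germ_section ::
  "'x topology \<Rightarrow> ('x, 'a, ('a, 'm) partial_object_scheme) presheaf \<Rightarrow>
   'x set \<Rightarrow> 'a \<Rightarrow> ('x, 'a) germ_fun" where
  "germ_section X F U s = (\<lambda>x\<in>U. germ X F x U s)"

text \<open>The sections that come locally from sections of \<open>F\<close> lying in \<open>P\<close>.\<close>

definition germ_sections ::
  "'x topology \<Rightarrow> ('x, 'a, ('a, 'm) partial_object_scheme) presheaf \<Rightarrow>
   ('x set \<Rightarrow> 'a set) \<Rightarrow> 'x set \<Rightarrow> ('x, 'a) germ_fun set" where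
  "germ_sections X F P U = {g \<in> extensional U.
     \<forall>x \<in> U. \<exists>V s. openin X V \<and> x \<in> V \<and> V \<subseteq> U \<and> s \<in> P V \<and> (\<forall>y \<in> V. g y = germ X F y V s)}"

definition germ_op ::
  "'x topology \<Rightarrow> ('x, 'a, ('a, 'm) partial_object_scheme) presheaf \<Rightarrow>
   ('x set \<Rightarrow> 'a \<Rightarrow> 'a \<Rightarrow> 'a) \<Rightarrow> 'x set \<Rightarrow>
   ('x, 'a) germ_fun \<Rightarrow> ('x, 'a) germ_fun \<Rightarrow> ('x, 'a) germ_fun" where
  "germ_op X F p U g h = (\<lambda>x\<in>U. \<Union>(V, s) \<in> g x. \<Union>(W, t) \<in> h x.
     germ X F x (V \<inter> W) (p (V \<inter> W) (rst F V (V \<inter> W) s) (rst F W (V \<inter> W) t)))"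

definition sheafify ::
  "'x topology \<Rightarrow> ('x, 'a) superalgebra_sheaf \<Rightarrow> ('x, ('x, 'a) germ_fun) superalgebra_sheaf" where
  "sheafify X F =
     \<lparr>sec = (\<lambda>U.
        \<lparr>carrier = germ_sections X F (\<lambda>V. carrier (sec F V)) U,
         mult = germ_op X F (\<lambda>V. mult (sec F V)) U,
         one = germ_section X F U \<one>\<^bsub>sec F U\<^esub>,
         zero = germ_section X F U \<zero>\<^bsub>sec F U\<^esub>,
         add = germ_op X F (\<lambda>V. add (sec F V)) U,
         smult = (\<lambda>c g. \<lambda>x\<in>U. \<Union>(V, s) \<in> g x. germ X F x V (c \<odot>\<^bsub>sec F V\<^esub> s)),
         parity_part = (\<lambda>p. germ_sections X F (\<lambda>V. parity_part (sec F V) p) U)\<rparr>),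
      rst = (\<lambda>U V g. restrict g V)\<rparr>"

subsection \<open>The exterior algebra of a sheaf of modules\<close>

definition exterior_presheaf ::
  "('x, 'r) superalgebra_sheaf \<Rightarrow> ('x, 'r, 'm) module_sheaf \<Rightarrow>
   ('x, ('r, 'm) ext_term set) superalgebra_sheaf" where
  "exterior_presheaf R E =
     \<lparr>sec = (\<lambda>U. exterior_algebra (sec R U) (sec E U)),
      rst = (\<lambda>U V a. \<Union>e \<in> a.
        ext_class (sec R V) (sec E V) (map_ext_term (rst R U V) (rst E U V) e))\<rparr>"

type_synonym ('x, 'r, 'm) ext_section = "('x, ('r, 'm) ext_term set) germ_fun"

definition exterior_sheaf ::
  "'x topology \<Rightarrow> ('x, 'r) superalgebra_sheaf \<Rightarrow> ('x, 'r, 'm) module_sheaf \<Rightarrow>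
   ('x, ('x, 'r, 'm) ext_section) superalgebra_sheaf" where
  "exterior_sheaf X R E = sheafify X (exterior_presheaf R E)"

definition exterior_power_sections ::
  "'x topology \<Rightarrow> ('x, 'r) superalgebra_sheaf \<Rightarrow> ('x, 'r, 'm) module_sheaf \<Rightarrow>
   int \<Rightarrow> 'x set \<Rightarrow> ('x, 'r, 'm) ext_section set" where
  "exterior_power_sections X R E k =
     germ_sections X (exterior_presheaf R E) (\<lambda>V. ext_grade (sec R V) (sec E V) k)"

definition scalar_section ::
  "'x topology \<Rightarrow> ('x, 'r) superalgebra_sheaf \<Rightarrow> ('x, 'r, 'm) module_sheaf \<Rightarrow>
   'x set \<Rightarrow> 'r \<Rightarrow> ('x, 'r, 'm) ext_section" where
  "scalar_section X R E U f =
     germ_section X (exterior_presheaf R E) U (ext_class (sec R U) (sec E U) (EScal f))"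

definition generator_section ::
  "'x topology \<Rightarrow> ('x, 'r) superalgebra_sheaf \<Rightarrow> ('x, 'r, 'm) module_sheaf \<Rightarrow>
   'x set \<Rightarrow> 'm \<Rightarrow> ('x, 'r, 'm) ext_section" where
  "generator_section X R E U t =
     germ_section X (exterior_presheaf R E) U (ext_class (sec R U) (sec E U) (EGen t))"

text \<open>
  The projection of the exterior algebra onto its scalars, when the latter are functions on \<open>X\<close>:
  the value at \<open>x\<close> is computed from any term representing the germ at \<open>x\<close>.
\<close>

definition exterior_projection ::
  "('x, 'x \<Rightarrow> complex) superalgebra_sheaf \<Rightarrow>
   'x set \<Rightarrow> ('x, 'x \<Rightarrow> complex, 'm) ext_section \<Rightarrow> 'x \<Rightarrow> complex" where
  "exterior_projection R U g =
     (\<lambda>x\<in>U. THE c. \<exists>V a e. (V, a) \<in> g x \<and> e \<in> a \<and> c = ext_aug (sec R V) e x)"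

subsection \<open>First cohomology\<close>

text \<open>
  Cech cohomology in degree one, as a direct limit over open covers.  Covers are indexed by the
  points of the space, with \<open>x \<in> U x\<close>; every open cover is refined by one of this form.  A class is
  a set of pairs of a cover and a cocycle on it.
\<close>

definition point_cover :: "'x topology \<Rightarrow> ('x \<Rightarrow> 'x set) \<Rightarrow> bool" where
  "point_cover X U \<longleftrightarrow> (\<forall>x \<in> topspace X. openin X (U x) \<and> x \<in> U x)"

type_synonym ('x, 'a) cochain = "('x \<Rightarrow> 'x set) \<times> ('x \<Rightarrow> 'x \<Rightarrow> 'a)"

definition cocycles :: "'x topology \<Rightarrow> ('x, 'a) group_sheaf \<Rightarrow> ('x, 'a) cochain set" where
  "cocycles X F = {(U, c). point_cover X U \<and>
     (\<forall>x \<in> topspace X. \<forall>y \<in> topspace X. c x y \<in> carrier (sec F (U x \<inter> U y))) \<and>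
     (\<forall>x \<in> topspace X. \<forall>y \<in> topspace X. \<forall>z \<in> topspace X.
        let W = U x \<inter> U y \<inter> U z in
        rst F (U x \<inter> U z) W (c x z) =
          rst F (U x \<inter> U y) W (c x y) \<oplus>\<^bsub>sec F W\<^esub> rst F (U y \<inter> U z) W (c y z))}"

definition cohomologous ::
  "'x topology \<Rightarrow> ('x, 'a) group_sheaf \<Rightarrow> (('x, 'a) cochain \<times> ('x, 'a) cochain) set" where
  "cohomologous X F = {((U, c), (V, d)). (U, c) \<in> cocycles X F \<and> (V, d) \<in> cocycles X F \<and>
     (\<exists>W h. point_cover X W \<and>
        (\<forall>x \<in> topspace X. W x \<subseteq> U x \<inter> V x \<and> h x \<in> carrier (sec F (W x))) \<and>
        (\<forall>x \<in> topspace X. \<forall>y \<in> topspace X.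
           let O' = W x \<inter> W y in
           rst F (U x \<inter> U y) O' (c x y) =
             rst F (V x \<inter> V y) O' (d x y) \<oplus>\<^bsub>sec F O'\<^esub>
               (rst F (W y) O' (h y) \<ominus>\<^bsub>sec F O'\<^esub> rst F (W x) O' (h x))))}"

definition cohomology_class ::
  "'x topology \<Rightarrow> ('x, 'a) group_sheaf \<Rightarrow> ('x, 'a) cochain \<Rightarrow> ('x, 'a) cochain set" where
  "cohomology_class X F c = cohomologous X F `` {c}"

definition H1 :: "'x topology \<Rightarrow> ('x, 'a) group_sheaf \<Rightarrow> ('x, 'a) cochain set ring" where
  "H1 X F = additive_group
     (cocycles X F // cohomologous X F)
     (cohomology_class X F (\<lambda>x. topspace X, \<lambda>x y. \<zero>\<^bsub>sec F (topspace X)\<^esub>))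
     (\<lambda>A B. \<Union>(U, c) \<in> A. \<Union>(V, d) \<in> B. cohomology_class X F
        (\<lambda>x. U x \<inter> V x,
         \<lambda>x y. let W = U x \<inter> V x \<inter> (U y \<inter> V y) in
           rst F (U x \<inter> U y) W (c x y) \<oplus>\<^bsub>sec F W\<^esub> rst F (V x \<inter> V y) W (d x y)))"

text \<open>
  The connecting map of a short exact sequence \<open>0 \<rightarrow> A \<rightarrow> B \<rightarrow> C \<rightarrow> 0\<close>, where \<open>A\<close> is a subsheaf of
  \<open>B\<close> and \<open>q\<close> is the map from \<open>B\<close> to \<open>C\<close>: lift the global section \<open>s\<close> of \<open>C\<close> locally to \<open>B\<close> and
  take the class of the differences of the lifts.
\<close>

definition connecting_map ::
  "'x topology \<Rightarrow> ('x, 'a) group_sheaf \<Rightarrow> ('x, 'a) group_sheaf \<Rightarrow> ('x, 'b) group_sheaf \<Rightarrow>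
   ('x set \<Rightarrow> 'a \<Rightarrow> 'b) \<Rightarrow> 'b \<Rightarrow> ('x, 'a) cochain set" where
  "connecting_map X A B C q s = (THE H. \<exists>U b. point_cover X U \<and>
     (\<forall>x \<in> topspace X. b x \<in> carrier (sec B (U x)) \<and>
        q (U x) (b x) = rst C (topspace X) (U x) s) \<and>
     H = cohomology_class X A
       (U, \<lambda>x y. let W = U x \<inter> U y in
          rst B (U y) W (b y) \<ominus>\<^bsub>sec B W\<^esub> rst B (U x) W (b x)))"

subsection \<open>Superderivations\<close>

text \<open>
  A section over \<open>U\<close> of the sheaf of superderivations is a derivation of the restriction of the
  sheaf to \<open>U\<close>, i.e. a compatible family over the open subsets of \<open>U\<close>.
\<close>

type_synonym ('x, 'a) derivation = "'x set \<Rightarrow> 'a \<Rightarrow> 'a"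

definition sheaf_superderivation ::
  "'x topology \<Rightarrow> ('x, 'a) superalgebra_sheaf \<Rightarrow> 'x set \<Rightarrow> bool \<Rightarrow> ('x, 'a) derivation \<Rightarrow> bool" where
  "sheaf_superderivation X F U p D \<longleftrightarrow>
     (\<forall>V. openin X V \<and> V \<subseteq> U \<longrightarrow> homogeneous_superderivation (sec F V) p (D V)) \<and>
     (\<forall>V W. openin X V \<and> openin X W \<and> W \<subseteq> V \<and> V \<subseteq> U \<longrightarrow>
        (\<forall>s \<in> carrier (sec F V). D W (rst F V W s) = rst F V W (D V s)))"

definition on_open_subsets ::
  "'x topology \<Rightarrow> ('x, 'a) superalgebra_sheaf \<Rightarrow> 'x set \<Rightarrow> ('x, 'a) derivation \<Rightarrow>
   ('x, 'a) derivation" where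
  "on_open_subsets X F U D = (\<lambda>V\<in>{V. openin X V \<and> V \<subseteq> U}. \<lambda>s\<in>carrier (sec F V). D V s)"

definition superderivations ::
  "'x topology \<Rightarrow> ('x, 'a) superalgebra_sheaf \<Rightarrow> 'x set \<Rightarrow> ('x, 'a) derivation set" where
  "superderivations X F U =
     {on_open_subsets X F U (\<lambda>V s. D\<^sub>0 V s \<oplus>\<^bsub>sec F V\<^esub> D\<^sub>1 V s) | D\<^sub>0 D\<^sub>1.
        sheaf_superderivation X F U False D\<^sub>0 \<and> sheaf_superderivation X F U True D\<^sub>1}"

text \<open>The subsheaf of the sheaf of superderivations cut out by a condition \<open>P\<close>.\<close>

definition superderivation_subsheaf ::
  "'x topology \<Rightarrow> ('x, 'a) superalgebra_sheaf \<Rightarrow> ('x set \<Rightarrow> ('x, 'a) derivation \<Rightarrow> bool) \<Rightarrow>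
   ('x, ('x, 'a) derivation) group_sheaf" where
  "superderivation_subsheaf X F P =
     \<lparr>sec = (\<lambda>U. additive_group
        {D \<in> superderivations X F U. P U D}
        (on_open_subsets X F U (\<lambda>V s. \<zero>\<^bsub>sec F V\<^esub>))
        (\<lambda>D D'. on_open_subsets X F U (\<lambda>V s. D V s \<oplus>\<^bsub>sec F V\<^esub> D' V s))),
      rst = (\<lambda>U V. on_open_subsets X F V)\<rparr>"


section \<open>Complex manifolds\<close>

text \<open>
  As for \<^const>\<open>Euclidean_space\<close>, vectors are sequences that vanish from index \<open>n\<close> on.
\<close>

definition complex_space :: "nat \<Rightarrow> (nat \<Rightarrow> complex) topology" where
  "complex_space n = subtopology (product_topology (\<lambda>i. euclidean) UNIV) {z. \<forall>i\<ge>n. z i = 0}"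

text \<open>Holomorphic functions of several variables: continuous and holomorphic in each variable.\<close>

definition holomorphic_on_space ::
  "nat \<Rightarrow> (nat \<Rightarrow> complex) set \<Rightarrow> ((nat \<Rightarrow> complex) \<Rightarrow> complex) \<Rightarrow> bool" where
  "holomorphic_on_space n W f \<longleftrightarrow>
     continuous_map (subtopology (complex_space n) W) euclidean f \<and>
     (\<forall>z \<in> W. \<forall>i<n. (\<lambda>w. f (z(i := w))) field_differentiable at (z i))"

type_synonym 'x chart = "'x set \<times> ('x \<Rightarrow> nat \<Rightarrow> complex)"

definition complex_manifold :: "'x topology \<Rightarrow> nat \<Rightarrow> 'x chart set \<Rightarrow> bool" where
  "complex_manifold X n \<A> \<longleftrightarrow>
     Hausdorff_space X \<and> second_countable X \<and>
     (\<Union>(U, \<phi>) \<in> \<A>. U) = topspace X \<and>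
     (\<forall>(U, \<phi>) \<in> \<A>. openin X U \<and> openin (complex_space n) (\<phi> ` U) \<and>
        homeomorphic_map (subtopology X U) (subtopology (complex_space n) (\<phi> ` U)) \<phi>) \<and>
     (\<forall>(U, \<phi>) \<in> \<A>. \<forall>(V, \<psi>) \<in> \<A>. \<forall>i<n.
        holomorphic_on_space n (\<phi> ` (U \<inter> V)) (\<lambda>z. \<psi> (inv_into U \<phi> z) i))"

definition holomorphic_function ::
  "nat \<Rightarrow> 'x chart set \<Rightarrow> 'x set \<Rightarrow> ('x \<Rightarrow> complex) \<Rightarrow> bool" where
  "holomorphic_function n \<A> U f \<longleftrightarrow>
     (\<forall>(V, \<phi>) \<in> \<A>. holomorphic_on_space n (\<phi> ` (U \<inter> V)) (\<lambda>z. f (inv_into V \<phi> z)))"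

text \<open>The sheaf of holomorphic functions, a sheaf of purely even superalgebras.\<close>

definition holomorphic_sheaf ::
  "nat \<Rightarrow> 'x chart set \<Rightarrow> ('x, 'x \<Rightarrow> complex) superalgebra_sheaf" where
  "holomorphic_sheaf n \<A> =
     \<lparr>sec = (\<lambda>U.
        \<lparr>carrier = {f \<in> extensional U. holomorphic_function n \<A> U f},
         mult = (\<lambda>f g. \<lambda>x\<in>U. f x * g x),
         one = (\<lambda>x\<in>U. 1),
         zero = (\<lambda>x\<in>U. 0),
         add = (\<lambda>f g. \<lambda>x\<in>U. f x + g x),
         smult = (\<lambda>c f. \<lambda>x\<in>U. c * f x),
         parity_part = (\<lambda>p. if p then {\<lambda>x\<in>U. 0}
                             else {f \<in> extensional U. holomorphic_function n \<A> U f})\<rparr>),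
      rst = (\<lambda>U V f. restrict f V)\<rparr>"


section \<open>Complex supermanifolds\<close>

text \<open>
  The field \<open>proj\<close> is the projection of the structure sheaf onto the sheaf of holomorphic functions.
\<close>

record ('x, 'a) superspace =
  body :: "'x topology"
  cdim :: nat
  atlas :: "'x chart set"
  strsheaf :: "('x, 'a) superalgebra_sheaf"
  proj :: "'x set \<Rightarrow> 'a \<Rightarrow> 'x \<Rightarrow> complex"

definition body_sheaf :: "('x, 'a) superspace \<Rightarrow> ('x, 'x \<Rightarrow> complex) superalgebra_sheaf" where
  "body_sheaf \<XX> = holomorphic_sheaf (cdim \<XX>) (atlas \<XX>)"

subsection \<open>The conormal sheaf and the split model\<close>

definition nil_ideal :: "('x, 'a) superspace \<Rightarrow> 'x set \<Rightarrow> 'a set" where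
  "nil_ideal \<XX> U = {s \<in> carrier (sec (strsheaf \<XX>) U). proj \<XX> U s = \<zero>\<^bsub>sec (body_sheaf \<XX>) U\<^esub>}"

definition nil_ideal_pow :: "('x, 'a) superspace \<Rightarrow> nat \<Rightarrow> 'x set \<Rightarrow> 'a set" where
  "nil_ideal_pow \<XX> l U = {s \<in> carrier (sec (strsheaf \<XX>) U).
     \<forall>x \<in> U. \<exists>V. openin (body \<XX>) V \<and> x \<in> V \<and> V \<subseteq> U \<and>
       rst (strsheaf \<XX>) U V s \<in> ideal_pow (sec (strsheaf \<XX>) V) (nil_ideal \<XX> V) l}"

text \<open>The quotient presheaf whose associated sheaf is the odd cotangent sheaf.\<close>

definition conormal_presheaf :: "('x, 'a) superspace \<Rightarrow> ('x, 'a set) group_sheaf" where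
  "conormal_presheaf \<XX> =
     \<lparr>sec = (\<lambda>U. let A = sec (strsheaf \<XX>) U; N = nil_ideal_pow \<XX> 2 U in
        additive_group ((\<lambda>j. N +>\<^bsub>A\<^esub> j) ` nil_ideal \<XX> U) N (set_add A)),
      rst = (\<lambda>U V a. \<Union>j \<in> a.
        nil_ideal_pow \<XX> 2 V +>\<^bsub>sec (strsheaf \<XX>) V\<^esub> rst (strsheaf \<XX>) U V j)\<rparr>"

definition conormal_class ::
  "('x, 'a) superspace \<Rightarrow> 'x set \<Rightarrow> 'a \<Rightarrow> ('x, 'a set) germ_fun" where
  "conormal_class \<XX> U j = germ_section (body \<XX>) (conormal_presheaf \<XX>) U
     (nil_ideal_pow \<XX> 2 U +>\<^bsub>sec (strsheaf \<XX>) U\<^esub> j)"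

text \<open>A holomorphic function acts through its local lifts to the structure sheaf.\<close>

definition conormal_smult ::
  "('x, 'a) superspace \<Rightarrow> 'x set \<Rightarrow> ('x \<Rightarrow> complex) \<Rightarrow>
   ('x, 'a set) germ_fun \<Rightarrow> ('x, 'a set) germ_fun" where
  "conormal_smult \<XX> U f t = (\<lambda>x\<in>U. \<Union>(V, a) \<in> t x. \<Union>j \<in> a.
     \<Union>W \<in> {W. openin (body \<XX>) W \<and> x \<in> W \<and> W \<subseteq> U \<inter> V}.
     \<Union>s \<in> {s \<in> carrier (sec (strsheaf \<XX>) W). proj \<XX> W s = restrict f W}.
       germ (body \<XX>) (conormal_presheaf \<XX>) x W
         (nil_ideal_pow \<XX> 2 W +>\<^bsub>sec (strsheaf \<XX>) W\<^esub>
            (s \<otimes>\<^bsub>sec (strsheaf \<XX>) W\<^esub> rst (strsheaf \<XX>) V W j)))"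

definition odd_cotangent_sheaf ::
  "('x, 'a) superspace \<Rightarrow> ('x, 'x \<Rightarrow> complex, ('x, 'a set) germ_fun) module_sheaf" where
  "odd_cotangent_sheaf \<XX> = (let X = body \<XX>; F = conormal_presheaf \<XX> in
     \<lparr>sec = (\<lambda>U.
        \<lparr>carrier = germ_sections X F (\<lambda>V. carrier (sec F V)) U,
         mult = undefined,
         one = undefined,
         zero = germ_section X F U \<zero>\<^bsub>sec F U\<^esub>,
         add = germ_op X F (\<lambda>V. add (sec F V)) U,
         smult = conormal_smult \<XX> U\<rparr>),
      rst = (\<lambda>U V t. restrict t V)\<rparr>)"

type_synonym ('x, 'a) split_section = "('x, 'x \<Rightarrow> complex, ('x, 'a set) germ_fun) ext_section"

definition split_model ::
  "('x, 'a) superspace \<Rightarrow> ('x, ('x, 'a) split_section) superspace" where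
  "split_model \<XX> =
     \<lparr>body = body \<XX>, cdim = cdim \<XX>, atlas = atlas \<XX>,
      strsheaf = exterior_sheaf (body \<XX>) (body_sheaf \<XX>) (odd_cotangent_sheaf \<XX>),
      proj = exterior_projection (body_sheaf \<XX>)\<rparr>"

subsection \<open>Supermanifolds and their isomorphisms\<close>

text \<open>Local isomorphisms are over the sheaf of holomorphic functions.\<close>

definition locally_exterior ::
  "('x, 'a) superspace \<Rightarrow> ('x, 'x \<Rightarrow> complex, 'm) module_sheaf \<Rightarrow> bool" where
  "locally_exterior \<XX> E \<longleftrightarrow>
     (let X = body \<XX>; F = strsheaf \<XX>; G = exterior_sheaf X (body_sheaf \<XX>) E in
      \<forall>x \<in> topspace X. \<exists>U \<phi>. openin X U \<and> x \<in> U \<and>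
        superalgebra_sheaf_hom (subtopology X U) F G \<phi> \<and>
        (\<forall>V. openin X V \<and> V \<subseteq> U \<longrightarrow>
           bij_betw (\<phi> V) (carrier (sec F V)) (carrier (sec G V)) \<and>
           (\<forall>s \<in> carrier (sec F V). exterior_projection (body_sheaf \<XX>) V (\<phi> V s) = proj \<XX> V s)))"

text \<open>
  The module \<open>E\<close> can be sought in any type accommodating the odd cotangent sheaf, to which it is
  necessarily isomorphic.
\<close>

definition complex_supermanifold :: "('x, 'a) superspace \<Rightarrow> bool" where
  "complex_supermanifold \<XX> \<longleftrightarrow>
     complex_manifold (body \<XX>) (cdim \<XX>) (atlas \<XX>) \<and>
     sheaf_of_supercommutative_algebras (body \<XX>) (strsheaf \<XX>) \<and>
     local_stalks (body \<XX>) (strsheaf \<XX>) \<and>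
     sheaf_epimorphism (body \<XX>) (strsheaf \<XX>) (body_sheaf \<XX>) (proj \<XX>) \<and>
     (\<exists>E :: ('x, 'x \<Rightarrow> complex, ('x, 'a set) germ_fun) module_sheaf.
        sheaf_of_modules (body \<XX>) (body_sheaf \<XX>) E \<and>
        locally_free_of_finite_rank (body \<XX>) (body_sheaf \<XX>) E \<and>
        locally_exterior \<XX> E)"

text \<open>
  An isomorphism is a biholomorphic map \<open>f\<close> of the bodies together with an isomorphism of sheaves
  of superalgebras from the structure sheaf of the target to the direct image of the structure sheaf
  of the source, lying over the pullback of functions along \<open>f\<close>.
\<close>

definition superspace_isomorphism ::
  "('x, 'a) superspace \<Rightarrow> ('y, 'b) superspace \<Rightarrow> ('x \<Rightarrow> 'y) \<Rightarrow> ('y set \<Rightarrow> 'b \<Rightarrow> 'a) \<Rightarrow> bool" where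
  "superspace_isomorphism \<XX> \<YY> f \<phi> \<longleftrightarrow>
     homeomorphic_map (body \<XX>) (body \<YY>) f \<and>
     (let pre = (\<lambda>V. {x \<in> topspace (body \<XX>). f x \<in> V}) in
      (\<forall>V. openin (body \<YY>) V \<longrightarrow>
         (\<forall>g. holomorphic_function (cdim \<YY>) (atlas \<YY>) V g \<longleftrightarrow>
              holomorphic_function (cdim \<XX>) (atlas \<XX>) (pre V) (g \<circ> f)) \<and>
         superalgebra_hom (sec (strsheaf \<YY>) V) (sec (strsheaf \<XX>) (pre V)) (\<phi> V) \<and>
         bij_betw (\<phi> V) (carrier (sec (strsheaf \<YY>) V)) (carrier (sec (strsheaf \<XX>) (pre V))) \<and>
         (\<forall>s \<in> carrier (sec (strsheaf \<YY>) V).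
            proj \<XX> (pre V) (\<phi> V s) = (\<lambda>x\<in>pre V. proj \<YY> V s (f x)))) \<and>
      (\<forall>V W. openin (body \<YY>) V \<and> openin (body \<YY>) W \<and> W \<subseteq> V \<longrightarrow>
         (\<forall>s \<in> carrier (sec (strsheaf \<YY>) V).
            \<phi> W (rst (strsheaf \<YY>) V W s) = rst (strsheaf \<XX>) (pre V) (pre W) (\<phi> V s))))"

definition isomorphic_superspaces ::
  "('x, 'a) superspace \<Rightarrow> ('y, 'b) superspace \<Rightarrow> bool" where
  "isomorphic_superspaces \<XX> \<YY> \<longleftrightarrow> (\<exists>f \<phi>. superspace_isomorphism \<XX> \<YY> f \<phi>)"

definition split_supermanifold :: "('x, 'a) superspace \<Rightarrow> bool" where
  "split_supermanifold \<XX> \<longleftrightarrow> isomorphic_superspaces \<XX> (split_model \<XX>)"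

subsection \<open>The filtration of the tangent sheaf and the Euler differential\<close>

definition tangent_filtration ::
  "('x, 'a) superspace \<Rightarrow> nat \<Rightarrow> ('x, ('x, 'a) derivation) group_sheaf" where
  "tangent_filtration \<XX> m = superderivation_subsheaf (body \<XX>) (strsheaf \<XX>)
     (\<lambda>U D. \<forall>V. openin (body \<XX>) V \<and> V \<subseteq> U \<longrightarrow>
        (\<forall>l. D V ` nil_ideal_pow \<XX> l V \<subseteq> nil_ideal_pow \<XX> (l + m) V))"

text \<open>Derivations of the split model of degree \<open>m\<close> with respect to its \<open>\<int>\<close>-grading.\<close>

definition split_tangent_degree ::
  "('x, 'a) superspace \<Rightarrow> int \<Rightarrow> ('x, ('x, ('x, 'a) split_section) derivation) group_sheaf" where
  "split_tangent_degree \<XX> m =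
     (let G = exterior_power_sections (body \<XX>) (body_sheaf \<XX>) (odd_cotangent_sheaf \<XX>) in
      superderivation_subsheaf (body (split_model \<XX>)) (strsheaf (split_model \<XX>))
        (\<lambda>U D. \<forall>V. openin (body \<XX>) V \<and> V \<subseteq> U \<longrightarrow> (\<forall>k. D V ` G k V \<subseteq> G (k + m) V)))"

text \<open>
  The quotient map from filtration degree 0 to degree 0 derivations of the split model.  The split
  model is generated by its parts of degrees 0 and 1, on which the derivation induced by \<open>D\<close> is the
  one that \<open>D\<close> induces modulo the nilpotent ideal and modulo its square.
\<close>

definition symbol ::
  "('x, 'a) superspace \<Rightarrow> 'x set \<Rightarrow> ('x, 'a) derivation \<Rightarrow>
   ('x, ('x, 'a) split_section) derivation" where
  "symbol \<XX> U D =
     (let scal = scalar_section (body \<XX>) (body_sheaf \<XX>) (odd_cotangent_sheaf \<XX>);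
          gen = generator_section (body \<XX>) (body_sheaf \<XX>) (odd_cotangent_sheaf \<XX>) in
      THE D'. D' \<in> carrier (sec (split_tangent_degree \<XX> 0) U) \<and>
        (\<forall>V. openin (body \<XX>) V \<and> V \<subseteq> U \<longrightarrow>
           (\<forall>s \<in> carrier (sec (strsheaf \<XX>) V).
              D' V (scal V (proj \<XX> V s)) = scal V (proj \<XX> V (D V s))) \<and>
           (\<forall>j \<in> nil_ideal \<XX> V.
              D' V (gen V (conormal_class \<XX> V j)) = gen V (conormal_class \<XX> V (D V j)))))"

text \<open>
  The embedding of endomorphisms of the odd cotangent sheaf into degree 0 derivations of the split
  model: the derivation vanishes on functions and extends the given endomorphism.
\<close>

definition endomorphism_derivation ::
  "('x, 'a) superspace \<Rightarrow> 'x set \<Rightarrow>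
   ('x set \<Rightarrow> ('x, 'a set) germ_fun \<Rightarrow> ('x, 'a set) germ_fun) \<Rightarrow>
   ('x, ('x, 'a) split_section) derivation" where
  "endomorphism_derivation \<XX> U A =
     (let scal = scalar_section (body \<XX>) (body_sheaf \<XX>) (odd_cotangent_sheaf \<XX>);
          gen = generator_section (body \<XX>) (body_sheaf \<XX>) (odd_cotangent_sheaf \<XX>) in
      THE D. D \<in> carrier (sec (split_tangent_degree \<XX> 0) U) \<and>
        (\<forall>V. openin (body \<XX>) V \<and> V \<subseteq> U \<longrightarrow>
           (\<forall>f \<in> carrier (sec (body_sheaf \<XX>) V).
              D V (scal V f) = \<zero>\<^bsub>sec (strsheaf (split_model \<XX>)) V\<^esub>) \<and>
           (\<forall>t \<in> carrier (sec (odd_cotangent_sheaf \<XX>) V). D V (gen V t) = gen V (A V t))))"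

definition euler_field ::
  "('x, 'a) superspace \<Rightarrow> ('x, ('x, 'a) split_section) derivation" where
  "euler_field \<XX> = endomorphism_derivation \<XX> (topspace (body \<XX>)) (\<lambda>V t. t)"

definition euler_differential ::
  "('x, 'a) superspace \<Rightarrow> ('x, ('x, 'a) derivation) cochain set" where
  "euler_differential \<XX> =
     connecting_map (body \<XX>) (tangent_filtration \<XX> 1) (tangent_filtration \<XX> 0)
       (split_tangent_degree \<XX> 0) (symbol \<XX>) (euler_field \<XX>)"

end

theory Submission
 imports Defs "HOL-Algebra.RingHom"
begin

text \<open>
 The Euler differential is the obstruction to lifting the Euler field to a derivation of the
 structure sheaf.  An isomorphism with the split model carries its Euler field to such a lift.
 Conversely, if the class vanishes, then the local lifts can be corrected so that they agree on
 overlaps, and their even parts glue to a global even lift \<open>D\<close>.  On the \<open>l\<close>-th power of the nilpotent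
 ideal, \<open>D\<close> is multiplication by \<open>l\<close> modulo the next power, and locally some power vanishes; hence
 functions lift uniquely to sections killed by \<open>D\<close>, and conormal classes to sections fixed by \<open>D\<close>.
 These eigenlifts extend to a homomorphism from the exterior sheaf, and in a local chart it is
 bijective because its composition with the chart is unipotent for the filtration.
\<close>

text \<open>The eigenvalues of an Euler lift on different powers of the nilpotent ideal are distinct
  integers, so over the complex numbers an error in one power can be divided away into the next;
  this produces the eigenlifts. Even parts suffice because even nilpotent sections lie in the square
  of the ideal: an odd derivation that preserves the filtration therefore raises it by one and does
  not affect the symbol. The main obstacle is sheafification. Over a general open set a holomorphic
  function need not lift to the structure sheaf, nor a conormal section to the nilpotent ideal. Over
  the domain of an Euler lift both do, by eigenlifts. Such domains form a base, on which derivations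
  of the split model are constructed and compared. The odd cotangent sheaf is nowhere shown to be
  free; bijectivity is instead reduced to the free module of a chart, mapped onto it by the linear
  part of the chart. The cohomology class is handled as an explicit set of cocycles, which removes
  the choice of local lifts.\<close>

abbreviation (input) "Sec F U == carrier (sec F U)"
abbreviation (input) "Par F U == parity_part (sec F U)"
abbreviation (input) sec_add ("(_ \<oplus>[_,_] _)" [65,0,0,66] 65) where "s \<oplus>[F,U] t == s \<oplus>\<^bsub>sec F U\<^esub> t"
abbreviation (input) sec_mult ("(_ \<otimes>[_,_] _)" [70,0,0,71] 70) where "s \<otimes>[F,U] t == s \<otimes>\<^bsub>sec F U\<^esub> t"
abbreviation (input) sec_minus ("(_ \<ominus>[_,_] _)" [65,0,0,66] 65) where "s \<ominus>[F,U] t == s \<ominus>\<^bsub>sec F U\<^esub> t"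
abbreviation (input) sec_uminus ("(\<ominus>[_,_] _)" [0,0,81] 80) where "\<ominus>[F,U] t == \<ominus>\<^bsub>sec F U\<^esub> t"
abbreviation (input) sec_smult ("(_ \<odot>[_,_] _)" [70,0,0,71] 70) where "c \<odot>[F,U] t == c \<odot>\<^bsub>sec F U\<^esub> t"
abbreviation (input) sec_zero ("\<zero>[_,_]") where "\<zero>[F,U] == \<zero>\<^bsub>sec F U\<^esub>"
abbreviation (input) sec_one ("\<one>[_,_]") where "\<one>[F,U] == \<one>\<^bsub>sec F U\<^esub>"

section \<open>Germs and sheafification\<close>

text \<open>Sections of a sheafification are handled through local representatives in the presheaf:
  operations and equalities of germ-valued functions are read off from the sections whose germs they
  are.\<close>

definition represents ::
 "'x topology => ('x, 'a, ('a, 'm) partial_object_scheme) presheaf =>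
  ('x, 'a) germ_fun => 'x set => 'a => bool" where
 "represents X G g V s \<longleftrightarrow>
   openin X V & s : Sec G V & (ALL y:V. g y = germ X G y V s)"

text \<open>Operations on germs are unions over representatives. Such a union collapses once every
  representative is known to give the same germ.\<close>

lemma UN_const_on: "[| A ~= {}; !!V s. (V, s) : A ==> f V s = c |] ==> (\<Union>(V, s)\<in>A. f V s) = c"
 by fastforce

locale presheaf_on =
 fixes X :: "'x topology" and G :: "('x, 'a, ('a, 'm) partial_object_scheme) presheaf"
 assumes presheaf: "is_presheaf X G"
begin

lemma rst_closed:
 assumes "openin X U" "openin X V" "V <= U" "s : Sec G U"
 shows "rst G U V s : Sec G V"
 using conjunct1[OF presheaf[unfolded is_presheaf_def], rule_format, of U V] assms
 by (auto simp: Pi_iff)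

lemma rst_id:
 assumes "openin X U" "s : Sec G U"
 shows "rst G U U s = s"
 using conjunct1[OF conjunct2[OF presheaf[unfolded is_presheaf_def]], rule_format] assms
 by simp

lemma rst_rst:
 assumes "openin X U" "openin X V" "openin X W" "W <= V" "V <= U" "s : Sec G U"
 shows "rst G V W (rst G U V s) = rst G U W s"
 using conjunct2[OF conjunct2[OF presheaf[unfolded is_presheaf_def]], rule_format] assms
 by simp

lemma germ_self: "[| openin X V; x : V; s : Sec G V |] ==> (V, s) : germ X G x V s"
 unfolding germ_def by auto

lemma germ_subset:
 assumes "openin X V" "openin X W" "s : Sec G V" "t : Sec G W"
  and "openin X O'" "x : O'" "O' <= V \<inter> W" "rst G V O' s = rst G W O' t"
 shows "germ X G x V s <= germ X G x W t"
proof clarify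
 fix A a assume "(A, a) : germ X G x V s"
 then obtain Q where Q: "openin X A" "x : A" "a : Sec G A"
  "openin X Q" "x : Q" "Q <= V \<inter> A" "rst G V Q s = rst G A Q a"
  unfolding germ_def by auto
 let ?N = "O' \<inter> Q"
 have N: "openin X ?N" using assms Q by auto
 have "rst G W ?N t = rst G O' ?N (rst G W O' t)"
  using rst_rst[of W O' ?N t] N assms by auto
 also have "... = rst G V ?N s" using assms rst_rst[of V O' ?N s] N by auto
 also have "... = rst G Q ?N (rst G V Q s)" using rst_rst[of V Q ?N s] N assms Q by auto
 also have "... = rst G A ?N a" using rst_rst[of A Q ?N a] N assms Q by auto
 finally show "(A, a) : germ X G x W t"
  unfolding germ_def using Q N assms by blast
qed

lemma germ_eqI:
 assumes "openin X V" "openin X W" "s : Sec G V" "t : Sec G W"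
  and "openin X O'" "x : O'" "O' <= V \<inter> W" "rst G V O' s = rst G W O' t"
 shows "germ X G x V s = germ X G x W t"
 using germ_subset[OF assms] germ_subset[of W V t s O' x] assms by auto

lemma germ_eqD:
 assumes "openin X W" "t : Sec G W" "x : W" "germ X G x V s = germ X G x W t"
 obtains O' where "openin X O'" "x : O'" "O' <= V \<inter> W" "rst G V O' s = rst G W O' t"
proof -
 have "(W, t) : germ X G x V s" using germ_self assms by metis
 then show thesis using that unfolding germ_def by auto
qed

lemma germ_rst:
 assumes "openin X V" "openin X W" "W <= V" "x : W" "s : Sec G V"
 shows "germ X G x W (rst G V W s) = germ X G x V s"
 by (rule germ_eqI[of W V _ _ W]) (use assms rst_closed rst_id in auto)

lemma represents_rst:
 assumes "represents X G g V s" "openin X W" "W <= V"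
 shows "represents X G g W (rst G V W s)"
 using assms germ_rst[of V W _ s] rst_closed unfolding represents_def by (metis subset_iff)

lemma germ_sections_represents:
 assumes "g : germ_sections X G P U" "x : U" "!!V. openin X V ==> P V <= Sec G V"
 obtains V s where "x : V" "V <= U" "s : P V" "represents X G g V s"
 using assms unfolding germ_sections_def represents_def by blast

lemma germ_sectionsI:
 assumes "g : extensional U"
  "!!x. x : U ==> EX V s. x : V & V <= U & s : P V & represents X G g V s"
 shows "g : germ_sections X G P U"
 unfolding germ_sections_def
proof (intro CollectI conjI ballI)
 fix x assume "x : U"
 then obtain V s where "x : V" "V <= U" "s : P V" "represents X G g V s" using assms(2) by blast
 then show "EX V s. openin X V & x : V & V <= U & s : P V & (ALL y:V. g y = germ X G y V s)"
  unfolding represents_def by (intro exI[of _ V] exI[of _ s]) auto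
qed (rule assms)

lemma germ_section_represents:
 assumes "openin X U" "s : Sec G U"
 shows "represents X G (germ_section X G U s) U s"
 using assms unfolding represents_def germ_section_def by auto

lemma germ_section_eqI:
 assumes "g : extensional U" "represents X G g U s"
 shows "g = germ_section X G U s"
 by (rule extensionalityI[of _ U]) (use assms in \<open>auto simp: germ_section_def represents_def\<close>)

lemma represents_eqD:
 assumes "represents X G g V s" "represents X G h W t" "x : V" "x : W" "g x = h x"
 obtains O' where "openin X O'" "x : O'" "O' <= V \<inter> W" "rst G V O' s = rst G W O' t"
 using assms germ_eqD[of W t x V s] unfolding represents_def by metis

lemma represents_eqI:
 assumes "represents X G g V s" "represents X G h V s" "x : V"
 shows "g x = h x"
 using assms unfolding represents_def by metis

lemma represents_restrict:
 assumes "represents X G g V s" "V <= U"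
 shows "represents X G (restrict g U) V s"
 using assms unfolding represents_def by auto

text \<open>Any representatives of the two germs agree with \<open>s\<close> and \<open>t\<close> on
  some neighbourhood, and \<open>p\<close> commutes with restriction. So every member of the union
  that defines \<open>germ_op\<close> is the germ of \<open>p V s t\<close>.\<close>

lemma germ_op_represents:
 assumes g: "represents X G g V s" and h: "represents X G h V t" and "V <= U"
  and pc: "!!V s t. [| openin X V; s : Sec G V; t : Sec G V |] ==>
        p V s t : Sec G V"
  and pr: "!!V W s t. [| openin X V; openin X W; W <= V; s : Sec G V;
        t : Sec G V |] ==> rst G V W (p V s t) = p W (rst G V W s) (rst G V W t)"
 shows "represents X G (germ_op X G p U g h) V (p V s t)"
proof -
 have V: "openin X V" "s : Sec G V" "t : Sec G V"
  using g h unfolding represents_def by auto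
 have "germ_op X G p U g h x = germ X G x V (p V s t)" if x: "x : V" for x
 proof -
  have gx: "g x = germ X G x V s" "h x = germ X G x V t"
   using g h x unfolding represents_def by auto
  have key: "germ X G x (A \<inter> B) (p (A \<inter> B) (rst G A (A \<inter> B) a) (rst G B (A \<inter> B) b)) =
    germ X G x V (p V s t)"
   if A: "(A, a) : germ X G x V s" and B: "(B, b) : germ X G x V t" for A B a b
  proof -
   obtain S where S: "openin X A" "x : A" "a : Sec G A" "openin X S" "x : S"
    "S <= V \<inter> A" "rst G V S s = rst G A S a"
    using A unfolding germ_def by auto
   obtain T where T: "openin X B" "x : B" "b : Sec G B" "openin X T" "x : T"
    "T <= V \<inter> B" "rst G V T t = rst G B T b"
    using B unfolding germ_def by auto
   let ?O = "S \<inter> T" and ?C = "A \<inter> B"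
   have o: "openin X ?O" "openin X ?C" "?O <= ?C" using S T by auto
   have c: "rst G A ?C a : Sec G ?C" "rst G B ?C b : Sec G ?C"
    using rst_closed S T o by auto
   have 1: "rst G V ?O s = rst G ?C ?O (rst G A ?C a)"
   proof -
    have "rst G V ?O s = rst G S ?O (rst G V S s)" using rst_rst[of V S ?O s] S T o V by auto
    also have "... = rst G A ?O a" using rst_rst[of A S ?O a] S T o V by auto
    also have "... = rst G ?C ?O (rst G A ?C a)" using rst_rst[of A ?C ?O a] S T o V by auto
    finally show ?thesis .
   qed
   have 2: "rst G V ?O t = rst G ?C ?O (rst G B ?C b)"
   proof -
    have "rst G V ?O t = rst G T ?O (rst G V T t)" using rst_rst[of V T ?O t] S T o V by auto
    also have "... = rst G B ?O b" using rst_rst[of B T ?O b] S T o V by auto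
    also have "... = rst G ?C ?O (rst G B ?C b)" using rst_rst[of B ?C ?O b] S T o V by auto
    finally show ?thesis .
   qed
   have OV: "?O <= V" using S by auto
   have 3: "rst G ?C ?O (p ?C (rst G A ?C a) (rst G B ?C b)) = rst G V ?O (p V s t)"
    using pr[OF o(2,1,3) c] pr[OF V(1) o(1) OV V(2,3)] 1 2 by simp
   show ?thesis
    by (rule germ_eqI[OF o(2) V(1) pc[OF o(2) c] pc[OF V] o(1) _ _ 3]) (use S T in auto)
  qed
  have ne: "germ X G x V s ~= {}" "germ X G x V t ~= {}"
   using germ_self[OF V(1) x] V(2,3) by auto
  have "germ_op X G p U g h x = (\<Union>(A, a)\<in>germ X G x V s. \<Union>(B, b)\<in>germ X G x V t.
    germ X G x (A \<inter> B) (p (A \<inter> B) (rst G A (A \<inter> B) a) (rst G B (A \<inter> B) b)))"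
   unfolding germ_op_def using x \<open>V <= U\<close> gx by auto
  also have "... = germ X G x V (p V s t)"
   by (intro UN_const_on ne key)
  finally show ?thesis .
 qed
 then show ?thesis using V pc unfolding represents_def by auto
qed

lemma germ_unary_represents:
 assumes g: "represents X G g V s" and "V <= U"
  and qc: "!!V s. [| openin X V; s : Sec G V |] ==> q V s : Sec G V"
  and qr: "!!V W s. [| openin X V; openin X W; W <= V; s : Sec G V |] ==>
        rst G V W (q V s) = q W (rst G V W s)"
 shows "represents X G (\<lambda>x\<in>U. \<Union>(V, s)\<in>g x. germ X G x V (q V s)) V (q V s)"
proof -
 have V: "openin X V" "s : Sec G V" using g unfolding represents_def by auto
 have "(\<Union>(V, s)\<in>g x. germ X G x V (q V s)) = germ X G x V (q V s)" if x: "x : V" for x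
 proof -
  have gx: "g x = germ X G x V s" using g x unfolding represents_def by auto
  have key: "germ X G x A (q A a) = germ X G x V (q V s)" if A: "(A, a) : germ X G x V s" for A a
  proof -
   obtain S where S: "openin X A" "x : A" "a : Sec G A" "openin X S" "x : S"
    "S <= V \<inter> A" "rst G V S s = rst G A S a"
    using A unfolding germ_def by auto
   show ?thesis by (rule germ_eqI[of A V _ _ S]) (use S V qc qr in auto)
  qed
  have "germ X G x V s ~= {}" using germ_self[OF V(1) x V(2)] by auto
  then show ?thesis unfolding gx by (intro UN_const_on key)
 qed
 then show ?thesis using V qc \<open>V <= U\<close> unfolding represents_def by auto
qed

end

section \<open>Terms for the exterior algebra\<close>

lemma UN2_const_on:
 assumes "A ~= {}" "B ~= {}" "!!x y. [| x : A; y : B |] ==> f x y = c"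
 shows "(\<Union>x\<in>A. \<Union>y\<in>B. f x y) = c"
proof (rule SUP_eq_const[OF assms(1)])
 fix x assume "x : A"
 then show "(\<Union>y\<in>B. f x y) = c" by (intro SUP_eq_const assms)
qed

text \<open>The universal property of the exterior algebra on the level of terms: scalars and
  generators are given values, and a term is computed from them.\<close>

primrec ext_ev ::
 "('b, 'n) ring_scheme => ('r => 'b) => ('m => 'b) => ('r, 'm) ext_term => 'b" where
 "ext_ev A \<sigma> l (EScal r) = \<sigma> r"
| "ext_ev A \<sigma> l (EGen m) = l m"
| "ext_ev A \<sigma> l (ESum a b) = ext_ev A \<sigma> l a \<oplus>\<^bsub>A\<^esub> ext_ev A \<sigma> l b"
| "ext_ev A \<sigma> l (EProd a b) = ext_ev A \<sigma> l a \<otimes>\<^bsub>A\<^esub> ext_ev A \<sigma> l b"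

text \<open>The Leibniz rule without signs, as for an even derivation. Scalars are differentiated as
  well, since the symbol of a vector field acts on functions.\<close>

primrec ext_der :: "('r => 'r) => ('m => 'm) => ('r, 'm) ext_term => ('r, 'm) ext_term" where
 "ext_der d \<delta> (EScal r) = EScal (d r)"
| "ext_der d \<delta> (EGen m) = EGen (\<delta> m)"
| "ext_der d \<delta> (ESum a b) = ESum (ext_der d \<delta> a) (ext_der d \<delta> b)"
| "ext_der d \<delta> (EProd a b) = ESum (EProd (ext_der d \<delta> a) b) (EProd a (ext_der d \<delta> b))"

lemma ext_terms_simps [simp]:
 "EScal r : ext_terms R M \<longleftrightarrow> r : carrier R"
 "EGen m : ext_terms R M \<longleftrightarrow> m : carrier M"
 "ESum a b : ext_terms R M \<longleftrightarrow> a : ext_terms R M & b : ext_terms R M"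
 "EProd a b : ext_terms R M \<longleftrightarrow> a : ext_terms R M & b : ext_terms R M"
 unfolding ext_terms_def by auto

lemma ext_ev_map: "ext_ev A \<sigma> l (map_ext_term f g e) = ext_ev A (%r. \<sigma> (f r)) (%m. l (g m)) e"
 by (induction e) auto

lemma ext_aug_ev: "ext_aug R e = ext_ev R (%r. r) (%_. \<zero>\<^bsub>R\<^esub>) e"
 by (induction e) auto

lemma ext_ev_cong:
 assumes "e : ext_terms R M" "!!r. r : carrier R ==> \<sigma> r = \<sigma>' r"
  "!!m. m : carrier M ==> l m = l' m"
 shows "ext_ev A \<sigma> l e = ext_ev A \<sigma>' l' e"
 using assms(1) by (induction e) (auto simp: assms)

lemma ext_ev_closed:
 assumes "ring A" "!!r. r : carrier R ==> \<sigma> r : carrier A" "!!m. m : carrier M ==> l m : carrier A"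
  and "e : ext_terms R M"
 shows "ext_ev A \<sigma> l e : carrier A"
proof -
 interpret ring A by fact
 show ?thesis using assms(4) by (induction e) (auto simp: assms)
qed

lemma ext_ev_hom:
 assumes "ring A" "!!r. r : carrier R ==> \<sigma> r : carrier A" "!!m. m : carrier M ==> l m : carrier A"
  and "h : ring_hom A B" "e : ext_terms R M"
 shows "h (ext_ev A \<sigma> l e) = ext_ev B (%r. h (\<sigma> r)) (%m. h (l m)) e"
 using assms(5)
 by (induction e)
  (auto simp: ring_hom_add[OF assms(4)] ring_hom_mult[OF assms(4)] ext_ev_closed[OF assms(1-3)])

lemma map_ext_terms:
 assumes "!!r. r : carrier R ==> f r : carrier R'" "!!m. m : carrier M ==> g m : carrier M'"
  and "e : ext_terms R M"
 shows "map_ext_term f g e : ext_terms R' M'"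
 using assms(3) by (induction e) (auto simp: assms)

lemma map_ext_cong:
 assumes "e : ext_terms R M" "!!r. r : carrier R ==> f r = f' r" "!!m. m : carrier M ==> g m = g' m"
 shows "map_ext_term f g e = map_ext_term f' g' e"
 using assms(1) by (induction e) (auto simp: assms)

lemma ext_parity_prod:
 "[| ext_parity p a; ext_parity q b |] ==> ext_parity (p = (~ q)) (EProd a b)"
 using ext_parity.intros(4)[of p a q b] by simp

lemma ext_parity_map: "ext_parity p e ==> ext_parity p (map_ext_term f g e)"
 by (induction rule: ext_parity.induct) (auto intro: ext_parity.intros(1-3) ext_parity_prod)

lemma ext_parity_der: "ext_parity p e ==> ext_parity p (ext_der d \<delta> e)"
 by (induction rule: ext_parity.induct) (auto intro: ext_parity.intros(1-3) ext_parity_prod)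

lemma ext_homogeneous_map:
 assumes "f \<zero>\<^bsub>R\<^esub> = \<zero>\<^bsub>R'\<^esub>"
 shows "ext_homogeneous R k e ==> ext_homogeneous R' k (map_ext_term f g e)"
 by (induction rule: ext_homogeneous.induct) (auto simp: assms intro: ext_homogeneous.intros)

lemma ext_homogeneous_der:
 assumes "d \<zero>\<^bsub>R\<^esub> = \<zero>\<^bsub>R\<^esub>"
 shows "ext_homogeneous R k e ==> ext_homogeneous R k (ext_der d \<delta> e)"
 by (induction rule: ext_homogeneous.induct) (auto simp: assms intro: ext_homogeneous.intros)

text \<open>Of the module only closure is assumed: the relations \<open>ext_gen_add\<close> and
  \<open>ext_gen_smult\<close> force additivity and linearity in the quotient. Hence the odd
  cotangent sheaf qualifies as soon as its operations are closed.\<close>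

locale ext_module =
 fixes R :: "('r, 'k) superalgebra_scheme" (structure)
  and M :: "('r, 'm, 'l) module_scheme"
 assumes R_cring: "cring R"
  and M_add: "[| m : carrier M; n : carrier M |] ==> m \<oplus>\<^bsub>M\<^esub> n : carrier M"
  and M_smult: "[| r : carrier R; m : carrier M |] ==> r \<odot>\<^bsub>M\<^esub> m : carrier M"
begin

sublocale cring R by (rule R_cring)

abbreviation "cl == ext_class R M"
abbreviation "T == ext_terms R M"
abbreviation "EA == exterior_algebra R M"

lemma ext_eq_terms: "ext_eq R M a b ==> a : T & b : T"
 by (induction rule: ext_eq.induct) (auto intro: M_add M_smult)

lemma cl_eq_iff: "a : T ==> cl a = cl b \<longleftrightarrow> ext_eq R M a b"
 unfolding ext_class_def by (auto intro: ext_refl ext_sym ext_trans)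

lemma cl_eqI: "ext_eq R M a b ==> cl a = cl b"
 using ext_eq_terms cl_eq_iff by blast

lemma cl_mem: "e : cl a \<longleftrightarrow> ext_eq R M a e"
 unfolding ext_class_def by auto

lemma cl_self: "a : T ==> a : cl a"
 unfolding cl_mem by (rule ext_refl)

lemma cl_ne: "a : T ==> cl a ~= {}"
 using cl_self by force

lemma cl_memD: "e : cl a ==> e : T & cl e = cl a"
 unfolding cl_mem using ext_eq_terms cl_eqI by metis

lemma EA_carrier: "carrier EA = cl ` T"
 unfolding exterior_algebra_def by simp

lemma cl_in [simp]: "a : T ==> cl a : carrier EA"
 unfolding EA_carrier by simp

lemma cl_sum: "[| a : T; b : T |] ==> cl (ESum a b) = cl a \<oplus>\<^bsub>EA\<^esub> cl b"
proof -
 assume "a : T" "b : T"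
 then have "(\<Union>d\<in>cl a. \<Union>e\<in>cl b. cl (ESum d e)) = cl (ESum a b)"
  by (intro UN2_const_on cl_eqI[OF ext_sym[OF ext_sum_cong]]) (simp_all only: cl_ne cl_mem not_False_eq_True)
 then show ?thesis unfolding exterior_algebra_def by simp
qed

lemma cl_prod: "[| a : T; b : T |] ==> cl (EProd a b) = cl a \<otimes>\<^bsub>EA\<^esub> cl b"
proof -
 assume "a : T" "b : T"
 then have "(\<Union>d\<in>cl a. \<Union>e\<in>cl b. cl (EProd d e)) = cl (EProd a b)"
  by (intro UN2_const_on cl_eqI[OF ext_sym[OF ext_prod_cong]]) (simp_all only: cl_ne cl_mem not_False_eq_True)
 then show ?thesis unfolding exterior_algebra_def by simp
qed

lemma EA_zero: "\<zero>\<^bsub>EA\<^esub> = cl (EScal \<zero>)" and EA_one: "\<one>\<^bsub>EA\<^esub> = cl (EScal \<one>)"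
 unfolding exterior_algebra_def by simp_all

lemma EA_ring: "ring EA"
proof (intro ringI abelian_groupI monoidI)
 fix x y z assume xyz: "x : carrier EA" "y : carrier EA" "z : carrier EA"
 then obtain a b c where abc: "a : T" "b : T" "c : T" "x = cl a" "y = cl b" "z = cl c"
  unfolding EA_carrier by auto
 note s = cl_sum[symmetric] cl_prod[symmetric] EA_zero EA_one
 show "x \<oplus>\<^bsub>EA\<^esub> y \<oplus>\<^bsub>EA\<^esub> z = x \<oplus>\<^bsub>EA\<^esub> (y \<oplus>\<^bsub>EA\<^esub> z)" using abc by (simp add: s cl_eqI ext_sum_assoc)
 show "x \<otimes>\<^bsub>EA\<^esub> y \<otimes>\<^bsub>EA\<^esub> z = x \<otimes>\<^bsub>EA\<^esub> (y \<otimes>\<^bsub>EA\<^esub> z)" using abc by (simp add: s cl_eqI ext_prod_assoc)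
 show "(x \<oplus>\<^bsub>EA\<^esub> y) \<otimes>\<^bsub>EA\<^esub> z = x \<otimes>\<^bsub>EA\<^esub> z \<oplus>\<^bsub>EA\<^esub> y \<otimes>\<^bsub>EA\<^esub> z"
  using abc by (simp add: s cl_eqI ext_distrib_right)
 show "z \<otimes>\<^bsub>EA\<^esub> (x \<oplus>\<^bsub>EA\<^esub> y) = z \<otimes>\<^bsub>EA\<^esub> x \<oplus>\<^bsub>EA\<^esub> z \<otimes>\<^bsub>EA\<^esub> y"
  using abc by (simp add: s cl_eqI ext_distrib_left)
next
 fix x y assume xy: "x : carrier EA" "y : carrier EA"
 then obtain a b where abc: "a : T" "b : T" "x = cl a" "y = cl b"
  unfolding EA_carrier by auto
 note s = cl_sum[symmetric] cl_prod[symmetric] EA_zero EA_one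
 show "x \<oplus>\<^bsub>EA\<^esub> y : carrier EA" "x \<otimes>\<^bsub>EA\<^esub> y : carrier EA" using abc by (simp_all add: s)
 show "x \<oplus>\<^bsub>EA\<^esub> y = y \<oplus>\<^bsub>EA\<^esub> x" using abc by (simp add: s cl_eqI ext_sum_comm)
next
 fix x assume "x : carrier EA"
 then obtain a where abc: "a : T" "x = cl a"
  unfolding EA_carrier by auto
 note s = cl_sum[symmetric] cl_prod[symmetric] EA_zero EA_one
 show "\<zero>\<^bsub>EA\<^esub> \<oplus>\<^bsub>EA\<^esub> x = x" using abc by (simp add: s cl_eqI ext_sum_zero)
 show "\<one>\<^bsub>EA\<^esub> \<otimes>\<^bsub>EA\<^esub> x = x" using abc by (simp add: s cl_eqI ext_prod_one)
 show "x \<otimes>\<^bsub>EA\<^esub> \<one>\<^bsub>EA\<^esub> = x"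
  using abc cl_eqI[OF ext_scal_central[of \<one> R a M]] by (simp add: s cl_eqI ext_prod_one)
 let ?n = "EProd (EScal (\<ominus> \<one>)) a"
 have "cl (ESum ?n a) = cl (ESum ?n (EProd (EScal \<one>) a))"
  using abc by (intro cl_eqI ext_sum_cong ext_refl ext_sym[OF ext_prod_one]) auto
 also have "... = cl (EProd (ESum (EScal (\<ominus> \<one>)) (EScal \<one>)) a)"
  using abc by (intro cl_eqI ext_sym[OF ext_distrib_right]) auto
 also have "... = cl (EProd (EScal (\<ominus> \<one> \<oplus> \<one>)) a)"
  using abc by (intro cl_eqI ext_prod_cong ext_sym[OF ext_scal_add] ext_refl) auto
 also have "... = cl (EScal \<zero>)"
  using abc by (simp add: l_neg cl_eqI ext_prod_zero)
 finally have "cl ?n \<oplus>\<^bsub>EA\<^esub> x = \<zero>\<^bsub>EA\<^esub>" using abc by (simp add: s)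
 then show "EX y:carrier EA. y \<oplus>\<^bsub>EA\<^esub> x = \<zero>\<^bsub>EA\<^esub>" using abc by (intro bexI[of _ "cl ?n"]) auto
qed (auto simp: EA_zero EA_one)

sublocale EA: ring EA by (rule EA_ring)

lemma cl_scal_add: "[| r : carrier R; s : carrier R |] ==> cl (EScal (r \<oplus> s)) = cl (EScal r) \<oplus>\<^bsub>EA\<^esub> cl (EScal s)"
 by (simp add: cl_sum[symmetric] cl_eqI ext_scal_add)

lemma cl_scal_mult: "[| r : carrier R; s : carrier R |] ==> cl (EScal (r \<otimes> s)) = cl (EScal r) \<otimes>\<^bsub>EA\<^esub> cl (EScal s)"
 by (simp add: cl_prod[symmetric] cl_eqI ext_scal_mult)

lemma cl_scal_hom: "(%r. cl (EScal r)) : ring_hom R EA"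
 by (rule ring_hom_memI) (auto simp: cl_scal_add cl_scal_mult EA_one)

lemma cl_gen_add: "[| m : carrier M; n : carrier M |] ==> cl (EGen (m \<oplus>\<^bsub>M\<^esub> n)) = cl (EGen m) \<oplus>\<^bsub>EA\<^esub> cl (EGen n)"
 by (simp add: cl_sum[symmetric] cl_eqI ext_gen_add)

lemma cl_gen_smult: "[| r : carrier R; m : carrier M |] ==>
  cl (EGen (r \<odot>\<^bsub>M\<^esub> m)) = cl (EScal r) \<otimes>\<^bsub>EA\<^esub> cl (EGen m)"
 by (simp add: cl_prod[symmetric] cl_eqI ext_gen_smult)

lemma cl_gen_square: "m : carrier M ==> cl (EGen m) \<otimes>\<^bsub>EA\<^esub> cl (EGen m) = \<zero>\<^bsub>EA\<^esub>"
 by (simp add: cl_prod[symmetric] EA_zero cl_eqI ext_gen_square)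

text \<open>Polarisation: expand the square of the generator of the sum of \<open>m\<close> and
  \<open>n\<close>.\<close>

lemma cl_gen_anticommute:
 assumes "m : carrier M" "n : carrier M"
 shows "cl (EGen m) \<otimes>\<^bsub>EA\<^esub> cl (EGen n) \<oplus>\<^bsub>EA\<^esub> cl (EGen n) \<otimes>\<^bsub>EA\<^esub> cl (EGen m) = \<zero>\<^bsub>EA\<^esub>"
 using cl_gen_square[OF M_add[OF assms]] cl_gen_square[OF assms(1)] cl_gen_square[OF assms(2)] assms
  EA.a_comm[of "cl (EGen m) \<otimes>\<^bsub>EA\<^esub> cl (EGen n)" "cl (EGen n) \<otimes>\<^bsub>EA\<^esub> cl (EGen m)"]
 by (simp add: cl_gen_add EA.l_distr EA.r_distr)

lemma cl_scal_central:
 assumes "r : carrier R" "x : carrier EA"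
 shows "x \<otimes>\<^bsub>EA\<^esub> cl (EScal r) = cl (EScal r) \<otimes>\<^bsub>EA\<^esub> x"
proof -
 obtain a where "a : T" "x = cl a" using assms unfolding EA_carrier by auto
 then show ?thesis using assms by (simp add: cl_prod[symmetric] cl_eqI ext_scal_central)
qed

lemma EA_smult: "a : T ==> c \<odot>\<^bsub>R\<^esub> \<one> : carrier R ==>
  c \<odot>\<^bsub>EA\<^esub> cl a = cl (EProd (EScal (c \<odot>\<^bsub>R\<^esub> \<one>)) a)"
proof -
 assume "a : T" "c \<odot>\<^bsub>R\<^esub> \<one> : carrier R"
 then have "(\<Union>e\<in>cl a. cl (EProd (EScal (c \<odot>\<^bsub>R\<^esub> \<one>)) e)) = cl (EProd (EScal (c \<odot>\<^bsub>R\<^esub> \<one>)) a)"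
  by (intro SUP_eq_const cl_eqI[OF ext_sym[OF ext_prod_cong]] ext_refl)
   (simp_all only: cl_ne cl_mem not_False_eq_True ext_terms_simps)
 then show ?thesis unfolding exterior_algebra_def by simp
qed

lemma EA_parity: "parity_part EA p = cl ` {e : T. ext_parity p e}"
 unfolding exterior_algebra_def by simp

text \<open>Evaluation descends to classes because every relation of \<open>ext_eq\<close> holds for
  the values: \<open>lq\<close> answers \<open>ext_gen_square\<close> and \<open>ce\<close> answers
  \<open>ext_scal_central\<close>; the others follow from the ring laws and linearity.\<close>

lemma ext_ev_eq:
 assumes "ext_eq R M a b" and A: "ring A" and s: "\<sigma> : ring_hom R A"
  and lc: "!!m. m : carrier M ==> l m : carrier A"
  and la: "!!m n. [| m : carrier M; n : carrier M |] ==> l (m \<oplus>\<^bsub>M\<^esub> n) = l m \<oplus>\<^bsub>A\<^esub> l n"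
  and ls: "!!r m. [| r : carrier R; m : carrier M |] ==> l (r \<odot>\<^bsub>M\<^esub> m) = \<sigma> r \<otimes>\<^bsub>A\<^esub> l m"
  and lq: "!!m. m : carrier M ==> l m \<otimes>\<^bsub>A\<^esub> l m = \<zero>\<^bsub>A\<^esub>"
  and ce: "!!r x. [| r : carrier R; x : carrier A |] ==> x \<otimes>\<^bsub>A\<^esub> \<sigma> r = \<sigma> r \<otimes>\<^bsub>A\<^esub> x"
 shows "ext_ev A \<sigma> l a = ext_ev A \<sigma> l b"
proof -
 interpret A: ring A by fact
 have sc: "!!r. r : carrier R ==> \<sigma> r : carrier A" using ring_hom_closed[OF s] .
 have c: "!!e. e : T ==> ext_ev A \<sigma> l e : carrier A" using ext_ev_closed[OF A sc lc] .
 have z: "\<sigma> \<zero> = \<zero>\<^bsub>A\<^esub>" using ring_hom_zero[OF s ring_axioms A] .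
 show ?thesis using assms(1)
 proof (induction rule: ext_eq.induct)
  case (ext_scal_central r a)
  then show ?case using ce c by simp
 next
  case (ext_sum_comm a b)
  then show ?case using A.a_comm c by simp
 qed (simp_all add: c sc lc la ls lq z A.m_assoc A.a_assoc A.l_distr A.r_distr ring_hom_add[OF s]
    ring_hom_mult[OF s] ring_hom_one[OF s])
qed

lemma ext_aug_closed: "e : T ==> ext_aug R e : carrier R"
 unfolding ext_aug_ev by (rule ext_ev_closed) (auto intro: ring_axioms)

lemma ext_aug_eq: "ext_eq R M a b ==> ext_aug R a = ext_aug R b"
 unfolding ext_aug_ev
 by (rule ext_ev_eq) (auto intro: ring_axioms m_comm ring_hom_memI)

lemma cl_map_ev:
 assumes "ext_module R' M'"
  and "!!r. r : carrier R ==> f r : carrier R'" "!!m. m : carrier M ==> g m : carrier M'"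
  and "e : T"
 shows "ext_class R' M' (map_ext_term f g e) = ext_ev (exterior_algebra R' M')
  (%r. ext_class R' M' (EScal (f r))) (%m. ext_class R' M' (EGen (g m))) e"
proof -
 interpret N: ext_module R' M' by fact
 show ?thesis using assms(4)
  by (induction e) (auto simp: N.cl_sum N.cl_prod map_ext_terms[OF assms(2,3)])
qed

text \<open>Functoriality is the universal property with the exterior algebra of the target as the
  receiving algebra.\<close>

lemma ext_eq_map:
 assumes "ext_eq R M a b" and N: "ext_module R' M'" and f: "f : ring_hom R R'"
  and g: "!!m. m : carrier M ==> g m : carrier M'"
  and ga: "!!m n. [| m : carrier M; n : carrier M |] ==> g (m \<oplus>\<^bsub>M\<^esub> n) = g m \<oplus>\<^bsub>M'\<^esub> g n"
  and gs: "!!r m. [| r : carrier R; m : carrier M |] ==> g (r \<odot>\<^bsub>M\<^esub> m) = f r \<odot>\<^bsub>M'\<^esub> g m"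
 shows "ext_eq R' M' (map_ext_term f g a) (map_ext_term f g b)"
proof -
 interpret N: ext_module R' M' by fact
 have fc: "!!r. r : carrier R ==> f r : carrier R'" using ring_hom_closed[OF f] .
 have T: "a : T" "b : T" using ext_eq_terms assms(1) by auto
 have "ext_ev N.EA (%r. N.cl (EScal (f r))) (%m. N.cl (EGen (g m))) a =
   ext_ev N.EA (%r. N.cl (EScal (f r))) (%m. N.cl (EGen (g m))) b"
 proof (rule ext_ev_eq[OF assms(1) N.EA_ring])
  show "(%r. N.cl (EScal (f r))) : ring_hom R N.EA"
   using ring_hom_trans[OF f N.cl_scal_hom] by (simp add: comp_def)
  show "x \<otimes>\<^bsub>N.EA\<^esub> N.cl (EScal (f r)) = N.cl (EScal (f r)) \<otimes>\<^bsub>N.EA\<^esub> x"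
   if "r : carrier R" "x : carrier N.EA" for r x
   using N.cl_scal_central fc that by blast
 qed (simp_all add: fc g ga gs N.cl_gen_add N.cl_gen_smult N.cl_gen_square)
 then have "N.cl (map_ext_term f g a) = N.cl (map_ext_term f g b)"
  using cl_map_ev[OF N fc g] T by simp
 then show ?thesis
  using N.cl_eq_iff[OF map_ext_terms[OF fc g T(1)]] by simp
qed

lemma ext_der_closed:
 assumes "!!r. r : carrier R ==> d r : carrier R" "!!m. m : carrier M ==> \<delta> m : carrier M"
 shows "e : T ==> ext_der d \<delta> e : T"
 by (induction e) (auto simp: assms)

text \<open>The critical relation is the vanishing square of a generator: its derivative is
  \<open>\<delta> m\<close> times \<open>m\<close> plus \<open>m\<close> times
  \<open>\<delta> m\<close>, which is zero by anticommutation.\<close>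

lemma ext_der_eq:
 assumes "ext_eq R M a b"
  and dc: "!!r. r : carrier R ==> d r : carrier R"
  and da: "!!r s. [| r : carrier R; s : carrier R |] ==> d (r \<oplus> s) = d r \<oplus> d s"
  and dm: "!!r s. [| r : carrier R; s : carrier R |] ==> d (r \<otimes> s) = d r \<otimes> s \<oplus> r \<otimes> d s"
  and ec: "!!m. m : carrier M ==> \<delta> m : carrier M"
  and ea: "!!m n. [| m : carrier M; n : carrier M |] ==> \<delta> (m \<oplus>\<^bsub>M\<^esub> n) = \<delta> m \<oplus>\<^bsub>M\<^esub> \<delta> n"
  and es: "!!r m. [| r : carrier R; m : carrier M |] ==>
        \<delta> (r \<odot>\<^bsub>M\<^esub> m) = d r \<odot>\<^bsub>M\<^esub> m \<oplus>\<^bsub>M\<^esub> r \<odot>\<^bsub>M\<^esub> \<delta> m"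
 shows "cl (ext_der d \<delta> a) = cl (ext_der d \<delta> b)"
proof -
 have c: "!!e. e : T ==> ext_der d \<delta> e : T" using ext_der_closed[OF dc ec] .
 have z: "d \<zero> = \<zero>"
 proof -
  have "d \<zero> \<oplus> d \<zero> = d \<zero>" using da[of \<zero> \<zero>] by simp
  then show ?thesis using dc[of \<zero>] by simp
 qed
 have o: "d \<one> = \<zero>"
 proof -
  have "d \<one> \<oplus> d \<one> = d \<one>" using dm[of \<one> \<one>] dc[of \<one>] by simp
  then show ?thesis using dc[of \<one>] by simp
 qed
 note s = cl_sum cl_prod cl_scal_add cl_scal_mult cl_gen_add cl_gen_smult c dc ec da dm ea es z o
  M_add M_smult EA.m_assoc EA.a_assoc EA.l_distr EA.r_distr EA_zero[symmetric] EA_one[symmetric]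
 show ?thesis using assms(1)
 proof (induction rule: ext_eq.induct)
  case (ext_sum_cong a a' b b')
  have "a : T" "a' : T" "b : T" "b' : T" using ext_sum_cong ext_eq_terms by auto
  then show ?case using ext_sum_cong.IH by (simp add: s)
 next
  case (ext_prod_cong a a' b b')
  have "a : T" "a' : T" "b : T" "b' : T" "cl a = cl a'" "cl b = cl b'"
   using ext_prod_cong ext_eq_terms cl_eqI by auto
  then show ?case using ext_prod_cong.IH by (simp add: s)
 next
  case (ext_scal_central r a)
  then show ?case by (simp add: s cl_scal_central EA.a_comm)
 next
  case (ext_gen_square m)
  then show ?case using cl_gen_anticommute[of "\<delta> m" m] by (simp add: s)
 qed (auto simp: s EA.a_ac)
qed

lemma cl_neg:
 assumes "a : T"
 shows "cl (EScal (\<ominus> \<one>)) \<otimes>\<^bsub>EA\<^esub> cl a = \<ominus>\<^bsub>EA\<^esub> cl a"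
proof -
 have "cl (EScal (\<ominus> \<one>)) \<oplus>\<^bsub>EA\<^esub> \<one>\<^bsub>EA\<^esub> = \<zero>\<^bsub>EA\<^esub>"
  unfolding EA_one EA_zero by (subst cl_scal_add[symmetric]) (auto simp: l_neg)
 then have "cl (EScal (\<ominus> \<one>)) = \<ominus>\<^bsub>EA\<^esub> \<one>\<^bsub>EA\<^esub>"
  by (intro EA.minus_equality[symmetric]) auto
 then show ?thesis using assms by (simp add: EA.l_minus)
qed

text \<open>Negating all generators induces an endomorphism that fixes classes of even terms and
  negates classes of odd ones. A class of both kinds equals its negative, and \<open>h\<close> plays
  the role of one half.\<close>

lemma ext_parity_disjoint:
 assumes M: "Module.module R M" and h: "h : carrier R" "h \<oplus> h = \<one>"
  and a: "ext_parity False a" "a : T" and b: "ext_parity True b" "b : T" and ab: "ext_eq R M a b"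
 shows "cl a = \<zero>\<^bsub>EA\<^esub>"
proof -
 interpret M: Module.module R M by fact
 let ?n = "map_ext_term (%r. r) (%m. (\<ominus> \<one>) \<odot>\<^bsub>M\<^esub> m)"
 have t: "?n e : T" if "e : T" for e by (rule map_ext_terms[OF _ _ that]) auto
 have p: "cl (?n e) = (if p then \<ominus>\<^bsub>EA\<^esub> cl e else cl e)" if "ext_parity p e" "e : T" for p e
  using that
  by (induction rule: ext_parity.induct)
   (auto simp: cl_sum cl_prod cl_gen_smult cl_neg t EA.minus_add EA.l_minus EA.r_minus)
 have "ext_eq R M (?n a) (?n b)"
  by (rule ext_eq_map[OF ab ext_module_axioms])
   (auto simp: M.smult_r_distr M.smult_assoc1[symmetric] m_comm intro!: ring_hom_memI)
 then have "cl a = \<ominus>\<^bsub>EA\<^esub> cl b" using p[OF a] p[OF b] cl_eqI by fastforce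
 then have "cl a = \<ominus>\<^bsub>EA\<^esub> cl a" using cl_eqI[OF ab] by simp
 then have z: "cl a \<oplus>\<^bsub>EA\<^esub> cl a = \<zero>\<^bsub>EA\<^esub>" using a cl_in EA.r_neg by metis
 have "cl a = cl (EScal (h \<oplus> h)) \<otimes>\<^bsub>EA\<^esub> cl a" using h a by (simp add: EA_one[symmetric])
 also have "... = cl (EScal h) \<otimes>\<^bsub>EA\<^esub> (cl a \<oplus>\<^bsub>EA\<^esub> cl a)"
  using h(1) a by (simp only: cl_scal_add[OF h(1) h(1)]) (simp add: EA.l_distr EA.r_distr)
 finally show ?thesis using z h by simp
qed

end

section \<open>Supercommutative superalgebras\<close>

definition ppart :: "('a, 'm) superalgebra_scheme => bool => 'a => 'a" where
 "ppart A p s = (THE u. u : parity_part A p & (EX v : parity_part A (~ p). s = u \<oplus>\<^bsub>A\<^esub> v))"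

text \<open>The parity involution. It records the sign that arises when an odd element, or an odd
  derivation, is moved past a section that need not be homogeneous.\<close>

definition tau :: "('a, 'm) superalgebra_scheme => 'a => 'a" where
 "tau A s = ppart A False s \<ominus>\<^bsub>A\<^esub> ppart A True s"

locale superalgebra =
 fixes A :: "('a, 'm) superalgebra_scheme" (structure)
 assumes sa: "supercommutative_superalgebra A"
begin

sublocale ring A
 using sa unfolding supercommutative_superalgebra_def by (elim conjE)

lemma sa_module: "Module.module complex_ring A"
 using sa unfolding supercommutative_superalgebra_def by (elim conjE)

sublocale Cmod: Module.module complex_ring A by (rule sa_module)

lemma complex_ring_simps [simp]:
 "carrier complex_ring = UNIV" "c \<oplus>\<^bsub>complex_ring\<^esub> d = c + d" "c \<otimes>\<^bsub>complex_ring\<^esub> d = c * d"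
 "\<one>\<^bsub>complex_ring\<^esub> = 1" "\<zero>\<^bsub>complex_ring\<^esub> = 0"
 unfolding complex_ring_def by simp_all

lemma sm_closed [simp]: "s : carrier A ==> c \<odot> s : carrier A"
 using Cmod.smult_closed by simp

lemma sm_add: "[| s : carrier A; t : carrier A |] ==> c \<odot> (s \<oplus> t) = c \<odot> s \<oplus> c \<odot> t"
 using Cmod.smult_r_distr by simp

lemma sm_plus: "s : carrier A ==> (c + d) \<odot> s = c \<odot> s \<oplus> d \<odot> s"
 using Cmod.smult_l_distr[of c d s] by simp

lemma sm_times: "s : carrier A ==> c \<odot> (d \<odot> s) = (c * d) \<odot> s"
 using Cmod.smult_assoc1[of c d s] by simp

lemma sm_1 [simp]: "s : carrier A ==> 1 \<odot> s = s"
 using Cmod.smult_one[of s] by simp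

lemma sm_0 [simp]: "s : carrier A ==> 0 \<odot> s = \<zero>"
 using Cmod.smult_l_null[of s] by simp

lemma sm_zero [simp]: "c \<odot> \<zero> = \<zero>"
 using Cmod.smult_r_null[of c] by simp

lemma sm_minus: "s : carrier A ==> c \<odot> (\<ominus> s) = \<ominus> (c \<odot> s)"
 using Cmod.smult_r_minus[of c s] by simp

lemma sm_m1: "s : carrier A ==> (-1) \<odot> s = \<ominus> s"
 using sm_plus[of s 1 "-1"] by (metis add.right_inverse minus_equality sm_0 sm_1 sm_closed a_comm)

lemma sm_neg: "s : carrier A ==> (- c) \<odot> s = \<ominus> (c \<odot> s)"
 using sm_times[of s "-1" c] sm_m1[of "c \<odot> s"] by simp

lemma sa_smult: "ALL c. ALL s : carrier A. ALL t : carrier A.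
  (c \<odot> s) \<otimes> t = c \<odot> (s \<otimes> t) & s \<otimes> (c \<odot> t) = c \<odot> (s \<otimes> t)"
 using sa unfolding supercommutative_superalgebra_def by (elim conjE)

lemma sa_parity: "ALL p. additive_subgroup (parity_part A p) A &
  (ALL c. ALL s : parity_part A p. c \<odot> s : parity_part A p)"
 using sa unfolding supercommutative_superalgebra_def by (elim conjE)

lemma sa_decompose: "ALL s : carrier A. EX! (u, v). u : parity_part A False &
  v : parity_part A True & s = u \<oplus> v"
 using sa unfolding supercommutative_superalgebra_def by (elim conjE)

lemma sa_commute: "ALL p q. ALL s : parity_part A p. ALL t : parity_part A q.
  s \<otimes> t : parity_part A (p ~= q) & s \<otimes> t = signed A (p & q) (t \<otimes> s)"
 using sa unfolding supercommutative_superalgebra_def by (elim conjE)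

lemma sm_mult:
 assumes "s : carrier A" "t : carrier A"
 shows "(c \<odot> s) \<otimes> t = c \<odot> (s \<otimes> t)" "s \<otimes> (c \<odot> t) = c \<odot> (s \<otimes> t)"
 using sa_smult assms by simp_all

lemma half:
 assumes "s : carrier A" "s \<oplus> s = \<zero>"
 shows "s = \<zero>"
proof -
 have "s = (1/2) \<odot> (s \<oplus> s)" using assms(1) sm_plus[of s "1/2" "1/2"] by (simp add: sm_add)
 then show ?thesis using assms(2) by simp
qed

lemma part_subgroup: "additive_subgroup (parity_part A p) A"
 using sa_parity by simp

lemma part_carrier [simp]: "s : parity_part A p ==> s : carrier A"
 using additive_subgroup.a_subset[OF part_subgroup] by auto

lemma part_zero [simp]: "\<zero> : parity_part A p"
 using additive_subgroup.zero_closed[OF part_subgroup] .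

lemma part_add: "[| s : parity_part A p; t : parity_part A p |] ==> s \<oplus> t : parity_part A p"
 using additive_subgroup.a_closed[OF part_subgroup] .

lemma part_neg: "s : parity_part A p ==> \<ominus> s : parity_part A p"
 using group.subgroupE(3)[OF add.is_group additive_subgroup.a_subgroup[OF part_subgroup]]
 by (simp add: a_inv_def)

lemma part_diff: "[| s : parity_part A p; t : parity_part A p |] ==> s \<ominus> t : parity_part A p"
 unfolding a_minus_def by (intro part_add part_neg)

lemma part_mult:
 assumes "s : parity_part A p" "t : parity_part A q"
 shows "s \<otimes> t : parity_part A (p ~= q)" and part_commute: "s \<otimes> t = signed A (p & q) (t \<otimes> s)"
 using sa_commute[rule_format, OF assms] by (rule conjunct1, rule conjunct2)

lemma part_decompose_ex1: "s : carrier A ==>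
  EX! (u, v). u : parity_part A False & v : parity_part A True & s = u \<oplus> v"
 using sa_decompose by (rule bspec)

lemma part_unique:
 assumes "u : parity_part A False" "v : parity_part A True" "u' : parity_part A False"
  "v' : parity_part A True" "u \<oplus> v = u' \<oplus> v'"
 shows "u = u'" "v = v'"
proof -
 have ex: "EX! (a, b). a : parity_part A False & b : parity_part A True & u \<oplus> v = a \<oplus> b"
  by (rule part_decompose_ex1) (simp add: part_carrier[OF assms(1)] part_carrier[OF assms(2)])
 have "(u, v) = (u', v')"
  by (rule trans[OF the1_equality[OF ex, symmetric] the1_equality[OF ex]])
   (simp_all add: assms(1-4) assms(5)[symmetric])
 then show "u = u'" "v = v'" by simp_all
qed

lemma ppart_eqI:
 assumes "u : parity_part A False" "v : parity_part A True"
 shows "ppart A False (u \<oplus> v) = u" "ppart A True (u \<oplus> v) = v"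
proof -
 show "ppart A False (u \<oplus> v) = u"
  unfolding ppart_def
 proof (rule the_equality)
  show "u : parity_part A False & (EX va:parity_part A (~ False). u \<oplus> v = u \<oplus> va)"
   using assms by auto
  fix w assume "w : parity_part A False & (EX v':parity_part A (~ False). u \<oplus> v = w \<oplus> v')"
  then obtain v' where "w : parity_part A False" "v' : parity_part A True" "u \<oplus> v = w \<oplus> v'" by auto
  then show "w = u" using part_unique(1)[OF assms] by simp
 qed
 show "ppart A True (u \<oplus> v) = v"
  unfolding ppart_def
 proof (rule the_equality)
  show "v : parity_part A True & (EX va:parity_part A (~ True). u \<oplus> v = v \<oplus> va)"
   using assms a_comm[of u v] by (intro conjI bexI[of _ u]) simp_all
  fix w assume w: "w : parity_part A True & (EX v':parity_part A (~ True). u \<oplus> v = w \<oplus> v')"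
  then obtain v' where v': "v' : parity_part A False" "u \<oplus> v = w \<oplus> v'" by auto
  then have "u \<oplus> v = v' \<oplus> w" using w v' a_comm[OF part_carrier part_carrier, of w True v' False] by simp
  then show "w = v" using part_unique(2)[OF assms v'(1) conjunct1[OF w]] by simp
 qed
qed

lemma ppart_decompose:
 assumes "s : carrier A"
 shows "s = ppart A False s \<oplus> ppart A True s" and ppart_in: "ppart A p s : parity_part A p"
proof -
 obtain u v where uv: "u : parity_part A False" "v : parity_part A True" "s = u \<oplus> v"
  using ex1_implies_ex[OF part_decompose_ex1[OF assms]] by auto
 show "s = ppart A False s \<oplus> ppart A True s" using ppart_eqI[OF uv(1,2)] uv(3) by simp
 show "ppart A p s : parity_part A p" using ppart_eqI[OF uv(1,2)] uv by (cases p) simp_all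
qed

lemma ppart_carrier [simp]: "s : carrier A ==> ppart A p s : carrier A"
 using ppart_in part_carrier by metis

lemma ppart_add:
 assumes "s : carrier A" "t : carrier A"
 shows "ppart A p (s \<oplus> t) = ppart A p s \<oplus> ppart A p t"
proof -
 have "s \<oplus> t = (ppart A False s \<oplus> ppart A False t) \<oplus> (ppart A True s \<oplus> ppart A True t)"
 proof -
  have "(ppart A False s \<oplus> ppart A False t) \<oplus> (ppart A True s \<oplus> ppart A True t) =
    (ppart A False s \<oplus> ppart A True s) \<oplus> (ppart A False t \<oplus> ppart A True t)"
   using assms by (simp add: a_ac)
  then show ?thesis
   by (simp only: ppart_decompose(1)[OF assms(1), symmetric] ppart_decompose(1)[OF assms(2), symmetric])
 qed
 then show ?thesis
  using ppart_eqI[OF part_add[OF ppart_in ppart_in] part_add[OF ppart_in ppart_in], OF assms assms]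
  by (cases p) simp_all
qed

lemma ppart_homogeneous:
 assumes "s : parity_part A p"
 shows "ppart A q s = (if q = p then s else \<zero>)"
proof (cases p)
 case True
 then have "s : parity_part A True" using assms by simp
 from ppart_eqI[OF part_zero this] show ?thesis using True assms by (cases q) simp_all
next
 case False
 then have "s : parity_part A False" using assms by simp
 from ppart_eqI[OF this part_zero] show ?thesis using False assms by (cases q) simp_all
qed

lemma even_commute:
 assumes "x : parity_part A False" "s : carrier A"
 shows "s \<otimes> x = x \<otimes> s"
proof -
 have x: "x : carrier A" using assms by simp
 have "s \<otimes> x = ppart A False s \<otimes> x \<oplus> ppart A True s \<otimes> x"
  using ppart_decompose(1)[OF assms(2)] assms(2) x by (metis l_distr ppart_carrier)
 also have "... = x \<otimes> ppart A False s \<oplus> x \<otimes> ppart A True s"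
  using part_commute[OF ppart_in assms(1), OF assms(2)] by (simp add: signed_def)
 also have "... = x \<otimes> s"
  using ppart_decompose(1)[OF assms(2)] assms(2) x by (metis r_distr ppart_carrier)
 finally show ?thesis .
qed

lemma tau_closed [simp]: "s : carrier A ==> tau A s : carrier A"
 unfolding tau_def by simp

lemma tau_add: "[| s : carrier A; t : carrier A |] ==> tau A (s \<oplus> t) = tau A s \<oplus> tau A t"
 unfolding tau_def a_minus_def by (simp add: ppart_add minus_add a_ac)

lemma odd_commute:
 assumes "x : parity_part A True" "s : carrier A"
 shows "s \<otimes> x = x \<otimes> tau A s"
proof -
 have x: "x : carrier A" using assms by simp
 have "s \<otimes> x = ppart A False s \<otimes> x \<oplus> ppart A True s \<otimes> x"
  using ppart_decompose(1)[OF assms(2)] assms(2) x by (metis l_distr ppart_carrier)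
 also have "... = x \<otimes> ppart A False s \<oplus> \<ominus> (x \<otimes> ppart A True s)"
  using part_commute[OF ppart_in assms(1), OF assms(2)] by (simp add: signed_def)
 also have "... = x \<otimes> tau A s"
  unfolding tau_def a_minus_def using assms(2) x by (simp add: r_distr r_minus)
 finally show ?thesis .
qed

lemma odd_square:
 assumes "x : parity_part A True"
 shows "x \<otimes> x = \<zero>"
proof (rule half)
 have "x \<otimes> x = \<ominus> (x \<otimes> x)" using part_commute[OF assms assms] by (simp add: signed_def)
 then show "x \<otimes> x \<oplus> x \<otimes> x = \<zero>" using assms part_carrier by (metis m_closed r_neg)
qed (use assms in simp)

lemma tau_mult:
 assumes s: "s : carrier A" and t: "t : carrier A"
 shows "tau A (s \<otimes> t) = tau A s \<otimes> tau A t"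
proof -
 define a b c d where "a = ppart A False s" "b = ppart A True s" "c = ppart A False t" "d = ppart A True t"
 note d = this
 have p: "a : parity_part A False" "b : parity_part A True" "c : parity_part A False" "d : parity_part A True"
  unfolding d by (rule ppart_in[OF s] ppart_in[OF t])+
 have c: "a : carrier A" "b : carrier A" "c : carrier A" "d : carrier A" using p by simp_all
 have st: "s = a \<oplus> b" "t = c \<oplus> d" unfolding d using ppart_decompose(1)[OF s] ppart_decompose(1)[OF t] by simp_all
 have m: "a \<otimes> c : parity_part A False" "b \<otimes> d : parity_part A False"
  "a \<otimes> d : parity_part A True" "b \<otimes> c : parity_part A True"
  using part_mult[OF p(1) p(3)] part_mult[OF p(2) p(4)] part_mult[OF p(1) p(4)] part_mult[OF p(2) p(3)]
  by simp_all
 have "s \<otimes> t = (a \<otimes> c \<oplus> b \<otimes> d) \<oplus> (a \<otimes> d \<oplus> b \<otimes> c)"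
  unfolding st using c by (simp add: l_distr r_distr a_ac)
 then have "tau A (s \<otimes> t) = (a \<otimes> c \<oplus> b \<otimes> d) \<ominus> (a \<otimes> d \<oplus> b \<otimes> c)"
  unfolding tau_def using ppart_eqI[OF part_add[OF m(1,2)] part_add[OF m(3,4)]] by simp
 also have "... = (a \<ominus> b) \<otimes> (c \<ominus> d)"
  using c by (simp add: a_minus_def l_distr r_distr l_minus r_minus minus_add a_ac)
 finally show ?thesis unfolding tau_def d by simp
qed

text \<open>Expresses the parity components by linear operations and \<open>tau\<close>. A complex
  subspace stable under \<open>tau\<close>, such as a power of the nilpotent ideal, therefore
  contains the components of its elements.\<close>

lemma ppart_tau:
 assumes "s : carrier A"
 shows "ppart A False s = (1/2) \<odot> (s \<oplus> tau A s)" "ppart A True s = (1/2) \<odot> (s \<ominus> tau A s)"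
proof -
 define a b where "a = ppart A False s" "b = ppart A True s"
 note d = this
 have c: "a : carrier A" "b : carrier A" "s = a \<oplus> b" unfolding d using ppart_decompose assms by simp_all
 have h: "x = (1/2) \<odot> (x \<oplus> x)" if "x : carrier A" for x
  using that sm_plus[of x "1/2" "1/2"] by (simp add: sm_add)
 have t: "tau A s = a \<ominus> b" unfolding tau_def d ..
 have "s \<oplus> tau A s = a \<oplus> a" unfolding t unfolding c(3) using c(1,2)
  by (simp add: a_minus_def a_ac r_neg r_neg1 r_neg2)
 then show "ppart A False s = (1/2) \<odot> (s \<oplus> tau A s)" using h[OF c(1)] d by simp
 have "s \<ominus> tau A s = (b \<oplus> b) \<oplus> (a \<oplus> \<ominus> a)" unfolding t unfolding c(3) using c(1,2)
  by (simp add: a_minus_def minus_add a_ac)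
 then have "s \<ominus> tau A s = b \<oplus> b" using c(1,2) by (simp add: r_neg)
 then show "ppart A True s = (1/2) \<odot> (s \<ominus> tau A s)" using h[OF c(2)] d by simp
qed

end

lemma superalgebra_hom_ppart:
 assumes "supercommutative_superalgebra A" "supercommutative_superalgebra B"
  and "superalgebra_hom A B f" "s : carrier A"
 shows "f (ppart A p s) = ppart B p (f s)"
proof -
 interpret A: superalgebra A by unfold_locales fact
 interpret B: superalgebra B by unfold_locales fact
 have h: "f : ring_hom A B" and "!!p. f ` parity_part A p <= parity_part B p"
  using assms(3) unfolding superalgebra_hom_def by auto
 then have q: "f (ppart A p s) : parity_part B p" for p using A.ppart_in[OF assms(4), of p] by auto
 have "f s = f (ppart A False s) \<oplus>\<^bsub>B\<^esub> f (ppart A True s)"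
  using A.ppart_decompose(1)[OF assms(4)] ring_hom_add[OF h, of "ppart A False s" "ppart A True s"] assms(4)
  by simp
 then show ?thesis using B.ppart_eqI[OF q q] by (cases p) simp_all
qed

lemma superderivationD:
 assumes "homogeneous_superderivation A p D"
 shows "s : carrier A ==> D s : carrier A"
  and "[| s : carrier A; t : carrier A |] ==> D (s \<oplus>\<^bsub>A\<^esub> t) = D s \<oplus>\<^bsub>A\<^esub> D t"
  and "s : carrier A ==> D (c \<odot>\<^bsub>A\<^esub> s) = c \<odot>\<^bsub>A\<^esub> D s"
  and "s : parity_part A q ==> D s : parity_part A (p ~= q)"
  and "[| s : parity_part A q; t : carrier A |] ==>
   D (s \<otimes>\<^bsub>A\<^esub> t) = (D s \<otimes>\<^bsub>A\<^esub> t) \<oplus>\<^bsub>A\<^esub> signed A (p & q) (s \<otimes>\<^bsub>A\<^esub> D t)"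
proof -
 note d = assms[unfolded homogeneous_superderivation_def]
 note D = conjunct1[OF d] conjunct1[OF conjunct2[OF d]] conjunct1[OF conjunct2[OF conjunct2[OF d]]]
  conjunct1[OF conjunct2[OF conjunct2[OF conjunct2[OF d]]]]
  conjunct2[OF conjunct2[OF conjunct2[OF conjunct2[OF d]]]]
 show "s : carrier A ==> D s : carrier A" using D(1) by (simp add: Pi_iff)
 show "[| s : carrier A; t : carrier A |] ==> D (s \<oplus>\<^bsub>A\<^esub> t) = D s \<oplus>\<^bsub>A\<^esub> D t" using D(2) by simp
 show "s : carrier A ==> D (c \<odot>\<^bsub>A\<^esub> s) = c \<odot>\<^bsub>A\<^esub> D s" using D(3) by simp
 show "s : parity_part A q ==> D s : parity_part A (p ~= q)" using D(4) by (simp add: image_subset_iff)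
 show "[| s : parity_part A q; t : carrier A |] ==>
   D (s \<otimes>\<^bsub>A\<^esub> t) = (D s \<otimes>\<^bsub>A\<^esub> t) \<oplus>\<^bsub>A\<^esub> signed A (p & q) (s \<otimes>\<^bsub>A\<^esub> D t)" using D(5) by simp
qed

locale even_derivation = superalgebra A for A :: "('a, 'm) superalgebra_scheme" (structure) +
 fixes D
 assumes D: "homogeneous_superderivation A False D"
begin

lemma
 shows D_closed [simp]: "s : carrier A ==> D s : carrier A"
  and D_add: "[| s : carrier A; t : carrier A |] ==> D (s \<oplus> t) = D s \<oplus> D t"
  and D_smult: "s : carrier A ==> D (c \<odot> s) = c \<odot> D s"
  and D_part: "s : parity_part A q ==> D s : parity_part A q"
 using superderivationD[OF D] by simp_all

lemma D_mult:
 assumes "s : carrier A" "t : carrier A"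
 shows "D (s \<otimes> t) = D s \<otimes> t \<oplus> s \<otimes> D t"
proof -
 have h: "D (u \<otimes> t) = D u \<otimes> t \<oplus> u \<otimes> D t" if "u : parity_part A q" for u q
  using superderivationD(5)[OF D that assms(2)] by (simp add: signed_def)
 define a b where "a = ppart A False s" "b = ppart A True s"
 note d = this
 have c: "a : carrier A" "b : carrier A" "s = a \<oplus> b" unfolding d using ppart_decompose assms by simp_all
 have "D (a \<otimes> t) = D a \<otimes> t \<oplus> a \<otimes> D t" "D (b \<otimes> t) = D b \<otimes> t \<oplus> b \<otimes> D t"
  unfolding d by (rule h[OF ppart_in[OF assms(1)]])+
 then show ?thesis unfolding c(3) using c(1,2) assms(2) by (simp add: l_distr D_add a_ac)
qed

lemma D_minus: "s : carrier A ==> D (\<ominus> s) = \<ominus> D s"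
 using D_smult[of s "-1"] by (simp add: sm_m1)

lemma D_diff: "[| s : carrier A; t : carrier A |] ==> D (s \<ominus> t) = D s \<ominus> D t"
 by (simp add: a_minus_def D_add D_minus)

lemma D_one: "D \<one> = \<zero>"
 using D_mult[of \<one> \<one>] D_closed[of \<one>] by simp

end

locale odd_derivation = superalgebra A for A :: "('a, 'm) superalgebra_scheme" (structure) +
 fixes D
 assumes D: "homogeneous_superderivation A True D"
begin

lemma
 shows D_closed [simp]: "s : carrier A ==> D s : carrier A"
  and D_add: "[| s : carrier A; t : carrier A |] ==> D (s \<oplus> t) = D s \<oplus> D t"
  and D_smult: "s : carrier A ==> D (c \<odot> s) = c \<odot> D s"
  and D_part: "s : parity_part A q ==> D s : parity_part A (~ q)"
 using superderivationD[OF D] by simp_all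

lemma D_mult:
 assumes "s : carrier A" "t : carrier A"
 shows "D (s \<otimes> t) = D s \<otimes> t \<oplus> tau A s \<otimes> D t"
proof -
 have h: "D (u \<otimes> t) = D u \<otimes> t \<oplus> signed A q (u \<otimes> D t)" if "u : parity_part A q" for u q
  using superderivationD(5)[OF D that assms(2)] by simp
 define a b where "a = ppart A False s" "b = ppart A True s"
 note d = this
 have c: "a : carrier A" "b : carrier A" "s = a \<oplus> b" unfolding d using ppart_decompose assms by simp_all
 have "D (a \<otimes> t) = D a \<otimes> t \<oplus> a \<otimes> D t" "D (b \<otimes> t) = D b \<otimes> t \<oplus> \<ominus> (b \<otimes> D t)"
  unfolding d using h[OF ppart_in[OF assms(1)]] by (simp_all add: signed_def)
 then have "D (a \<otimes> t \<oplus> b \<otimes> t) = (D a \<oplus> D b) \<otimes> t \<oplus> (a \<oplus> \<ominus> b) \<otimes> D t"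
  using c(1,2) assms(2) by (simp add: D_add l_distr l_minus a_ac)
 moreover have "tau A s = a \<oplus> \<ominus> b" unfolding tau_def d a_minus_def ..
 moreover have "s \<otimes> t = a \<otimes> t \<oplus> b \<otimes> t" unfolding c(3) using c(1,2) assms(2) by (simp add: l_distr)
 moreover have "D s = D a \<oplus> D b" unfolding c(3) using c(1,2) by (simp add: D_add)
 ultimately show ?thesis by simp
qed

end

section \<open>Sheaves of supercommutative superalgebras\<close>

locale superalgebra_sheaf_on =
 fixes X :: "'x topology" and F :: "('x, 'a) superalgebra_sheaf"
 assumes sheaf: "sheaf_of_supercommutative_algebras X F"
begin

lemma F_is_sheaf: "is_sheaf X F"
 using sheaf unfolding sheaf_of_supercommutative_algebras_def by (elim conjE)

sublocale presheaf_on X F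
 using F_is_sheaf unfolding is_sheaf_def by unfold_locales (elim conjE)

lemma F_sa: "openin X U ==> supercommutative_superalgebra (sec F U)"
 using sheaf unfolding sheaf_of_supercommutative_algebras_def by (elim conjE) simp

lemma F_super: "openin X U ==> superalgebra (sec F U)"
 using F_sa by unfold_locales

lemma F_ring: "openin X U ==> ring (sec F U)"
 using F_sa unfolding supercommutative_superalgebra_def by simp

lemma F_rst_hom: "[| openin X U; openin X V; V <= U |] ==> superalgebra_hom (sec F U) (sec F V) (rst F U V)"
 using sheaf unfolding sheaf_of_supercommutative_algebras_def by (elim conjE) simp

context
 fixes U V assumes o: "openin X U" "openin X V" "V <= U"
begin

lemma F_rst_ring_hom: "rst F U V : ring_hom (sec F U) (sec F V)"
 using F_rst_hom[OF o] unfolding superalgebra_hom_def by simp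

lemmas F_rst_add = ring_hom_add[OF F_rst_ring_hom]
lemmas F_rst_mult = ring_hom_mult[OF F_rst_ring_hom]
lemmas F_rst_one = ring_hom_one[OF F_rst_ring_hom]

lemma F_rst_zero: "rst F U V \<zero>[F,U] = \<zero>[F,V]"
 using ring_hom_zero[OF F_rst_ring_hom F_ring F_ring] o by simp

lemma F_rst_smult: "s : Sec F U ==> rst F U V (c \<odot>[F,U] s) = c \<odot>[F,V] rst F U V s"
 using F_rst_hom[OF o] unfolding superalgebra_hom_def by simp

lemma F_rst_part: "s : Par F U p ==> rst F U V s : Par F V p"
 using F_rst_hom[OF o] unfolding superalgebra_hom_def by (simp add: image_subset_iff)

lemma F_rst_ppart: "s : Sec F U ==> rst F U V (ppart (sec F U) p s) = ppart (sec F V) p (rst F U V s)"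
 using superalgebra_hom_ppart[OF F_sa F_sa F_rst_hom] o by simp

lemma F_rst_minus: "s : Sec F U ==> rst F U V (\<ominus>[F,U] s) = \<ominus>[F,V] rst F U V s"
 using F_rst_smult[of s "-1"] superalgebra.sm_m1[OF F_super] o rst_closed[OF o] by metis

lemma F_rst_diff:
 assumes "s : Sec F U" "t : Sec F U"
 shows "rst F U V (s \<ominus>[F,U] t) = rst F U V s \<ominus>[F,V] rst F U V t"
proof -
 interpret A: ring "sec F U" using F_ring o by simp
 show ?thesis using assms unfolding a_minus_def by (simp add: F_rst_add F_rst_minus)
qed

end

lemma glue:
 assumes "!!V. V : \<U> ==> openin X V & s V : Sec F V"
  and "!!V W. [| V : \<U>; W : \<U> |] ==> rst F V (V \<inter> W) (s V) = rst F W (V \<inter> W) (s W)"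
 shows "EX! t. t : Sec F (\<Union>\<U>) & (ALL V:\<U>. rst F (\<Union>\<U>) V t = s V)"
 by (rule conjunct2[OF F_is_sheaf[unfolded is_sheaf_def], rule_format], intro conjI ballI)
  (use assms in simp_all)

text \<open>Uniqueness of gluing, applied to the cover by all open sets on which the two sections
  agree.\<close>

lemma separated:
 assumes V: "openin X V" and s: "s : Sec F V" "t : Sec F V"
  and loc: "!!x. x : V ==> EX W. openin X W & x : W & W <= V & rst F V W s = rst F V W t"
 shows "s = t"
proof -
 let ?U = "{W. openin X W & W <= V & rst F V W s = rst F V W t}"
 have U: "\<Union>?U = V" using loc by fast
 have "EX! t. t : Sec F (\<Union>?U) & (ALL W:?U. rst F (\<Union>?U) W t = rst F V W s)"
 proof (rule glue)
  fix W assume "W : ?U"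
  then show "openin X W & rst F V W s : Sec F W" using rst_closed V s by simp
 next
  fix W W' assume "W : ?U" "W' : ?U"
  then have "openin X W" "openin X W'" "W <= V" "W' <= V" by simp_all
  then show "rst F W (W \<inter> W') (rst F V W s) = rst F W' (W \<inter> W') (rst F V W' s)"
   by (simp add: rst_rst[OF V _ _ _ _ s(1)] openin_Int le_infI1 le_infI2 del: Int_subset_iff)
 qed
 then obtain u where "!!v. v : Sec F V ==> (ALL W:?U. rst F V W v = rst F V W s) ==> v = u"
  unfolding U by auto
 then show ?thesis using s by auto
qed

text \<open>Sections with property \<open>Q\<close> are unique wherever they exist, and
  \<open>Q\<close> is inherited by restrictions, so local solutions agree on overlaps automatically.
  \<open>Q\<close> itself is not asserted of the glued section, as it may fail to be local; each
  application recovers what it wants from the restrictions.\<close>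

lemma glue_unique:
 assumes V: "openin X V"
  and ex: "!!x. x : V ==> EX W s. openin X W & x : W & W <= V & s : Sec F W & Q W s"
  and he: "!!W W' s. [| openin X W; openin X W'; W' <= W; W <= V; s : Sec F W; Q W s |]
    ==> Q W' (rst F W W' s)"
  and un: "!!W s s'. [| openin X W; W <= V; s : Sec F W; s' : Sec F W; Q W s; Q W s' |]
    ==> s = s'"
 shows "EX! t. t : Sec F V &
  (ALL W s. openin X W & W <= V & s : Sec F W & Q W s --> rst F V W t = s)"
proof -
 let ?U = "{W. openin X W & W <= V & (EX s. s : Sec F W & Q W s)}"
 define s where "s = (%W. SOME s. s : Sec F W & Q W s)"
 have s: "s W : Sec F W" "Q W (s W)" if "W : ?U" for W
  unfolding s_def using that someI_ex[of "%s. s : Sec F W & Q W s"] by auto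
 have U: "\<Union>?U = V" using ex by fast
 have eq: "s' = s W" if "openin X W" "W <= V" "s' : Sec F W" "Q W s'" for W s'
 proof -
  have "W : ?U" using that by auto
  then show ?thesis using un[OF that(1-3) s(1) that(4) s(2)] by simp
 qed
 have "EX! t. t : Sec F (\<Union>?U) & (ALL W:?U. rst F (\<Union>?U) W t = s W)"
 proof (rule glue)
  fix W assume "W : ?U"
  then show "openin X W & s W : Sec F W" using s(1)[of W] by simp
 next
  fix W W' assume W: "W : ?U" "W' : ?U"
  have o: "openin X W" "openin X W'" "openin X (W \<inter> W')" "W <= V" "W' <= V" "W \<inter> W' <= V"
   using W by auto
  have "rst F W (W \<inter> W') (s W) = s (W \<inter> W')"
   by (intro eq he[of W] rst_closed) (use o s[OF W(1)] in auto)
  moreover have "rst F W' (W \<inter> W') (s W') = s (W \<inter> W')"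
   by (intro eq he[of W'] rst_closed) (use o s[OF W(2)] in auto)
  ultimately show "rst F W (W \<inter> W') (s W) = rst F W' (W \<inter> W') (s W')" by simp
 qed
 then have ex1: "EX! t. t : Sec F V & (ALL W:?U. rst F V W t = s W)" unfolding U .
 have "(ALL W:?U. rst F V W t = s W) \<longleftrightarrow>
  (ALL W s. openin X W & W <= V & s : Sec F W & Q W s --> rst F V W t = s)" for t
 proof (intro iffI allI impI ballI)
  fix W s' assume *: "ALL W:?U. rst F V W t = s W"
   and W: "openin X W & W <= V & s' : Sec F W & Q W s'"
  then have "W : ?U" by auto
  then show "rst F V W t = s'" using * eq[of W s'] W by simp
 next
  fix W assume *: "ALL W s. openin X W & W <= V & s : Sec F W & Q W s --> rst F V W t = s"
   and "W : ?U"
  then show "rst F V W t = s W" using s[of W] by simp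
 qed
 then show ?thesis using ex1 by simp
qed

lemma part_local:
 assumes V: "openin X V" and s: "s : Sec F V"
  and loc: "!!x. x : V ==> EX W. openin X W & x : W & W <= V & rst F V W s : Par F W p"
 shows "s : Par F V p"
proof -
 interpret A: superalgebra "sec F V" using F_super[OF V] .
 have "s = ppart (sec F V) p s"
 proof (rule separated[OF V s])
  fix x assume "x : V"
  then obtain W where W: "openin X W" "x : W" "W <= V" "rst F V W s : Par F W p"
   using loc by auto
  then show "EX W. openin X W & x : W & W <= V & rst F V W s = rst F V W (ppart (sec F V) p s)"
   using F_rst_ppart[OF V W(1) W(3) s, of p] superalgebra.ppart_homogeneous[OF F_super[OF W(1)] W(4), of p]
   by (intro exI[of _ W]) simp
 qed (use s in simp)
 then show ?thesis using A.ppart_in[OF s, of p] by simp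
qed

end

section \<open>The exterior sheaf\<close>

text \<open>Used both for the module of a chart and for the odd cotangent sheaf. By
  \<open>E_ne\<close> there is a generator \<open>m\<close>, and \<open>0\<close> times
  \<open>m\<close> is an odd term that represents zero; as a scalar, zero is an even term
  only.\<close>

locale exterior_base =
 fixes X :: "'x topology"
  and R :: "('x, 'x => complex) superalgebra_sheaf"
  and E :: "('x, 'x => complex, 'm) module_sheaf"
 assumes R_cring: "openin X U ==> cring (sec R U)"
  and R_rst: "rst R U V f = restrict f V"
  and R_ext: "[| openin X U; f : Sec R U |] ==> f : extensional U"
  and R_hom: "[| openin X U; openin X V; V <= U |] ==> rst R U V : ring_hom (sec R U) (sec R V)"
  and R_smult: "openin X U ==> c \<odot>[R,U] \<one>[R,U] : Sec R U"
  and R_rst_smult: "[| openin X U; openin X V; V <= U |] ==>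
   rst R U V (c \<odot>[R,U] \<one>[R,U]) = c \<odot>[R,V] \<one>[R,V]"
  and E_presheaf: "is_presheaf X E"
  and E_add: "[| openin X U; m : Sec E U; n : Sec E U |] ==>
   m \<oplus>[E,U] n : Sec E U"
  and E_smult: "[| openin X U; f : Sec R U; m : Sec E U |] ==>
   f \<odot>[E,U] m : Sec E U"
  and E_rst_add: "[| openin X U; openin X V; V <= U; m : Sec E U; n : Sec E U |] ==>
   rst E U V (m \<oplus>[E,U] n) = rst E U V m \<oplus>[E,V] rst E U V n"
  and E_rst_smult: "[| openin X U; openin X V; V <= U; f : Sec R U; m : Sec E U |] ==>
   rst E U V (f \<odot>[E,U] m) = rst R U V f \<odot>[E,V] rst E U V m"
  and E_ne: "openin X U ==> Sec E U ~= {}"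
begin

sublocale E: presheaf_on X E by unfold_locales (rule E_presheaf)

abbreviation "P == exterior_presheaf R E"
abbreviation "B == exterior_sheaf X R E"
abbreviation "cls U == ext_class (sec R U) (sec E U)"
abbreviation "trm U == ext_terms (sec R U) (sec E U)"
abbreviation "eeq U == ext_eq (sec R U) (sec E U)"
abbreviation "tr V W == map_ext_term (rst R V W) (rst E V W)"

lemma EM: "openin X U ==> ext_module (sec R U) (sec E U)"
 by (rule ext_module.intro) (rule R_cring E_add E_smult; assumption)+

lemma R_ring: "openin X U ==> ring (sec R U)"
 using R_cring by (rule cring.axioms(1))

lemma R_closed: "[| openin X U; openin X V; V <= U; f : Sec R U |] ==>
  rst R U V f : Sec R V"
 using ring_hom_closed[OF R_hom] .

lemma R_zero: "[| openin X U; openin X V; V <= U |] ==> rst R U V \<zero>[R,U] = \<zero>[R,V]"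
 using ring_hom_zero[OF R_hom R_ring R_ring] .

lemma zero_in: "openin X U ==> \<zero>[R,U] : Sec R U"
 and one_in: "openin X U ==> \<one>[R,U] : Sec R U"
 using ring.ring_simprules[OF R_ring] by simp_all

lemma tr_trm: "[| openin X U; openin X V; V <= U; e : trm U |] ==> tr U V e : trm V"
 using map_ext_terms[of "sec R U" _ "sec R V" "sec E U" _ "sec E V", OF R_closed E.rst_closed] .

lemma tr_eq: "[| openin X U; openin X V; V <= U; eeq U a b |] ==> eeq V (tr U V a) (tr U V b)"
 by (rule ext_module.ext_eq_map[OF EM _ EM R_hom])
  (simp_all add: E.rst_closed E_rst_add E_rst_smult)

lemma tr_id: "[| openin X U; e : trm U |] ==> tr U U e = e"
 using map_ext_cong[of e "sec R U" "sec E U" "rst R U U" "%r. r" "rst E U U" "%m. m"]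
 by (simp add: E.rst_id R_rst R_ext extensional_restrict ext_term.map_ident)

lemma tr_tr: "[| openin X U; openin X V; openin X W; W <= V; V <= U; e : trm U |] ==>
  tr V W (tr U V e) = tr U W e"
 unfolding ext_term.map_comp comp_def
 by (rule map_ext_cong[of e "sec R U" "sec E U"])
  (simp_all add: E.rst_rst R_rst restrict_restrict Int_absorb1)

lemma P_sec: "sec P U = exterior_algebra (sec R U) (sec E U)"
 unfolding exterior_presheaf_def by simp

lemma P_carrier: "openin X U ==> Sec P U = cls U ` trm U"
 unfolding P_sec by (rule ext_module.EA_carrier[OF EM])

lemma cls_eq_iff: "[| openin X U; a : trm U |] ==> cls U a = cls U b \<longleftrightarrow> eeq U a b"
 using ext_module.cl_eq_iff[OF EM] .

lemma cls_in: "[| openin X U; a : trm U |] ==> cls U a : Sec P U"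
 unfolding P_carrier by simp

lemma P_rst:
 assumes o: "openin X V" "openin X W" "W <= V" and e: "e : trm V"
 shows "rst P V W (cls V e) = cls W (tr V W e)"
proof -
 interpret V: ext_module "sec R V" "sec E V" by (rule EM[OF o(1)])
 interpret W: ext_module "sec R W" "sec E W" by (rule EM[OF o(2)])
 have "(\<Union>e'\<in>cls V e. cls W (tr V W e')) = cls W (tr V W e)"
 proof (rule SUP_eq_const[OF V.cl_ne[OF e]])
  fix e' assume "e' : cls V e"
  then have "eeq V e e'" unfolding V.cl_mem .
  then show "cls W (tr V W e') = cls W (tr V W e)"
   using W.cl_eqI[OF tr_eq[OF o]] by simp
 qed
 then show ?thesis unfolding exterior_presheaf_def by simp
qed

lemma P_presheaf: "is_presheaf X P"
 unfolding is_presheaf_def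
proof (intro conjI allI impI ballI funcsetI)
 fix U V s assume "openin X U & openin X V & V <= U" "s : Sec P U"
 then show "rst P U V s : Sec P V"
  using tr_trm by (auto simp: P_carrier P_rst)
next
 fix U s assume "openin X U" "s : Sec P U"
 then show "rst P U U s = s" by (auto simp: P_carrier P_rst tr_id)
next
 fix U V W s assume "openin X U & openin X V & openin X W & W <= V & V <= U"
  "s : Sec P U"
 then show "rst P V W (rst P U V s) = rst P U W s"
  using tr_trm by (auto simp: P_carrier P_rst tr_tr)
qed

sublocale P: presheaf_on X P by unfold_locales (rule P_presheaf)

definition rep :: "('x, 'x => complex, 'm) ext_section => 'x set => ('x => complex, 'm) ext_term => bool" where
 "rep g V e \<longleftrightarrow> openin X V & e : trm V & represents X P g V (cls V e)"

lemma repD: "rep g V e ==> openin X V" "rep g V e ==> e : trm V"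
 "rep g V e ==> represents X P g V (cls V e)"
 unfolding rep_def by simp_all

lemma rep_rst: "[| rep g V e; openin X W; W <= V |] ==> rep g W (tr V W e)"
 using P.represents_rst[of g V "cls V e" W] unfolding rep_def by (simp add: P_rst tr_trm)

lemma rep_restrict: "[| rep g V e; V <= U |] ==> rep (restrict g U) V e"
 using P.represents_restrict unfolding rep_def by simp

lemma B_carrier: "Sec B U = germ_sections X P (%V. Sec P V) U"
 and B_parity: "Par B U p = germ_sections X P (%V. Par P V p) U"
 and B_rst: "rst B U V g = restrict g V"
 unfolding exterior_sheaf_def sheafify_def by simp_all

lemma B_ext: "g : Sec B U ==> g : extensional U"
 unfolding B_carrier germ_sections_def by simp

lemma rep_ex:
 assumes "g : Sec B U" "x : U"
 obtains V e where "x : V" "V <= U" "rep g V e"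
proof -
 obtain V s where V: "x : V" "V <= U" "s : Sec P V" "represents X P g V s"
  using P.germ_sections_represents[OF assms[unfolded B_carrier] subset_refl] .
 have o: "openin X V" using V(4) unfolding represents_def by simp
 then obtain e where "e : trm V" "s = cls V e" using V(3) unfolding P_carrier[OF o] by auto
 then show thesis using V o that unfolding rep_def by simp
qed

lemma P_parity: "openin X U ==> Par P U p = cls U ` {e : trm U. ext_parity p e}"
 unfolding P_sec by (rule ext_module.EA_parity[OF EM])

lemma P_parity_sub: "openin X U ==> Par P U p <= Sec P U"
 unfolding P_parity P_carrier by auto

lemma rep_ex_parity:
 assumes "g : Par B U p" "x : U"
 obtains V e where "x : V" "V <= U" "rep g V e" "ext_parity p e"
proof -
 obtain V s where V: "x : V" "V <= U" "s : Par P V p" "represents X P g V s"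
  using P.germ_sections_represents[OF assms[unfolded B_parity] P_parity_sub] .
 have o: "openin X V" using V(4) unfolding represents_def by simp
 then obtain e where "e : trm V" "s = cls V e" "ext_parity p e" using V(3) unfolding P_parity[OF o] by auto
 then show thesis using V o that unfolding rep_def by simp
qed

lemma B_mem:
 assumes "g : extensional U" "!!x. x : U ==> EX V e. x : V & V <= U & rep g V e"
 shows "g : Sec B U"
 unfolding B_carrier
proof (rule P.germ_sectionsI[OF assms(1)])
 fix x assume "x : U"
 from assms(2)[OF this] obtain V e where V: "x : V" "V <= U" "rep g V e" by metis
 then show "EX V s. x : V & V <= U & s : Sec P V & represents X P g V s"
  using cls_in[OF repD(1,2)[OF V(3)]] repD(3)[OF V(3)]
  by (intro exI[of _ V] exI[of _ "cls V e"]) simp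
qed

lemma B_parity_mem:
 assumes "g : extensional U" "!!x. x : U ==> EX V e. x : V & V <= U & rep g V e & ext_parity p e"
 shows "g : Par B U p"
 unfolding B_parity
proof (rule P.germ_sectionsI[OF assms(1)])
 fix x assume "x : U"
 from assms(2)[OF this] obtain V e where V: "x : V" "V <= U" "rep g V e" "ext_parity p e" by metis
 then have "cls V e : Par P V p"
  unfolding P_parity[OF repD(1)[OF V(3)]] using repD(2)[OF V(3)] by simp
 then show "EX V s. x : V & V <= U & s : Par P V p & represents X P g V s"
  using V repD(3)[OF V(3)] by (intro exI[of _ V] exI[of _ "cls V e"]) simp
qed

lemma B_parity_carrier: "g : Par B U p ==> g : Sec B U"
 by (rule B_mem, simp add: B_parity germ_sections_def, metis rep_ex_parity)

lemma B_restrict: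
 assumes "g : Sec B U" "openin X V" "V <= U"
 shows "rst B U V g : Sec B V"
 unfolding B_rst
proof (rule B_mem)
 fix x assume x: "x : V"
 then obtain W e where W: "x : W" "W <= U" "rep g W e" using rep_ex[OF assms(1)] assms(3) by blast
 have o: "openin X (W \<inter> V)" using repD(1)[OF W(3)] assms by auto
 have "rep (restrict g V) (W \<inter> V) (tr W (W \<inter> V) e)"
  by (rule rep_restrict[OF rep_rst[OF W(3) o]]) auto
 then show "EX W e. x : W & W <= V & rep (restrict g V) W e"
  using x W by (intro exI[of _ "W \<inter> V"] exI) auto
qed simp

lemma rep_eq_at:
 assumes "rep g W e" "rep h W e'" "eeq W e e'" "x : W"
 shows "g x = h x"
proof -
 have "cls W e = cls W e'" using assms cls_eq_iff repD by metis
 then show ?thesis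
  using P.represents_eqI[of g W "cls W e" h x] repD(3)[OF assms(1)] repD(3)[OF assms(2)] assms(4) by simp
qed

lemma B_eqI:
 assumes "g : extensional U" "h : extensional U"
  "!!x. x : U ==> EX W e e'. x : W & rep g W e & rep h W e' & eeq W e e'"
 shows "g = h"
proof (rule extensionalityI[OF assms(1,2)])
 fix x assume "x : U"
 then show "g x = h x" using assms(3)[of x] rep_eq_at by blast
qed

lemma rep_eqD:
 assumes "rep g V e" "rep h W e'" "x : V" "x : W" "g x = h x"
 obtains O' where "openin X O'" "x : O'" "O' <= V" "O' <= W" "eeq O' (tr V O' e) (tr W O' e')"
proof -
 obtain O' where O': "openin X O'" "x : O'" "O' <= V \<inter> W" "rst P V O' (cls V e) = rst P W O' (cls W e')"
  using P.represents_eqD[OF repD(3)[OF assms(1)] repD(3)[OF assms(2)] assms(3-5)] .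
 have s: "O' <= V" "O' <= W" using O' by auto
 have t: "tr V O' e : trm O'"
  by (rule tr_trm[OF repD(1)[OF assms(1)] O'(1) s(1) repD(2)[OF assms(1)]])
 have "cls O' (tr V O' e) = cls O' (tr W O' e')"
  using O'(4) P_rst[OF repD(1)[OF assms(1)] O'(1) s(1) repD(2)[OF assms(1)]]
   P_rst[OF repD(1)[OF assms(2)] O'(1) s(2) repD(2)[OF assms(2)]] by simp
 then show thesis using that[OF O'(1,2) s] cls_eq_iff[OF O'(1) t] by simp
qed

lemma cls_sum: "[| openin X U; a : trm U; b : trm U |] ==> cls U (ESum a b) = cls U a \<oplus>[P,U] cls U b"
 unfolding P_sec by (rule ext_module.cl_sum[OF EM])

lemma cls_prod: "[| openin X U; a : trm U; b : trm U |] ==> cls U (EProd a b) = cls U a \<otimes>[P,U] cls U b"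
 unfolding P_sec by (rule ext_module.cl_prod[OF EM])

lemma cls_smult: "[| openin X U; a : trm U |] ==>
  c \<odot>[P,U] cls U a = cls U (EProd (EScal (c \<odot>[R,U] \<one>[R,U])) a)"
 unfolding P_sec by (rule ext_module.EA_smult[OF EM]) (simp_all add: R_smult)

lemma rep_add:
 assumes "rep g V a" "rep h V b" "V <= U"
 shows "rep (g \<oplus>[B,U] h) V (ESum a b)"
proof -
 have o: "openin X V" "a : trm V" "b : trm V" using assms repD by blast+
 have "represents X P (germ_op X P (%V. add (sec P V)) U g h) V (cls V a \<oplus>[P,V] cls V b)"
 proof (rule P.germ_op_represents[OF repD(3)[OF assms(1)] repD(3)[OF assms(2)] assms(3)])
  show "s \<oplus>[P,V] t : Sec P V"
   if "openin X V" "s : Sec P V" "t : Sec P V" for V s t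
   using ring.ring_simprules(1)[OF ext_module.EA_ring[OF EM[OF that(1)]]] that(2,3) unfolding P_sec by simp
  show "rst P V W (s \<oplus>[P,V] t) = rst P V W s \<oplus>[P,W] rst P V W t"
   if "openin X V" "openin X W" "W <= V" "s : Sec P V" "t : Sec P V" for V W s t
  proof -
   note h = that
   obtain c d where c: "c : trm V" "s = cls V c" "d : trm V" "t = cls V d"
    using h(4,5) unfolding P_carrier[OF h(1)] by auto
   then show ?thesis using h(1-3) by (simp add: cls_sum[symmetric] P_rst tr_trm)
  qed
 qed
 then show ?thesis using o unfolding rep_def by (simp add: cls_sum exterior_sheaf_def sheafify_def)
qed

lemma rep_mult:
 assumes "rep g V a" "rep h V b" "V <= U"
 shows "rep (g \<otimes>[B,U] h) V (EProd a b)"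
proof -
 have o: "openin X V" "a : trm V" "b : trm V" using assms repD by blast+
 have "represents X P (germ_op X P (%V. mult (sec P V)) U g h) V (cls V a \<otimes>[P,V] cls V b)"
 proof (rule P.germ_op_represents[OF repD(3)[OF assms(1)] repD(3)[OF assms(2)] assms(3)])
  show "s \<otimes>[P,V] t : Sec P V"
   if "openin X V" "s : Sec P V" "t : Sec P V" for V s t
   using ring.ring_simprules(5)[OF ext_module.EA_ring[OF EM[OF that(1)]]] that(2,3) unfolding P_sec by simp
  show "rst P V W (s \<otimes>[P,V] t) = rst P V W s \<otimes>[P,W] rst P V W t"
   if "openin X V" "openin X W" "W <= V" "s : Sec P V" "t : Sec P V" for V W s t
  proof -
   note h = that
   obtain c d where c: "c : trm V" "s = cls V c" "d : trm V" "t = cls V d"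
    using h(4,5) unfolding P_carrier[OF h(1)] by auto
   then show ?thesis using h(1-3) by (simp add: cls_prod[symmetric] P_rst tr_trm)
  qed
 qed
 then show ?thesis using o unfolding rep_def by (simp add: cls_prod exterior_sheaf_def sheafify_def)
qed

lemma rep_smult:
 assumes "rep g V a" "V <= U"
 shows "rep (c \<odot>[B,U] g) V (EProd (EScal (c \<odot>[R,V] \<one>[R,V])) a)"
proof -
 have o: "openin X V" "a : trm V" using assms repD by blast+
 have "represents X P (\<lambda>x\<in>U. \<Union>(V, s)\<in>g x. germ X P x V (c \<odot>[P,V] s)) V (c \<odot>[P,V] cls V a)"
 proof (rule P.germ_unary_represents[OF repD(3)[OF assms(1)] assms(2)])
  show "c \<odot>[P,V] s : Sec P V"
   if "openin X V" "s : Sec P V" for V s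
  proof -
   note h = that
   obtain d where "d : trm V" "s = cls V d" using h(2) unfolding P_carrier[OF h(1)] by auto
   then show ?thesis using h(1) by (simp add: cls_smult cls_in R_smult)
  qed
  show "rst P V W (c \<odot>[P,V] s) = c \<odot>[P,W] rst P V W s"
   if "openin X V" "openin X W" "W <= V" "s : Sec P V" for V W s
  proof -
   note h = that
   obtain d where c: "d : trm V" "s = cls V d"
    using h(4) unfolding P_carrier[OF h(1)] by auto
   then show ?thesis using h(1-3) by (simp add: cls_smult P_rst tr_trm R_smult R_rst_smult)
  qed
 qed
 then show ?thesis using o unfolding rep_def by (simp add: cls_smult R_smult exterior_sheaf_def sheafify_def)
qed

lemma P_one: "openin X U ==> \<one>[P,U] = cls U (EScal \<one>[R,U])"
 and P_zero: "openin X U ==> \<zero>[P,U] = cls U (EScal \<zero>[R,U])"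
 unfolding P_sec by (rule ext_module.EA_one[OF EM] ext_module.EA_zero[OF EM], assumption)+

lemma rep_one: "openin X U ==> rep \<one>[B,U] U (EScal \<one>[R,U])"
 and rep_zero: "openin X U ==> rep \<zero>[B,U] U (EScal \<zero>[R,U])"
 unfolding rep_def exterior_sheaf_def sheafify_def
 by (simp_all add: cls_in one_in zero_in P_one P_zero P.germ_section_represents)

definition sect :: "'x set => ('x => complex, 'm) ext_term => ('x, 'x => complex, 'm) ext_section" where
 "sect V e = germ_section X P V (cls V e)"

lemma rep_sect: "[| openin X V; e : trm V |] ==> rep (sect V e) V e"
 unfolding rep_def sect_def by (simp add: P.germ_section_represents cls_in)

lemma sect_ext: "sect V e : extensional V"
 unfolding sect_def germ_section_def by simp

lemma sect_in: "[| openin X V; e : trm V |] ==> sect V e : Sec B V"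
 by (rule B_mem[OF sect_ext]) (use rep_sect in blast)

lemma sect_parity: "[| openin X V; e : trm V; ext_parity p e |] ==> sect V e : Par B V p"
 by (rule B_parity_mem[OF sect_ext]) (use rep_sect in blast)

lemma sect_eqI: "[| g : extensional V; rep g V e |] ==> g = sect V e"
 unfolding sect_def using P.germ_section_eqI repD(3) by metis

lemma scalar_section_sect: "scalar_section X R E V f = sect V (EScal f)"
 and generator_section_sect: "generator_section X R E V m = sect V (EGen m)"
 unfolding scalar_section_def generator_section_def sect_def by simp_all

lemma B_op_ext: "g \<oplus>[B,U] h : extensional U" "g \<otimes>[B,U] h : extensional U"
 "c \<odot>[B,U] g : extensional U" "\<zero>[B,U] : extensional U" "\<one>[B,U] : extensional U"
 unfolding exterior_sheaf_def sheafify_def germ_op_def germ_section_def by simp_all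

lemma sect_sum: "[| openin X V; a : trm V; b : trm V |] ==> sect V (ESum a b) = sect V a \<oplus>[B,V] sect V b"
 by (rule sect_eqI[symmetric, OF B_op_ext(1) rep_add[OF rep_sect rep_sect]]) simp_all

lemma sect_prod: "[| openin X V; a : trm V; b : trm V |] ==> sect V (EProd a b) = sect V a \<otimes>[B,V] sect V b"
 by (rule sect_eqI[symmetric, OF B_op_ext(2) rep_mult[OF rep_sect rep_sect]]) simp_all

lemma sect_eq: "[| openin X V; eeq V a b |] ==> sect V a = sect V b"
 unfolding sect_def using ext_module.cl_eqI[OF EM] by metis

lemma sect_zero: "openin X V ==> \<zero>[B,V] = sect V (EScal \<zero>[R,V])"
 and sect_one: "openin X V ==> \<one>[B,V] = sect V (EScal \<one>[R,V])"
 by (rule sect_eqI, rule B_op_ext, rule rep_zero rep_one, assumption)+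

lemma sect_rst: "[| openin X V; openin X W; W <= V; e : trm V |] ==> rst B V W (sect V e) = sect W (tr V W e)"
 unfolding B_rst by (rule sect_eqI[OF _ rep_restrict[OF rep_rst[OF rep_sect]]]) simp_all

lemma aug_tr:
 assumes "openin X V" "openin X W" "W <= V" "e : trm V"
 shows "ext_aug (sec R W) (tr V W e) = rst R V W (ext_aug (sec R V) e)"
 unfolding ext_aug_ev ext_ev_map
 using ext_ev_hom[OF R_ring[OF assms(1)] _ _ R_hom[OF assms(1-3)] assms(4), of "%r. r" "%_. \<zero>[R,V]"]
 by (simp add: zero_in assms R_zero)

text \<open>The definite description is proper: two terms for the same germ become equivalent on a
  smaller neighbourhood, and the augmentation respects both equivalence and restriction.\<close>

lemma exterior_projection_rep:
 assumes r: "rep g V e" and V: "V <= U" and x: "x : V"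
 shows "exterior_projection R U g x = ext_aug (sec R V) e x"
proof -
 have o: "openin X V" "e : trm V" using r repD by blast+
 have gx: "g x = germ X P x V (cls V e)" using repD(3)[OF r] x unfolding represents_def by simp
 have "(THE c. EX V a e. (V, a) : g x & e : a & c = ext_aug (sec R V) e x) = ext_aug (sec R V) e x"
 proof (rule the_equality)
  show "EX V' a e'. (V', a) : g x & e' : a & ext_aug (sec R V) e x = ext_aug (sec R V') e' x"
   using P.germ_self[OF o(1) x cls_in[OF o]] ext_module.cl_self[OF EM[OF o(1)] o(2)]
   unfolding gx by (intro exI[of _ V] exI[of _ "cls V e"] exI[of _ e]) simp
  fix c assume "EX V' a e'. (V', a) : g x & e' : a & c = ext_aug (sec R V') e' x"
  then obtain V' a e' where h: "(V', a) : germ X P x V (cls V e)" "e' : a" "c = ext_aug (sec R V') e' x"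
   unfolding gx by auto
  then obtain W where W: "openin X V'" "a : Sec P V'" "openin X W" "x : W" "W <= V \<inter> V'"
   "rst P V W (cls V e) = rst P V' W a" unfolding germ_def by auto
  have s: "W <= V" "W <= V'" using W by auto
  obtain a' where "a' : trm V'" "a = cls V' a'" using W(2) unfolding P_carrier[OF W(1)] by auto
  then have a: "e' : trm V'" "a = cls V' e'" using ext_module.cl_memD[OF EM[OF W(1)]] h(2) by metis+
  have "cls W (tr V W e) = cls W (tr V' W e')"
   using W(6) unfolding a(2) P_rst[OF o(1) W(3) s(1) o(2)] P_rst[OF W(1,3) s(2) a(1)] .
  then have "eeq W (tr V W e) (tr V' W e')"
   using cls_eq_iff[OF W(3) tr_trm[OF o(1) W(3) s(1) o(2)]] by simp
  then have "ext_aug (sec R W) (tr V W e) = ext_aug (sec R W) (tr V' W e')"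
   by (rule ext_module.ext_aug_eq[OF EM[OF W(3)]])
  then have "restrict (ext_aug (sec R V) e) W x = restrict (ext_aug (sec R V') e') W x"
   unfolding aug_tr[OF o(1) W(3) s(1) o(2)] aug_tr[OF W(1,3) s(2) a(1)] R_rst by simp
  then show "c = ext_aug (sec R V) e x" using W(4) h(3) by simp
 qed
 then show ?thesis unfolding exterior_projection_def using V x by auto
qed

lemma exterior_projection_sect:
 assumes "openin X V" "e : trm V"
 shows "exterior_projection R V (sect V e) = ext_aug (sec R V) e"
proof (rule extensionalityI[of _ V])
 show "exterior_projection R V (sect V e) : extensional V" unfolding exterior_projection_def by simp
 show "ext_aug (sec R V) e : extensional V"
  using R_ext[OF assms(1) ext_module.ext_aug_closed[OF EM[OF assms(1)] assms(2)]] .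
qed (rule exterior_projection_rep[OF rep_sect[OF assms]], simp_all)

lemma rep_ex2:
 assumes "g : Sec B U" "h : Sec B U" "x : U"
 obtains V a b where "x : V" "V <= U" "rep g V a" "rep h V b"
proof -
 obtain V a where V: "x : V" "V <= U" "rep g V a" using rep_ex[OF assms(1,3)] .
 obtain W b where W: "x : W" "W <= U" "rep h W b" using rep_ex[OF assms(2,3)] .
 have o: "openin X (V \<inter> W)" using repD(1)[OF V(3)] repD(1)[OF W(3)] by auto
 show thesis
  by (rule that[OF _ _ rep_rst[OF V(3) o] rep_rst[OF W(3) o]]) (use V W in auto)
qed

lemma B_add_in: "[| g : Sec B U; h : Sec B U |] ==> g \<oplus>[B,U] h : Sec B U"
 by (rule B_mem[OF B_op_ext(1)]) (metis rep_ex2 rep_add)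

lemma B_mult_in: "[| g : Sec B U; h : Sec B U |] ==> g \<otimes>[B,U] h : Sec B U"
 by (rule B_mem[OF B_op_ext(2)]) (metis rep_ex2 rep_mult)

lemma B_smult_in: "g : Sec B U ==> c \<odot>[B,U] g : Sec B U"
 by (rule B_mem[OF B_op_ext(3)]) (metis rep_ex rep_smult)

lemma B_zero_in: "openin X U ==> \<zero>[B,U] : Par B U p"
proof -
 assume U: "openin X U"
 obtain m where m: "m : Sec E U" using E_ne[OF U] by auto
 let ?z = "EProd (EScal \<zero>[R,U]) (EGen m)"
 have e: "eeq U ?z (EScal \<zero>[R,U])" by (rule ext_prod_zero) (simp add: m)
 have t: "?z : trm U" using m zero_in[OF U] by simp
 have p: "ext_parity True ?z"
  using ext_parity.intros(4)[OF ext_parity.intros(1) ext_parity.intros(2), of "\<zero>[R,U]" m] by simp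
 show ?thesis
  using sect_parity[OF U t p] sect_eq[OF U e] sect_zero[OF U]
   sect_parity[OF U _ ext_parity.intros(1), of "\<zero>[R,U]"] zero_in[OF U] by (cases p) simp_all
qed

end

section \<open>Evaluation of the exterior sheaf in a sheaf of superalgebras\<close>

text \<open>The data for mapping the exterior sheaf to \<open>F\<close>: \<open>\<sigma>\<close> on
  functions and \<open>l\<close> on generators. Even values of \<open>\<sigma>\<close> are central
  and odd values of \<open>l\<close> have square zero, which is what the relations demand. The
  instances below come from eigenlifts.\<close>

locale exterior_eval = exterior_base X R E + F: superalgebra_sheaf_on X F
 for X :: "'x topology" and R :: "('x, 'x => complex) superalgebra_sheaf"
  and E :: "('x, 'x => complex, 'm) module_sheaf" and F :: "('x, 'a) superalgebra_sheaf" +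
 fixes U0 and \<sigma> :: "'x set => ('x => complex) => 'a" and l :: "'x set => 'm => 'a"
 assumes U0: "openin X U0"
  and \<sigma>_hom: "[| openin X V; V <= U0 |] ==> \<sigma> V : ring_hom (sec R V) (sec F V)"
  and \<sigma>_even: "[| openin X V; V <= U0; f : Sec R V |] ==> \<sigma> V f : Par F V False"
  and \<sigma>_smult: "[| openin X V; V <= U0 |] ==> \<sigma> V (c \<odot>[R,V] \<one>[R,V]) = c \<odot>[F,V] \<one>[F,V]"
  and \<sigma>_rst: "[| openin X V; openin X W; W <= V; V <= U0; f : Sec R V |] ==>
   \<sigma> W (rst R V W f) = rst F V W (\<sigma> V f)"
  and l_odd: "[| openin X V; V <= U0; m : Sec E V |] ==> l V m : Par F V True"
  and l_add: "[| openin X V; V <= U0; m : Sec E V; n : Sec E V |] ==>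
   l V (m \<oplus>[E,V] n) = l V m \<oplus>[F,V] l V n"
  and l_smult: "[| openin X V; V <= U0; f : Sec R V; m : Sec E V |] ==>
   l V (f \<odot>[E,V] m) = \<sigma> V f \<otimes>[F,V] l V m"
  and l_rst: "[| openin X V; openin X W; W <= V; V <= U0; m : Sec E V |] ==>
   l W (rst E V W m) = rst F V W (l V m)"
begin

abbreviation "ev V == ext_ev (sec F V) (\<sigma> V) (l V)"

lemma \<sigma>_in: "[| openin X V; V <= U0; f : Sec R V |] ==> \<sigma> V f : Sec F V"
 using superalgebra.part_carrier[OF F.F_super \<sigma>_even] .

lemma l_in: "[| openin X V; V <= U0; m : Sec E V |] ==> l V m : Sec F V"
 using superalgebra.part_carrier[OF F.F_super l_odd] .

lemma ev_closed: "[| openin X V; V <= U0; e : trm V |] ==> ev V e : Sec F V"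
 by (rule ext_ev_closed[OF F.F_ring]) (simp_all add: \<sigma>_in l_in)

lemma ev_eq:
 assumes V: "openin X V" "V <= U0" and ab: "eeq V a b"
 shows "ev V a = ev V b"
proof -
 interpret A: superalgebra "sec F V" by (rule F.F_super[OF V(1)])
 show ?thesis
  by (rule ext_module.ext_ev_eq[OF EM[OF V(1)] ab F.F_ring[OF V(1)] \<sigma>_hom[OF V]])
   (simp_all add: l_in V l_add l_smult A.odd_square[OF l_odd[OF V]] A.even_commute[OF \<sigma>_even[OF V]])
qed

lemma ev_tr:
 assumes o: "openin X V" "openin X W" "W <= V" "V <= U0" and e: "e : trm V"
 shows "ev W (tr V W e) = rst F V W (ev V e)"
proof -
 have "rst F V W (ev V e) = ext_ev (sec F W) (%r. rst F V W (\<sigma> V r)) (%m. rst F V W (l V m)) e"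
  by (rule ext_ev_hom[OF F.F_ring[OF o(1)] _ _ F.F_rst_ring_hom[OF o(1-3)] e])
   (simp_all add: \<sigma>_in l_in o)
 also have "... = ext_ev (sec F W) (%r. \<sigma> W (rst R V W r)) (%m. l W (rst E V W m)) e"
  by (rule ext_ev_cong[OF e]) (simp_all add: \<sigma>_rst l_rst o)
 finally show ?thesis unfolding ext_ev_map by simp
qed

lemma ev_parity:
 assumes V: "openin X V" "V <= U0" and "ext_parity p e" "e : trm V"
 shows "ev V e : Par F V p"
proof -
 interpret A: superalgebra "sec F V" by (rule F.F_super[OF V(1)])
 show ?thesis using assms(3,4)
 proof (induction rule: ext_parity.induct)
  case (3 p a b) then show ?case by (simp add: A.part_add)
 next
  case (4 p a q b)
  then have "ev V a : Par F V p" "ev V b : Par F V q" by simp_all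
  then show ?case using A.part_mult(1)[of "ev V a" p "ev V b" q] by simp
 qed (simp_all add: \<sigma>_even l_odd V)
qed

text \<open>Two terms for the same section are equivalent only after restriction near each point, so
  their values agree locally; separatedness of \<open>F\<close> turns this into equality. This makes
  the glueing in \<open>Phi\<close> possible.\<close>

lemma ev_unique:
 assumes V: "V <= U0" and r: "rep g V e" "rep g V e'"
 shows "ev V e = ev V e'"
proof -
 have o: "openin X V" "e : trm V" "e' : trm V" using r repD by blast+
 show ?thesis
 proof (rule F.separated[OF o(1)])
  fix x assume x: "x : V"
  obtain W where W: "openin X W" "x : W" "W <= V" "W <= V" "eeq W (tr V W e) (tr V W e')"
   using rep_eqD[OF r x x refl] .
  have "rst F V W (ev V e) = rst F V W (ev V e')"
   using ev_tr[OF o(1) W(1,3) V o(2)] ev_tr[OF o(1) W(1,3) V o(3)] ev_eq[OF W(1) order_trans[OF W(3) V] W(5)]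
   by simp
  then show "EX W. openin X W & x : W & W <= V & rst F V W (ev V e) = rst F V W (ev V e')"
   using W by auto
 qed (simp_all add: ev_closed o V)
qed

definition Phi :: "'x set => ('x, 'x => complex, 'm) ext_section => 'a" where
 "Phi V g = (THE t. t : Sec F V & (ALL W s. openin X W & W <= V & s : Sec F W &
   (EX e. rep g W e & s = ev W e) --> rst F V W t = s))"

lemma
 assumes V: "openin X V" "V <= U0" and g: "g : Sec B V"
 shows Phi_in: "Phi V g : Sec F V"
  and Phi_rep: "[| rep g W e; W <= V |] ==> rst F V W (Phi V g) = ev W e"
proof -
 have "EX! t. t : Sec F V & (ALL W s. openin X W & W <= V & s : Sec F W &
   (EX e. rep g W e & s = ev W e) --> rst F V W t = s)"
 proof (rule F.glue_unique[OF V(1)])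
  fix x assume "x : V"
  then obtain W e where W: "x : W" "W <= V" "rep g W e" using rep_ex[OF g] by blast
  then show "EX W s. openin X W & x : W & W <= V & s : Sec F W & (EX e. rep g W e & s = ev W e)"
   using repD[OF W(3)] V(2) by (intro exI[of _ W] exI[of _ "ev W e"]) (auto intro: ev_closed)
 next
  fix W W' s assume W: "openin X W" "openin X W'" "W' <= W" "W <= V" "EX e. rep g W e & s = ev W e"
  then obtain e where e: "rep g W e" "s = ev W e" by auto
  show "EX e. rep g W' e & rst F W W' s = ev W' e"
   using rep_rst[OF e(1) W(2,3)] ev_tr[OF W(1-3) order_trans[OF W(4) V(2)] repD(2)[OF e(1)]] e(2) by auto
 next
  fix W s s' assume W: "W <= V" "EX e. rep g W e & s = ev W e" "EX e. rep g W e & s' = ev W e"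
  then obtain e e' where e: "rep g W e" "s = ev W e" "rep g W e'" "s' = ev W e'" by auto
  show "s = s'" unfolding e(2,4) by (rule ev_unique[OF order_trans[OF W(1) V(2)] e(1,3)])
 qed
 from theI'[OF this]
 have *: "Phi V g : Sec F V & (ALL W s. openin X W & W <= V & s : Sec F W &
   (EX e. rep g W e & s = ev W e) --> rst F V W (Phi V g) = s)" unfolding Phi_def .
 then show "Phi V g : Sec F V" by simp
 show "rst F V W (Phi V g) = ev W e" if r: "rep g W e" "W <= V" for W e
 proof -
  have "openin X W" "ev W e : Sec F W"
   using repD[OF r(1)] ev_closed order_trans[OF r(2) V(2)] by blast+
  then show ?thesis
   using r by (intro conjunct2[OF *, rule_format, of W "ev W e"] conjI exI[of _ e]) simp_all
 qed
qed

lemma Phi_eqI: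
 assumes V: "openin X V" "V <= U0" and g: "g : Sec B V" and s: "s : Sec F V"
  and h: "!!x. x : V ==> EX W e. x : W & W <= V & rep g W e & rst F V W s = ev W e"
 shows "Phi V g = s"
proof (rule F.separated[OF V(1) Phi_in[OF V g] s])
 fix x assume "x : V"
 then obtain W e where W: "x : W" "W <= V" "rep g W e" "rst F V W s = ev W e" using h by blast
 then show "EX W. openin X W & x : W & W <= V & rst F V W (Phi V g) = rst F V W s"
  using Phi_rep[OF V g W(3,2)] repD(1)[OF W(3)] by (intro exI[of _ W]) simp
qed

lemma Phi_sect: "[| openin X V; V <= U0; e : trm V |] ==> Phi V (sect V e) = ev V e"
proof -
 assume V: "openin X V" "V <= U0" and e: "e : trm V"
 have "rst F V V (Phi V (sect V e)) = ev V e"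
  by (rule Phi_rep[OF V sect_in[OF V(1) e] rep_sect[OF V(1) e]]) simp
 then show ?thesis using F.rst_id[OF V(1) Phi_in[OF V sect_in[OF V(1) e]]] by simp
qed

lemma Phi_rst:
 assumes V: "openin X V" "V <= U0" and W: "openin X W" "W <= V" and g: "g : Sec B V"
 shows "Phi W (rst B V W g) = rst F V W (Phi V g)"
proof (rule Phi_eqI)
 show "openin X W" "W <= U0" using V W by auto
 show "rst B V W g : Sec B W" using B_restrict[OF g W] .
 show "rst F V W (Phi V g) : Sec F W" using F.rst_closed[OF V(1) W Phi_in[OF V g]] .
 fix x assume x: "x : W"
 obtain W' e where W': "x : W'" "W' <= W" "rep (rst B V W g) W' e"
  using rep_ex[OF B_restrict[OF g W] x] .
 have o: "openin X W'" using repD(1)[OF W'(3)] .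
 have "represents X P g W' (cls W' e)"
  using repD(3)[OF W'(3)] W'(2) unfolding represents_def B_rst by (auto simp: subset_iff)
 then have r: "rep g W' e" using repD[OF W'(3)] unfolding rep_def by simp
 show "EX W' e. x : W' & W' <= W & rep (rst B V W g) W' e & rst F W W' (rst F V W (Phi V g)) = ev W' e"
  using W' Phi_rep[OF V g r] F.rst_rst[OF V(1) W(1) o W'(2) W(2) Phi_in[OF V g]] W(2)
  by (intro exI[of _ W'] exI[of _ e]) auto
qed

lemma Phi_hom:
 assumes V: "openin X V" "V <= U0"
 shows "superalgebra_hom (sec B V) (sec F V) (Phi V)"
proof -
 interpret A: superalgebra "sec F V" by (rule F.F_super[OF V(1)])
 have V': "W <= U0" if "W <= V" for W using that V by auto
 have add: "Phi V (g \<oplus>[B,V] h) = Phi V g \<oplus>[F,V] Phi V h"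
  and mult: "Phi V (g \<otimes>[B,V] h) = Phi V g \<otimes>[F,V] Phi V h"
  if g: "g : Sec B V" and h: "h : Sec B V" for g h
 proof -
  have *: "EX W a b. x : W & W <= V & openin X W & rep g W a & rep h W b & rst F V W (Phi V g) = ev W a &
    rst F V W (Phi V h) = ev W b" if "x : V" for x
  proof -
   obtain W a b where W: "x : W" "W <= V" "rep g W a" "rep h W b" using rep_ex2[OF g h \<open>x : V\<close>] .
   show ?thesis using W repD(1)[OF W(3)] Phi_rep[OF V g W(3,2)] Phi_rep[OF V h W(4,2)] by blast
  qed
  show "Phi V (g \<oplus>[B,V] h) = Phi V g \<oplus>[F,V] Phi V h"
  proof (rule Phi_eqI[OF V B_add_in[OF g h]])
   fix x assume "x : V"
   then obtain W a b where W: "x : W" "W <= V" "openin X W" "rep g W a" "rep h W b"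
    "rst F V W (Phi V g) = ev W a" "rst F V W (Phi V h) = ev W b" using * by blast
   then show "EX W e. x : W & W <= V & rep (g \<oplus>[B,V] h) W e &
     rst F V W (Phi V g \<oplus>[F,V] Phi V h) = ev W e"
    using rep_add[OF W(4,5,2)] F.F_rst_add[OF V(1) W(3,2) Phi_in[OF V g] Phi_in[OF V h]]
    by (intro exI[of _ W] exI[of _ "ESum a b"]) simp
  qed (simp add: Phi_in V g h)
  show "Phi V (g \<otimes>[B,V] h) = Phi V g \<otimes>[F,V] Phi V h"
  proof (rule Phi_eqI[OF V B_mult_in[OF g h]])
   fix x assume "x : V"
   then obtain W a b where W: "x : W" "W <= V" "openin X W" "rep g W a" "rep h W b"
    "rst F V W (Phi V g) = ev W a" "rst F V W (Phi V h) = ev W b" using * by blast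
   then show "EX W e. x : W & W <= V & rep (g \<otimes>[B,V] h) W e &
     rst F V W (Phi V g \<otimes>[F,V] Phi V h) = ev W e"
    using rep_mult[OF W(4,5,2)] F.F_rst_mult[OF V(1) W(3,2) Phi_in[OF V g] Phi_in[OF V h]]
    by (intro exI[of _ W] exI[of _ "EProd a b"]) simp
  qed (simp add: Phi_in V g h)
 qed
 have one: "Phi V \<one>[B,V] = \<one>[F,V]"
  unfolding sect_one[OF V(1)] using ring_hom_one[OF \<sigma>_hom[OF V]]
  by (simp add: Phi_sect[OF V] one_in V)
 have sm: "Phi V (c \<odot>[B,V] g) = c \<odot>[F,V] Phi V g" if g: "g : Sec B V" for c g
 proof (rule Phi_eqI[OF V B_smult_in[OF g]])
  fix x assume "x : V"
  then obtain W a where W: "x : W" "W <= V" "rep g W a" using rep_ex[OF g] by blast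
  interpret W: superalgebra "sec F W" by (rule F.F_super[OF repD(1)[OF W(3)]])
  have a: "ev W a : Sec F W" using ev_closed repD[OF W(3)] V'[OF W(2)] by blast
  show "EX W e. x : W & W <= V & rep (c \<odot>[B,V] g) W e & rst F V W (c \<odot>[F,V] Phi V g) = ev W e"
   using W rep_smult[OF W(3,2)] F.F_rst_smult[OF V(1) repD(1)[OF W(3)] W(2) Phi_in[OF V g]]
    Phi_rep[OF V g W(3,2)] \<sigma>_smult[OF repD(1)[OF W(3)] V'[OF W(2)]] a
   by (intro exI[of _ W] exI[of _ "EProd (EScal (c \<odot>[R,W] \<one>[R,W])) a"])
    (simp add: W.sm_mult)
 qed (simp add: Phi_in V g)
 have par: "Phi V g : Par F V p" if g: "g : Par B V p" for g p
 proof (rule F.part_local[OF V(1) Phi_in[OF V B_parity_carrier[OF g]]])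
  fix x assume "x : V"
  then obtain W a where W: "x : W" "W <= V" "rep g W a" "ext_parity p a" using rep_ex_parity[OF g] by blast
  then show "EX W. openin X W & x : W & W <= V & rst F V W (Phi V g) : Par F W p"
   using Phi_rep[OF V B_parity_carrier[OF g] W(3,2)] repD[OF W(3)] ev_parity[OF _ V'[OF W(2)] W(4)]
   by (intro exI[of _ W]) simp
 qed
 show ?thesis unfolding superalgebra_hom_def
  using Phi_in[OF V] add mult one sm par by (auto intro!: ring_hom_memI)
qed

end

section \<open>Derivations of the exterior sheaf\<close>

text \<open>The derivations \<open>d\<close> and \<open>\<delta>\<close> need to be given on the members of a base of topology only.\<close>

locale exterior_der = exterior_base X R E
 for X :: "'x topology" and R :: "('x, 'x => complex) superalgebra_sheaf"
  and E :: "('x, 'x => complex, 'm) module_sheaf" +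
 fixes U0 and Bs :: "'x set set" and d :: "'x set => ('x => complex) => 'x => complex" and \<delta> :: "'x set => 'm => 'm"
 assumes Bs_open: "V : Bs ==> openin X V"
  and Bs_down: "[| V : Bs; openin X W; W <= V |] ==> W : Bs"
  and Bs_cover: "x : U0 ==> EX V:Bs. x : V"
  and d_in: "[| V : Bs; f : Sec R V |] ==> d V f : Sec R V"
  and d_add: "[| V : Bs; f : Sec R V; g : Sec R V |] ==>
   d V (f \<oplus>[R,V] g) = d V f \<oplus>[R,V] d V g"
  and d_mult: "[| V : Bs; f : Sec R V; g : Sec R V |] ==>
   d V (f \<otimes>[R,V] g) = d V f \<otimes>[R,V] g \<oplus>[R,V] f \<otimes>[R,V] d V g"
  and d_const: "V : Bs ==> d V (c \<odot>[R,V] \<one>[R,V]) = \<zero>[R,V]"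
  and d_rst: "[| V : Bs; openin X W; W <= V; f : Sec R V |] ==> d W (rst R V W f) = rst R V W (d V f)"
  and \<delta>_in: "[| V : Bs; m : Sec E V |] ==> \<delta> V m : Sec E V"
  and \<delta>_add: "[| V : Bs; m : Sec E V; n : Sec E V |] ==>
   \<delta> V (m \<oplus>[E,V] n) = \<delta> V m \<oplus>[E,V] \<delta> V n"
  and \<delta>_smult: "[| V : Bs; f : Sec R V; m : Sec E V |] ==>
   \<delta> V (f \<odot>[E,V] m) = d V f \<odot>[E,V] m \<oplus>[E,V] f \<odot>[E,V] \<delta> V m"
  and \<delta>_rst: "[| V : Bs; openin X W; W <= V; m : Sec E V |] ==> \<delta> W (rst E V W m) = rst E V W (\<delta> V m)"
begin

abbreviation "der V == ext_der (d V) (\<delta> V)"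

lemma der_in: "[| V : Bs; e : trm V |] ==> der V e : trm V"
 using ext_module.ext_der_closed[OF EM[OF Bs_open]] d_in \<delta>_in by metis

lemma d_zero: assumes "V : Bs" shows "d V \<zero>[R,V] = \<zero>[R,V]"
proof -
 interpret ring "sec R V" by (rule R_ring[OF Bs_open[OF assms]])
 show ?thesis using d_add[OF assms, of "\<zero>[R,V]" "\<zero>[R,V]"] d_in[OF assms, of "\<zero>[R,V]"] by simp
qed

lemma der_eq: assumes "V : Bs" "eeq V a b" shows "eeq V (der V a) (der V b)"
proof -
 note o = Bs_open[OF assms(1)]
 have "cls V (der V a) = cls V (der V b)"
  by (rule ext_module.ext_der_eq[OF EM[OF o] assms(2)])
   (simp_all add: d_in d_add d_mult \<delta>_in \<delta>_add \<delta>_smult assms)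
 moreover have "a : trm V" using ext_module.ext_eq_terms[OF EM[OF o] assms(2)] by simp
 ultimately show ?thesis using cls_eq_iff[OF o der_in[OF assms(1)]] by simp
qed

lemma der_tr: assumes "V : Bs" "openin X W" "W <= V" shows "e : trm V ==> der W (tr V W e) = tr V W (der V e)"
 by (induction e) (simp_all add: d_rst \<delta>_rst assms)

lemma rep_ex_Bs:
 assumes "g : Sec B V" "x : V" "V <= U0"
 obtains W e where "W : Bs" "x : W" "W <= V" "rep g W e"
proof -
 obtain W e where W: "x : W" "W <= V" "rep g W e" using rep_ex[OF assms(1,2)] .
 obtain A where A: "A : Bs" "x : A" using Bs_cover assms by blast
 have o: "openin X (W \<inter> A)" using repD(1)[OF W(3)] Bs_open[OF A(1)] by auto
 show thesis
  by (rule that[OF _ _ _ rep_rst[OF W(3) o]]) (use Bs_down[OF A(1) o] W A in auto)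
qed

lemma rep_ex2_Bs:
 assumes "g : Sec B V" "h : Sec B V" "x : V" "V <= U0"
 obtains W a b where "W : Bs" "x : W" "W <= V" "rep g W a" "rep h W b"
proof -
 obtain W e where W: "W : Bs" "x : W" "W <= V" "rep g W e" using rep_ex_Bs[OF assms(1,3,4)] .
 obtain W' e' where W': "W' : Bs" "x : W'" "W' <= V" "rep h W' e'" using rep_ex_Bs[OF assms(2,3,4)] .
 have o: "openin X (W \<inter> W')" using Bs_open[OF W(1)] Bs_open[OF W'(1)] by auto
 show thesis
  by (rule that[OF _ _ _ rep_rst[OF W(4) o] rep_rst[OF W'(4) o]]) (use Bs_down[OF W(1) o] W W' in auto)
qed

definition Der :: "('x, ('x, 'x => complex, 'm) ext_section) derivation" where
 "Der V g = (\<lambda>x\<in>V. SOME c. EX W e. W : Bs & x : W & rep g W e & c = sect W (der W e) x)"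

lemma Der_ext: "Der V g : extensional V"
 unfolding Der_def by simp

text \<open>The choice in \<open>Der\<close> is harmless: representing terms over two base sets
  become equivalent on a smaller set, and \<open>der\<close> respects equivalence and commutes with
  restriction.\<close>

lemma Der_rep:
 assumes W: "W : Bs" "W <= V" and r: "rep g W e"
 shows "rep (Der V g) W (der W e)"
proof -
 note o = Bs_open[OF W(1)]
 have t: "e : trm W" "der W e : trm W" using repD(2)[OF r] der_in[OF W(1)] by auto
 have "Der V g x = sect W (der W e) x" if x: "x : W" for x
 proof -
  have "(SOME c. EX W e. W : Bs & x : W & rep g W e & c = sect W (der W e) x) = sect W (der W e) x"
  proof (rule someI2)
   show "EX W' e'. W' : Bs & x : W' & rep g W' e' & sect W (der W e) x = sect W' (der W' e') x"
    using W x r by (intro exI[of _ W] exI[of _ e]) simp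
   fix c assume "EX W' e'. W' : Bs & x : W' & rep g W' e' & c = sect W' (der W' e') x"
   then obtain W' e' where W': "W' : Bs" "x : W'" "rep g W' e'" "c = sect W' (der W' e') x" by auto
   have t': "e' : trm W'" "der W' e' : trm W'" using repD(2)[OF W'(3)] der_in[OF W'(1)] by auto
   obtain O' where O': "openin X O'" "x : O'" "O' <= W" "O' <= W'" "eeq O' (tr W O' e) (tr W' O' e')"
    using rep_eqD[OF r W'(3) x W'(2) refl] .
   note r1 = rep_rst[OF rep_sect[OF o t(2)] O'(1,3)]
   note r2 = rep_rst[OF rep_sect[OF Bs_open[OF W'(1)] t'(2)] O'(1,4)]
   have "eeq O' (der O' (tr W O' e)) (der O' (tr W' O' e'))"
    by (rule der_eq[OF Bs_down[OF W(1) O'(1,3)] O'(5)])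
   then have "eeq O' (tr W O' (der W e)) (tr W' O' (der W' e'))"
    unfolding der_tr[OF W(1) O'(1,3) t(1)] der_tr[OF W'(1) O'(1,4) t'(1)] .
   then show "c = sect W (der W e) x" unfolding W'(4) using rep_eq_at[OF r1 r2 _ O'(2)] by simp
  qed
  then show ?thesis unfolding Der_def using x W(2) by auto
 qed
 then show ?thesis
  using rep_sect[OF o t(2)] unfolding rep_def represents_def by simp
qed

lemma Der_in:
 assumes "V <= U0" "g : Sec B V"
 shows "Der V g : Sec B V"
proof (rule B_mem[OF Der_ext])
 fix x assume "x : V"
 then obtain W e where "W : Bs" "x : W" "W <= V" "rep g W e" using rep_ex_Bs[OF assms(2) _ assms(1)] by blast
 then show "EX W e. x : W & W <= V & rep (Der V g) W e"
  using Der_rep[of W V g e] by (intro exI[of _ W] exI[of _ "der W e"]) simp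
qed

lemma Der_parity:
 assumes "V <= U0" "g : Par B V p"
 shows "Der V g : Par B V p"
proof (rule B_parity_mem[OF Der_ext])
 fix x assume x: "x : V"
 obtain W e where W: "x : W" "W <= V" "rep g W e" "ext_parity p e" using rep_ex_parity[OF assms(2) x] .
 obtain A where A: "A : Bs" "x : A" using Bs_cover x assms(1) by blast
 let ?O = "W \<inter> A"
 have o: "openin X ?O" using repD(1)[OF W(3)] Bs_open[OF A(1)] by auto
 have b: "?O : Bs" by (rule Bs_down[OF A(1) o]) auto
 have "rep (Der V g) ?O (der ?O (tr W ?O e))"
  by (rule Der_rep[OF b _ rep_rst[OF W(3) o]]) (use W in auto)
 moreover have "ext_parity p (der ?O (tr W ?O e))" by (intro ext_parity_der ext_parity_map W)
 ultimately show "EX W e. x : W & W <= V & rep (Der V g) W e & ext_parity p e"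
  using W A by (intro exI[of _ ?O] exI) auto
qed

lemma Der_grade:
 assumes V: "V <= U0" and g: "g : exterior_power_sections X R E k V"
 shows "Der V g : exterior_power_sections X R E k V"
 unfolding exterior_power_sections_def
proof (rule P.germ_sectionsI[OF Der_ext])
 fix x assume x: "x : V"
 have sub: "ext_grade (sec R V) (sec E V) k <= Sec P V" if "openin X V" for V
  unfolding ext_grade_def P_carrier[OF that] by auto
 obtain W s where W: "x : W" "W <= V" "s : ext_grade (sec R W) (sec E W) k" "represents X P g W s"
  using P.germ_sections_represents[OF g[unfolded exterior_power_sections_def] x sub] .
 have oW: "openin X W" using W(4) unfolding represents_def by simp
 obtain e where e: "e : trm W" "ext_homogeneous (sec R W) k e" "s = cls W e"
  using W(3) unfolding ext_grade_def by auto
 have r: "rep g W e" unfolding rep_def using oW e W by simp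
 obtain A where A: "A : Bs" "x : A" using Bs_cover x V by blast
 let ?O = "W \<inter> A"
 have o: "openin X ?O" using oW Bs_open[OF A(1)] by auto
 have b: "?O : Bs" by (rule Bs_down[OF A(1) o]) auto
 have r': "rep (Der V g) ?O (der ?O (tr W ?O e))"
  by (rule Der_rep[OF b _ rep_rst[OF r o]]) (use W in auto)
 have "ext_homogeneous (sec R ?O) k (der ?O (tr W ?O e))"
  using ext_homogeneous_map[of "rst R W ?O" "sec R W" "sec R ?O", OF R_zero[OF oW o] e(2)]
  by (intro ext_homogeneous_der[of "d ?O" "sec R ?O"] d_zero[OF b]) simp
 then have "cls ?O (der ?O (tr W ?O e)) : ext_grade (sec R ?O) (sec E ?O) k"
  unfolding ext_grade_def using repD(2)[OF r'] by simp
 then show "EX W s. x : W & W <= V & s : ext_grade (sec R W) (sec E W) k & represents X P (Der V g) W s"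
  using repD(3)[OF r'] W A by (intro exI[of _ ?O] exI[of _ "cls ?O (der ?O (tr W ?O e))"]) auto
qed

lemma Der_homogeneous:
 assumes V: "openin X V" "V <= U0"
 shows "homogeneous_superderivation (sec B V) False (Der V)"
 unfolding homogeneous_superderivation_def
proof (intro conjI ballI allI funcsetI)
 fix s assume s: "s : Sec B V"
 show "Der V s : Sec B V" by (rule Der_in[OF V(2) s])
 fix t assume t: "t : Sec B V"
 show "Der V (s \<oplus>[B,V] t) = Der V s \<oplus>[B,V] Der V t"
 proof (rule B_eqI[OF Der_ext B_op_ext(1)])
  fix x assume x: "x : V"
  obtain W a b where W: "W : Bs" "x : W" "W <= V" "rep s W a" "rep t W b" using rep_ex2_Bs[OF s t x V(2)] .
  have r1: "rep (Der V (s \<oplus>[B,V] t)) W (der W (ESum a b))"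
   by (rule Der_rep[OF W(1,3) rep_add[OF W(4,5,3)]])
  have r2: "rep (Der V s \<oplus>[B,V] Der V t) W (ESum (der W a) (der W b))"
   by (rule rep_add[OF Der_rep[OF W(1,3,4)] Der_rep[OF W(1,3,5)] W(3)])
  show "EX W e e'. x : W & rep (Der V (s \<oplus>[B,V] t)) W e &
    rep (Der V s \<oplus>[B,V] Der V t) W e' & eeq W e e'"
   using r1 r2 W(2) ext_refl[OF repD(2)[OF r2]] by auto
 qed
next
 fix c s assume s: "s : Sec B V"
 show "Der V (c \<odot>[B,V] s) = c \<odot>[B,V] Der V s"
 proof (rule B_eqI[OF Der_ext B_op_ext(3)])
  fix x assume x: "x : V"
  obtain W a where W: "W : Bs" "x : W" "W <= V" "rep s W a" using rep_ex_Bs[OF s x V(2)] .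
  note oW = Bs_open[OF W(1)]
  interpret W: ext_module "sec R W" "sec E W" by (rule EM[OF oW])
  let ?c = "c \<odot>[R,W] \<one>[R,W]"
  have r1: "rep (Der V (c \<odot>[B,V] s)) W (der W (EProd (EScal ?c) a))"
   by (rule Der_rep[OF W(1,3) rep_smult[OF W(4,3)]])
  have r2: "rep (c \<odot>[B,V] Der V s) W (EProd (EScal ?c) (der W a))"
   by (rule rep_smult[OF Der_rep[OF W(1,3,4)] W(3)])
  have t: "a : trm W" "der W a : trm W" "?c : Sec R W"
   using repD(2)[OF W(4)] der_in[OF W(1)] R_smult[OF oW] by auto
  have "cls W (der W (EProd (EScal ?c) a)) = cls W (EProd (EScal ?c) (der W a))"
   using t by (simp add: d_const[OF W(1)] W.cl_sum W.cl_prod W.EA_zero[symmetric])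
  then have "eeq W (der W (EProd (EScal ?c) a)) (EProd (EScal ?c) (der W a))"
   using cls_eq_iff[OF oW repD(2)[OF r1]] by blast
  then show "EX W e e'. x : W & rep (Der V (c \<odot>[B,V] s)) W e & rep (c \<odot>[B,V] Der V s) W e' & eeq W e e'"
   using r1 r2 W(2) by blast
 qed
next
 fix q show "Der V ` Par B V q <= Par B V (False ~= q)"
  using Der_parity[OF V(2)] by auto
next
 fix q s t assume "s : Par B V q" and t: "t : Sec B V"
 then have s: "s : Sec B V" using B_parity_carrier by blast
 show "Der V (s \<otimes>[B,V] t) =
  Der V s \<otimes>[B,V] t \<oplus>[B,V] signed (sec B V) (False & q) (s \<otimes>[B,V] Der V t)"
  unfolding signed_def simp_thms if_False
 proof (rule B_eqI[OF Der_ext B_op_ext(1)])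
  fix x assume x: "x : V"
  obtain W a b where W: "W : Bs" "x : W" "W <= V" "rep s W a" "rep t W b" using rep_ex2_Bs[OF s t x V(2)] .
  have r1: "rep (Der V (s \<otimes>[B,V] t)) W (der W (EProd a b))"
   by (rule Der_rep[OF W(1,3) rep_mult[OF W(4,5,3)]])
  have r2: "rep (Der V s \<otimes>[B,V] t \<oplus>[B,V] s \<otimes>[B,V] Der V t) W
    (ESum (EProd (der W a) b) (EProd a (der W b)))"
   by (rule rep_add[OF rep_mult[OF Der_rep[OF W(1,3,4)] W(5,3)] rep_mult[OF W(4) Der_rep[OF W(1,3,5)] W(3)] W(3)])
  show "EX W e e'. x : W & rep (Der V (s \<otimes>[B,V] t)) W e &
    rep (Der V s \<otimes>[B,V] t \<oplus>[B,V] s \<otimes>[B,V] Der V t) W e' & eeq W e e'"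
   using r1 r2 W(2) ext_refl[OF repD(2)[OF r2]] by auto
 qed
qed

lemma Der_rst:
 assumes "openin X V" "openin X W" "W <= V" "V <= U0" "g : Sec B V"
 shows "Der W (rst B V W g) = rst B V W (Der V g)"
proof (rule B_eqI)
 show "Der W (rst B V W g) : extensional W" by (rule Der_ext)
 show "rst B V W (Der V g) : extensional W" unfolding B_rst by simp
 fix x assume x: "x : W"
 have "x : V" using x assms by auto
 obtain W' e where W': "W' : Bs" "x : W'" "W' <= V" "rep g W' e" using rep_ex_Bs[OF assms(5) \<open>x : V\<close> assms(4)] .
 let ?O = "W' \<inter> W"
 have o: "openin X ?O" using Bs_open[OF W'(1)] assms by auto
 have b: "?O : Bs" by (rule Bs_down[OF W'(1) o]) auto
 have r: "rep g ?O (tr W' ?O e)" by (rule rep_rst[OF W'(4) o]) auto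
 have "rep (Der W (rst B V W g)) ?O (der ?O (tr W' ?O e))"
  unfolding B_rst by (rule Der_rep[OF b _ rep_restrict[OF r]]) auto
 moreover have "rep (rst B V W (Der V g)) ?O (der ?O (tr W' ?O e))"
  unfolding B_rst by (rule rep_restrict[OF Der_rep[OF b _ r]]) (use W' in auto)
 moreover have "eeq ?O (der ?O (tr W' ?O e)) (der ?O (tr W' ?O e))"
  by (rule ext_refl[OF der_in[OF b repD(2)[OF r]]])
 ultimately show "EX W'' e e'. x : W'' & rep (Der W (rst B V W g)) W'' e & rep (rst B V W (Der V g)) W'' e' & eeq W'' e e'"
  using x W'(2) by blast
qed

lemma Der_superderivation: "sheaf_superderivation X B U0 False Der"
 unfolding sheaf_superderivation_def
proof (intro conjI allI impI ballI)
 fix V assume "openin X V & V <= U0"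
 then show "homogeneous_superderivation (sec B V) False (Der V)" by (elim conjE) (rule Der_homogeneous)
next
 fix V W s assume "openin X V & openin X W & W <= V & V <= U0" "s : Sec B V"
 then show "Der W (rst B V W s) = rst B V W (Der V s)" by (elim conjE) (rule Der_rst)
qed

lemma Der_sect:
 assumes "W : Bs" "e : trm W"
 shows "Der W (sect W e) = sect W (der W e)"
 by (rule sect_eqI[OF Der_ext Der_rep[OF assms(1) _ rep_sect[OF Bs_open[OF assms(1)] assms(2)]]]) simp

end

section \<open>Holomorphic functions\<close>

text \<open>Holomorphy is differentiability along coordinate lines. An open set meets such a line in
  an open set, so functions that agree on it have the same partial derivatives there.\<close>

lemma complex_space_slice:
 assumes O: "openin (complex_space n) S" and z: "z : S" and i: "i < n"
 shows "open {w. z(i := w) : S}"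
proof -
 have zs: "ALL k>=n. z k = 0"
  using openin_subset[OF O] z unfolding complex_space_def by auto
 have "continuous_map euclidean (product_topology (%i. euclidean) UNIV) (%w::complex. z(i := w))"
  unfolding continuous_map_componentwise_UNIV
 proof
  fix k show "continuous_map euclidean euclidean (%w::complex. (z(i := w)) k)"
   by (cases "k = i") simp_all
 qed
 then have "continuous_map euclidean (complex_space n) (%w::complex. z(i := w))"
  unfolding complex_space_def continuous_map_in_subtopology using zs i by auto
 then have "openin euclidean {w : topspace euclidean. z(i := w) : S}"
  using O by (rule openin_continuous_map_preimage)
 then show ?thesis by simp
qed

lemma holomorphic_on_space_subset:
 assumes f: "holomorphic_on_space n S f" and T: "openin (complex_space n) T" "T <= S"
  and eq: "!!z. z : T ==> g z = f z"
 shows "holomorphic_on_space n T g"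
 unfolding holomorphic_on_space_def
proof (intro conjI ballI allI impI)
 have "continuous_map (subtopology (complex_space n) T) euclidean f"
  using f T(2) continuous_map_from_subtopology_mono unfolding holomorphic_on_space_def by metis
 then show "continuous_map (subtopology (complex_space n) T) euclidean g"
  by (rule continuous_map_eq) (simp add: eq)
 fix z i assume z: "z : T" and i: "i < n"
 then have "(%w. f (z(i := w))) field_differentiable at (z i)"
  using f T(2) unfolding holomorphic_on_space_def by auto
 then obtain f' where f': "((%w. f (z(i := w))) has_field_derivative f') (at (z i))"
  unfolding field_differentiable_def by auto
 have "((%w. g (z(i := w))) has_field_derivative f') (at (z i))"
  by (rule has_field_derivative_transform_within_open[OF f' complex_space_slice[OF T(1) z i]])
   (simp_all add: z eq)
 then show "(%w. g (z(i := w))) field_differentiable at (z i)"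
  unfolding field_differentiable_def by auto
qed

lemma holomorphic_function_restrict:
 assumes X: "complex_manifold X n \<A>" and f: "holomorphic_function n \<A> U f"
  and V: "openin X V" "V <= U" and eq: "!!x. x : V ==> g x = f x"
 shows "holomorphic_function n \<A> V g"
 unfolding holomorphic_function_def
proof (intro ballI, clarify)
 fix C \<phi> assume C: "(C, \<phi>) : \<A>"
 have "ALL (U, \<phi>) : \<A>. openin X U & openin (complex_space n) (\<phi> ` U) &
    homeomorphic_map (subtopology X U) (subtopology (complex_space n) (\<phi> ` U)) \<phi>"
  using X unfolding complex_manifold_def by (elim conjE)
 from bspec[OF this C] have h: "openin X C" "openin (complex_space n) (\<phi> ` C)"
  "homeomorphic_map (subtopology X C) (subtopology (complex_space n) (\<phi> ` C)) \<phi>" by simp_all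
 have inj: "inj_on \<phi> C"
  using homeomorphic_imp_injective_map[OF h(3)] openin_subset[OF h(1)] by (simp add: topspace_subtopology inf_absorb2)
 have "openin (subtopology X C) (V \<inter> C)" using V(1) by (rule openin_subtopology_Int)
 then have "openin (subtopology (complex_space n) (\<phi> ` C)) (\<phi> ` (V \<inter> C))"
  using homeomorphic_imp_open_map[OF h(3)] unfolding open_map_def by simp
 then have o: "openin (complex_space n) (\<phi> ` (V \<inter> C))"
  using openin_trans_full[OF _ h(2)] by simp
 show "holomorphic_on_space n (\<phi> ` (V \<inter> C)) (%z. g (inv_into C \<phi> z))"
 proof (rule holomorphic_on_space_subset[OF _ o])
  show "holomorphic_on_space n (\<phi> ` (U \<inter> C)) (%z. f (inv_into C \<phi> z))"
   using f C unfolding holomorphic_function_def by auto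
  show "\<phi> ` (V \<inter> C) <= \<phi> ` (U \<inter> C)" using V(2) by auto
  fix z assume "z : \<phi> ` (V \<inter> C)"
  then obtain x where "x : V" "x : C" "z = \<phi> x" by auto
  then show "g (inv_into C \<phi> z) = f (inv_into C \<phi> z)" using eq inv_into_f_f[OF inj] by simp
 qed
qed

section \<open>Identities for differences in a ring\<close>

context ring
begin

lemma diff_add_diff: "[| a : carrier R; b : carrier R; c : carrier R |] ==> (a \<ominus> b) \<oplus> (b \<ominus> c) = a \<ominus> c"
 by (simp add: a_minus_def a_assoc r_neg1 r_neg2)

lemma diff_diff_diff: "[| a : carrier R; b : carrier R; c : carrier R |] ==> (a \<ominus> c) \<ominus> (b \<ominus> c) = a \<ominus> b"
 using diff_add_diff[of a c b] by (simp add: a_minus_def minus_add a_ac)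

lemma diff_add: "[| a : carrier R; b : carrier R |] ==> b \<oplus> (a \<ominus> b) = a"
 by (simp add: a_minus_def a_lcomm r_neg)

lemma diff_cancel: "[| a : carrier R; b : carrier R |] ==> a \<ominus> (a \<ominus> b) = b"
 by (simp add: a_minus_def minus_add r_neg1 r_neg2)

lemma diff_swap: "[| a : carrier R; b : carrier R |] ==> \<ominus> (a \<ominus> b) = b \<ominus> a"
 by (simp add: a_minus_def minus_add a_comm)

lemma diff_plus_diff: "[| a : carrier R; b : carrier R; c : carrier R; d : carrier R |] ==>
  (a \<oplus> b) \<ominus> (c \<oplus> d) = (a \<ominus> c) \<oplus> (b \<ominus> d)"
 by (simp add: a_minus_def minus_add a_ac)

lemma diff_zero_iff: "[| a : carrier R; b : carrier R |] ==> a \<ominus> b = \<zero> \<longleftrightarrow> a = b"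
 by (metis a_minus_def diff_add minus_zero r_neg r_zero zero_closed)

end

section \<open>The filtration by powers of the nilpotent ideal\<close>

locale supermanifold =
 fixes \<XX> :: "('x, 'a) superspace"
 assumes complex_supermanifold: "complex_supermanifold \<XX>"
begin

abbreviation "X == body \<XX>"
abbreviation "F == strsheaf \<XX>"
abbreviation "R == body_sheaf \<XX>"
abbreviation "J == nil_ideal \<XX>"
abbreviation "N == nil_ideal_pow \<XX>"
abbreviation "pj == proj \<XX>"
abbreviation "I l U == ideal_pow (sec F U) (J U) l"

lemma manifold: "complex_manifold X (cdim \<XX>) (atlas \<XX>)"
 and F_sheaf: "sheaf_of_supercommutative_algebras X F"
 and pj_epi: "sheaf_epimorphism X F R pj"
 and local_model: "EX E :: ('x, 'x => complex, ('x, 'a set) germ_fun) module_sheaf.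
    sheaf_of_modules X R E & locally_free_of_finite_rank X R E & locally_exterior \<XX> E"
 using complex_supermanifold unfolding complex_supermanifold_def by simp_all

sublocale F: superalgebra_sheaf_on X F by unfold_locales (rule F_sheaf)

lemma R_simps:
 "rst R U V f = restrict f V"
 "\<zero>[R,U] = (\<lambda>x\<in>U. 0)" "\<one>[R,U] = (\<lambda>x\<in>U. 1)"
 "f \<oplus>[R,U] g = (\<lambda>x\<in>U. f x + g x)" "f \<otimes>[R,U] g = (\<lambda>x\<in>U. f x * g x)"
 "c \<odot>[R,U] f = (\<lambda>x\<in>U. c * f x)"
 "Par R U True = {\<lambda>x\<in>U. 0}"
 unfolding body_sheaf_def holomorphic_sheaf_def by simp_all

lemma R_carrier: "f : Sec R U \<longleftrightarrow> f : extensional U & holomorphic_function (cdim \<XX>) (atlas \<XX>) U f"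
 unfolding body_sheaf_def holomorphic_sheaf_def by simp

text \<open>\<open>Module.module\<close> includes that the scalars form a commutative ring, so the
  ring laws for holomorphic functions can be taken from the module of the local model.\<close>

lemma R_cring: "openin X U ==> cring (sec R U)"
 using local_model unfolding sheaf_of_modules_def
 by (elim exE conjE) (simp add: Module.module_def)

lemma R_rst_in: "[| openin X V; V <= U; f : Sec R U |] ==> restrict f V : Sec R V"
 unfolding R_carrier by (auto intro: holomorphic_function_restrict[OF manifold])

lemma R_rst_hom: "[| openin X U; openin X V; V <= U |] ==> rst R U V : ring_hom (sec R U) (sec R V)"
proof (rule ring_hom_memI)
 assume o: "openin X U" "openin X V" "V <= U"
 show "rst R U V f : Sec R V" if "f : Sec R U" for f
  using R_rst_in[OF o(2,3) that] by (simp add: R_simps(1))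
qed (auto simp: R_simps restrict_def subset_iff fun_eq_iff)

lemma pj_super: "openin X U ==> superalgebra_hom (sec F U) (sec R U) (pj U)"
 using pj_epi unfolding sheaf_epimorphism_def superalgebra_sheaf_hom_def by (elim conjE) simp

lemma pj_hom: "openin X U ==> pj U : ring_hom (sec F U) (sec R U)"
 using pj_super unfolding superalgebra_hom_def by simp

lemma pj_in: "[| openin X U; s : Sec F U |] ==> pj U s : Sec R U"
 using ring_hom_closed[OF pj_hom] .

lemma pj_ext: "[| openin X U; s : Sec F U |] ==> pj U s : extensional U"
 using pj_in R_carrier by blast

lemma pj_smult: "[| openin X U; s : Sec F U |] ==> pj U (c \<odot>[F,U] s) = c \<odot>[R,U] pj U s"
 using pj_super unfolding superalgebra_hom_def by simp

lemma pj_odd: "[| openin X U; s : Par F U True |] ==> pj U s = \<zero>[R,U]"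
proof -
 assume U: "openin X U" and s: "s : Par F U True"
 have "pj U ` Par F U True <= Par R U True"
  using pj_super[OF U] unfolding superalgebra_hom_def by simp
 then show ?thesis using s unfolding R_simps by auto
qed

lemma pj_rst: "[| openin X U; openin X V; V <= U; s : Sec F U |] ==>
  pj V (rst F U V s) = restrict (pj U s) V"
 using pj_epi unfolding sheaf_epimorphism_def superalgebra_sheaf_hom_def by (elim conjE) (simp add: R_simps)

lemma pj_lift:
 assumes "openin X U" "f : Sec R U" "x : U"
 obtains V s where "openin X V" "x : V" "V <= U" "s : Sec F V" "pj V s = restrict f V"
proof -
 have "ALL U. openin X U --> (ALL t : Sec R U. ALL x : U.
    EX V. openin X V & x : V & V <= U & (EX s : Sec F V. pj V s = rst R U V t))"
  using pj_epi unfolding sheaf_epimorphism_def by (elim conjE)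
 from this[rule_format, OF assms] show thesis using that by (auto simp: R_simps)
qed

text \<open>Constants are projections of constant sections of the structure sheaf, hence
  holomorphic.\<close>

lemma R_const: "openin X U ==> c \<odot>[R,U] \<one>[R,U] : Sec R U"
proof -
 assume U: "openin X U"
 interpret A: superalgebra "sec F U" by (rule F.F_super[OF U])
 have "pj U (c \<odot>[F,U] \<one>[F,U]) = c \<odot>[R,U] \<one>[R,U]"
  using pj_smult[OF U A.one_closed] ring_hom_one[OF pj_hom[OF U]] by simp
 then show ?thesis using pj_in[OF U A.sm_closed[OF A.one_closed]] by metis
qed

lemma R_const_rst: "[| openin X U; openin X V; V <= U |] ==>
  rst R U V (c \<odot>[R,U] \<one>[R,U]) = c \<odot>[R,V] \<one>[R,V]"
 unfolding R_simps by (auto simp: restrict_def subset_iff fun_eq_iff)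

lemma exterior_baseI:
 assumes "is_presheaf X E"
  and "!!U m n. [| openin X U; m : Sec E U; n : Sec E U |] ==>
   m \<oplus>[E,U] n : Sec E U"
  and "!!U f m. [| openin X U; f : Sec R U; m : Sec E U |] ==>
   f \<odot>[E,U] m : Sec E U"
  and "!!U V m n. [| openin X U; openin X V; V <= U; m : Sec E U; n : Sec E U |] ==>
   rst E U V (m \<oplus>[E,U] n) = rst E U V m \<oplus>[E,V] rst E U V n"
  and "!!U V f m. [| openin X U; openin X V; V <= U; f : Sec R U; m : Sec E U |] ==>
   rst E U V (f \<odot>[E,U] m) = restrict f V \<odot>[E,V] rst E U V m"
  and "!!U. openin X U ==> Sec E U ~= {}"
 shows "exterior_base X R E"
 apply (rule exterior_base.intro)
       apply (simp_all only: R_cring R_rst_hom R_const R_const_rst assms simp_thms)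
 apply (simp_all only: R_carrier R_simps(1) assms simp_thms)
 done

lemma J_iff: "s : J U \<longleftrightarrow> s : Sec F U & pj U s = \<zero>[R,U]"
 unfolding nil_ideal_def by simp

lemma J_iff_pointwise:
 "openin X U ==> s : J U \<longleftrightarrow> s : Sec F U & (ALL x:U. pj U s x = 0)"
 unfolding J_iff R_simps using pj_ext[of U s] by (auto intro: extensionalityI[of _ U])

lemma J_ideal: "openin X U ==> ideal (J U) (sec F U)"
proof -
 assume U: "openin X U"
 interpret ring_hom_ring "sec F U" "sec R U" "pj U"
  by (rule ring_hom_ringI2[OF F.F_ring[OF U] cring.axioms(1)[OF R_cring[OF U]] pj_hom[OF U]])
 have "J U = a_kernel (sec F U) (sec R U) (pj U)"
  unfolding nil_ideal_def a_kernel_def kernel_def by simp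
 then show ?thesis using kernel_is_ideal by simp
qed

lemma J_odd: "[| openin X U; s : Par F U True |] ==> s : J U"
 unfolding J_iff using pj_odd superalgebra.part_carrier[OF F.F_super] by blast

lemma pj_diff_J:
 assumes U: "openin X U" and s: "s : Sec F U" "t : Sec F U"
 shows "s \<ominus>[F,U] t : J U \<longleftrightarrow> pj U s = pj U t"
proof -
 interpret ring_hom_ring "sec F U" "sec R U" "pj U"
  by (rule ring_hom_ringI2[OF F.F_ring[OF U] cring.axioms(1)[OF R_cring[OF U]] pj_hom[OF U]])
 have "pj U (s \<ominus>[F,U] t) = pj U s \<ominus>[R,U] pj U t"
  using s by (simp add: a_minus_def)
 then show ?thesis unfolding J_iff using s pj_in[OF U] by (simp add: S.diff_zero_iff)
qed

lemma I_ideal: "openin X U ==> ideal (I l U) (sec F U)"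
proof (induction l)
 case 0
 then show ?case using ring.oneideal[OF F.F_ring] by simp
next
 case (Suc l)
 then show ?case using ring.ideal_prod_is_ideal[OF F.F_ring _ J_ideal] by simp
qed

lemma I_in: "[| openin X U; s : I l U |] ==> s : Sec F U"
 using ideal.Icarr[OF I_ideal] .

lemma I_add: "[| openin X U; s : I l U; t : I l U |] ==> s \<oplus>[F,U] t : I l U"
 using additive_subgroup.a_closed[OF ideal.axioms(1)[OF I_ideal]] .

lemma I_mult: "openin X U ==> s : I k U ==> t : I l U ==> s \<otimes>[F,U] t : I (k + l) U"
proof (induction l arbitrary: t)
 case 0
 then show ?case using ideal.I_r_closed[OF I_ideal] by simp
next
 case (Suc l)
 interpret A: ring "sec F U" by (rule F.F_ring[OF Suc.prems(1)])
 have s: "s : Sec F U" using I_in Suc.prems by blast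
 from Suc.prems(3) have "t : ideal_prod (sec F U) (I l U) (J U)" by simp
 then show ?case
 proof (induction t rule: ideal_prod.induct)
  case (prod i j)
  have c: "i : Sec F U" "j : Sec F U"
   using prod I_in[OF Suc.prems(1)] J_iff by blast+
  have "(s \<otimes>[F,U] i) \<otimes>[F,U] j : I (Suc (k + l)) U"
   using Suc.IH[OF Suc.prems(1,2) prod(1)] prod(2) by (simp add: ideal_prod.prod)
  then show ?case using s c by (simp add: A.m_assoc)
 next
  case (sum s1 s2)
  have c: "s1 : Sec F U" "s2 : Sec F U"
   using sum(1,2) I_in[OF Suc.prems(1), of _ "Suc l"] by simp_all
  show ?case using I_add[OF Suc.prems(1) sum(3,4)] s c by (simp add: A.r_distr)
 qed
qed

lemma I_rst: "openin X U ==> openin X V ==> V <= U ==> s : I l U ==> rst F U V s : I l V"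
proof (induction l arbitrary: s)
 case 0
 then show ?case using F.rst_closed by simp
next
 case (Suc l)
 note o = Suc.prems(1-3)
 from Suc.prems(4) have "s : ideal_prod (sec F U) (I l U) (J U)" by simp
 then show ?case
 proof (induction s rule: ideal_prod.induct)
  case (prod i j)
  have c: "i : Sec F U" "j : Sec F U"
   using prod I_in[OF o(1)] J_iff by blast+
  have "rst F U V j : J V"
   using prod(2) F.rst_closed[OF o c(2)] pj_rst[OF o c(2)] o(3)
   unfolding J_iff R_simps by (auto simp: restrict_def fun_eq_iff)
  then show ?case using Suc.IH[OF o prod(1)] by (simp add: F.F_rst_mult[OF o c] ideal_prod.prod)
 next
  case (sum s1 s2)
  have c: "s1 : Sec F U" "s2 : Sec F U"
   using sum(1,2) I_in[OF o(1), of _ "Suc l"] by simp_all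
  show ?case using I_add[OF o(2) sum(3,4)] by (simp add: F.F_rst_add[OF o c])
 qed
qed

lemma J_tau: "openin X U ==> s : J U ==> tau (sec F U) s : J U"
proof -
 assume U: "openin X U" and s: "s : J U"
 interpret A: superalgebra "sec F U" by (rule F.F_super[OF U])
 interpret h: ring_hom_ring "sec F U" "sec R U" "pj U"
  by (rule ring_hom_ringI2[OF F.F_ring[OF U] cring.axioms(1)[OF R_cring[OF U]] pj_hom[OF U]])
 have c: "s : Sec F U" using s J_iff by blast
 let ?a = "ppart (sec F U) False s" and ?b = "ppart (sec F U) True s"
 have b: "pj U ?b = \<zero>[R,U]" by (rule pj_odd[OF U A.ppart_in[OF c]])
 have "pj U (?a \<oplus>[F,U] ?b) = \<zero>[R,U]"
  using s A.ppart_decompose(1)[OF c] unfolding J_iff by simp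
 then have "pj U ?a = \<zero>[R,U]" using b c by (simp add: h.hom_add)
 then show ?thesis unfolding J_iff tau_def using b c by (simp add: a_minus_def h.hom_add h.hom_a_inv)
qed

lemma I_tau: "openin X U ==> s : I l U ==> tau (sec F U) s : I l U"
proof (induction l arbitrary: s)
 case 0
 then show ?case using superalgebra.tau_closed[OF F.F_super] by simp
next
 case (Suc l)
 interpret A: superalgebra "sec F U" by (rule F.F_super[OF Suc.prems(1)])
 from Suc.prems(2) have "s : ideal_prod (sec F U) (I l U) (J U)" by simp
 then show ?case
 proof (induction s rule: ideal_prod.induct)
  case (prod i j)
  have c: "i : Sec F U" "j : Sec F U"
   using prod I_in[OF Suc.prems(1)] J_iff by blast+
  show ?case using Suc.IH[OF Suc.prems(1) prod(1)] J_tau[OF Suc.prems(1) prod(2)] c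
   by (simp add: A.tau_mult ideal_prod.prod)
 next
  case (sum s1 s2)
  have c: "s1 : Sec F U" "s2 : Sec F U"
   using sum(1,2) I_in[OF Suc.prems(1), of _ "Suc l"] by simp_all
  show ?case using I_add[OF Suc.prems(1) sum(3,4)] c by (simp add: A.tau_add)
 qed
qed

lemma I_Suc: "openin X U ==> s : I (Suc l) U ==> s : I l U"
 using ring.ideal_prod_inter[OF F.F_ring I_ideal J_ideal] by auto

lemma N_iff: "s : N l U \<longleftrightarrow> s : Sec F U &
  (ALL x : U. EX V. openin X V & x : V & V <= U & rst F U V s : I l V)"
 unfolding nil_ideal_pow_def by simp

lemma N_in: "s : N l U ==> s : Sec F U"
 unfolding N_iff by simp

lemma N_ex: "[| s : N l U; x : U |] ==> EX V. openin X V & x : V & V <= U & rst F U V s : I l V"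
 unfolding N_iff by simp

lemma NI: "[| s : Sec F U; !!x. x : U ==> EX V. openin X V & x : V & V <= U & rst F U V s : I l V |]
  ==> s : N l U"
 unfolding N_iff by simp

lemma I_N: "[| openin X U; s : I l U |] ==> s : N l U"
 by (rule NI) (use I_in F.rst_id in auto)

text \<open>A section lies in \<open>N\<close> when it lies in the algebraic power \<open>I\<close>
  near each point. Shrinking to a common neighbourhood transfers closure properties of
  \<open>I\<close> to \<open>N\<close>.\<close>

lemma N_binary:
 assumes U: "openin X U" and s: "s : N k U" and t: "t : N l U" and p: "p : Sec F U"
  and h: "!!V. [| openin X V; V <= U; rst F U V s : I k V; rst F U V t : I l V |] ==> rst F U V p : I m V"
 shows "p : N m U"
proof (rule NI[OF p])
 fix x assume x: "x : U"
 obtain V where V: "openin X V" "x : V" "V <= U" "rst F U V s : I k V" using N_ex[OF s x] by blast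
 obtain W where W: "openin X W" "x : W" "W <= U" "rst F U W t : I l W" using N_ex[OF t x] by blast
 let ?O = "V \<inter> W"
 have o: "openin X ?O" "?O <= U" "?O <= V" "?O <= W" "x : ?O" using V W by auto
 have "rst F U ?O s : I k ?O"
  using I_rst[OF V(1) o(1,3) V(4)] F.rst_rst[OF U V(1) o(1,3) V(3) N_in[OF s]] by simp
 moreover have "rst F U ?O t : I l ?O"
  using I_rst[OF W(1) o(1,4) W(4)] F.rst_rst[OF U W(1) o(1,4) W(3) N_in[OF t]] by simp
 ultimately have "rst F U ?O p : I m ?O" by (rule h[OF o(1,2)])
 then show "EX V. openin X V & x : V & V <= U & rst F U V p : I m V" using o by blast
qed

lemma N_add: "[| openin X U; s : N l U; t : N l U |] ==> s \<oplus>[F,U] t : N l U"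
 by (rule N_binary, assumption, assumption, assumption)
  (simp_all add: ring.ring_simprules(1)[OF F.F_ring] N_in F.F_rst_add I_add)

lemma N_mult: "[| openin X U; s : N k U; t : N l U |] ==> s \<otimes>[F,U] t : N (k + l) U"
 by (rule N_binary, assumption, assumption, assumption)
  (simp_all add: ring.ring_simprules(5)[OF F.F_ring] N_in F.F_rst_mult I_mult)

lemma N_0: "openin X U ==> N 0 U = Sec F U"
 using I_N[of U _ 0] N_in by auto

lemma N_smult: "[| openin X U; s : N l U |] ==> c \<odot>[F,U] s : N l U"
proof -
 assume U: "openin X U" and s: "s : N l U"
 interpret A: superalgebra "sec F U" by (rule F.F_super[OF U])
 have "(c \<odot>[F,U] \<one>[F,U]) \<otimes>[F,U] s : N (0 + l) U"
  by (rule N_mult[OF U _ s]) (simp add: N_0[OF U])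
 then show ?thesis using N_in[OF s] by (simp add: A.sm_mult)
qed

lemma N_neg: "[| openin X U; s : N l U |] ==> \<ominus>[F,U] s : N l U"
 using N_smult[of U s l "-1"] superalgebra.sm_m1[OF F.F_super N_in] by simp

lemma N_diff: "[| openin X U; s : N l U; t : N l U |] ==> s \<ominus>[F,U] t : N l U"
 unfolding a_minus_def by (intro N_add N_neg)

lemma N_zero: "openin X U ==> \<zero>[F,U] : N l U"
 using I_N additive_subgroup.zero_closed[OF ideal.axioms(1)[OF I_ideal]] by blast

lemma N_rst: "[| openin X U; openin X V; V <= U; s : N l U |] ==> rst F U V s : N l V"
proof -
 assume o: "openin X U" "openin X V" "V <= U" and s: "s : N l U"
 show ?thesis
 proof (rule NI[OF F.rst_closed[OF o N_in[OF s]]])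
  fix x assume x: "x : V"
  then obtain W where W: "openin X W" "x : W" "W <= U" "rst F U W s : I l W" using N_ex[OF s] o by blast
  let ?O = "V \<inter> W"
  have o': "openin X ?O" "?O <= U" "?O <= V" "?O <= W" "x : ?O" using o x W by auto
  have "rst F V ?O (rst F U V s) : I l ?O"
   using I_rst[OF W(1) o'(1,4) W(4)] F.rst_rst[OF o(1) W(1) o'(1,4) W(3) N_in[OF s]]
    F.rst_rst[OF o(1,2) o'(1,3) o(3) N_in[OF s]] by simp
  then show "EX W. openin X W & x : W & W <= V & rst F V W (rst F U V s) : I l W" using o' by blast
 qed
qed

lemma N_local:
 assumes U: "openin X U" and s: "s : Sec F U"
  and h: "!!x. x : U ==> EX V. openin X V & x : V & V <= U & rst F U V s : N l V"
 shows "s : N l U"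
proof (rule NI[OF s])
 fix x assume "x : U"
 then obtain V where V: "openin X V" "x : V" "V <= U" "rst F U V s : N l V" using h by blast
 obtain W where W: "openin X W" "x : W" "W <= V" "rst F V W (rst F U V s) : I l W"
  using N_ex[OF V(4,2)] by blast
 then show "EX V. openin X V & x : V & V <= U & rst F U V s : I l V"
  using F.rst_rst[OF U V(1) W(1,3) V(3) s] V(3) by (intro exI[of _ W]) auto
qed

lemma I_1: "openin X U ==> I 1 U = J U"
proof -
 assume U: "openin X U"
 interpret A: ring "sec F U" by (rule F.F_ring[OF U])
 have "I 1 U = ideal_prod (sec F U) (Sec F U) (J U)" by simp
 moreover have "... <= J U"
  using A.ideal_prod_inter[OF A.oneideal J_ideal[OF U]] by auto
 moreover have "J U <= ideal_prod (sec F U) (Sec F U) (J U)"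
 proof
  fix j assume j: "j : J U"
  then have "\<one>[F,U] \<otimes>[F,U] j : ideal_prod (sec F U) (Sec F U) (J U)"
   by (intro ideal_prod.prod) simp_all
  then show "j : ideal_prod (sec F U) (Sec F U) (J U)" using j J_iff by simp
 qed
 ultimately show ?thesis by simp
qed

lemma J_local:
 assumes U: "openin X U" and s: "s : Sec F U"
  and h: "!!x. x : U ==> EX V. openin X V & x : V & V <= U & rst F U V s : J V"
 shows "s : J U"
 unfolding J_iff_pointwise[OF U]
proof (intro conjI s ballI)
 fix x assume "x : U"
 then obtain V where V: "openin X V" "x : V" "V <= U" "rst F U V s : J V" using h by blast
 have "pj V (rst F U V s) x = 0" using V(2,4) unfolding J_iff_pointwise[OF V(1)] by simp
 then show "pj U s x = 0" using pj_rst[OF U V(1,3) s] V(2) by simp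
qed

lemma N_1: "openin X U ==> N 1 U = J U"
proof
 assume U: "openin X U"
 show "N 1 U <= J U"
 proof
  fix s assume s: "s : N 1 U"
  show "s : J U" by (rule J_local[OF U N_in[OF s]]) (use N_ex[OF s] I_1 in metis)
 qed
 show "J U <= N 1 U" using I_N[OF U, of _ 1] unfolding I_1[OF U] by auto
qed

lemma J_rst: "[| openin X U; openin X V; V <= U; s : J U |] ==> rst F U V s : J V"
 using N_rst[of U V s 1] by (simp only: N_1)

lemma N_Suc: "[| openin X U; s : N (Suc l) U |] ==> s : N l U"
proof -
 assume U: "openin X U" and s: "s : N (Suc l) U"
 show ?thesis
 proof (rule NI[OF N_in[OF s]])
  fix x assume "x : U"
  then obtain V where V: "openin X V" "x : V" "V <= U" "rst F U V s : I (Suc l) V" using N_ex[OF s] by blast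
  then show "EX V. openin X V & x : V & V <= U & rst F U V s : I l V"
   using I_Suc[OF V(1) V(4)] by blast
 qed
qed

lemma N_mono: "openin X U ==> k <= l ==> s : N l U ==> s : N k U"
proof (induction l)
 case (Suc l)
 then show ?case using N_Suc[of U s l] by (cases "k = Suc l") simp_all
qed simp

lemma N_J: "[| openin X U; s : N (Suc l) U |] ==> s : J U"
 using N_mono[of U 1 "Suc l" s] N_1 by simp

lemma rst_tau: "[| openin X U; openin X V; V <= U; s : Sec F U |] ==>
  rst F U V (tau (sec F U) s) = tau (sec F V) (rst F U V s)"
 unfolding tau_def
 using superalgebra.ppart_carrier[OF F.F_super] by (simp add: F.F_rst_diff F.F_rst_ppart)

lemma N_tau: "[| openin X U; s : N l U |] ==> tau (sec F U) s : N l U"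
 by (rule N_binary[of U s l s l], assumption, assumption, assumption)
  (simp_all add: superalgebra.tau_closed[OF F.F_super] N_in rst_tau I_tau)

lemma N_ppart: "[| openin X U; s : N l U |] ==> ppart (sec F U) p s : N l U"
 using superalgebra.ppart_tau[OF F.F_super N_in, of U s l]
 by (cases p) (simp_all add: N_smult N_add N_diff N_tau)

lemma N_eq_diff:
 assumes "openin X U" "s : Sec F U" "t : Sec F U" "u : Sec F U"
  "s \<ominus>[F,U] t : N l U" "t \<ominus>[F,U] u : N l U"
 shows "s \<ominus>[F,U] u : N l U"
 using N_add[OF assms(1,5,6)] ring.diff_add_diff[OF F.F_ring[OF assms(1)] assms(2-4)] by simp

end

section \<open>Derivations and the filtration\<close>

lemma sheaf_derD:
 assumes "sheaf_superderivation X F U p D"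
 shows "[| openin X V; V <= U |] ==> homogeneous_superderivation (sec F V) p (D V)"
  and "[| openin X V; openin X W; W <= V; V <= U; s : Sec F V |] ==>
   D W (rst F V W s) = rst F V W (D V s)"
 using assms unfolding sheaf_superderivation_def by (elim conjE, simp)+

lemma sheaf_derI:
 assumes "!!V. [| openin X V; V <= U |] ==> homogeneous_superderivation (sec F V) p (D V)"
  and "!!V W s. [| openin X V; openin X W; W <= V; V <= U; s : Sec F V |] ==>
   D W (rst F V W s) = rst F V W (D V s)"
 shows "sheaf_superderivation X F U p D"
 unfolding sheaf_superderivation_def by (intro conjI allI impI ballI assms) simp_all

lemma sheaf_der_subset:
 assumes "sheaf_superderivation X F U p D" "V <= U"
 shows "sheaf_superderivation X F V p D"
 by (rule sheaf_derI)
  (use sheaf_derD[OF assms(1)] order_trans[OF _ assms(2)] in simp_all)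

context supermanifold
begin

text \<open>The analogue of \<open>N_binary\<close> for one argument: an estimate on the algebraic
  powers extends to \<open>N\<close> for every operation that commutes with restriction.\<close>

lemma N_transfer:
 assumes T: "!!V s. [| openin X V; V <= U; s : I l V |] ==> T V s : N m V"
  and Tc: "!!V s. [| openin X V; V <= U; s : Sec F V |] ==> T V s : Sec F V"
  and Tr: "!!V W s. [| openin X V; openin X W; W <= V; V <= U; s : Sec F V |] ==>
   rst F V W (T V s) = T W (rst F V W s)"
  and V: "openin X V" "V <= U" and s: "s : N l V"
 shows "T V s : N m V"
proof (rule N_local[OF V(1) Tc[OF V N_in[OF s]]])
 fix x assume "x : V"
 then obtain W where W: "openin X W" "x : W" "W <= V" "rst F V W s : I l W" using N_ex[OF s] by blast
 have "T W (rst F V W s) : N m W" by (rule T[OF W(1) order_trans[OF W(3) V(2)] W(4)])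
 then show "EX W. openin X W & x : W & W <= V & rst F V W (T V s) : N m W"
  using Tr[OF V(1) W(1,3) V(2) N_in[OF s]] W by (intro exI[of _ W]) simp
qed

lemma I_induct [consumes 2, case_names prod sum]:
 assumes "openin X V" "s : I (Suc l) V"
  and "!!i j. [| i : I l V; j : J V; i : Sec F V; j : Sec F V |] ==> P (i \<otimes>[F,V] j)"
  and "!!s t. [| s : I (Suc l) V; t : I (Suc l) V; s : Sec F V; t : Sec F V; P s; P t |]
   ==> P (s \<oplus>[F,V] t)"
 shows "P s"
proof -
 from assms(2) have "s : ideal_prod (sec F V) (I l V) (J V)" by simp
 then show ?thesis
 proof (induction s rule: ideal_prod.induct)
  case (prod i j)
  show ?case using assms(3)[OF prod I_in[OF assms(1) prod(1)]] prod(2) J_iff by blast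
 next
  case (sum s t)
  have "s : I (Suc l) V" "t : I (Suc l) V" using sum by simp_all
  then show ?case using assms(4) sum(3,4) I_in[OF assms(1)] by blast
 qed
qed

text \<open>Each power of the ideal is spanned by products of an element of the previous power and
  one of \<open>J\<close>. The Leibniz rule therefore propagates the estimate from the levels 0 and
  1 to all levels.\<close>

lemma der_filtration:
 assumes D: "sheaf_superderivation X F U p D"
  and h0: "!!V s. [| openin X V; V <= U; s : Sec F V |] ==> D V s : N m V"
  and h1: "!!V s. [| openin X V; V <= U; s : J V |] ==> D V s : N (Suc m) V"
 shows "[| openin X V; V <= U; s : N l V |] ==> D V s : N (l + m) V"
proof -
 note d = sheaf_derD(1)[OF D]
 have I: "D V s : N (l + m) V" if "openin X V" "V <= U" "s : I l V" for V s l
  using that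
 proof (induction l arbitrary: s)
  case 0
  then show ?case using h0 by simp
 next
  case (Suc l)
  note V = Suc.prems(1,2)
  interpret A: superalgebra "sec F V" by (rule F.F_super[OF V(1)])
  from Suc.prems(1,3) show ?case
  proof (induction s rule: I_induct)
   case (prod i j)
   \<comment> \<open>\<open>t\<close> is \<open>i\<close> itself, or \<open>tau\<close> of
     \<open>i\<close> when the derivation is odd. Both lie in the same power, so the sign causes no
     case distinction below.\<close>
   obtain t where t: "t : I l V" "D V (i \<otimes>[F,V] j) = D V i \<otimes>[F,V] j \<oplus>[F,V] t \<otimes>[F,V] D V j"
   proof (cases p)
    case True
    then interpret odd_derivation "sec F V" "D V" using d[OF V] by unfold_locales simp
    show ?thesis using that[OF I_tau[OF V(1) prod(1)]] D_mult[OF prod(3,4)] by simp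
   next
    case False
    then interpret even_derivation "sec F V" "D V" using d[OF V] by unfold_locales simp
    show ?thesis using that[OF prod(1)] D_mult[OF prod(3,4)] by simp
   qed
   have 1: "D V i \<otimes>[F,V] j : N ((l + m) + 1) V"
    using N_mult[OF V(1) Suc.IH[OF V prod(1)], of j 1] prod(2) unfolding N_1[OF V(1)] by simp
   have 2: "t \<otimes>[F,V] D V j : N (l + Suc m) V"
    by (rule N_mult[OF V(1) I_N[OF V(1) t(1)] h1[OF V prod(2)]])
   show ?case unfolding t(2) using N_add[OF V(1) 1] 2 by simp
  next
   case (sum s t)
   then show ?case using superderivationD(2)[OF d[OF V] sum(3,4)] N_add[OF V(1)] by simp
  qed
 qed
 show "[| openin X V; V <= U; s : N l V |] ==> D V s : N (l + m) V"
  by (rule N_transfer[of U l D "l + m" V s, OF I])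
   (use superderivationD(1)[OF d] sheaf_derD(2)[OF D] in simp_all)
qed

text \<open>The even derivations that act on the graded sheaf as the Euler vector field.\<close>

definition euler_lift :: "'x set => ('x, 'a) derivation => bool" where
 "euler_lift U D \<longleftrightarrow> openin X U & sheaf_superderivation X F U False D &
  (ALL V. openin X V & V <= U --> (ALL s:Sec F V. D V s : J V) &
   (ALL j:J V. D V j \<ominus>[F,V] j : N 2 V))"

lemma eulerD:
 assumes "euler_lift U D"
 shows "openin X U" "sheaf_superderivation X F U False D"
  "[| openin X V; V <= U; s : Sec F V |] ==> D V s : J V"
  "[| openin X V; V <= U; s : J V |] ==> D V s \<ominus>[F,V] s : N 2 V"
  "[| openin X V; openin X W; W <= V; V <= U; s : Sec F V |] ==>
   D W (rst F V W s) = rst F V W (D V s)"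
  "[| openin X V; V <= U |] ==> even_derivation (sec F V) (D V)"
proof -
 show 1: "openin X U" "sheaf_superderivation X F U False D"
  "[| openin X V; V <= U; s : Sec F V |] ==> D V s : J V"
  "[| openin X V; V <= U; s : J V |] ==> D V s \<ominus>[F,V] s : N 2 V"
  using assms unfolding euler_lift_def by simp_all
 show "[| openin X V; openin X W; W <= V; V <= U; s : Sec F V |] ==>
   D W (rst F V W s) = rst F V W (D V s)"
  by (rule sheaf_derD(2)[OF 1(2)])
 show "[| openin X V; V <= U |] ==> even_derivation (sec F V) (D V)"
  by (intro even_derivation.intro even_derivation_axioms.intro F.F_super sheaf_derD(1)[OF 1(2)])
qed

lemma euler_subset: "[| euler_lift U D; openin X V; V <= U |] ==> euler_lift V D"
proof -
 assume E: "euler_lift U D" and V: "openin X V" "V <= U"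
 show ?thesis
  unfolding euler_lift_def
 proof (intro conjI allI impI ballI V(1) sheaf_der_subset[OF eulerD(2)[OF E] V(2)])
  fix W assume W: "openin X W & W <= V"
  then have W': "openin X W" "W <= U" using V by auto
  show "D W s : J W" if "s : Sec F W" for s by (rule eulerD(3)[OF E W' that])
  show "D W j \<ominus>[F,W] j : N 2 W" if "j : J W" for j by (rule eulerD(4)[OF E W' that])
 qed
qed

lemma (in superalgebra) grade_mult:
 assumes "even_derivation A D" "i : carrier A" "j : carrier A"
 shows "D (i \<otimes> j) \<ominus> (a + 1) \<odot> (i \<otimes> j) = (D i \<ominus> a \<odot> i) \<otimes> j \<oplus> i \<otimes> (D j \<ominus> j)"
proof -
 interpret even_derivation A D by fact
 have "D (i \<otimes> j) \<ominus> (a + 1) \<odot> (i \<otimes> j) = (D i \<otimes> j \<oplus> i \<otimes> D j) \<ominus> (a \<odot> (i \<otimes> j) \<oplus> i \<otimes> j)"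
  using assms by (simp add: D_mult sm_plus)
 also have "... = (D i \<otimes> j \<ominus> a \<odot> (i \<otimes> j)) \<oplus> (i \<otimes> D j \<ominus> i \<otimes> j)"
  using assms by (intro diff_plus_diff) simp_all
 also have "... = (D i \<ominus> a \<odot> i) \<otimes> j \<oplus> i \<otimes> (D j \<ominus> j)"
  using assms by (simp add: a_minus_def l_distr r_distr l_minus r_minus sm_mult)
 finally show ?thesis .
qed

text \<open>Weights add under products: by \<open>grade_mult\<close> the deviation of
  \<open>D\<close> from \<open>l + 1\<close> on a product is the deviation from \<open>l\<close> on
  the first factor times the second, plus the first times the deviation from 1 on the second. Both
  summands lie one power deeper.\<close>

lemma euler_grade:
 assumes EL: "euler_lift U D"
 shows "[| openin X V; V <= U; s : N l V |] ==> D V s \<ominus>[F,V] of_nat l \<odot>[F,V] s : N (Suc l) V"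
proof -
 have I: "D V s \<ominus>[F,V] of_nat l \<odot>[F,V] s : N (Suc l) V"
  if "openin X V" "V <= U" "s : I l V" for V s l
  using that
 proof (induction l arbitrary: s)
  case 0
  interpret even_derivation "sec F V" "D V" by (rule eulerD(6)[OF EL 0(1,2)])
  show ?case using 0 eulerD(3)[OF EL 0(1,2)] N_1[OF 0(1)] by (simp add: a_minus_def)
 next
  case (Suc l)
  note V = Suc.prems(1,2)
  interpret even_derivation "sec F V" "D V" by (rule eulerD(6)[OF EL V])
  from Suc.prems(1,3) show ?case
  proof (induction s rule: I_induct)
   case (prod i j)
   have 1: "(D V i \<ominus>[F,V] of_nat l \<odot>[F,V] i) \<otimes>[F,V] j : N (Suc l + 1) V"
    by (rule N_mult[OF V(1) Suc.IH[OF V prod(1)]]) (simp only: N_1[OF V(1)] prod(2))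
   have 2: "i \<otimes>[F,V] (D V j \<ominus>[F,V] j) : N (l + 2) V"
    by (rule N_mult[OF V(1) I_N[OF V(1) prod(1)] eulerD(4)[OF EL V prod(2)]])
   show ?case
    using grade_mult[OF even_derivation_axioms prod(3,4), of "of_nat l"] N_add[OF V(1) 1] 2
    by (simp add: add.commute)
  next
   case (sum s t)
   have "D V (s \<oplus>[F,V] t) \<ominus>[F,V] of_nat (Suc l) \<odot>[F,V] (s \<oplus>[F,V] t) =
     (D V s \<ominus>[F,V] of_nat (Suc l) \<odot>[F,V] s) \<oplus>[F,V]
     (D V t \<ominus>[F,V] of_nat (Suc l) \<odot>[F,V] t)"
    using sum(3,4) by (simp only: D_add sm_add) (intro diff_plus_diff; simp)
   then show ?case using N_add[OF V(1) sum(5,6)] by simp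
  qed
 qed
 assume V: "openin X V" "V <= U" "s : N l V"
 show ?thesis
 proof (rule N_transfer[of U l "%V s. D V s \<ominus>[F,V] of_nat l \<odot>[F,V] s", OF I _ _ V])
  show "D V s \<ominus>[F,V] of_nat l \<odot>[F,V] s : Sec F V"
   if h: "openin X V" "V <= U" "s : Sec F V" for V s
  proof -
   interpret even_derivation "sec F V" "D V" by (rule eulerD(6)[OF EL h(1,2)])
   show ?thesis using h by simp
  qed
  show "rst F V W (D V s \<ominus>[F,V] of_nat l \<odot>[F,V] s) =
    D W (rst F V W s) \<ominus>[F,W] of_nat l \<odot>[F,W] rst F V W s"
   if h: "openin X V" "openin X W" "W <= V" "V <= U" "s : Sec F V" for V W s
  proof -
   interpret even_derivation "sec F V" "D V" by (rule eulerD(6)[OF EL h(1,4)])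
   show ?thesis using h eulerD(5)[OF EL h] by (simp add: F.F_rst_diff F.F_rst_smult)
  qed
 qed
qed

end

text \<open>The Euler field kills functions and fixes generators. The Leibniz rule for a scaled
  generator then has a first summand with scalar zero, and \<open>z\<close> says that this summand
  disappears.\<close>

lemma (in exterior_base) euler_exterior_der:
 assumes U0: "openin X U0"
  and z: "!!V m n. [| openin X V; m : Sec E V; n : Sec E V |] ==>
   \<zero>[R,V] \<odot>[E,V] m \<oplus>[E,V] n = n"
 shows "exterior_der X R E U0 {V. openin X V & V <= U0} (%V f. \<zero>[R,V]) (%V m. m)"
proof (intro exterior_der.intro exterior_base_axioms exterior_der_axioms.intro)
 show "EX V:{V. openin X V & V <= U0}. x : V" if "x : U0" for x using U0 that by auto
 fix V assume "V : {V. openin X V & V <= U0}"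
 then have V: "openin X V" by simp
 interpret cring "sec R V" by (rule R_cring[OF V])
 show "openin X V" by fact
 show "\<zero>[R,V] : Sec R V" by simp
 show "\<zero>[R,V] = \<zero>[R,V] \<oplus>[R,V] \<zero>[R,V]" by simp
 fix f g assume f: "f : Sec R V"
 show "\<zero>[R,V] = \<zero>[R,V] \<otimes>[R,V] g \<oplus>[R,V] f \<otimes>[R,V] \<zero>[R,V]"
  if "g : Sec R V" using f that by simp
 show "f \<odot>[E,V] m = \<zero>[R,V] \<odot>[E,V] m \<oplus>[E,V] f \<odot>[E,V] m"
  if "m : Sec E V" for m using z[OF V that E_smult[OF V f that]] by simp
qed (auto simp: R_zero)

text \<open>An odd part has to be present even for a scalar. There it is \<open>0\<close> times a
  generator; for a single generator the even part is the zero scalar.\<close>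

lemma (in exterior_base) trm_parity_decompose:
 assumes V: "openin X V"
 shows "e : trm V ==> EX a b. a : trm V & b : trm V & ext_parity False a & ext_parity True b & eeq V e (ESum a b)"
proof (induction e)
 case (EScal r)
 obtain m where m: "m : Sec E V" using E_ne[OF V] by auto
 interpret ext_module "sec R V" "sec E V" by (rule EM[OF V])
 let ?z = "EProd (EScal \<zero>[R,V]) (EGen m)"
 have "cl (EScal r) = cl (ESum (EScal r) ?z)"
  using EScal m by (simp add: cl_sum cl_prod EA_zero[symmetric])
 then have "eeq V (EScal r) (ESum (EScal r) ?z)" using cl_eq_iff EScal by blast
 moreover have "ext_parity True ?z"
  using ext_parity.intros(4)[OF ext_parity.intros(1) ext_parity.intros(2), of "\<zero>[R,V]" m] by simp
 ultimately show ?case using EScal m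
  by (intro exI[of _ "EScal r"] exI[of _ ?z]) (auto intro: ext_parity.intros(1))
next
 case (EGen m)
 interpret ext_module "sec R V" "sec E V" by (rule EM[OF V])
 have "cl (EGen m) = cl (ESum (EScal \<zero>[R,V]) (EGen m))"
  using EGen by (simp add: cl_sum EA_zero[symmetric])
 then have "eeq V (EGen m) (ESum (EScal \<zero>[R,V]) (EGen m))" using cl_eq_iff EGen by blast
 then show ?case using EGen
  by (intro exI[of _ "EScal \<zero>[R,V]"] exI[of _ "EGen m"]) (auto intro: ext_parity.intros(1,2))
next
 case (ESum c d)
 interpret ext_module "sec R V" "sec E V" by (rule EM[OF V])
 obtain c0 c1 where c: "c0 : trm V" "c1 : trm V" "ext_parity False c0" "ext_parity True c1" "eeq V c (ESum c0 c1)"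
  using ESum by auto
 obtain d0 d1 where d: "d0 : trm V" "d1 : trm V" "ext_parity False d0" "ext_parity True d1" "eeq V d (ESum d0 d1)"
  using ESum by auto
 have "cl (ESum c d) = cl (ESum (ESum c0 d0) (ESum c1 d1))"
  using c d ESum.prems cl_eqI[OF c(5)] cl_eqI[OF d(5)] by (simp add: cl_sum EA.a_ac)
 then have "eeq V (ESum c d) (ESum (ESum c0 d0) (ESum c1 d1))" using cl_eq_iff ESum.prems by blast
 then show ?case using c d
  by (intro exI[of _ "ESum c0 d0"] exI[of _ "ESum c1 d1"]) (auto intro: ext_parity.intros(3))
next
 case (EProd c d)
 interpret ext_module "sec R V" "sec E V" by (rule EM[OF V])
 obtain c0 c1 where c: "c0 : trm V" "c1 : trm V" "ext_parity False c0" "ext_parity True c1" "eeq V c (ESum c0 c1)"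
  using EProd by auto
 obtain d0 d1 where d: "d0 : trm V" "d1 : trm V" "ext_parity False d0" "ext_parity True d1" "eeq V d (ESum d0 d1)"
  using EProd by auto
 let ?a = "ESum (EProd c0 d0) (EProd c1 d1)" and ?b = "ESum (EProd c0 d1) (EProd c1 d0)"
 have "cl (EProd c d) = cl (ESum ?a ?b)"
  using c d EProd.prems cl_eqI[OF c(5)] cl_eqI[OF d(5)]
  by (simp add: cl_sum cl_prod EA.l_distr EA.r_distr EA.a_ac)
 then have "eeq V (EProd c d) (ESum ?a ?b)" using cl_eq_iff EProd.prems by blast
 moreover have "ext_parity False ?a" "ext_parity True ?b"
  using ext_parity.intros(3) ext_parity_prod[OF c(3) d(3)] ext_parity_prod[OF c(4) d(4)]
   ext_parity_prod[OF c(3) d(4)] ext_parity_prod[OF c(4) d(3)] by auto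
 ultimately show ?case using c d by (intro exI[of _ ?a] exI[of _ ?b]) simp
qed

section \<open>Superalgebra isomorphisms with an exterior sheaf\<close>

text \<open>
 The map \<open>pre\<close> is the preimage map of a homeomorphism \<open>f\<close>.  It serves both for local
 isomorphisms, where \<open>f\<close> is the identity, and for isomorphisms with the split model.
\<close>

locale ext_iso = supermanifold \<XX> + EB: exterior_base "body \<XX>" "body_sheaf \<XX>" E
 for \<XX> :: "('x, 'a) superspace" and E :: "('x, 'x => complex, 'm) module_sheaf" +
 fixes f :: "'x => 'x" and pre :: "'x set => 'x set" and U0 :: "'x set"
  and \<psi> :: "'x set => ('x, 'x => complex, 'm) ext_section => 'a"
 assumes U0: "openin X U0" and f: "homeomorphic_map X X f"
  and pre_eq: "[| openin X V; V <= U0 |] ==> pre V = {x : topspace X. f x : V}"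
  and \<psi>_hom: "[| openin X V; V <= U0 |] ==> superalgebra_hom (sec EB.B V) (sec F (pre V)) (\<psi> V)"
  and \<psi>_bij: "[| openin X V; V <= U0 |] ==> bij_betw (\<psi> V) (Sec EB.B V) (Sec F (pre V))"
  and \<psi>_rst: "[| openin X V; openin X W; W <= V; V <= U0; g : Sec EB.B V |] ==>
   \<psi> W (rst EB.B V W g) = rst F (pre V) (pre W) (\<psi> V g)"
  and \<psi>_pj: "[| openin X V; V <= U0; g : Sec EB.B V |] ==>
   pj (pre V) (\<psi> V g) = (\<lambda>x\<in>pre V. exterior_projection R V g (f x))"
  and E_zero_smult: "[| openin X V; m : Sec E V; n : Sec E V |] ==>
   \<zero>[R,V] \<odot>[E,V] m \<oplus>[E,V] n = n"
begin

lemma f_cont: "continuous_map X X f"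
 using f by (rule homeomorphic_imp_continuous_map)

lemma pre_open: "[| openin X V; V <= U0 |] ==> openin X (pre V)"
 unfolding pre_eq using openin_continuous_map_preimage[OF f_cont] by blast

lemma pre_mono: "[| openin X V; openin X W; W <= V; V <= U0 |] ==> pre W <= pre V"
 using pre_eq[of W] pre_eq[of V] by auto

lemma pre_f: "[| openin X V; V <= U0; x : pre V |] ==> f x : V"
 using pre_eq by auto

lemma pre_surj: assumes "openin X V" "V <= U0" "y : V" obtains x where "x : pre V" "f x = y"
proof -
 have "y : f ` topspace X"
  using homeomorphic_imp_surjective_map[OF f] openin_subset[OF assms(1)] assms(3) by auto
 then show thesis using that pre_eq[OF assms(1,2)] assms(3) by auto
qed

lemma pre_image:
 assumes "openin X W" "W <= pre U0"
 shows "openin X (f ` W)" "f ` W <= U0" "pre (f ` W) = W"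
proof -
 show o: "openin X (f ` W)"
  using homeomorphic_imp_open_map[OF f] assms(1) unfolding open_map_def by simp
 show s: "f ` W <= U0" using assms pre_eq[OF U0 subset_refl] by auto
 show "pre (f ` W) = W"
  unfolding pre_eq[OF o s]
  using openin_subset[OF assms(1)] homeomorphic_imp_injective_map[OF f] by (auto simp: inj_on_def subset_iff)
qed

definition s :: "'x set => ('x => complex, 'm) ext_term => 'a" where
 "s V e = \<psi> V (EB.sect V e)"

context
 fixes V assumes V: "openin X V" "V <= U0"
begin

interpretation A: superalgebra "sec F (pre V)" by (rule F.F_super[OF pre_open[OF V]])
interpretation EM: ext_module "sec R V" "sec E V" by (rule EB.EM[OF V(1)])

lemma \<psi>_ring_hom: "\<psi> V : ring_hom (sec EB.B V) (sec F (pre V))"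
 using \<psi>_hom[OF V] unfolding superalgebra_hom_def by simp

lemma \<psi>_in: "g : Sec EB.B V ==> \<psi> V g : Sec F (pre V)"
 using ring_hom_closed[OF \<psi>_ring_hom] .

lemma \<psi>_smult: "g : Sec EB.B V ==> \<psi> V (c \<odot>[EB.B,V] g) = c \<odot>[F,pre V] \<psi> V g"
 using \<psi>_hom[OF V] unfolding superalgebra_hom_def by simp

lemma \<psi>_parity: "g : Par EB.B V p ==> \<psi> V g : Par F (pre V) p"
 using \<psi>_hom[OF V] unfolding superalgebra_hom_def by (simp add: image_subset_iff)

lemma \<psi>_inj: "[| g : Sec EB.B V; h : Sec EB.B V; \<psi> V g = \<psi> V h |] ==> g = h"
 using bij_betw_imp_inj_on[OF \<psi>_bij[OF V]] unfolding inj_on_def by simp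

lemma s_in: "e : EB.trm V ==> s V e : Sec F (pre V)"
 unfolding s_def by (rule \<psi>_in[OF EB.sect_in[OF V(1)]])

lemma s_sum: "[| a : EB.trm V; b : EB.trm V |] ==> s V (ESum a b) = s V a \<oplus>[F,pre V] s V b"
 unfolding s_def using ring_hom_add[OF \<psi>_ring_hom] by (simp add: EB.sect_sum EB.sect_in V)

lemma s_prod: "[| a : EB.trm V; b : EB.trm V |] ==> s V (EProd a b) = s V a \<otimes>[F,pre V] s V b"
 unfolding s_def using ring_hom_mult[OF \<psi>_ring_hom] by (simp add: EB.sect_prod EB.sect_in V)

lemma s_eq: "EB.eeq V a b ==> s V a = s V b"
 unfolding s_def using EB.sect_eq[OF V(1)] by metis

lemma s_scal_zero: "s V (EScal \<zero>[R,V]) = \<zero>[F,pre V]"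
proof -
 have z: "EScal \<zero>[R,V] : EB.trm V" using EB.zero_in[OF V(1)] by simp
 have "s V (EScal \<zero>[R,V]) \<oplus>[F,pre V] s V (EScal \<zero>[R,V]) = s V (EScal \<zero>[R,V])"
  unfolding s_sum[OF z z, symmetric] by (rule s_eq[OF ext_sum_zero[OF z]])
 then show ?thesis using s_in[OF z] by simp
qed

lemma s_scal_central: "[| r : Sec R V; e : EB.trm V |] ==>
  s V e \<otimes>[F,pre V] s V (EScal r) = s V (EScal r) \<otimes>[F,pre V] s V e"
 using s_eq[OF ext_scal_central[of r "sec R V" e "sec E V"]] by (simp add: s_prod)

lemma s_scal_add: "[| r : Sec R V; q : Sec R V |] ==>
  s V (EScal (r \<oplus>[R,V] q)) = s V (EScal r) \<oplus>[F,pre V] s V (EScal q)"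
 using s_eq[OF ext_scal_add[of r "sec R V" q "sec E V"]] by (simp add: s_sum)

lemma s_scal_mult: "[| r : Sec R V; q : Sec R V |] ==>
  s V (EScal (r \<otimes>[R,V] q)) = s V (EScal r) \<otimes>[F,pre V] s V (EScal q)"
 using s_eq[OF ext_scal_mult[of r "sec R V" q "sec E V"]] by (simp add: s_prod)

lemma s_gen_add: "[| m : Sec E V; n : Sec E V |] ==>
  s V (EGen (m \<oplus>[E,V] n)) = s V (EGen m) \<oplus>[F,pre V] s V (EGen n)"
 using s_eq[OF ext_gen_add[of m "sec E V" n "sec R V"]] by (simp add: s_sum)

lemma s_gen_smult: "[| r : Sec R V; m : Sec E V |] ==>
  s V (EGen (r \<odot>[E,V] m)) = s V (EScal r) \<otimes>[F,pre V] s V (EGen m)"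
 using s_eq[OF ext_gen_smult[of r "sec R V" m "sec E V"]] by (simp add: s_prod)

lemma s_gen_odd: "m : Sec E V ==> s V (EGen m) : Par F (pre V) True"
 unfolding s_def by (rule \<psi>_parity[OF EB.sect_parity[OF V(1) _ ext_parity.intros(2)]]) simp

lemma s_pj: "e : EB.trm V ==> pj (pre V) (s V e) = (\<lambda>x\<in>pre V. ext_aug (sec R V) e (f x))"
 unfolding s_def by (simp add: \<psi>_pj[OF V EB.sect_in[OF V(1)]] EB.exterior_projection_sect[OF V(1)])

lemma s_gen_J: "m : Sec E V ==> s V (EGen m) : J (pre V)"
 by (rule J_odd[OF pre_open[OF V] s_gen_odd])

lemma s_rep:
 assumes t: "t : Sec F (pre V)" and x: "x : pre V"
 obtains W e where "openin X W" "f x : W" "W <= V" "e : EB.trm W" "rst F (pre V) (pre W) t = s W e"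
  "x : pre W" "openin X (pre W)" "pre W <= pre V" "W <= U0"
proof -
 obtain g where g: "g : Sec EB.B V" "t = \<psi> V g"
  using bij_betw_imp_surj_on[OF \<psi>_bij[OF V]] t by auto
 obtain W e where W: "f x : W" "W <= V" "EB.rep g W e" using EB.rep_ex[OF g(1) pre_f[OF V x]] .
 have o: "openin X W" "e : EB.trm W" using EB.repD W(3) by blast+
 have WU: "W <= U0" using W(2) V(2) by auto
 have r: "rst EB.B V W g = EB.sect W e"
  unfolding EB.B_rst by (rule EB.sect_eqI[OF _ EB.rep_restrict[OF W(3) subset_refl]]) simp
 have "rst F (pre V) (pre W) t = s W e"
  unfolding s_def g(2) using \<psi>_rst[OF V(1) o(1) W(2) V(2) g(1)] r by simp
 moreover have "x : pre W" using x W(1) pre_eq[OF V] pre_eq[OF o(1) WU] by simp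
 ultimately show thesis
  using that[OF o(1) W(1,2) o(2) _ _ pre_open[OF o(1) WU] pre_mono[OF V(1) o(1) W(2) V(2)] WU] by simp
qed

text \<open>Up to the square of the ideal a term is a function plus one generator, and the Euler
  derivation removes the function. Both facts are proved in one induction because the same generator
  \<open>m\<close> has to serve in both.\<close>

lemma s_linear_der:
 assumes d: "!!r. r : Sec R V ==> d r = \<zero>[R,V]" and \<delta>: "!!m. \<delta> m = m"
 shows "e : EB.trm V ==> EX m q p. m : Sec E V & q : I 2 (pre V) & p : I 2 (pre V) &
  s V e = s V (EScal (ext_aug (sec R V) e)) \<oplus>[F,pre V] (s V (EGen m) \<oplus>[F,pre V] q) &
  s V (ext_der d \<delta> e) = s V (EGen m) \<oplus>[F,pre V] p"
proof (induction e)
 interpret I2: ideal "I 2 (pre V)" "sec F (pre V)" by (rule I_ideal[OF pre_open[OF V]])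
 {
  case (EScal r)
  obtain m where m: "m : Sec E V" using EB.E_ne[OF V(1)] by auto
  have "s V (EGen (\<zero>[R,V] \<odot>[E,V] m)) = \<zero>[F,pre V]"
   using s_gen_smult[OF EB.zero_in[OF V(1)] m] s_in[of "EGen m"] m by (simp add: s_scal_zero)
  then show ?case using EScal EB.E_smult[OF V(1) EB.zero_in[OF V(1)] m] s_in[OF EScal]
   by (intro exI[of _ "\<zero>[R,V] \<odot>[E,V] m"] exI[of _ "\<zero>[F,pre V]"]) (simp add: d s_scal_zero)
 next
  case (EGen m)
  then show ?case using s_in[OF EGen]
   by (intro exI[of _ m] exI[of _ "\<zero>[F,pre V]"]) (simp add: \<delta> s_scal_zero)
 next
  case (ESum a b)
  then have ab: "a : EB.trm V" "b : EB.trm V" by simp_all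
  obtain m q p where m: "m : Sec E V" "q : I 2 (pre V)" "p : I 2 (pre V)"
   "s V a = s V (EScal (ext_aug (sec R V) a)) \<oplus>[F,pre V] (s V (EGen m) \<oplus>[F,pre V] q)"
   "s V (ext_der d \<delta> a) = s V (EGen m) \<oplus>[F,pre V] p" using ESum.IH(1)[OF ab(1)] by auto
  obtain n q' p' where n: "n : Sec E V" "q' : I 2 (pre V)" "p' : I 2 (pre V)"
   "s V b = s V (EScal (ext_aug (sec R V) b)) \<oplus>[F,pre V] (s V (EGen n) \<oplus>[F,pre V] q')"
   "s V (ext_der d \<delta> b) = s V (EGen n) \<oplus>[F,pre V] p'" using ESum.IH(2)[OF ab(2)] by auto
  have c: "ext_aug (sec R V) a : Sec R V" "ext_aug (sec R V) b : Sec R V"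
   using EM.ext_aug_closed ab by simp_all
  have t: "ext_der d \<delta> a : EB.trm V" "ext_der d \<delta> b : EB.trm V"
   using EM.ext_der_closed[of d \<delta>] ab d \<delta> by simp_all
  have c': "s V (EScal (ext_aug (sec R V) a)) : Sec F (pre V)"
   "s V (EScal (ext_aug (sec R V) b)) : Sec F (pre V)"
   "s V (EGen m) : Sec F (pre V)" "s V (EGen n) : Sec F (pre V)"
   "p : Sec F (pre V)" "q : Sec F (pre V)" "p' : Sec F (pre V)" "q' : Sec F (pre V)"
   using c m n by (simp_all add: s_in I2.Icarr)
  show ?case
   using m(1-3) n(1-3) c c' EM.M_add
   by (intro exI[of _ "m \<oplus>[E,V] n"] exI[of _ "q \<oplus>[F,pre V] q'"] exI[of _ "p \<oplus>[F,pre V] p'"])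
    (simp add: s_sum[OF ab] s_sum[OF t] m(4,5) n(4,5) s_scal_add s_gen_add I2.a_closed A.a_ac)
 next
  case (EProd a b)
  then have ab: "a : EB.trm V" "b : EB.trm V" by simp_all
  obtain m q p where m: "m : Sec E V" "q : I 2 (pre V)" "p : I 2 (pre V)"
   "s V a = s V (EScal (ext_aug (sec R V) a)) \<oplus>[F,pre V] (s V (EGen m) \<oplus>[F,pre V] q)"
   "s V (ext_der d \<delta> a) = s V (EGen m) \<oplus>[F,pre V] p" using EProd.IH(1)[OF ab(1)] by auto
  obtain n q' p' where n: "n : Sec E V" "q' : I 2 (pre V)" "p' : I 2 (pre V)"
   "s V b = s V (EScal (ext_aug (sec R V) b)) \<oplus>[F,pre V] (s V (EGen n) \<oplus>[F,pre V] q')"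
   "s V (ext_der d \<delta> b) = s V (EGen n) \<oplus>[F,pre V] p'" using EProd.IH(2)[OF ab(2)] by auto
  have c: "ext_aug (sec R V) a : Sec R V" "ext_aug (sec R V) b : Sec R V"
   using EM.ext_aug_closed ab by simp_all
  have t: "ext_der d \<delta> a : EB.trm V" "ext_der d \<delta> b : EB.trm V"
   using EM.ext_der_closed[of d \<delta>] ab d \<delta> by simp_all
  define A0 B0 A1 B1 where df: "A0 = s V (EScal (ext_aug (sec R V) a))"
   "B0 = s V (EScal (ext_aug (sec R V) b))" "A1 = s V (EGen m)" "B1 = s V (EGen n)"
  have c': "A0 : Sec F (pre V)" "B0 : Sec F (pre V)"
   "A1 : Sec F (pre V)" "B1 : Sec F (pre V)"
   "q : Sec F (pre V)" "q' : Sec F (pre V)" "p : Sec F (pre V)" "p' : Sec F (pre V)"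
   using c m n by (simp_all add: df s_in I2.Icarr)
  \<comment> \<open>The linear part of a product crosses the function part of each factor with the
    generator of the other. \<open>?q\<close> and \<open>?p\<close> collect what lies in the second
    power; the product of the two generators occurs once in \<open>?q\<close> and twice in
    \<open>?p\<close>, since it has weight two.\<close>
  let ?m = "(ext_aug (sec R V) a \<odot>[E,V] n) \<oplus>[E,V] (ext_aug (sec R V) b \<odot>[E,V] m)"
  let ?q = "(A1 \<otimes>[F,pre V] B1) \<oplus>[F,pre V] (A0 \<otimes>[F,pre V] q' \<oplus>[F,pre V] (A1 \<otimes>[F,pre V] q' \<oplus>[F,pre V] (q \<otimes>[F,pre V] B0 \<oplus>[F,pre V] (q \<otimes>[F,pre V] B1 \<oplus>[F,pre V] q \<otimes>[F,pre V] q'))))"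
  let ?p = "(A1 \<otimes>[F,pre V] B1 \<oplus>[F,pre V] (A1 \<otimes>[F,pre V] q' \<oplus>[F,pre V] (p \<otimes>[F,pre V] B0 \<oplus>[F,pre V] (p \<otimes>[F,pre V] B1 \<oplus>[F,pre V] p \<otimes>[F,pre V] q')))) \<oplus>[F,pre V]
   (A1 \<otimes>[F,pre V] B1 \<oplus>[F,pre V] (A0 \<otimes>[F,pre V] p' \<oplus>[F,pre V] (A1 \<otimes>[F,pre V] p' \<oplus>[F,pre V] (q \<otimes>[F,pre V] B1 \<oplus>[F,pre V] q \<otimes>[F,pre V] p'))))"
  have "A1 \<otimes>[F,pre V] B1 : I (1 + 1) (pre V)"
   unfolding df using s_gen_J m(1) n(1) I_1[OF pre_open[OF V]]
   by (intro I_mult[OF pre_open[OF V]]) simp_all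
  then have x: "A1 \<otimes>[F,pre V] B1 : I 2 (pre V)" by (simp only: one_add_one)
  note l = I2.I_l_closed[OF n(2)] I2.I_l_closed[OF n(3)] and r = I2.I_r_closed[OF m(2)] I2.I_r_closed[OF m(3)]
  have q: "?q : I 2 (pre V)" "?p : I 2 (pre V)" by (intro I2.a_closed x l r c')+
  have mm: "?m : Sec E V" "ext_aug (sec R V) a \<odot>[E,V] n : Sec E V"
   "ext_aug (sec R V) b \<odot>[E,V] m : Sec E V"
   using c m n by (simp_all add: EM.M_add EM.M_smult)
  have "s V (EGen ?m) = A0 \<otimes>[F,pre V] B1 \<oplus>[F,pre V] B0 \<otimes>[F,pre V] A1"
   unfolding s_gen_add[OF mm(2,3)] s_gen_smult[OF c(1) n(1)] s_gen_smult[OF c(2) m(1)] df ..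
  also have "B0 \<otimes>[F,pre V] A1 = A1 \<otimes>[F,pre V] B0"
   unfolding df using s_scal_central[OF c(2), of "EGen m"] m(1) by simp
  finally have g: "s V (EGen ?m) = A0 \<otimes>[F,pre V] B1 \<oplus>[F,pre V] A1 \<otimes>[F,pre V] B0" .
  have 1: "s V (EProd a b) = s V (EScal (ext_aug (sec R V) (EProd a b))) \<oplus>[F,pre V] (s V (EGen ?m) \<oplus>[F,pre V] ?q)"
   unfolding s_prod[OF ab] m(4) n(4) g ext_aug.simps s_scal_mult[OF c] df[symmetric]
   using c' by (simp add: A.l_distr A.r_distr A.a_ac)
  have "s V (ext_der d \<delta> (EProd a b)) = (A1 \<oplus>[F,pre V] p) \<otimes>[F,pre V] (B0 \<oplus>[F,pre V] (B1 \<oplus>[F,pre V] q')) \<oplus>[F,pre V] (A0 \<oplus>[F,pre V] (A1 \<oplus>[F,pre V] q)) \<otimes>[F,pre V] (B1 \<oplus>[F,pre V] p')"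
   using ab t by (simp add: s_sum s_prod m(5) n(5)) (simp add: m(4) n(4) df)
  also have "... = s V (EGen ?m) \<oplus>[F,pre V] ?p"
   unfolding g using c' by (simp add: A.l_distr A.r_distr A.a_ac)
  finally show ?case using mm(1) q 1 by blast
 }
qed

lemma s_linear: "e : EB.trm V ==> EX m q. m : Sec E V & q : I 2 (pre V) &
  s V e = s V (EScal (ext_aug (sec R V) e)) \<oplus>[F,pre V] (s V (EGen m) \<oplus>[F,pre V] q)"
proof -
 assume e: "e : EB.trm V"
 from s_linear_der[of "%_. \<zero>[R,V]" "%m. m", OF refl refl e]
 show ?thesis by (elim exE conjE) (intro exI conjI)
qed

lemma s_euler:
 assumes d: "!!r. r : Sec R V ==> d r = \<zero>[R,V]" "!!m. \<delta> m = m" and e: "e : EB.trm V"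
 shows "EX c p. c : J (pre V) & p : I 2 (pre V) &
  s V e = s V (EScal (ext_aug (sec R V) e)) \<oplus>[F,pre V] c & s V (ext_der d \<delta> e) = c \<oplus>[F,pre V] p"
proof -
 interpret I2: ideal "I 2 (pre V)" "sec F (pre V)" by (rule I_ideal[OF pre_open[OF V]])
 interpret J: ideal "J (pre V)" "sec F (pre V)" by (rule J_ideal[OF pre_open[OF V]])
 obtain m q p where m: "m : Sec E V" "q : I 2 (pre V)" "p : I 2 (pre V)"
  "s V e = s V (EScal (ext_aug (sec R V) e)) \<oplus>[F,pre V] (s V (EGen m) \<oplus>[F,pre V] q)"
  "s V (ext_der d \<delta> e) = s V (EGen m) \<oplus>[F,pre V] p"
  by (rule exE[OF s_linear_der[where d = d and \<delta> = \<delta>, OF _ _ e]], erule d(1), rule d(2), elim exE conjE, rule that)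
 note c = J.Icarr[OF s_gen_J[OF m(1)]] I2.Icarr[OF m(2)] I2.Icarr[OF m(3)]
 have "q : J (pre V)" using N_J[OF pre_open[OF V], of q 1] I_N[OF pre_open[OF V] m(2)] by (simp only: Suc_1)
 then have 1: "s V (EGen m) \<oplus>[F,pre V] q : J (pre V)" by (rule J.a_closed[OF s_gen_J[OF m(1)]])
 have 2: "p \<ominus>[F,pre V] q : I 2 (pre V)" unfolding a_minus_def by (rule I2.a_closed[OF m(3) I2.a_inv_closed[OF m(2)]])
 have 3: "s V (EGen m) \<oplus>[F,pre V] p = (s V (EGen m) \<oplus>[F,pre V] q) \<oplus>[F,pre V] (p \<ominus>[F,pre V] q)"
  using c by (simp only: A.a_assoc A.minus_closed A.diff_add)
 show ?thesis by (intro exI conjI, rule 1, rule 2, rule m(4), rule trans[OF m(5) 3])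
qed

text \<open>\<open>\<psi> V\<close> respects parity by definition, its inverse does not by
  definition. Split a representing term into an even and an odd one: the image of the one with the
  wrong parity vanishes, since parity decompositions in \<open>F\<close> are unique, and injectivity
  removes the term itself.\<close>

lemma \<psi>_parity_inv:
 assumes g: "g : Sec EB.B V" and p: "\<psi> V g : Par F (pre V) p"
 shows "g : Par EB.B V p"
proof (rule EB.B_parity_mem[OF EB.B_ext[OF g]])
 fix y assume y: "y : V"
 obtain W e where W: "y : W" "W <= V" "EB.rep g W e" using EB.rep_ex[OF g y] .
 have o: "openin X W" "e : EB.trm W" using EB.repD W(3) by blast+
 have WU: "W <= U0" using W(2) V(2) by auto
 interpret W: superalgebra "sec F (pre W)" by (rule F.F_super[OF pre_open[OF o(1) WU]])
 obtain a b where ab: "a : EB.trm W" "b : EB.trm W" "ext_parity False a" "ext_parity True b"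
  "EB.eeq W e (ESum a b)" using EB.trm_parity_decompose[OF o] by blast
 let ?z = "EScal \<zero>[R,W]"
 have z: "?z : EB.trm W" using EB.zero_in[OF o(1)] by simp
 have "rst EB.B V W g = EB.sect W e"
  unfolding EB.B_rst by (rule EB.sect_eqI[OF _ EB.rep_restrict[OF W(3) subset_refl]]) simp
 then have "\<psi> W (EB.sect W e) = rst F (pre V) (pre W) (\<psi> V g)"
  using \<psi>_rst[OF V(1) o(1) W(2) V(2) g] by simp
 moreover have "rst F (pre V) (pre W) (\<psi> V g) : Par F (pre W) p"
  by (rule F.F_rst_part[OF pre_open[OF V] pre_open[OF o(1) WU] pre_mono[OF V(1) o(1) W(2) V(2)] p])
 moreover have hom: "\<psi> W : ring_hom (sec EB.B W) (sec F (pre W))" "!!p. \<psi> W ` Par EB.B W p <= Par F (pre W) p"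
  using \<psi>_hom[OF o(1) WU] unfolding superalgebra_hom_def by simp_all
 moreover have sum: "EB.sect W e = EB.sect W a \<oplus>[EB.B,W] EB.sect W b"
  using EB.sect_eq[OF o(1) ab(5)] EB.sect_sum[OF o(1) ab(1,2)] by simp
 ultimately have q: "\<psi> W (EB.sect W a) \<oplus>[F,pre W] \<psi> W (EB.sect W b) : Par F (pre W) p"
  using ring_hom_add[OF hom(1) EB.sect_in[OF o(1) ab(1)] EB.sect_in[OF o(1) ab(2)]] by simp
 have pa: "\<psi> W (EB.sect W a) : Par F (pre W) False" "\<psi> W (EB.sect W b) : Par F (pre W) True"
  using hom(2) EB.sect_parity[OF o(1) ab(1,3)] EB.sect_parity[OF o(1) ab(2,4)] by blast+
 have inj: "inj_on (\<psi> W) (Sec EB.B W)" by (rule bij_betw_imp_inj_on[OF \<psi>_bij[OF o(1) WU]])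
 have z0: "\<psi> W (EB.sect W ?z) = \<zero>[F,pre W]"
 proof -
  have "EB.sect W ?z = EB.sect W ?z \<oplus>[EB.B,W] EB.sect W ?z"
   using EB.sect_eq[OF o(1) ext_sum_zero[OF z]] EB.sect_sum[OF o(1) z z] by simp
  then have "\<psi> W (EB.sect W ?z) = \<psi> W (EB.sect W ?z) \<oplus>[F,pre W] \<psi> W (EB.sect W ?z)"
   using ring_hom_add[OF hom(1) EB.sect_in[OF o(1) z] EB.sect_in[OF o(1) z]] by simp
  then show ?thesis using ring_hom_closed[OF hom(1) EB.sect_in[OF o(1) z]] by simp
 qed
 obtain c where c: "c : EB.trm W" "ext_parity p c" "EB.sect W e = EB.sect W c"
 proof (cases p)
  case True
  have "\<psi> W (EB.sect W a) = \<zero>[F,pre W]"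
   using W.ppart_homogeneous[OF q, of False] W.ppart_eqI[OF pa] True by simp
  then have "EB.sect W a = EB.sect W ?z"
   using inj_onD[OF inj, of "EB.sect W a" "EB.sect W ?z"] z0 EB.sect_in[OF o(1) ab(1)] EB.sect_in[OF o(1) z] by simp
  then have "EB.sect W e = EB.sect W b"
   using sum EB.sect_sum[OF o(1) z ab(2)] EB.sect_eq[OF o(1) ext_sum_zero[OF ab(2)]] by simp
  then show ?thesis using that ab True by simp
 next
  case False
  have "\<psi> W (EB.sect W b) = \<zero>[F,pre W]"
   using W.ppart_homogeneous[OF q, of True] W.ppart_eqI[OF pa] False by simp
  then have "EB.sect W b = EB.sect W ?z"
   using inj_onD[OF inj, of "EB.sect W b" "EB.sect W ?z"] z0 EB.sect_in[OF o(1) ab(2)] EB.sect_in[OF o(1) z] by simp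
  then have "EB.sect W e = EB.sect W a"
   using sum EB.sect_sum[OF o(1) ab(1) z] EB.sect_eq[OF o(1) ext_trans[OF ext_sum_comm[OF ab(1) z] ext_sum_zero[OF ab(1)]]] by simp
  then show ?thesis using that ab False by simp
 qed
 have "represents X EB.P g W (EB.cls W c)"
  unfolding represents_def
 proof (intro conjI ballI)
  show "openin X W" "EB.cls W c : Sec EB.P W" using o c EB.cls_in by simp_all
  fix y assume y: "y : W"
  have "g y = EB.sect W e y"
   using EB.rep_eq_at[OF W(3) EB.rep_sect[OF o] ext_refl[OF o(2)] y] .
  also have "... = EB.sect W c y" using c(3) by simp
  also have "... = germ X EB.P y W (EB.cls W c)"
   using EB.repD(3)[OF EB.rep_sect[OF o(1) c(1)]] y unfolding represents_def by simp
  finally show "g y = germ X EB.P y W (EB.cls W c)" .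
 qed
 then have "EB.rep g W c" unfolding EB.rep_def using o c by simp
 then show "EX W e. y : W & W <= V & EB.rep g W e & ext_parity p e"
  using W(1,2) c(2) by (intro exI[of _ W] exI[of _ c]) simp
qed

end

end

text \<open>The right ideal generated by \<open>G\<close>, built so that statements about it follow
  by induction on sums of products with the generator in front.\<close>

inductive_set right_span :: "('a, 'm) ring_scheme => 'a set => 'a set" for A G where
 right_span_zero: "\<zero>\<^bsub>A\<^esub> : right_span A G"
| right_span_gen: "[| g : G; c : carrier A |] ==> g \<otimes>\<^bsub>A\<^esub> c : right_span A G"
| right_span_add: "[| x : right_span A G; y : right_span A G |] ==> x \<oplus>\<^bsub>A\<^esub> y : right_span A G"

lemma (in ring) plus_diff_cancel:
 assumes "a : carrier R" "b : carrier R"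
 shows "(a \<oplus> b) \<ominus> a = b"
proof -
 have "(a \<oplus> b) \<ominus> a = (b \<oplus> a) \<oplus> \<ominus> a" unfolding a_minus_def using a_comm[OF assms] by simp
 also have "... = b" using assms by (simp add: a_assoc r_neg)
 finally show ?thesis .
qed

lemma (in ring) right_span_closed: "[| x : right_span R G; G <= carrier R |] ==> x : carrier R"
 by (induction rule: right_span.induct) auto

lemma (in ring) right_span_mult:
 "[| x : right_span R G; G <= carrier R; c : carrier R |] ==> x \<otimes> c : right_span R G"
proof (induction rule: right_span.induct)
 case (right_span_gen g d)
 then have "(g \<otimes> d) \<otimes> c = g \<otimes> (d \<otimes> c)" by (intro m_assoc) auto
 then show ?case using right_span_gen by (simp add: right_span.right_span_gen)
next
 case (right_span_add x y)
 then show ?case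
  using right_span_closed[of x G] right_span_closed[of y G] by (simp add: l_distr right_span.right_span_add)
qed (simp add: right_span.right_span_zero)

section \<open>The nilpotent ideal in a chart\<close>

context ext_iso
begin

context
 fixes V assumes V: "openin X V" "V <= U0"
begin

lemma s_rst:
 assumes W: "openin X W" "W <= V" and e: "e : EB.trm V"
 shows "rst F (pre V) (pre W) (s V e) = s W (EB.tr V W e)"
 unfolding s_def using \<psi>_rst[OF V(1) W V(2) EB.sect_in[OF V(1) e]] EB.sect_rst[OF V(1) W e] by simp

lemma s_scal_even: "r : Sec R V ==> s V (EScal r) : Par F (pre V) False"
 unfolding s_def by (rule \<psi>_parity[OF V EB.sect_parity[OF V(1) _ ext_parity.intros(1)]]) simp

lemma aug_zero:
 assumes e: "e : EB.trm V" and j: "s V e : J (pre V)"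
 shows "ext_aug (sec R V) e = \<zero>[R,V]"
proof (rule extensionalityI[of _ V])
 show "ext_aug (sec R V) e : extensional V"
  using EB.R_ext[OF V(1) ext_module.ext_aug_closed[OF EB.EM[OF V(1)] e]] .
 show "\<zero>[R,V] : extensional V" unfolding R_simps by simp
 fix y assume "y : V"
 then obtain x where x: "x : pre V" "f x = y" using pre_surj[OF V] by blast
 then have "pj (pre V) (s V e) x = 0" using j unfolding J_iff_pointwise[OF pre_open[OF V]] by simp
 then show "ext_aug (sec R V) e y = \<zero>[R,V] y"
  using x \<open>y : V\<close> unfolding s_pj[OF V e] R_simps by simp
qed

text \<open>In the linear form of a term the function part is the augmentation, which vanishes for a
  section of \<open>J\<close>. A single generator remains modulo the square.\<close>

lemma J_linear:
 assumes t: "t : J (pre V)" and x: "x : pre V"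
 obtains W m where "openin X W" "f x : W" "W <= V" "W <= U0" "x : pre W" "openin X (pre W)" "pre W <= pre V"
  "m : Sec E W" "rst F (pre V) (pre W) t \<ominus>[F,pre W] s W (EGen m) : N 2 (pre W)"
proof -
 have tc: "t : Sec F (pre V)" using t J_iff by blast
 obtain W e where W: "openin X W" "f x : W" "W <= V" "e : EB.trm W" "rst F (pre V) (pre W) t = s W e"
  "x : pre W" "openin X (pre W)" "pre W <= pre V" "W <= U0" using s_rep[OF V tc x] .
 interpret A: superalgebra "sec F (pre W)" by (rule F.F_super[OF W(7)])
 have "s W e : J (pre W)" using J_rst[OF pre_open[OF V] W(7,8) t] W(5) by simp
 then have z: "ext_aug (sec R W) e = \<zero>[R,W]" by (rule ext_iso.aug_zero[OF ext_iso_axioms W(1,9,4)])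
 obtain m q where m: "m : Sec E W" "q : I 2 (pre W)"
  "s W e = s W (EScal (ext_aug (sec R W) e)) \<oplus>[F,pre W] (s W (EGen m) \<oplus>[F,pre W] q)"
  using s_linear[OF W(1,9,4)] by blast
 have c: "s W (EGen m) : Sec F (pre W)" "q : Sec F (pre W)"
  using s_in[OF W(1,9)] m(1) I_in[OF W(7) m(2)] by simp_all
 have "s W e \<ominus>[F,pre W] s W (EGen m) = q"
  unfolding m(3) z s_scal_zero[OF W(1,9)] using c A.plus_diff_cancel by simp
 then show thesis using that[OF W(1,2,3,9,6,7,8) m(1)] I_N[OF W(7) m(2)] W(5) by simp
qed

text \<open>By \<open>J_linear\<close> the section is locally an odd generator modulo the square.
  Taking even parts removes the generator and keeps the remainder in the square.\<close>

lemma even_J: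
 assumes t: "t : J (pre V)" "t : Par F (pre V) False"
 shows "t : N 2 (pre V)"
proof (rule N_local[OF pre_open[OF V]])
 show "t : Sec F (pre V)" using t J_iff by blast
 fix x assume x: "x : pre V"
 obtain W m where W: "openin X W" "f x : W" "W <= V" "W <= U0" "x : pre W" "openin X (pre W)" "pre W <= pre V"
  "m : Sec E W" "rst F (pre V) (pre W) t \<ominus>[F,pre W] s W (EGen m) : N 2 (pre W)"
  using J_linear[OF t(1) x] .
 interpret A: superalgebra "sec F (pre W)" by (rule F.F_super[OF W(6)])
 have e: "rst F (pre V) (pre W) t : Par F (pre W) False"
  by (rule F.F_rst_part[OF pre_open[OF V] W(6,7) t(2)])
 have "ppart (sec F (pre W)) False (rst F (pre V) (pre W) t \<ominus>[F,pre W] s W (EGen m)) = rst F (pre V) (pre W) t"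
  unfolding a_minus_def by (rule A.ppart_eqI(1)[OF e A.part_neg[OF s_gen_odd[OF W(1,4,8)]]])
 then have "rst F (pre V) (pre W) t : N 2 (pre W)" using N_ppart[OF W(6,9), of False] by simp
 then show "EX W. openin X W & x : W & W <= pre V & rst F (pre V) W t : N 2 W"
  using W(5-7) by blast
qed

end

text \<open>
 If the module is generated by \<open>b 0, \<dots>, b (r - 1)\<close>, then the product of \<open>k\<close> distinct generators
 annihilates the power \<open>r + 1 - k\<close> of the nilpotent ideal.
\<close>

context
 fixes b :: "nat => 'm" and r :: nat
 assumes b: "!!i. i < r ==> b i : Sec E U0"
  and abelian: "!!W. openin X W ==> abelian_monoid (sec E W)"
  and span: "!!W m. [| openin X W; W <= U0; m : Sec E W |] ==>
   EX c. c : {..<r} \<rightarrow> Sec R W &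
    m = (\<Oplus>\<^bsub>sec E W\<^esub>i\<in>{..<r}. c i \<odot>[E,W] rst E U0 W (b i))"
begin

definition \<theta> :: "'x set => nat => 'a" where
 "\<theta> V i = s V (EGen (rst E U0 V (b i)))"

definition \<theta>s :: "'x set => nat list => 'a" where
 "\<theta>s V L = foldr (%i x. \<theta> V i \<otimes>[F,pre V] x) L \<one>[F,pre V]"

definition \<Theta> :: "'x set => 'a set" where
 "\<Theta> V = right_span (sec F (pre V)) (\<theta> V ` {..<r})"

context
 fixes V assumes V: "openin X V" "V <= U0"
begin

interpretation A: superalgebra "sec F (pre V)" by (rule F.F_super[OF pre_open[OF V]])
interpretation EM: ext_module "sec R V" "sec E V" by (rule EB.EM[OF V(1)])

lemma bV: "i < r ==> rst E U0 V (b i) : Sec E V"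
 using EB.E.rst_closed[OF U0 V b] .

lemma \<theta>_odd: "i < r ==> \<theta> V i : Par F (pre V) True"
 unfolding \<theta>_def using s_gen_odd[OF V bV] .

lemma \<theta>_in: "i < r ==> \<theta> V i : Sec F (pre V)"
 using A.part_carrier[OF \<theta>_odd] .

lemma \<theta>_sub: "\<theta> V ` {..<r} <= Sec F (pre V)"
 using \<theta>_in by auto

lemma \<theta>_rst: "[| openin X W; W <= V; i < r |] ==> rst F (pre V) (pre W) (\<theta> V i) = \<theta> W i"
 unfolding \<theta>_def using s_rst[OF V, of W "EGen (rst E U0 V (b i))"] bV EB.E.rst_rst[OF U0 V(1) _ _ V(2) b] by simp

lemma \<theta>s_in: "set L <= {..<r} ==> \<theta>s V L : Sec F (pre V)"
 unfolding \<theta>s_def by (induction L) (auto simp: \<theta>_in)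

lemma \<theta>s_snoc: "[| set L <= {..<r}; k < r |] ==> \<theta>s V (L @ [k]) = \<theta>s V L \<otimes>[F,pre V] \<theta> V k"
proof (induction L)
 case (Cons a L)
 then have "\<theta>s V L : Sec F (pre V)" by (intro \<theta>s_in) auto
 then show ?case using Cons by (simp add: \<theta>s_def A.m_assoc \<theta>_in)
qed (simp add: \<theta>s_def \<theta>_in)

text \<open>The last factor is moved to the left until it meets its copy. The sign is absorbed by
  \<open>tau\<close>, and the square of an odd section is zero.\<close>

lemma \<theta>s_repeat: "[| set L <= {..<r}; k : set L |] ==> \<theta>s V L \<otimes>[F,pre V] \<theta> V k = \<zero>[F,pre V]"
proof (induction L)
 case (Cons a L)
 have L: "set L <= {..<r}" "a < r" "k < r" using Cons.prems by auto
 have c: "\<theta>s V L : Sec F (pre V)" "\<theta> V a : Sec F (pre V)" "\<theta> V k : Sec F (pre V)"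
  using \<theta>s_in[OF L(1)] \<theta>_in L by auto
 have "\<theta>s V (a # L) = \<theta> V a \<otimes>[F,pre V] \<theta>s V L" unfolding \<theta>s_def by simp
 then have e: "\<theta>s V (a # L) \<otimes>[F,pre V] \<theta> V k =
   \<theta> V a \<otimes>[F,pre V] (\<theta>s V L \<otimes>[F,pre V] \<theta> V k)" using c by (simp add: A.m_assoc)
 show ?case
 proof (cases "k : set L")
  case True
  then show ?thesis unfolding e using Cons.IH[OF L(1)] c by simp
 next
  case False
  then have k: "k = a" using Cons.prems by simp
  have "\<theta> V a \<otimes>[F,pre V] (\<theta>s V L \<otimes>[F,pre V] \<theta> V a) =
    (\<theta> V a \<otimes>[F,pre V] \<theta> V a) \<otimes>[F,pre V] tau (sec F (pre V)) (\<theta>s V L)"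
   using c A.odd_commute[OF \<theta>_odd[OF L(2)] c(1)] by (simp add: A.m_assoc)
  then show ?thesis using e A.odd_square[OF \<theta>_odd[OF L(2)]] c unfolding k by simp
 qed
qed simp

lemma \<theta>s_rst:
 assumes W: "openin X W" "W <= V"
 shows "set L <= {..<r} ==> rst F (pre V) (pre W) (\<theta>s V L) = \<theta>s W L"
proof (induction L)
 have WU: "W <= U0" using W V by auto
 note o = pre_open[OF V] pre_open[OF W(1) WU] pre_mono[OF V(1) W V(2)]
 {
  case Nil
  then show ?case unfolding \<theta>s_def using F.F_rst_one[OF o] by simp
 next
  case (Cons a L)
  then show ?case
   using F.F_rst_mult[OF o, of "\<theta> V a" "\<theta>s V L"] \<theta>_in[of a] \<theta>s_in[of L] \<theta>_rst[OF W, of a]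
   by (simp add: \<theta>s_def)
 }
qed

lemma \<Theta>_gen:
 assumes m: "m : Sec E V"
 shows "s V (EGen m) : \<Theta> V"
proof -
 interpret AE: abelian_monoid "sec E V" by (rule abelian[OF V(1)])
 obtain c where c: "c : {..<r} \<rightarrow> Sec R V"
  "m = (\<Oplus>\<^bsub>sec E V\<^esub>i\<in>{..<r}. c i \<odot>[E,V] rst E U0 V (b i))" using span[OF V m] by blast
 have g: "c i \<odot>[E,V] rst E U0 V (b i) : Sec E V" if "i < r" for i
  using EB.E_smult[OF V(1) _ bV[OF that]] c(1) that by auto
 have "finite S ==> S <= {..<r} ==>
  s V (EGen (\<Oplus>\<^bsub>sec E V\<^esub>i\<in>S. c i \<odot>[E,V] rst E U0 V (b i))) : \<Theta> V" for S
 proof (induction S rule: finite_induct)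
  case empty
  have "s V (EGen \<zero>[E,V]) \<oplus>[F,pre V] s V (EGen \<zero>[E,V]) = s V (EGen \<zero>[E,V])"
   using s_gen_add[OF V AE.zero_closed AE.zero_closed] by simp
  then have "s V (EGen \<zero>[E,V]) = \<zero>[F,pre V]" using s_in[OF V, of "EGen \<zero>[E,V]"] by simp
  then show ?case unfolding \<Theta>_def by (simp add: right_span_zero)
 next
  case (insert i S)
  have i: "i < r" "c i : Sec R V" using insert c(1) by auto
  have S: "(%i. c i \<odot>[E,V] rst E U0 V (b i)) : S \<rightarrow> Sec E V" using g insert by auto
  have sc: "s V (EScal (c i)) : Sec F (pre V)" using s_in[OF V, of "EScal (c i)"] i by simp
  have "s V (EGen (c i \<odot>[E,V] rst E U0 V (b i))) = s V (EScal (c i)) \<otimes>[F,pre V] \<theta> V i"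
   using s_gen_smult[OF V i(2) bV[OF i(1)]] unfolding \<theta>_def .
  also have "... = \<theta> V i \<otimes>[F,pre V] s V (EScal (c i))"
   using A.even_commute[OF s_scal_even[OF V i(2)] \<theta>_in[OF i(1)]] by simp
  finally have "s V (EGen (c i \<odot>[E,V] rst E U0 V (b i))) : \<Theta> V"
   unfolding \<Theta>_def using right_span_gen[of "\<theta> V i" "\<theta> V ` {..<r}" "s V (EScal (c i))" "sec F (pre V)"] i sc by simp
  then show ?case
   using insert S g[OF i(1)] s_gen_add[OF V g[OF i(1)] AE.finsum_closed[OF S]]
    AE.finsum_insert[OF insert(1,2) S g[OF i(1)]]
   by (simp add: \<Theta>_def right_span_add)
 qed
 from this[of "{..<r}"] show ?thesis unfolding c(2) by simp
qed

lemma \<Theta>_closed: "x : \<Theta> V ==> x : Sec F (pre V)"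
 unfolding \<Theta>_def using A.right_span_closed[OF _ \<theta>_sub] .

lemma \<Theta>_mult: "[| x : \<Theta> V; c : Sec F (pre V) |] ==> x \<otimes>[F,pre V] c : \<Theta> V"
 unfolding \<Theta>_def using A.right_span_mult[OF _ \<theta>_sub] .

lemma \<Theta>_add: "[| x : \<Theta> V; y : \<Theta> V |] ==> x \<oplus>[F,pre V] y : \<Theta> V"
 unfolding \<Theta>_def by (rule right_span_add)

lemma \<Theta>_term: "e : EB.trm V ==>
  EX y:\<Theta> V. s V e = s V (EScal (ext_aug (sec R V) e)) \<oplus>[F,pre V] y"
proof (induction e)
 case (EScal r)
 then show ?case using s_in[OF V EScal]
  by (intro bexI[of _ "\<zero>[F,pre V]"]) (simp_all add: \<Theta>_def right_span_zero)
next
 case (EGen m)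
 then show ?case using s_in[OF V EGen] \<Theta>_gen
  by (intro bexI[of _ "s V (EGen m)"]) (simp_all add: s_scal_zero[OF V])
next
 case (ESum a b)
 then have ab: "a : EB.trm V" "b : EB.trm V" by simp_all
 obtain y where y: "y : \<Theta> V" "s V a = s V (EScal (ext_aug (sec R V) a)) \<oplus>[F,pre V] y"
  using ESum.IH(1)[OF ab(1)] by auto
 obtain z where z: "z : \<Theta> V" "s V b = s V (EScal (ext_aug (sec R V) b)) \<oplus>[F,pre V] z"
  using ESum.IH(2)[OF ab(2)] by auto
 have g: "ext_aug (sec R V) a : Sec R V" "ext_aug (sec R V) b : Sec R V"
  using EM.ext_aug_closed ab by simp_all
 show ?case
  using y(1) z(1) g \<Theta>_closed s_in[OF V, of "EScal _"] \<Theta>_add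
  by (intro bexI[of _ "y \<oplus>[F,pre V] z"])
   (simp_all add: s_sum[OF V ab] y(2) z(2) s_scal_add[OF V] A.a_ac)
next
 case (EProd a b)
 then have ab: "a : EB.trm V" "b : EB.trm V" by simp_all
 obtain y where y: "y : \<Theta> V" "s V a = s V (EScal (ext_aug (sec R V) a)) \<oplus>[F,pre V] y"
  using EProd.IH(1)[OF ab(1)] by auto
 obtain z where z: "z : \<Theta> V" "s V b = s V (EScal (ext_aug (sec R V) b)) \<oplus>[F,pre V] z"
  using EProd.IH(2)[OF ab(2)] by auto
 have g: "ext_aug (sec R V) a : Sec R V" "ext_aug (sec R V) b : Sec R V"
  using EM.ext_aug_closed ab by simp_all
 define A0 B0 where d: "A0 = s V (EScal (ext_aug (sec R V) a))" "B0 = s V (EScal (ext_aug (sec R V) b))"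
 have c: "A0 : Sec F (pre V)" "B0 : Sec F (pre V)" "y : Sec F (pre V)"
  "z : Sec F (pre V)" using s_in[OF V, of "EScal _"] g y(1) z(1) \<Theta>_closed by (simp_all add: d)
 have "A0 \<otimes>[F,pre V] z = z \<otimes>[F,pre V] A0"
  unfolding d using A.even_commute[OF s_scal_even[OF V g(1)] c(4)] by simp
 then have 1: "s V (EProd a b) = A0 \<otimes>[F,pre V] B0 \<oplus>[F,pre V]
   (z \<otimes>[F,pre V] A0 \<oplus>[F,pre V] (y \<otimes>[F,pre V] B0 \<oplus>[F,pre V] y \<otimes>[F,pre V] z))"
  unfolding s_prod[OF V ab] y(2) z(2) d[symmetric] using c by (simp add: A.l_distr A.r_distr A.a_ac)
 have 2: "A0 \<otimes>[F,pre V] B0 = s V (EScal (ext_aug (sec R V) (EProd a b)))"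
  unfolding d using s_scal_mult[OF V g] by simp
 have "z \<otimes>[F,pre V] A0 \<oplus>[F,pre V]
   (y \<otimes>[F,pre V] B0 \<oplus>[F,pre V] y \<otimes>[F,pre V] z) : \<Theta> V"
  by (intro \<Theta>_add \<Theta>_mult y(1) z(1) c)
 then show ?case using 1[unfolded 2] by blast
qed

end

text \<open>An element of \<open>J\<close> is locally a sum of products \<open>\<theta>_k c\<close>.
  Moving the cofactor from the lower power past \<open>\<theta>_k\<close> costs only a
  \<open>tau\<close>. If \<open>k\<close> occurs in \<open>L\<close>, the product vanishes by
  \<open>\<theta>s_repeat\<close>; otherwise \<open>k\<close> extends \<open>L\<close> while the
  power drops by one, so \<open>length L + l\<close> is kept. At power 0 the list would be a
  distinct list of more than \<open>r\<close> indices below \<open>r\<close>.\<close>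

lemma annihilate: "[| openin X V; V <= U0; t : N l (pre V); distinct L; set L <= {..<r}; r < length L + l |] ==>
  \<theta>s V L \<otimes>[F,pre V] t = \<zero>[F,pre V]"
proof (induction l arbitrary: V t L)
 case 0
 have "card (set L) <= card {..<r}" using 0(5) by (intro card_mono) auto
 then show ?case using 0(4,6) by (simp add: distinct_card)
next
 case (Suc l)
 note LL = Suc.prems(4-6)
 have I: "\<theta>s W L \<otimes>[F,pre W] u = \<zero>[F,pre W]"
  if W: "openin X W" "W <= U0" and u: "u : I (Suc l) (pre W)" for W u
 proof -
  note oW = pre_open[OF W]
  interpret W: superalgebra "sec F (pre W)" by (rule F.F_super[OF oW])
  note c = \<theta>s_in[OF W LL(2)]
  from oW u show ?thesis
  proof (induction u rule: I_induct)
   case (prod i j)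
   show ?case
   proof (rule F.separated[OF oW])
    fix x assume x: "x : pre W"
    obtain W' e where W': "openin X W'" "f x : W'" "W' <= W" "e : EB.trm W'" "rst F (pre W) (pre W') j = s W' e"
     "x : pre W'" "openin X (pre W')" "pre W' <= pre W" "W' <= U0" using s_rep[OF W prod(4) x] .
    interpret W': superalgebra "sec F (pre W')" by (rule F.F_super[OF W'(7)])
    note o = oW W'(7,8)
    let ?i = "rst F (pre W) (pre W') i"
    have i: "?i : I l (pre W')" by (rule I_rst[OF o prod(1)])
    have ic: "?i : Sec F (pre W')" by (rule I_in[OF W'(7) i])
    have "s W' e : J (pre W')" using J_rst[OF o prod(2)] W'(5) by simp
    then have z: "ext_aug (sec R W') e = \<zero>[R,W']" by (rule aug_zero[OF W'(1,9,4)])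
    obtain y where y: "y : \<Theta> W'" "s W' e = s W' (EScal (ext_aug (sec R W') e)) \<oplus>[F,pre W'] y"
     using \<Theta>_term[OF W'(1,9,4)] by blast
    have sy: "s W' e = y" unfolding y(2) z s_scal_zero[OF W'(1,9)] using \<Theta>_closed[OF W'(1,9) y(1)] by simp
    have c': "\<theta>s W' L : Sec F (pre W')" by (rule \<theta>s_in[OF W'(1,9) LL(2)])
    have zero: "\<theta>s W' L \<otimes>[F,pre W'] (?i \<otimes>[F,pre W'] y) = \<zero>[F,pre W']"
     using y(1) unfolding \<Theta>_def
    proof (induction rule: right_span.induct)
     case right_span_zero
     then show ?case using c' ic by simp
    next
     case (right_span_gen g d)
     then obtain k where k: "k < r" "g = \<theta> W' k" by auto
     have kc: "\<theta> W' k : Sec F (pre W')" by (rule \<theta>_in[OF W'(1,9) k(1)])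
     have tc: "tau (sec F (pre W')) ?i : Sec F (pre W')" using ic by simp
     have e: "\<theta>s W' L \<otimes>[F,pre W'] (?i \<otimes>[F,pre W'] (g \<otimes>[F,pre W'] d)) =
       ((\<theta>s W' L \<otimes>[F,pre W'] \<theta> W' k) \<otimes>[F,pre W'] tau (sec F (pre W')) ?i) \<otimes>[F,pre W'] d"
     proof -
      have "?i \<otimes>[F,pre W'] (g \<otimes>[F,pre W'] d) = (?i \<otimes>[F,pre W'] \<theta> W' k) \<otimes>[F,pre W'] d"
       unfolding k(2) using ic kc right_span_gen(2) by (simp add: W'.m_assoc)
      also have "?i \<otimes>[F,pre W'] \<theta> W' k = \<theta> W' k \<otimes>[F,pre W'] tau (sec F (pre W')) ?i"
       by (rule W'.odd_commute[OF \<theta>_odd[OF W'(1,9) k(1)] ic])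
      finally show ?thesis using c' kc tc right_span_gen(2) by (simp add: W'.m_assoc)
     qed
     have "(\<theta>s W' L \<otimes>[F,pre W'] \<theta> W' k) \<otimes>[F,pre W'] tau (sec F (pre W')) ?i = \<zero>[F,pre W']"
     proof (cases "k : set L")
      case True
      then show ?thesis using \<theta>s_repeat[OF W'(1,9) LL(2) True] tc by simp
     next
      case False
      have "\<theta>s W' (L @ [k]) \<otimes>[F,pre W'] tau (sec F (pre W')) ?i = \<zero>[F,pre W']"
       using Suc.IH[OF W'(1,9) I_N[OF W'(7) I_tau[OF W'(7) i]], of "L @ [k]"] False LL k(1) by simp
      then show ?thesis unfolding \<theta>s_snoc[OF W'(1,9) LL(2) k(1)] .
     qed
     then show ?case unfolding e using right_span_gen(2) by simp
    next
     case (right_span_add y z)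
     have "y : Sec F (pre W')" "z : Sec F (pre W')"
      using right_span_add(1,2) \<Theta>_closed[OF W'(1,9)] unfolding \<Theta>_def by simp_all
     then show ?case using right_span_add(3,4) c' ic by (simp add: W'.r_distr)
    qed
    have "rst F (pre W) (pre W') (\<theta>s W L \<otimes>[F,pre W] (i \<otimes>[F,pre W] j)) =
      \<theta>s W' L \<otimes>[F,pre W'] (?i \<otimes>[F,pre W'] y)"
     using c prod(3,4) \<theta>s_rst[OF W W'(1,3) LL(2)] W'(5) sy by (simp add: F.F_rst_mult[OF o])
    then show "EX O'. openin X O' & x : O' & O' <= pre W &
      rst F (pre W) O' (\<theta>s W L \<otimes>[F,pre W] (i \<otimes>[F,pre W] j)) = rst F (pre W) O' \<zero>[F,pre W]"
     using zero F.F_rst_zero[OF o] W'(6-8) by (intro exI[of _ "pre W'"]) simp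
   qed (use c prod(3,4) in simp_all)
  next
   case (sum u v)
   then show ?case using c by (simp add: W.r_distr)
  qed
 qed
 note V = Suc.prems(1,2)
 note oV = pre_open[OF V]
 interpret A: superalgebra "sec F (pre V)" by (rule F.F_super[OF oV])
 have c: "\<theta>s V L : Sec F (pre V)" "t : Sec F (pre V)"
  using \<theta>s_in[OF V LL(2)] N_in[OF Suc.prems(3)] by auto
 show ?case
 proof (rule F.separated[OF oV])
  fix x assume "x : pre V"
  then obtain O' where O': "openin X O'" "x : O'" "O' <= pre V" "rst F (pre V) O' t : I (Suc l) O'"
   using N_ex[OF Suc.prems(3)] by blast
  let ?W = "f ` O'"
  have s: "O' <= pre U0" using O'(3) pre_mono[OF U0 V(1,2) subset_refl] by auto
  note W = pre_image[OF O'(1) s]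
  have WV: "?W <= V" using O'(3) pre_f[OF V] by auto
  have "\<theta>s ?W L \<otimes>[F,O'] rst F (pre V) O' t = \<zero>[F,O']"
   using I[OF W(1,2)] O'(4) unfolding W(3) by simp
  moreover have "rst F (pre V) O' (\<theta>s V L) = \<theta>s ?W L"
   using \<theta>s_rst[OF V W(1) WV LL(2)] unfolding W(3) .
  ultimately show "EX W. openin X W & x : W & W <= pre V &
    rst F (pre V) W (\<theta>s V L \<otimes>[F,pre V] t) = rst F (pre V) W \<zero>[F,pre V]"
   using O' F.F_rst_mult[OF oV O'(1,3) c] F.F_rst_zero[OF oV O'(1,3)] by (intro exI[of _ O']) simp
 qed (use c in simp_all)
qed

lemma nilpotent:
 assumes "openin X V" "V <= U0" "t : N (Suc r) (pre V)"
 shows "t = \<zero>[F,pre V]"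
proof -
 interpret A: superalgebra "sec F (pre V)" by (rule F.F_super[OF pre_open[OF assms(1,2)]])
 show ?thesis using annihilate[OF assms, of "[]"] N_in[OF assms(3)] by (simp add: \<theta>s_def)
qed

end

text \<open>The lift is the Euler field of the exterior sheaf conjugated by \<open>\<psi>\<close>.
  Since \<open>\<psi>\<close> ends over preimages under \<open>f\<close>, the value over
  \<open>W\<close> is computed over the image of \<open>W\<close>, whose preimage is
  \<open>W\<close>.\<close>

lemma transport_euler: "EX D. euler_lift (pre U0) D"
proof -
 interpret ED: exterior_der X R E U0 "{V. openin X V & V <= U0}" "%V f. \<zero>[R,V]" "%V m. m"
  by (rule EB.euler_exterior_der[OF U0 E_zero_smult])
 define iv where "iv = (%V. inv_into (Sec EB.B V) (\<psi> V))"
 define D where "D = (%W t. \<psi> (f ` W) (ED.Der (f ` W) (iv (f ` W) t)))"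
 have iv: "iv V t : Sec EB.B V" "\<psi> V (iv V t) = t"
  if "openin X V" "V <= U0" "t : Sec F (pre V)" for V t
  using that(3) bij_betw_imp_surj_on[OF \<psi>_bij[OF that(1,2)]] unfolding iv_def
  by (metis inv_into_into, metis f_inv_into_f)
 have iv_eq: "iv V (\<psi> V g) = g" if "openin X V" "V <= U0" "g : Sec EB.B V" for V g
  unfolding iv_def by (rule inv_into_f_f[OF bij_betw_imp_inj_on[OF \<psi>_bij[OF that(1,2)]] that(3)])
 have hom: "homogeneous_superderivation (sec F (pre V)) False (%t. \<psi> V (ED.Der V (iv V t)))"
  if V: "openin X V" "V <= U0" for V
  unfolding homogeneous_superderivation_def
 proof (intro conjI ballI allI funcsetI)
  note dd = superderivationD[OF ED.Der_homogeneous[OF V]]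
  note Din = ED.Der_in[OF V(2)]
  fix t assume t: "t : Sec F (pre V)"
  note it = iv[OF V t]
  show "\<psi> V (ED.Der V (iv V t)) : Sec F (pre V)" by (rule \<psi>_in[OF V Din[OF it(1)]])
  fix u assume u: "u : Sec F (pre V)"
  note iu = iv[OF V u]
  have "iv V (t \<oplus>[F,pre V] u) = iv V t \<oplus>[EB.B,V] iv V u"
   using iv_eq[OF V EB.B_add_in[OF it(1) iu(1)]] ring_hom_add[OF \<psi>_ring_hom[OF V] it(1) iu(1)] it iu by simp
  then show "\<psi> V (ED.Der V (iv V (t \<oplus>[F,pre V] u))) =
    \<psi> V (ED.Der V (iv V t)) \<oplus>[F,pre V] \<psi> V (ED.Der V (iv V u))"
   using dd(2)[OF it(1) iu(1)] ring_hom_add[OF \<psi>_ring_hom[OF V] Din[OF it(1)] Din[OF iu(1)]] by simp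
 next
  note dd = superderivationD[OF ED.Der_homogeneous[OF V]]
  note Din = ED.Der_in[OF V(2)]
  fix c t assume t: "t : Sec F (pre V)"
  note it = iv[OF V t]
  have "iv V (c \<odot>[F,pre V] t) = c \<odot>[EB.B,V] iv V t"
   using iv_eq[OF V EB.B_smult_in[OF it(1)]] \<psi>_smult[OF V it(1)] it by simp
  then show "\<psi> V (ED.Der V (iv V (c \<odot>[F,pre V] t))) = c \<odot>[F,pre V] \<psi> V (ED.Der V (iv V t))"
   using dd(3)[OF it(1)] \<psi>_smult[OF V Din[OF it(1)]] by simp
 next
  fix q
  show "(%t. \<psi> V (ED.Der V (iv V t))) ` Par F (pre V) q <= Par F (pre V) (False ~= q)"
  proof (rule image_subsetI)
   fix t assume t: "t : Par F (pre V) q"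
   have tc: "t : Sec F (pre V)" by (rule superalgebra.part_carrier[OF F.F_super[OF pre_open[OF V]] t])
   have "iv V t : Par EB.B V q"
    by (rule \<psi>_parity_inv[OF V iv(1)[OF V tc]]) (use iv(2)[OF V tc] t in simp)
   then show "\<psi> V (ED.Der V (iv V t)) : Par F (pre V) (False ~= q)"
    using \<psi>_parity[OF V ED.Der_parity[OF V(2)]] by simp
  qed
 next
  note dd = superderivationD[OF ED.Der_homogeneous[OF V]]
  note Din = ED.Der_in[OF V(2)]
  fix q t u assume t: "t : Par F (pre V) q" and u: "u : Sec F (pre V)"
  have tc: "t : Sec F (pre V)" by (rule superalgebra.part_carrier[OF F.F_super[OF pre_open[OF V]] t])
  note it = iv[OF V tc] and iu = iv[OF V u]
  have p: "iv V t : Par EB.B V q"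
   by (rule \<psi>_parity_inv[OF V iv(1)[OF V tc]]) (use iv(2)[OF V tc] t in simp)
  have "iv V (t \<otimes>[F,pre V] u) = iv V t \<otimes>[EB.B,V] iv V u"
   using iv_eq[OF V EB.B_mult_in[OF it(1) iu(1)]] ring_hom_mult[OF \<psi>_ring_hom[OF V] it(1) iu(1)] it iu by simp
  then have "ED.Der V (iv V (t \<otimes>[F,pre V] u)) =
    ED.Der V (iv V t) \<otimes>[EB.B,V] iv V u \<oplus>[EB.B,V] iv V t \<otimes>[EB.B,V] ED.Der V (iv V u)"
   using dd(5)[OF p iu(1)] by (simp add: signed_def)
  then show "\<psi> V (ED.Der V (iv V (t \<otimes>[F,pre V] u))) =
    \<psi> V (ED.Der V (iv V t)) \<otimes>[F,pre V] u \<oplus>[F,pre V]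
    signed (sec F (pre V)) (False & q) (t \<otimes>[F,pre V] \<psi> V (ED.Der V (iv V u)))"
   using ring_hom_add[OF \<psi>_ring_hom[OF V] EB.B_mult_in[OF Din[OF it(1)] iu(1)] EB.B_mult_in[OF it(1) Din[OF iu(1)]]]
    ring_hom_mult[OF \<psi>_ring_hom[OF V] Din[OF it(1)] iu(1)]
    ring_hom_mult[OF \<psi>_ring_hom[OF V] it(1) Din[OF iu(1)]] it(2) iu(2)
   by (simp add: signed_def)
 qed
 have nat: "rst F (pre V) (pre W) (\<psi> V (ED.Der V (iv V t))) = \<psi> W (ED.Der W (iv W (rst F (pre V) (pre W) t)))"
  if V: "openin X V" "openin X W" "W <= V" "V <= U0" and t: "t : Sec F (pre V)" for V W t
 proof -
  have WU: "W <= U0" using V by auto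
  note it = iv[OF V(1,4) t]
  have "iv W (rst F (pre V) (pre W) t) = rst EB.B V W (iv V t)"
   using iv_eq[OF V(2) WU EB.B_restrict[OF it(1) V(2,3)]] \<psi>_rst[OF V it(1)] it(2) by simp
  then show ?thesis
   using ED.Der_rst[OF V it(1)] \<psi>_rst[OF V ED.Der_in[OF V(4) it(1)]] by simp
 qed
 have term_der: "\<psi> W (ED.Der W (iv W (s W e))) = s W (ED.der W e)"
  if W: "openin X W" "W <= U0" "e : EB.trm W" for W e
 proof -
  have "W : {V. openin X V & V <= U0}" using W by simp
  then show ?thesis unfolding s_def
   using iv_eq[OF W(1,2) EB.sect_in[OF W(1,3)]] ED.Der_sect[OF _ W(3)] by simp
 qed
 \<comment> \<open>One local form for both conditions of \<open>euler_lift\<close>: the value is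
   \<open>c\<close> in \<open>J\<close> up to an element \<open>p\<close> of the second power, and
   \<open>c\<close> is the section itself if that lies in \<open>J\<close>.\<close>
 have loc: "EX W c p. openin X (pre W) & x : pre W & pre W <= pre V & c : J (pre W) & p : I 2 (pre W) &
   rst F (pre V) (pre W) (\<psi> V (ED.Der V (iv V t))) = c \<oplus>[F,pre W] p &
   (t : J (pre V) --> rst F (pre V) (pre W) t = c)"
  if V: "openin X V" "V <= U0" and t: "t : Sec F (pre V)" and x: "x : pre V" for V t x
 proof -
  obtain W e where W: "openin X W" "f x : W" "W <= V" "e : EB.trm W" "rst F (pre V) (pre W) t = s W e"
   "x : pre W" "openin X (pre W)" "pre W <= pre V" "W <= U0" using s_rep[OF V t x] .
  interpret A: superalgebra "sec F (pre W)" by (rule F.F_super[OF W(7)])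
  obtain c p where c: "c : J (pre W)" "p : I 2 (pre W)"
   "s W e = s W (EScal (ext_aug (sec R W) e)) \<oplus>[F,pre W] c" "s W (ED.der W e) = c \<oplus>[F,pre W] p"
   using s_euler[OF W(1,9) _ _ W(4), of "%f. \<zero>[R,W]" "%m. m"] by blast
  have "rst F (pre V) (pre W) (\<psi> V (ED.Der V (iv V t))) = c \<oplus>[F,pre W] p"
   using nat[OF V(1) W(1,3) V(2) t] term_der[OF W(1,9,4)] W(5) c(4) by simp
  moreover have "rst F (pre V) (pre W) t = c" if j: "t : J (pre V)"
  proof -
   have "s W e : J (pre W)" using J_rst[OF pre_open[OF V] W(7,8) j] W(5) by simp
   then have "ext_aug (sec R W) e = \<zero>[R,W]" by (rule aug_zero[OF W(1,9,4)])
   then show ?thesis using c(1,3) W(5) s_scal_zero[OF W(1,9)] J_iff by simp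
  qed
  ultimately show ?thesis using W(6-8) c(1,2) by blast
 qed
 have D_pre: "D (pre V) t = \<psi> V (ED.Der V (iv V t))" if "openin X V" "V <= U0" for V t
 proof -
  note h = that
  have "f ` pre V = V"
  proof
   show "f ` pre V <= V" using pre_f[OF h] by auto
   show "V <= f ` pre V"
   proof
    fix y assume "y : V"
    then obtain x where "x : pre V" "f x = y" using pre_surj[OF h] by blast
    then show "y : f ` pre V" by auto
   qed
  qed
  then show ?thesis unfolding D_def by simp
 qed
 have pre0: "openin X (pre U0)" by (rule pre_open[OF U0 subset_refl])
 have "euler_lift (pre U0) D"
  unfolding euler_lift_def
 proof (intro conjI pre0 sheaf_derI allI impI ballI)
  fix W assume W: "openin X W" "W <= pre U0"
  note V = pre_image[OF W]
  have "D W = (%t. \<psi> (f ` W) (ED.Der (f ` W) (iv (f ` W) t)))" unfolding D_def ..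
  then show "homogeneous_superderivation (sec F W) False (D W)" using hom[OF V(1,2)] unfolding V(3) by simp
  fix W' t assume W': "openin X W'" "W' <= W" and t: "t : Sec F W"
  have W'U: "W' <= pre U0" using W W' by auto
  note V' = pre_image[OF W'(1) W'U]
  show "D W' (rst F W W' t) = rst F W W' (D W t)"
   using nat[OF V(1) V'(1) image_mono[OF W'(2)] V(2), of t] t unfolding V(3) V'(3) D_def by simp
 next
  fix W t assume W': "openin X W & W <= pre U0" and t: "t : Sec F W"
  then have W: "openin X W" "W <= pre U0" by simp_all
  note V = pre_image[OF W]
  have c: "D W t : Sec F W"
   using superderivationD(1)[OF hom[OF V(1,2)]] t D_pre[OF V(1,2)] unfolding V(3) by simp
  show "D W t : J W"
  proof (rule J_local[OF W(1) c])
   fix x assume "x : W"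
   then obtain W' c p where w: "openin X (pre W')" "x : pre W'" "pre W' <= W" "c : J (pre W')" "p : I 2 (pre W')"
    "rst F W (pre W') (\<psi> (f ` W) (ED.Der (f ` W) (iv (f ` W) t))) = c \<oplus>[F,pre W'] p"
    using loc[OF V(1,2), of t x] t unfolding V(3) by blast
   have "c \<oplus>[F,pre W'] p : N 1 (pre W')"
    by (rule N_add[OF w(1)]) (use w(4) N_1[OF w(1)] N_mono[OF w(1) _ I_N[OF w(1,5)], of 1] in simp_all)
   then show "EX V. openin X V & x : V & V <= W & rst F W V (D W t) : J V"
    using w unfolding D_def N_1[OF w(1)] by (intro exI[of _ "pre W'"]) simp
  qed
 next
  fix W t assume W': "openin X W & W <= pre U0" and t: "t : J W"
  then have W: "openin X W" "W <= pre U0" by simp_all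
  note V = pre_image[OF W]
  interpret A: superalgebra "sec F W" by (rule F.F_super[OF W(1)])
  have tc: "t : Sec F W" using t J_iff by blast
  have c: "D W t : Sec F W"
   using superderivationD(1)[OF hom[OF V(1,2)]] tc D_pre[OF V(1,2)] unfolding V(3) by simp
  show "D W t \<ominus>[F,W] t : N 2 W"
  proof (rule N_local[OF W(1)])
   show "D W t \<ominus>[F,W] t : Sec F W" using c tc by simp
   fix x assume "x : W"
   then obtain W' c' p where w: "openin X (pre W')" "x : pre W'" "pre W' <= W" "c' : J (pre W')" "p : I 2 (pre W')"
    "rst F W (pre W') (\<psi> (f ` W) (ED.Der (f ` W) (iv (f ` W) t))) = c' \<oplus>[F,pre W'] p"
    "rst F W (pre W') t = c'"
    using loc[OF V(1,2), of t x] t tc unfolding V(3) by blast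
   interpret A': superalgebra "sec F (pre W')" by (rule F.F_super[OF w(1)])
   have cc: "c' : Sec F (pre W')" "p : Sec F (pre W')"
    using w(4) J_iff I_in[OF w(1,5)] by auto
   have "rst F W (pre W') (D W t \<ominus>[F,W] t) = (c' \<oplus>[F,pre W'] p) \<ominus>[F,pre W'] c'"
    using F.F_rst_diff[OF W(1) w(1,3) c tc] w(6,7) unfolding D_def by simp
   also have "... = p" using cc by (rule A'.plus_diff_cancel)
   finally show "EX V. openin X V & x : V & V <= W & rst F W V (D W t \<ominus>[F,W] t) : N 2 V"
    using w(1-3) I_N[OF w(1,5)] by (intro exI[of _ "pre W'"]) simp
  qed
 qed
 then show ?thesis by blast
qed

end

section \<open>Local charts\<close>

context exterior_base
begin

text \<open>A \<open>ring_hom\<close> into the exterior sheaf is only known to preserve sums, so the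
  image of zero is recognised by being its own double. On terms the exterior algebra is a ring,
  where this forces zero.\<close>

lemma B_idem:
 assumes V: "openin X V" and g: "g : Sec B V" and gg: "g \<oplus>[B,V] g = g"
 shows "g = sect V (EScal \<zero>[R,V])"
proof (rule B_eqI[OF B_ext[OF g] sect_ext])
 fix x assume x: "x : V"
 obtain W e where W: "x : W" "W <= V" "rep g W e" using rep_ex[OF g x] .
 have o: "openin X W" using repD(1)[OF W(3)] .
 have r: "rep g W (ESum e e)" using rep_add[OF W(3,3,2)] unfolding gg .
 obtain O' where O': "openin X O'" "x : O'" "O' <= W" "O' <= W" "eeq O' (tr W O' (ESum e e)) (tr W O' e)"
  using rep_eqD[OF r W(3,1,1) refl] .
 interpret ext_module "sec R O'" "sec E O'" by (rule EM[OF O'(1)])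
 have t: "tr W O' e : trm O'" using tr_trm[OF o O'(1,3) repD(2)[OF W(3)]] .
 have "cl (tr W O' e) \<oplus>\<^bsub>EA\<^esub> cl (tr W O' e) = cl (tr W O' e)" using cl_eqI[OF O'(5)] t by (simp add: cl_sum)
 then have "cl (tr W O' e) = cl (EScal \<zero>[R,O'])" using t by (simp add: EA_zero[symmetric])
 then have e: "eeq O' (tr W O' e) (EScal \<zero>[R,O'])" using cl_eq_iff[OF t] by simp
 have OV: "O' <= V" using O'(3) W(2) by auto
 have z: "rep (sect V (EScal \<zero>[R,V])) O' (EScal \<zero>[R,O'])"
  using rep_rst[OF rep_sect[OF V] O'(1) OV, of "EScal \<zero>[R,V]"] zero_in[OF V] R_zero[OF V O'(1) OV] by simp
 show "EX W e e'. x : W & rep g W e & rep (sect V (EScal \<zero>[R,V])) W e' & eeq W e e'"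
  using rep_rst[OF W(3) O'(1,3)] z e O'(2) by blast
qed

lemma parity_disjoint:
 assumes V: "openin X V" and M: "Module.module (sec R V) (sec E V)"
  and h: "h : Sec R V" "h \<oplus>[R,V] h = \<one>[R,V]"
  and a: "ext_parity p a" "a : trm V" and b: "ext_parity (~ p) b" "b : trm V" and ab: "eeq V a b"
 shows "eeq V b (EScal \<zero>[R,V])"
proof -
 interpret ext_module "sec R V" "sec E V" by (rule EM[OF V])
 have "cl b = \<zero>\<^bsub>EA\<^esub>"
 proof (cases p)
  case True
  then show ?thesis using ext_parity_disjoint[OF M h, of b a] a b ext_sym[OF ab] by simp
 next
  case False
  then show ?thesis using ext_parity_disjoint[OF M h, of a b] a b ab cl_eqI[OF ab] by simp
 qed
 then show ?thesis unfolding EA_zero using cl_eq_iff[OF b(2)] by simp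
qed

end

lemma inverse_superalgebra_hom:
 assumes f: "superalgebra_hom A B f" and bij: "bij_betw f (carrier A) (carrier B)"
  and A: "ring A" "!!c s. s : carrier A ==> c \<odot>\<^bsub>A\<^esub> s : carrier A"
  and p: "!!p g. g : parity_part B p ==> inv_into (carrier A) f g : parity_part A p"
 shows "superalgebra_hom B A (inv_into (carrier A) f)"
proof -
 interpret ring A by fact
 have h: "f : ring_hom A B" "!!c s. s : carrier A ==> f (c \<odot>\<^bsub>A\<^esub> s) = c \<odot>\<^bsub>B\<^esub> f s"
  using f unfolding superalgebra_hom_def by simp_all
 let ?i = "inv_into (carrier A) f"
 have i: "?i (f a) = a" if "a : carrier A" for a
  using inv_into_f_f[OF bij_betw_imp_inj_on[OF bij] that] .
 have s: "EX a:carrier A. x = f a" if "x : carrier B" for x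
  using bij_betw_imp_surj_on[OF bij] that by auto
 have "?i : ring_hom B A"
 proof (rule ring_hom_memI)
  fix x assume "x : carrier B"
  then obtain a where a: "a : carrier A" "x = f a" using s by blast
  then show "?i x : carrier A" using i by simp
  fix y assume "y : carrier B"
  then obtain b where b: "b : carrier A" "y = f b" using s by blast
  show "?i (x \<otimes>\<^bsub>B\<^esub> y) = ?i x \<otimes>\<^bsub>A\<^esub> ?i y"
   using i[of "a \<otimes>\<^bsub>A\<^esub> b"] a b i ring_hom_mult[OF h(1) a(1) b(1)] by simp
  show "?i (x \<oplus>\<^bsub>B\<^esub> y) = ?i x \<oplus>\<^bsub>A\<^esub> ?i y"
   using i[of "a \<oplus>\<^bsub>A\<^esub> b"] a b i ring_hom_add[OF h(1) a(1) b(1)] by simp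
 next
  show "?i \<one>\<^bsub>B\<^esub> = \<one>\<^bsub>A\<^esub>" using i[of "\<one>\<^bsub>A\<^esub>"] ring_hom_one[OF h(1)] by simp
 qed
 moreover have "?i (c \<odot>\<^bsub>B\<^esub> x) = c \<odot>\<^bsub>A\<^esub> ?i x" if x: "x : carrier B" for c x
 proof -
  obtain a where a: "a : carrier A" "x = f a" using s[OF x] by blast
  show ?thesis using i[of "c \<odot>\<^bsub>A\<^esub> a"] a i A(2) h(2)[OF a(1), of c] by simp
 qed
 ultimately show ?thesis unfolding superalgebra_hom_def using p by (auto simp: image_subset_iff)
qed

context supermanifold
begin

lemma module_sheaf_exterior_base:
 assumes "sheaf_of_modules X R E"
 shows "exterior_base X R E"
proof -
 have E: "is_presheaf X E" "!!U. openin X U ==> Module.module (sec R U) (sec E U)"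
  "!!U V s t. [| openin X U; openin X V; V <= U; s : Sec E U; t : Sec E U |] ==>
      rst E U V (s \<oplus>[E,U] t) = rst E U V s \<oplus>[E,V] rst E U V t"
  "!!U V f s. [| openin X U; openin X V; V <= U; f : Sec R U; s : Sec E U |] ==>
      rst E U V (f \<odot>[E,U] s) = rst R U V f \<odot>[E,V] rst E U V s"
  using assms unfolding sheaf_of_modules_def is_sheaf_def by (elim conjE, simp)+
 show ?thesis
 proof (rule exterior_baseI[OF E(1) _ _ E(3)])
  fix U assume U: "openin X U"
  interpret Module.module "sec R U" "sec E U" by (rule E(2)[OF U])
  show "m \<oplus>[E,U] n : Sec E U" if "m : Sec E U" "n : Sec E U" for m n
   using that by simp
  show "f \<odot>[E,U] m : Sec E U" if "f : Sec R U" "m : Sec E U" for f m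
   using that by simp
  show "Sec E U ~= {}" by blast
 next
  fix U V f m assume "openin X U" "openin X V" "V <= U" "f : Sec R U" "m : Sec E U"
  from E(4)[OF this] show "rst E U V (f \<odot>[E,U] m) = restrict f V \<odot>[E,V] rst E U V m"
   unfolding R_simps(1) .
 qed
qed

lemma R_half:
 assumes "openin X V"
 obtains h where "h : Sec R V" "h \<oplus>[R,V] h = \<one>[R,V]"
 by (rule that[OF R_const[OF assms, of "1/2"]]) (simp add: R_simps cong: restrict_cong)

text \<open>The definition provides a map from the structure sheaf to the exterior sheaf;
  \<open>ext_iso\<close> wants the inverse, over a set on which the module has a basis too. The only
  property not inherited formally is that the inverse respects parity.\<close>

lemma chart:
 assumes x: "x : topspace X"
 obtains E :: "('x, 'x => complex, ('x, 'a set) germ_fun) module_sheaf" and U \<psi> r b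
 where "x : U" "ext_iso \<XX> E (%x. x) (%V. V) U \<psi>" "!!i. i < r ==> b i : Sec E U"
  "!!W. openin X W ==> abelian_monoid (sec E W)"
  "!!W m. [| openin X W; W <= U; m : Sec E W |] ==>
   EX c. c : {..<r::nat} \<rightarrow> Sec R W &
    m = (\<Oplus>\<^bsub>sec E W\<^esub>i\<in>{..<r}. c i \<odot>[E,W] rst E U W (b i))"
proof -
 obtain E :: "('x, 'x => complex, ('x, 'a set) germ_fun) module_sheaf" where
  E: "sheaf_of_modules X R E" "locally_free_of_finite_rank X R E" "locally_exterior \<XX> E"
  using local_model by blast
 interpret EB: exterior_base X R E by (rule module_sheaf_exterior_base[OF E(1)])
 have mod: "Module.module (sec R U) (sec E U)" if "openin X U" for U
  using E(1) that unfolding sheaf_of_modules_def by (elim conjE) simp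
 obtain U1 \<phi> where U1: "openin X U1" "x : U1" "superalgebra_sheaf_hom (subtopology X U1) F EB.B \<phi>"
  "!!V. [| openin X V; V <= U1 |] ==> bij_betw (\<phi> V) (Sec F V) (Sec EB.B V)"
  "!!V t. [| openin X V; V <= U1; t : Sec F V |] ==> exterior_projection R V (\<phi> V t) = pj V t"
  using E(3)[unfolded locally_exterior_def Let_def, rule_format, OF x] by (elim exE conjE) simp
 obtain U2 r b where U2: "openin X U2" "x : U2" "ALL i<r. b i : Sec E U2"
  "ALL W. openin X W & W <= U2 --> (ALL t : Sec E W. EX! f. f : {..<r::nat} \<rightarrow>\<^sub>E Sec R W &
       t = (\<Oplus>\<^bsub>sec E W\<^esub>i\<in>{..<r}. f i \<odot>[E,W] rst E U2 W (b i)))"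
  using E(2)[unfolded locally_free_of_finite_rank_def, rule_format, OF x] by (elim exE conjE) simp
 let ?U = "U1 \<inter> U2"
 have U: "openin X ?U" using U1 U2 by auto
 define \<psi> where "\<psi> = (%V. inv_into (Sec F V) (\<phi> V))"
 have osub: "openin (subtopology X U1) V" if "openin X V" "V <= U1" for V
  using that U1(1) by (simp add: openin_open_subtopology)
 have hom: "superalgebra_hom (sec F V) (sec EB.B V) (\<phi> V)" if "openin X V" "V <= U1" for V
  using U1(3) osub[OF that] unfolding superalgebra_sheaf_hom_def by simp
 have nat: "\<phi> W (rst F V W t) = rst EB.B V W (\<phi> V t)"
  if "openin X V" "openin X W" "W <= V" "V <= U1" "t : Sec F V" for V W t
  using U1(3) osub[OF that(1,4)] osub[OF that(2) order_trans[OF that(3,4)]] that(3,5)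
  unfolding superalgebra_sheaf_hom_def by simp
 have zero: "\<phi> V \<zero>[F,V] = EB.sect V (EScal \<zero>[R,V])" if V: "openin X V" "V <= U1" for V
 proof -
  interpret A: superalgebra "sec F V" by (rule F.F_super[OF V(1)])
  have h: "\<phi> V : ring_hom (sec F V) (sec EB.B V)" using hom[OF V] unfolding superalgebra_hom_def by simp
  show ?thesis
   by (rule EB.B_idem[OF V(1) ring_hom_closed[OF h A.zero_closed]])
    (use ring_hom_add[OF h A.zero_closed A.zero_closed] in simp)
 qed
 have par: "inv_into (Sec F V) (\<phi> V) g : Par F V p"
  if V: "openin X V" "V <= U1" and g: "g : Par EB.B V p" for V p g
 proof -
  interpret A: superalgebra "sec F V" by (rule F.F_super[OF V(1)])
  define t where "t = inv_into (Sec F V) (\<phi> V) g"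
  have gc: "g : Sec EB.B V" by (rule EB.B_parity_carrier[OF g])
  have t: "t : Sec F V" "\<phi> V t = g"
   using gc bij_betw_imp_surj_on[OF U1(4)[OF V]] unfolding t_def by (metis inv_into_into, metis f_inv_into_f)
  have h: "\<phi> V : ring_hom (sec F V) (sec EB.B V)" "!!p. \<phi> V ` Par F V p <= Par EB.B V p"
   using hom[OF V] unfolding superalgebra_hom_def by simp_all
  let ?u = "ppart (sec F V) (~ p) t" and ?v = "ppart (sec F V) p t"
  have uv: "?u : Sec F V" "?v : Sec F V" using t by simp_all
  have tuv: "t = ?v \<oplus>[F,V] ?u"
   using A.ppart_decompose(1)[OF t(1)] A.a_comm[OF uv] by (cases p) simp_all
  have guv: "g = \<phi> V ?v \<oplus>[EB.B,V] \<phi> V ?u"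
   using ring_hom_add[OF h(1) uv(2,1)] tuv t(2) by simp
  have pu: "\<phi> V ?u : Par EB.B V (~ p)" "\<phi> V ?v : Par EB.B V p"
   using h(2) A.ppart_in[OF t(1)] by blast+
  \<comment> \<open>\<open>?u\<close> is the component of the wrong parity. Near \<open>y\<close>
    its image has a term of parity \<open>~ p\<close>, and also, being \<open>g\<close> minus the
    image of \<open>?v\<close>, a term of parity \<open>p\<close>. By \<open>parity_disjoint\<close>
    the image vanishes there, and \<open>\<phi>\<close> is injective.\<close>
  have "?u = \<zero>[F,V]"
  proof (rule F.separated[OF V(1) uv(1) A.zero_closed])
   fix y assume y: "y : V"
   obtain W1 e where W1: "y : W1" "W1 <= V" "EB.rep g W1 e" "ext_parity p e" using EB.rep_ex_parity[OF g y] .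
   obtain W2 a' where W2: "y : W2" "W2 <= V" "EB.rep (\<phi> V ?v) W2 a'" "ext_parity p a'"
    using EB.rep_ex_parity[OF pu(2) y] .
   obtain W3 b' where W3: "y : W3" "W3 <= V" "EB.rep (\<phi> V ?u) W3 b'" "ext_parity (~ p) b'"
    using EB.rep_ex_parity[OF pu(1) y] .
   let ?W = "W2 \<inter> W3"
   have oW: "openin X ?W" using EB.repD(1)[OF W2(3)] EB.repD(1)[OF W3(3)] by auto
   have WV: "?W <= V" using W2 by auto
   have ra: "EB.rep (\<phi> V ?v) ?W (EB.tr W2 ?W a')" by (rule EB.rep_rst[OF W2(3) oW]) auto
   have rb: "EB.rep (\<phi> V ?u) ?W (EB.tr W3 ?W b')" by (rule EB.rep_rst[OF W3(3) oW]) auto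
   have rg: "EB.rep g ?W (ESum (EB.tr W2 ?W a') (EB.tr W3 ?W b'))"
    using EB.rep_add[OF ra rb WV] unfolding guv[symmetric] .
   have yW: "y : ?W" using W2 W3 by auto
   obtain O' where O': "openin X O'" "y : O'" "O' <= W1" "O' <= ?W"
    "EB.eeq O' (EB.tr W1 O' e) (EB.tr ?W O' (ESum (EB.tr W2 ?W a') (EB.tr W3 ?W b')))"
    using EB.rep_eqD[OF W1(3) rg W1(1) yW refl] .
   have OV: "O' <= V" "O' <= U1" using O'(3) W1(2) V(2) by auto
   interpret EM: ext_module "sec R O'" "sec E O'" by (rule EB.EM[OF O'(1)])
   let ?e = "EB.tr W1 O' e" and ?a = "EB.tr ?W O' (EB.tr W2 ?W a')" and ?b = "EB.tr ?W O' (EB.tr W3 ?W b')"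
   note re = EB.rep_rst[OF W1(3) O'(1,3)] and ra' = EB.rep_rst[OF ra O'(1,4)] and rb' = EB.rep_rst[OF rb O'(1,4)]
   have tt: "?e : EB.trm O'" "?a : EB.trm O'" "?b : EB.trm O'"
    using EB.repD(2)[OF re] EB.repD(2)[OF ra'] EB.repD(2)[OF rb'] by simp_all
   let ?n = "EProd (EScal (\<ominus>[R,O'] \<one>[R,O'])) ?a"
   have nt: "?n : EB.trm O'" using tt by simp
   have "EM.cl (ESum ?e ?n) = EM.cl ?b"
   proof -
    have "EM.cl ?e = EM.cl ?a \<oplus>\<^bsub>EM.EA\<^esub> EM.cl ?b" using EM.cl_eqI[OF O'(5)] tt by (simp add: EM.cl_sum)
    moreover have "EM.cl ?n = \<ominus>\<^bsub>EM.EA\<^esub> EM.cl ?a" using tt EM.cl_neg by (simp add: EM.cl_prod)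
    ultimately have "EM.cl (ESum ?e ?n) = (EM.cl ?a \<oplus>\<^bsub>EM.EA\<^esub> EM.cl ?b) \<ominus>\<^bsub>EM.EA\<^esub> EM.cl ?a"
     using EM.cl_sum[OF tt(1) nt] unfolding a_minus_def by simp
    also have "... = EM.cl ?b" using tt by (intro EM.EA.plus_diff_cancel) simp_all
    finally show ?thesis .
   qed
   then have eb: "EB.eeq O' (ESum ?e ?n) ?b" using EM.cl_eq_iff[of "ESum ?e ?n" ?b] tt nt by simp
   have "ext_parity p ?a" by (intro ext_parity_map W2(4))
   then have "ext_parity p ?n"
    using ext_parity.intros(4)[OF ext_parity.intros(1), of p ?a "\<ominus>[R,O'] \<one>[R,O']"]
    by (simp only: simp_thms)
   then have pe: "ext_parity p (ESum ?e ?n)" by (intro ext_parity.intros(3) ext_parity_map[OF W1(4)])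
   have pb: "ext_parity (~ p) ?b" by (intro ext_parity_map W3(4))
   obtain hh where hh: "hh : Sec R O'" "hh \<oplus>[R,O'] hh = \<one>[R,O']" using R_half[OF O'(1)] .
   have b0: "EB.eeq O' ?b (EScal \<zero>[R,O'])"
    by (rule EB.parity_disjoint[OF O'(1) mod[OF O'(1)] hh pe _ pb tt(3) eb]) (use tt nt in simp)
   have "\<phi> O' (rst F V O' ?u) = rst EB.B V O' (\<phi> V ?u)" by (rule nat[OF V(1) O'(1) OV(1) V(2) uv(1)])
   also have "... = EB.sect O' ?b"
    unfolding EB.B_rst by (rule EB.sect_eqI[OF _ EB.rep_restrict[OF rb' subset_refl]]) simp
   also have "... = EB.sect O' (EScal \<zero>[R,O'])" by (rule EB.sect_eq[OF O'(1) b0])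
   also have "... = \<phi> O' \<zero>[F,O']" using zero[OF O'(1) OV(2)] by simp
   finally have "rst F V O' ?u = \<zero>[F,O']"
    using inj_onD[OF bij_betw_imp_inj_on[OF U1(4)[OF O'(1) OV(2)]]] F.rst_closed[OF V(1) O'(1) OV(1) uv(1)]
     ring.ring_simprules(2)[OF F.F_ring[OF O'(1)]] by blast
   then show "EX W. openin X W & y : W & W <= V & rst F V W ?u = rst F V W \<zero>[F,V]"
    using O'(1,2) OV(1) F.F_rst_zero[OF V(1) O'(1) OV(1)] by (intro exI[of _ O']) simp
  qed
  then have "t = ?v" using tuv uv by simp
  then show ?thesis unfolding t_def[symmetric] using A.ppart_in[OF t(1), of p] by simp
 qed
 have inv: "\<psi> V g : Sec F V" "\<phi> V (\<psi> V g) = g"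
  if "openin X V" "V <= U1" "g : Sec EB.B V" for V g
  using that(3) bij_betw_imp_surj_on[OF U1(4)[OF that(1,2)]] unfolding \<psi>_def
  by (metis inv_into_into, metis f_inv_into_f)
 have "ext_iso \<XX> E (%x. x) (%V. V) ?U \<psi>"
 proof (intro ext_iso.intro ext_iso_axioms.intro supermanifold_axioms EB.exterior_base_axioms)
  show "openin X ?U" by (rule U)
  show "homeomorphic_map X X (%x. x)" using homeomorphic_map_id[of X X] by (simp add: id_def)
  fix V assume V: "openin X V"
  show "V = {x : topspace X. x : V}" using openin_subset[OF V] by auto
  show "\<zero>[R,V] \<odot>[E,V] m \<oplus>[E,V] n = n" if "m : Sec E V" "n : Sec E V" for m n
  proof -
   interpret Module.module "sec R V" "sec E V" by (rule mod[OF V])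
   show ?thesis using that by simp
  qed
  assume "V <= ?U"
  then have VU: "V <= U1" by auto
  show "superalgebra_hom (sec EB.B V) (sec F V) (\<psi> V)"
   unfolding \<psi>_def
   by (rule inverse_superalgebra_hom[OF hom[OF V VU] U1(4)[OF V VU] F.F_ring[OF V]
      superalgebra.sm_closed[OF F.F_super[OF V]] par[OF V VU]])
  show "bij_betw (\<psi> V) (Sec EB.B V) (Sec F V)"
   unfolding \<psi>_def by (rule bij_betw_inv_into[OF U1(4)[OF V VU]])
  fix g assume g: "g : Sec EB.B V"
  show "pj V (\<psi> V g) = (\<lambda>x\<in>V. exterior_projection R V g x)"
  proof -
   have "exterior_projection R V g = pj V (\<psi> V g)"
    using U1(5)[OF V VU inv(1)[OF V VU g]] inv(2)[OF V VU g] by simp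
   then show ?thesis using extensional_restrict[OF pj_ext[OF V inv(1)[OF V VU g]]] by simp
  qed
  fix W assume W: "openin X W" "W <= V"
  have WU: "W <= U1" using W VU by auto
  have "\<phi> W (rst F V W (\<psi> V g)) = rst EB.B V W g"
   using nat[OF V W VU inv(1)[OF V VU g]] inv(2)[OF V VU g] by simp
  then show "\<psi> W (rst EB.B V W g) = rst F V W (\<psi> V g)"
   using inv_into_f_f[OF bij_betw_imp_inj_on[OF U1(4)[OF W(1) WU]] F.rst_closed[OF V W inv(1)[OF V VU g]]]
   unfolding \<psi>_def by simp
 qed
 moreover have "rst E U2 ?U (b i) : Sec E ?U" if "i < r" for i
  using EB.E.rst_closed[OF U2(1) U _ ] U2(3) that by simp
 moreover have "abelian_monoid (sec E W)" if "openin X W" for W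
  using mod[OF that] unfolding Module.module_def abelian_group_def by (elim conjE)
 moreover have "EX c. c : {..<r} \<rightarrow> Sec R W &
    m = (\<Oplus>\<^bsub>sec E W\<^esub>i\<in>{..<r}. c i \<odot>[E,W] rst E ?U W (rst E U2 ?U (b i)))"
  if W: "openin X W" "W <= ?U" and m: "m : Sec E W" for W m
 proof -
  interpret Module.module "sec R W" "sec E W" by (rule mod[OF W(1)])
  have WU: "W <= U2" using W by auto
  obtain c where c: "c : {..<r} \<rightarrow>\<^sub>E Sec R W"
   "m = (\<Oplus>\<^bsub>sec E W\<^esub>i\<in>{..<r}. c i \<odot>[E,W] rst E U2 W (b i))"
   using ex1_implies_ex[OF U2(4)[rule_format, OF conjI[OF W(1) WU] m]] by (elim exE conjE) (rule that)
  have c': "c : {..<r} \<rightarrow> Sec R W" using c(1) by (auto simp: PiE_def)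
  have "rst E ?U W (rst E U2 ?U (b i)) = rst E U2 W (b i)" if "i < r" for i
   using EB.E.rst_rst[OF U2(1) U W(1,2)] U2(3) that by simp
  then have "m = (\<Oplus>\<^bsub>sec E W\<^esub>i\<in>{..<r}. c i \<odot>[E,W] rst E ?U W (rst E U2 ?U (b i)))"
   unfolding c(2)
   by (intro M.finsum_cong') (use c' EB.E.rst_closed[OF U2(1) W(1) WU] U2(3) in auto)
  then show ?thesis using c' by blast
 qed
 ultimately show thesis using that[of ?U E \<psi> r "%i. rst E U2 ?U (b i)"] U1(2) U2(2) by blast
qed

section \<open>Local properties obtained from charts\<close>

lemma even_J:
 assumes V: "openin X V" and t: "t : J V" "t : Par F V False"
 shows "t : N 2 V"
proof (rule N_local[OF V])
 show "t : Sec F V" using t J_iff by blast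
 fix x assume x: "x : V"
 then have "x : topspace X" using openin_subset[OF V] by auto
 then obtain E :: "('x, 'x => complex, ('x, 'a set) germ_fun) module_sheaf" and U \<psi>
  where U: "x : U" "ext_iso \<XX> E (%x. x) (%V. V) U \<psi>" using chart by metis
 interpret ext_iso \<XX> E "%x. x" "%V. V" U \<psi> by (rule U(2))
 let ?W = "U \<inter> V"
 have o: "openin X ?W" "?W <= U" "?W <= V" using U0 V by auto
 have "rst F V ?W t : N 2 ?W"
  by (rule even_J[OF o(1,2) J_rst[OF V o(1,3) t(1)] F.F_rst_part[OF V o(1,3) t(2)]])
 then show "EX W. openin X W & x : W & W <= V & rst F V W t : N 2 W" using o x U(1) by blast
qed

lemma locally_nilpotent:
 assumes "x : topspace X"
 obtains U K where "openin X U" "x : U" "!!V t. [| openin X V; V <= U; t : N K V |] ==> t = \<zero>[F,V]"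
proof -
 obtain E :: "('x, 'x => complex, ('x, 'a set) germ_fun) module_sheaf" and U \<psi> r b
  where U: "x : U" "ext_iso \<XX> E (%x. x) (%V. V) U \<psi>" "!!i. i < r ==> b i : Sec E U"
  "!!W. openin X W ==> abelian_monoid (sec E W)"
  "!!W m. [| openin X W; W <= U; m : Sec E W |] ==>
   EX c. c : {..<r::nat} \<rightarrow> Sec R W &
    m = (\<Oplus>\<^bsub>sec E W\<^esub>i\<in>{..<r}. c i \<odot>[E,W] rst E U W (b i))"
  by (rule chart[OF assms], rule that)
 interpret ext_iso \<XX> E "%x. x" "%V. V" U \<psi> by (rule U(2))
 show thesis by (rule that[OF U0 U(1) nilpotent[OF U(3-5)]])
qed

lemma local_euler_lift:
 assumes "x : topspace X"
 obtains U D where "x : U" "euler_lift U D"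
proof -
 obtain E :: "('x, 'x => complex, ('x, 'a set) germ_fun) module_sheaf" and U \<psi>
  where U: "x : U" "ext_iso \<XX> E (%x. x) (%V. V) U \<psi>" using chart[OF assms] by metis
 show thesis using ext_iso.transport_euler[OF U(2)] that[OF U(1)] by blast
qed

section \<open>The odd cotangent sheaf\<close>

abbreviation "C == conormal_presheaf \<XX>"
abbreviation "M == odd_cotangent_sheaf \<XX>"

abbreviation "cc == conormal_class \<XX>"

definition cs :: "'x set => 'a => 'a set" where
 "cs U j = N 2 U +>\<^bsub>sec F U\<^esub> j"

lemma cs_mem:
 assumes U: "openin X U" and j: "j : Sec F U"
 shows "k : cs U j \<longleftrightarrow> k : Sec F U & k \<ominus>[F,U] j : N 2 U"
proof -
 interpret A: ring "sec F U" by (rule F.F_ring[OF U])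
 have "k : cs U j \<longleftrightarrow> (EX h:N 2 U. k = h \<oplus>[F,U] j)"
  unfolding cs_def a_r_coset_def r_coset_def by simp
 also have "... \<longleftrightarrow> k : Sec F U & k \<ominus>[F,U] j : N 2 U"
 proof
  assume "EX h:N 2 U. k = h \<oplus>[F,U] j"
  then obtain h where h: "h : N 2 U" "k = h \<oplus>[F,U] j" by blast
  have hc: "h : Sec F U" by (rule N_in[OF h(1)])
  have "k \<ominus>[F,U] j = h" unfolding h(2) using hc j by (simp add: a_minus_def A.a_assoc A.r_neg)
  then show "k : Sec F U & k \<ominus>[F,U] j : N 2 U" using h hc j by simp
 next
  assume k: "k : Sec F U & k \<ominus>[F,U] j : N 2 U"
  then have "k = (k \<ominus>[F,U] j) \<oplus>[F,U] j" using j by (simp add: a_minus_def A.a_assoc A.l_neg)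
  then show "EX h:N 2 U. k = h \<oplus>[F,U] j" using k by blast
 qed
 finally show ?thesis .
qed

lemma J_in: "j : J U ==> j : Sec F U"
 using J_iff by blast

lemma cs_eq_iff:
 assumes U: "openin X U" and j: "j : Sec F U" and k: "k : Sec F U"
 shows "cs U j = cs U k \<longleftrightarrow> j \<ominus>[F,U] k : N 2 U"
proof -
 interpret A: ring "sec F U" by (rule F.F_ring[OF U])
 have sw: "b \<ominus>[F,U] a : N 2 U"
  if "a : Sec F U" "b : Sec F U" "a \<ominus>[F,U] b : N 2 U" for a b
  using N_neg[OF U that(3)] A.diff_swap[OF that(1,2)] by simp
 show ?thesis
 proof
  assume "cs U j = cs U k"
  moreover have "j : cs U j" using cs_mem[OF U j, of j] j N_zero[OF U] by (simp add: A.diff_zero_iff[THEN iffD2])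
  ultimately show "j \<ominus>[F,U] k : N 2 U" using cs_mem[OF U k, of j] by simp
 next
  assume jk: "j \<ominus>[F,U] k : N 2 U"
  show "cs U j = cs U k"
  proof (rule Set.set_eqI)
   fix x show "x : cs U j \<longleftrightarrow> x : cs U k"
    unfolding cs_mem[OF U j] cs_mem[OF U k]
    using N_eq_diff[OF U _ j k _ jk, of x] N_eq_diff[OF U _ k j _ sw[OF j k jk], of x] by blast
  qed
 qed
qed

lemma C_carrier: "Sec C U = cs U ` J U"
 unfolding conormal_presheaf_def additive_group_def cs_def Let_def by simp

lemma C_add:
 assumes U: "openin X U" and j: "j : Sec F U" and k: "k : Sec F U"
 shows "cs U j \<oplus>[C,U] cs U k = cs U (j \<oplus>[F,U] k)"
proof -
 interpret A: ring "sec F U" by (rule F.F_ring[OF U])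
 have "cs U j <+>\<^bsub>sec F U\<^esub> cs U k = cs U (j \<oplus>[F,U] k)"
 proof (rule Set.set_eqI)
  fix x
  have "x : cs U j <+>\<^bsub>sec F U\<^esub> cs U k \<longleftrightarrow> (EX a:cs U j. EX b:cs U k. x = a \<oplus>[F,U] b)"
   unfolding set_add_def set_mult_def by auto
  also have "... \<longleftrightarrow> x : cs U (j \<oplus>[F,U] k)"
  proof
   assume "EX a:cs U j. EX b:cs U k. x = a \<oplus>[F,U] b"
   then obtain a b where ab: "a : cs U j" "b : cs U k" "x = a \<oplus>[F,U] b" by blast
   have c: "a : Sec F U" "b : Sec F U" "a \<ominus>[F,U] j : N 2 U" "b \<ominus>[F,U] k : N 2 U"
    using ab cs_mem[OF U j] cs_mem[OF U k] by auto
   have "x \<ominus>[F,U] (j \<oplus>[F,U] k) : N 2 U"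
    unfolding ab(3) A.diff_plus_diff[OF c(1,2) j k] by (rule N_add[OF U c(3,4)])
   then show "x : cs U (j \<oplus>[F,U] k)" using cs_mem[OF U A.a_closed[OF j k]] c ab(3) by simp
  next
   assume x: "x : cs U (j \<oplus>[F,U] k)"
   then have xc: "x : Sec F U" "x \<ominus>[F,U] (j \<oplus>[F,U] k) : N 2 U"
    using cs_mem[OF U A.a_closed[OF j k]] by auto
   have "k : cs U k" using cs_mem[OF U k, of k] k N_zero[OF U] by (simp add: A.diff_zero_iff[THEN iffD2])
   moreover have "x \<ominus>[F,U] k : cs U j"
   proof -
    have "(x \<ominus>[F,U] k) \<ominus>[F,U] j = x \<ominus>[F,U] (j \<oplus>[F,U] k)"
     using xc j k by (simp add: a_minus_def A.minus_add A.a_ac)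
    then show ?thesis using xc j k cs_mem[OF U j] by simp
   qed
   moreover have "x = (x \<ominus>[F,U] k) \<oplus>[F,U] k" using xc k by (simp add: a_minus_def A.a_assoc A.l_neg)
   ultimately show "EX a:cs U j. EX b:cs U k. x = a \<oplus>[F,U] b" by blast
  qed
  finally show "x : cs U j <+>\<^bsub>sec F U\<^esub> cs U k \<longleftrightarrow> x : cs U (j \<oplus>[F,U] k)" .
 qed
 then show ?thesis unfolding conormal_presheaf_def additive_group_def Let_def by simp
qed

lemma C_rst:
 assumes o: "openin X U" "openin X V" "V <= U" and j: "j : Sec F U"
 shows "rst C U V (cs U j) = cs V (rst F U V j)"
proof -
 interpret A: ring "sec F U" by (rule F.F_ring[OF o(1)])
 have "(\<Union>k\<in>cs U j. cs V (rst F U V k)) = cs V (rst F U V j)"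
 proof (rule SUP_eq_const)
  show "cs U j ~= {}" using cs_mem[OF o(1) j, of j] j N_zero[OF o(1)]
   by (auto simp: A.diff_zero_iff[THEN iffD2])
  fix k assume "k : cs U j"
  then have k: "k : Sec F U" "k \<ominus>[F,U] j : N 2 U" using cs_mem[OF o(1) j] by auto
  show "cs V (rst F U V k) = cs V (rst F U V j)"
   unfolding cs_eq_iff[OF o(2) F.rst_closed[OF o k(1)] F.rst_closed[OF o j]]
   using N_rst[OF o k(2)] F.F_rst_diff[OF o k(1) j] by simp
 qed
 then show ?thesis unfolding conormal_presheaf_def cs_def by simp
qed

lemma C_presheaf: "is_presheaf X C"
 unfolding is_presheaf_def
proof (intro conjI allI impI ballI funcsetI)
 fix U V a assume "openin X U & openin X V & V <= U" "a : Sec C U"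
 then show "rst C U V a : Sec C V"
  using J_rst by (auto simp: C_carrier C_rst J_in)
next
 fix U a assume "openin X U" "a : Sec C U"
 then show "rst C U U a = a" by (auto simp: C_carrier C_rst J_in F.rst_id)
next
 fix U V W a assume "openin X U & openin X V & openin X W & W <= V & V <= U" "a : Sec C U"
 then show "rst C V W (rst C U V a) = rst C U W a"
  using F.rst_closed by (auto simp: C_carrier C_rst J_in F.rst_rst)
qed

sublocale C: presheaf_on X C by unfold_locales (rule C_presheaf)

definition repM :: "('x, 'a set) germ_fun => 'x set => 'a => bool" where
 "repM t V j \<longleftrightarrow> openin X V & j : J V & represents X C t V (cs V j)"

lemma repMD: "repM t V j ==> openin X V" "repM t V j ==> j : J V" "repM t V j ==> represents X C t V (cs V j)"
 unfolding repM_def by simp_all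

lemma repM_rst: "[| repM t V j; openin X W; W <= V |] ==> repM t W (rst F V W j)"
 using C.represents_rst[of t V "cs V j" W] unfolding repM_def by (simp add: C_rst J_rst J_in)

lemma repM_restrict: "[| repM t V j; V <= U |] ==> repM (restrict t U) V j"
 using C.represents_restrict unfolding repM_def by simp

lemma M_simps:
 "Sec M U = germ_sections X C (%V. Sec C V) U"
 "\<zero>[M,U] = germ_section X C U \<zero>[C,U]"
 "t \<oplus>[M,U] u = germ_op X C (%V. add (sec C V)) U t u"
 "h \<odot>[M,U] t = conormal_smult \<XX> U h t"
 "rst M U V t = restrict t V"
 unfolding odd_cotangent_sheaf_def Let_def by simp_all

lemma M_ext: "t : Sec M U ==> t : extensional U"
 unfolding M_simps germ_sections_def by simp

lemma repM_ex:
 assumes "t : Sec M U" "x : U"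
 obtains V j where "x : V" "V <= U" "repM t V j"
proof -
 obtain V a where V: "x : V" "V <= U" "a : Sec C V" "represents X C t V a"
  using C.germ_sections_represents[OF assms[unfolded M_simps] subset_refl] .
 then obtain j where "j : J V" "a = cs V j" unfolding C_carrier by auto
 then show thesis using V that[of V j] unfolding repM_def represents_def by simp
qed

lemma M_mem:
 assumes "t : extensional U" "!!x. x : U ==> EX V j. x : V & V <= U & repM t V j"
 shows "t : Sec M U"
 unfolding M_simps
proof (rule C.germ_sectionsI[OF assms(1)])
 fix x assume "x : U"
 from assms(2)[OF this] obtain V j where V: "x : V" "V <= U" "repM t V j" by metis
 then show "EX V a. x : V & V <= U & a : Sec C V & represents X C t V a"
  using repMD(2,3)[OF V(3)] by (intro exI[of _ V] exI[of _ "cs V j"]) (simp add: C_carrier)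
qed

lemma repM_eq_at:
 assumes "repM t V j" "repM u V k" "j \<ominus>[F,V] k : N 2 V" "x : V"
 shows "t x = u x"
proof -
 have "cs V j = cs V k" using cs_eq_iff[OF repMD(1)[OF assms(1)]] J_in repMD(2) assms(1-3) by metis
 then show ?thesis
  using C.represents_eqI[of t V "cs V j" u x] repMD(3)[OF assms(1)] repMD(3)[OF assms(2)] assms(4) by simp
qed

lemma M_eqI:
 assumes "t : extensional U" "u : extensional U"
  "!!x. x : U ==> EX W j k. x : W & repM t W j & repM u W k & j \<ominus>[F,W] k : N 2 W"
 shows "t = u"
proof (rule extensionalityI[OF assms(1,2)])
 fix x assume "x : U"
 from assms(3)[OF this] show "t x = u x" using repM_eq_at by metis
qed

text \<open>Equality of conormal germs gives membership of the difference in \<open>N 2\<close> near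
  each point only. As \<open>N 2\<close> is defined by a local condition, it holds on all of
  \<open>O'\<close>.\<close>

lemma repM_unique:
 assumes t: "repM t V j" "repM u W k" and O': "openin X O'" "O' <= V" "O' <= W" and eq: "!!x. x : O' ==> t x = u x"
 shows "rst F V O' j \<ominus>[F,O'] rst F W O' k : N 2 O'"
proof -
 interpret A: ring "sec F O'" by (rule F.F_ring[OF O'(1)])
 have oV: "openin X V" "openin X W" "j : Sec F V" "k : Sec F W"
  using t repMD J_in by blast+
 let ?j = "rst F V O' j" and ?k = "rst F W O' k"
 have c: "?j : Sec F O'" "?k : Sec F O'"
  using F.rst_closed oV O' by blast+
 show ?thesis
 proof (rule N_local[OF O'(1)])
  fix x assume x: "x : O'"
  obtain Q where Q: "openin X Q" "x : Q" "Q <= V \<inter> W" "rst C V Q (cs V j) = rst C W Q (cs W k)"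
   using C.represents_eqD[OF repMD(3)[OF t(1)] repMD(3)[OF t(2)] _ _ eq[OF x]] x O' by blast
  have Qs: "Q <= V" "Q <= W" using Q by auto
  let ?S = "Q \<inter> O'"
  have S: "openin X ?S" "?S <= O'" "?S <= Q" "x : ?S" using Q x O' by auto
  have "rst F V Q j \<ominus>[F,Q] rst F W Q k : N 2 Q"
   using Q(4) C_rst[OF oV(1) Q(1) Qs(1) oV(3)] C_rst[OF oV(2) Q(1) Qs(2) oV(4)]
    cs_eq_iff[OF Q(1) F.rst_closed[OF oV(1) Q(1) Qs(1) oV(3)] F.rst_closed[OF oV(2) Q(1) Qs(2) oV(4)]] by simp
  from N_rst[OF Q(1) S(1,3) this]
  have "rst F V ?S j \<ominus>[F,?S] rst F W ?S k : N 2 ?S"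
   using F.F_rst_diff[OF Q(1) S(1,3) F.rst_closed[OF oV(1) Q(1) Qs(1) oV(3)] F.rst_closed[OF oV(2) Q(1) Qs(2) oV(4)]]
    F.rst_rst[OF oV(1) Q(1) S(1,3) Qs(1) oV(3)] F.rst_rst[OF oV(2) Q(1) S(1,3) Qs(2) oV(4)] by simp
  then have "rst F O' ?S (?j \<ominus>[F,O'] ?k) : N 2 ?S"
   using F.F_rst_diff[OF O'(1) S(1,2) c] F.rst_rst[OF oV(1) O'(1) S(1,2) O'(2) oV(3)]
    F.rst_rst[OF oV(2) O'(1) S(1,2) O'(3) oV(4)] by simp
  then show "EX W'. openin X W' & x : W' & W' <= O' & rst F O' W' (?j \<ominus>[F,O'] ?k) : N 2 W'"
   using S by blast
 qed (use c in simp)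
qed

lemma J_add: "[| openin X V; j : J V; k : J V |] ==> j \<oplus>[F,V] k : J V"
 using additive_subgroup.a_closed[OF ideal.axioms(1)[OF J_ideal]] .

lemma J_mult: "[| openin X V; s : Sec F V; k : J V |] ==> s \<otimes>[F,V] k : J V"
 using ideal.I_l_closed[OF J_ideal] by blast

lemma repM_add:
 assumes "repM t V j" "repM u V k" "V <= U"
 shows "repM (t \<oplus>[M,U] u) V (j \<oplus>[F,V] k)"
proof -
 have o: "openin X V" "j : J V" "k : J V" using assms repMD by blast+
 have "represents X C (germ_op X C (%V. add (sec C V)) U t u) V (cs V j \<oplus>[C,V] cs V k)"
 proof (rule C.germ_op_represents[OF repMD(3)[OF assms(1)] repMD(3)[OF assms(2)] assms(3)])
  show "s \<oplus>[C,V] t : Sec C V"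
   if h: "openin X V" "s : Sec C V" "t : Sec C V" for V s t
   using h(2,3) J_add[OF h(1)] unfolding C_carrier by (auto simp: C_add[OF h(1)] J_in)
  show "rst C V W (s \<oplus>[C,V] t) = rst C V W s \<oplus>[C,W] rst C V W t"
   if h: "openin X V" "openin X W" "W <= V" "s : Sec C V" "t : Sec C V" for V W s t
  proof -
   note h' = h
   obtain c d where c: "c : J V" "s = cs V c" "d : J V" "t = cs V d"
    using h'(4,5) unfolding C_carrier by auto
   have cc: "c : Sec F V" "d : Sec F V" using c J_in by auto
   show ?thesis using cc J_in[OF J_add[OF h'(1) c(1,3)]] F.rst_closed[OF h'(1-3)]
    unfolding c(2,4) by (simp add: C_add[OF h'(1)] C_add[OF h'(2)] C_rst[OF h'(1-3)] F.F_rst_add[OF h'(1-3)])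
  qed
 qed
 then show ?thesis
  using o J_add[OF o] unfolding repM_def M_simps by (simp add: C_add[OF o(1)] J_in)
qed

text \<open>Independence of all choices: two lifts of \<open>h\<close> differ by an element of
  \<open>J\<close>, two representatives by an element of the square. Writing
  \<open>S K - S' K'\<close> as \<open>(S - S') K + S' (K - K')\<close> puts both changes into the
  square.\<close>

lemma repM_smult:
 assumes t: "repM t V j" and V: "V <= U" and s: "s : Sec F V" "pj V s = restrict h V"
 shows "repM (h \<odot>[M,U] t) V (s \<otimes>[F,V] j)"
proof -
 have o: "openin X V" "j : J V" using t repMD by blast+
 have jc: "j : Sec F V" by (rule J_in[OF o(2)])
 have sj: "s \<otimes>[F,V] j : J V" by (rule J_mult[OF o(1) s(1) o(2)])
 have key: "germ X C x W (N 2 W +>\<^bsub>sec F W\<^esub> (s' \<otimes>[F,W] rst F V' W j')) = germ X C x V (cs V (s \<otimes>[F,V] j))"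
  if x: "x : V" and a: "(V', a) : t x" "j' : a" and W: "openin X W" "x : W" "W <= U \<inter> V'"
   and s': "s' : Sec F W" "pj W s' = restrict h W" for x V' a j' W s'
 proof -
  have "t x = germ X C x V (cs V j)" using repMD(3)[OF t] x unfolding represents_def by simp
  then have "(V', a) : germ X C x V (cs V j)" using a by simp
  then obtain Q where Q: "openin X V'" "a : Sec C V'" "openin X Q" "x : Q" "Q <= V \<inter> V'"
   "rst C V Q (cs V j) = rst C V' Q a" unfolding germ_def by auto
  obtain j2 where j2: "j2 : J V'" "a = cs V' j2" using Q(2) unfolding C_carrier by auto
  have j'd: "j' : Sec F V'" "j' \<ominus>[F,V'] j2 : N 2 V'"
   using a(2) unfolding j2(2) cs_mem[OF Q(1) J_in[OF j2(1)]] by auto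
  interpret A': ring "sec F V'" by (rule F.F_ring[OF Q(1)])
  have aj': "a = cs V' j'" unfolding j2(2) using cs_eq_iff[OF Q(1) j'd(1) J_in[OF j2(1)]] j'd(2) by simp
  have j'J: "j' : J V'"
  proof -
   have "j' \<ominus>[F,V'] j2 : J V'" using N_J[OF Q(1), of _ 1] j'd(2) by (simp add: numeral_2_eq_2)
   from J_add[OF Q(1) j2(1) this] show ?thesis using A'.diff_add[OF j'd(1) J_in[OF j2(1)]] by simp
  qed
  let ?O = "Q \<inter> W"
  have O': "openin X ?O" "x : ?O" "?O <= V" "?O <= V'" "?O <= Q" "?O <= W" "W <= V'" "Q <= V" "Q <= V'" using Q W by auto
  interpret A: ring "sec F ?O" by (rule F.F_ring[OF O'(1)])
  have "rst F V Q j \<ominus>[F,Q] rst F V' Q j' : N 2 Q"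
   using Q(6) unfolding aj' C_rst[OF o(1) Q(3) O'(8) jc] C_rst[OF Q(1,3) O'(9) j'd(1)]
   using cs_eq_iff[OF Q(3) F.rst_closed[OF o(1) Q(3) O'(8) jc] F.rst_closed[OF Q(1,3) O'(9) j'd(1)]] by simp
  from N_rst[OF Q(3) O'(1,5) this]
  have jj: "rst F V ?O j \<ominus>[F,?O] rst F V' ?O j' : N 2 ?O"
   using F.F_rst_diff[OF Q(3) O'(1,5) F.rst_closed[OF o(1) Q(3) O'(8) jc] F.rst_closed[OF Q(1,3) O'(9) j'd(1)]]
    F.rst_rst[OF o(1) Q(3) O'(1,5,8) jc] F.rst_rst[OF Q(1,3) O'(1,5,9) j'd(1)] by simp
  define S S' K K' where d: "S = rst F V ?O s" "S' = rst F W ?O s'" "K = rst F V ?O j" "K' = rst F V' ?O j'"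
  have c: "S : Sec F ?O" "S' : Sec F ?O" "K : Sec F ?O" "K' : Sec F ?O"
   unfolding d using F.rst_closed[OF o(1) O'(1,3) s(1)] F.rst_closed[OF W(1) O'(1,6) s'(1)]
    F.rst_closed[OF o(1) O'(1,3) jc] F.rst_closed[OF Q(1) O'(1,4) j'd(1)] by simp_all
  have "pj ?O S = pj ?O S'"
   unfolding d pj_rst[OF o(1) O'(1,3) s(1)] pj_rst[OF W(1) O'(1,6) s'(1)] s(2) s'(2)
   using O'(3,6) by (simp add: restrict_restrict Int_absorb1)
  then have "S \<ominus>[F,?O] S' : N 1 ?O" using pj_diff_J[OF O'(1) c(1,2)] N_1[OF O'(1)] by simp
  moreover have "K : N 1 ?O" unfolding d N_1[OF O'(1)] by (rule J_rst[OF o(1) O'(1,3) o(2)])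
  ultimately have "(S \<ominus>[F,?O] S') \<otimes>[F,?O] K : N (1 + 1) ?O" by (rule N_mult[OF O'(1)])
  then have 1: "(S \<ominus>[F,?O] S') \<otimes>[F,?O] K : N 2 ?O" by (simp only: one_add_one)
  have "S' \<otimes>[F,?O] (K \<ominus>[F,?O] K') : N (0 + 2) ?O"
   by (rule N_mult[OF O'(1)]) (use N_0[OF O'(1)] c jj d in simp_all)
  then have "(S \<ominus>[F,?O] S') \<otimes>[F,?O] K \<oplus>[F,?O] S' \<otimes>[F,?O] (K \<ominus>[F,?O] K') : N 2 ?O"
   unfolding add_0 by (rule N_add[OF O'(1) 1])
  moreover have "(S \<ominus>[F,?O] S') \<otimes>[F,?O] K \<oplus>[F,?O] S' \<otimes>[F,?O] (K \<ominus>[F,?O] K')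
    = (S \<otimes>[F,?O] K \<ominus>[F,?O] S' \<otimes>[F,?O] K) \<oplus>[F,?O] (S' \<otimes>[F,?O] K \<ominus>[F,?O] S' \<otimes>[F,?O] K')"
   using c by (simp add: a_minus_def A.l_distr A.r_distr A.l_minus A.r_minus)
  moreover have "... = S \<otimes>[F,?O] K \<ominus>[F,?O] S' \<otimes>[F,?O] K'" using c by (intro A.diff_add_diff) simp_all
  ultimately have "S \<otimes>[F,?O] K \<ominus>[F,?O] S' \<otimes>[F,?O] K' : N 2 ?O" by simp
  then have "cs ?O (S \<otimes>[F,?O] K) = cs ?O (S' \<otimes>[F,?O] K')"
   using cs_eq_iff[OF O'(1)] c by simp
  moreover have 2: "rst F V ?O (s \<otimes>[F,V] j) = S \<otimes>[F,?O] K"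
   unfolding d by (rule F.F_rst_mult[OF o(1) O'(1,3) s(1) jc])
  moreover have j'W: "rst F V' W j' : J W" by (rule J_rst[OF Q(1) W(1) O'(7) j'J])
  moreover have 3: "rst F W ?O (s' \<otimes>[F,W] rst F V' W j') = S' \<otimes>[F,?O] K'"
   unfolding d using F.F_rst_mult[OF W(1) O'(1,6) s'(1) J_in[OF j'W]] F.rst_rst[OF Q(1) W(1) O'(1,6,7) j'd(1)] by simp
  ultimately have e: "rst C W ?O (cs W (s' \<otimes>[F,W] rst F V' W j')) = rst C V ?O (cs V (s \<otimes>[F,V] j))"
   using C_rst[OF W(1) O'(1,6) J_in[OF J_mult[OF W(1) s'(1) j'W]]] C_rst[OF o(1) O'(1,3) J_in[OF sj]] by simp
  show ?thesis
   unfolding cs_def[symmetric]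
   by (rule C.germ_eqI[OF W(1) o(1) _ _ O'(1,2) _ e])
    (use J_mult[OF W(1) s'(1) j'W] sj O' in \<open>auto simp: C_carrier\<close>)
 qed
 have "conormal_smult \<XX> U h t x = germ X C x V (cs V (s \<otimes>[F,V] j))" if x: "x : V" for x
 proof (rule equalityI)
  have xU: "x : U" using x V by auto
  show "conormal_smult \<XX> U h t x <= germ X C x V (cs V (s \<otimes>[F,V] j))"
  proof
   fix y assume "y : conormal_smult \<XX> U h t x"
   then obtain V' a j' W s' where w: "(V', a) : t x" "j' : a" "openin X W" "x : W" "W <= U \<inter> V'"
    "s' : Sec F W" "pj W s' = restrict h W"
    "y : germ X C x W (N 2 W +>\<^bsub>sec F W\<^esub> (s' \<otimes>[F,W] rst F V' W j'))"
    unfolding conormal_smult_def using xU by auto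
   then show "y : germ X C x V (cs V (s \<otimes>[F,V] j))" using key[OF x w(1-7)] by simp
  qed
  have tx: "t x = germ X C x V (cs V j)" using repMD(3)[OF t] x unfolding represents_def by simp
  have w1: "(V, cs V j) : t x" unfolding tx using C.germ_self[OF o(1) x] o(2) by (simp add: C_carrier)
  interpret A: ring "sec F V" by (rule F.F_ring[OF o(1)])
  have w2: "j : cs V j" using cs_mem[OF o(1) jc, of j] jc N_zero[OF o(1)] by (simp add: A.diff_zero_iff[THEN iffD2])
  have "germ X C x V (N 2 V +>\<^bsub>sec F V\<^esub> (s \<otimes>[F,V] rst F V V j)) <= conormal_smult \<XX> U h t x"
  proof
   fix y assume y: "y : germ X C x V (N 2 V +>\<^bsub>sec F V\<^esub> (s \<otimes>[F,V] rst F V V j))"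
   show "y : conormal_smult \<XX> U h t x"
    unfolding conormal_smult_def restrict_apply'[OF xU]
    by (rule UN_I[OF w1], unfold prod.case, rule UN_I[OF w2], rule UN_I[of V], use o(1) x V in simp,
      rule UN_I[of s], use s in simp, rule y)
  qed
  then show "germ X C x V (cs V (s \<otimes>[F,V] j)) <= conormal_smult \<XX> U h t x"
   unfolding cs_def F.rst_id[OF o(1) jc] .
 qed
 then show ?thesis unfolding repM_def M_simps represents_def using o sj by (simp add: C_carrier)
qed

lemma M_op_ext: "t \<oplus>[M,U] u : extensional U" "h \<odot>[M,U] t : extensional U"
 unfolding M_simps germ_op_def conormal_smult_def by simp_all

lemma repM_lift:
 assumes U: "openin X U" and t: "t : Sec M U" and h: "h : Sec R U" and x: "x : U"
 obtains V j s where "x : V" "V <= U" "repM t V j" "s : Sec F V" "pj V s = restrict h V"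
proof -
 obtain V j where V: "x : V" "V <= U" "repM t V j" using repM_ex[OF t x] .
 obtain W s where W: "openin X W" "x : W" "W <= U" "s : Sec F W" "pj W s = restrict h W"
  using pj_lift[OF U h x] .
 let ?O = "V \<inter> W"
 have o: "openin X ?O" "?O <= V" "?O <= W" "?O <= U" "x : ?O" using V W repMD(1)[OF V(3)] by auto
 have "pj ?O (rst F W ?O s) = restrict h ?O"
  unfolding pj_rst[OF W(1) o(1,3) W(4)] W(5) using o(3) by (simp add: restrict_restrict Int_absorb1)
 then show thesis using that[OF o(5,4) repM_rst[OF V(3) o(1,2)] F.rst_closed[OF W(1) o(1,3) W(4)]] by simp
qed

lemma M_add_in:
 assumes "t : Sec M U" "u : Sec M U"
 shows "t \<oplus>[M,U] u : Sec M U"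
proof (rule M_mem[OF M_op_ext(1)])
 fix x assume x: "x : U"
 obtain V j where V: "x : V" "V <= U" "repM t V j" using repM_ex[OF assms(1) x] .
 obtain W k where W: "x : W" "W <= U" "repM u W k" using repM_ex[OF assms(2) x] .
 let ?O = "V \<inter> W"
 have o: "openin X ?O" "?O <= V" "?O <= W" "?O <= U" "x : ?O" using V W repMD(1)[OF V(3)] repMD(1)[OF W(3)] by auto
 show "EX V j. x : V & V <= U & repM (t \<oplus>[M,U] u) V j"
  using repM_add[OF repM_rst[OF V(3) o(1,2)] repM_rst[OF W(3) o(1,3)] o(4)] o by blast
qed

lemma M_smult_in:
 assumes "openin X U" "h : Sec R U" "t : Sec M U"
 shows "h \<odot>[M,U] t : Sec M U"
proof (rule M_mem[OF M_op_ext(2)])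
 fix x assume x: "x : U"
 obtain V j s where V: "x : V" "V <= U" "repM t V j" "s : Sec F V" "pj V s = restrict h V"
  using repM_lift[OF assms(1,3,2) x] .
 show "EX V j. x : V & V <= U & repM (h \<odot>[M,U] t) V j"
  using repM_smult[OF V(3,2,4,5)] V by blast
qed

lemma N_self: "[| openin X U; s : Sec F U |] ==> s \<ominus>[F,U] s : N l U"
 using N_zero ring.diff_zero_iff[OF F.F_ring] by metis

lemma M_rst_in:
 assumes "openin X V" "V <= U" "t : Sec M U"
 shows "restrict t V : Sec M V"
proof (rule M_mem)
 fix x assume x: "x : V"
 then have "x : U" using assms by auto
 obtain W k where W: "x : W" "W <= U" "repM t W k" using repM_ex[OF assms(3) \<open>x : U\<close>] .
 let ?O = "V \<inter> W"
 have o: "openin X ?O" "?O <= V" "?O <= W" "x : ?O" using x W repMD(1)[OF W(3)] assms by auto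
 show "EX W j. x : W & W <= V & repM (restrict t V) W j"
  using repM_restrict[OF repM_rst[OF W(3) o(1,3)] o(2)] o by blast
qed simp

lemma cc_repM:
 assumes "openin X U" "j : J U"
 shows "repM (cc U j) U j"
 unfolding repM_def conormal_class_def cs_def[symmetric]
 using assms C.germ_section_represents[of U "cs U j"] by (simp add: C_carrier)

lemma cc_in:
 assumes "openin X U" "j : J U"
 shows "cc U j : Sec M U"
 by (rule M_mem) (use cc_repM[OF assms] in \<open>auto simp: conormal_class_def germ_section_def\<close>)

lemma cc_eqI:
 assumes "t : extensional U" "repM t U j"
 shows "t = cc U j"
 unfolding conormal_class_def cs_def[symmetric]
 by (rule C.germ_section_eqI[OF assms(1) repMD(3)[OF assms(2)]])

lemma cc_ext: "cc U j : extensional U"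
 unfolding conormal_class_def germ_section_def by simp

lemma M_exterior_base: "exterior_base X R M"
proof (rule exterior_baseI)
 show "is_presheaf X M"
  unfolding is_presheaf_def
 proof (intro conjI allI impI ballI funcsetI)
  fix U V t assume "openin X U & openin X V & V <= U" "t : Sec M U"
  then show "rst M U V t : Sec M V" unfolding M_simps(5) by (intro M_rst_in) simp_all
 next
  fix U t assume "openin X U" "t : Sec M U"
  then show "rst M U U t = t" unfolding M_simps(5) by (intro extensional_restrict M_ext)
 next
  fix U V W t assume "openin X U & openin X V & openin X W & W <= V & V <= U" "t : Sec M U"
  then show "rst M V W (rst M U V t) = rst M U W t" unfolding M_simps(5) by (simp add: restrict_restrict Int_absorb1)
 qed
 fix U assume U: "openin X U"
 show "Sec M U ~= {}"
  using cc_in[OF U, of "\<zero>[F,U]"] N_zero[OF U, of 1] N_1[OF U] by auto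
 fix m n f assume m: "m : Sec M U"
 show "m \<oplus>[M,U] n : Sec M U" if "n : Sec M U" using M_add_in[OF m that] .
 show "f \<odot>[M,U] m : Sec M U" if "f : Sec R U" using M_smult_in[OF U that m] .
 fix V assume V: "openin X V" "V <= U"
 show "rst M U V (m \<oplus>[M,U] n) = rst M U V m \<oplus>[M,V] rst M U V n" if n: "n : Sec M U"
  unfolding M_simps(5)
 proof (rule M_eqI)
  show "restrict (m \<oplus>[M,U] n) V : extensional V" by simp
  show "restrict m V \<oplus>[M,V] restrict n V : extensional V" by (rule M_op_ext(1))
  fix x assume x: "x : V"
  then have xU: "x : U" using V by auto
  obtain A j where A: "x : A" "A <= U" "repM m A j" using repM_ex[OF m xU] .
  obtain B k where B: "x : B" "B <= U" "repM n B k" using repM_ex[OF n xU] .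
  let ?O = "A \<inter> B \<inter> V"
  have o: "openin X ?O" "?O <= A" "?O <= B" "?O <= V" "?O <= U" "x : ?O"
   using A B V x repMD(1)[OF A(3)] repMD(1)[OF B(3)] by auto
  note rm = repM_rst[OF A(3) o(1,2)] and rn = repM_rst[OF B(3) o(1,3)]
  note r1 = repM_restrict[OF repM_add[OF rm rn o(5)] o(4)]
  note r2 = repM_add[OF repM_restrict[OF rm o(4)] repM_restrict[OF rn o(4)] o(4)]
  show "EX W j k. x : W & repM (restrict (m \<oplus>[M,U] n) V) W j &
    repM (restrict m V \<oplus>[M,V] restrict n V) W k & j \<ominus>[F,W] k : N 2 W"
   using r1 r2 o(6) N_self[OF o(1) J_in[OF repMD(2)[OF r1]]] by blast
 qed
 show "rst M U V (f \<odot>[M,U] m) = restrict f V \<odot>[M,V] rst M U V m" if f: "f : Sec R U"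
  unfolding M_simps(5)
 proof (rule M_eqI)
  show "restrict (f \<odot>[M,U] m) V : extensional V" by simp
  show "restrict f V \<odot>[M,V] restrict m V : extensional V" by (rule M_op_ext(2))
  fix x assume x: "x : V"
  then have xU: "x : U" using V by auto
  obtain A j s where A: "x : A" "A <= U" "repM m A j" "s : Sec F A" "pj A s = restrict f A"
   using repM_lift[OF U m f xU] .
  let ?O = "A \<inter> V"
  have o: "openin X ?O" "?O <= A" "?O <= V" "?O <= U" "x : ?O"
   using A V x repMD(1)[OF A(3)] by auto
  note rm = repM_rst[OF A(3) o(1,2)]
  have sr: "rst F A ?O s : Sec F ?O" by (rule F.rst_closed[OF repMD(1)[OF A(3)] o(1,2) A(4)])
  have p: "pj ?O (rst F A ?O s) = restrict f ?O"
   unfolding pj_rst[OF repMD(1)[OF A(3)] o(1,2) A(4)] A(5) using o(2) by (simp add: restrict_restrict Int_absorb1)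
  have p': "pj ?O (rst F A ?O s) = restrict (restrict f V) ?O"
   unfolding p using o(3) by (simp add: restrict_restrict Int_absorb1)
  note r1 = repM_restrict[OF repM_smult[OF rm o(4) sr p] o(3)]
  note r2 = repM_smult[OF repM_restrict[OF rm o(3)] o(3) sr p']
  show "EX W j k. x : W & repM (restrict (f \<odot>[M,U] m) V) W j &
    repM (restrict f V \<odot>[M,V] restrict m V) W k & j \<ominus>[F,W] k : N 2 W"
   using r1 r2 o(5) N_self[OF o(1) J_in[OF repMD(2)[OF r1]]] by blast
 qed
qed

sublocale MB: exterior_base X R M by (rule M_exterior_base)

text \<open>The module law behind the Leibniz rule of the Euler derivation, where the derivative of
  the scalar is zero; compare \<open>euler_exterior_der\<close>.\<close>

lemma M_zero_smult:
 assumes U: "openin X U" and m: "m : Sec M U" and n: "n : Sec M U"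
 shows "\<zero>[R,U] \<odot>[M,U] m \<oplus>[M,U] n = n"
proof (rule M_eqI[OF M_op_ext(1) M_ext[OF n]])
 fix x assume x: "x : U"
 obtain A j where A: "x : A" "A <= U" "repM m A j" using repM_ex[OF m x] .
 obtain B k where B: "x : B" "B <= U" "repM n B k" using repM_ex[OF n x] .
 let ?O = "A \<inter> B"
 have o: "openin X ?O" "?O <= A" "?O <= B" "?O <= U" "x : ?O"
  using A B repMD(1)[OF A(3)] repMD(1)[OF B(3)] by auto
 interpret S: ring "sec F ?O" by (rule F.F_ring[OF o(1)])
 note rm = repM_rst[OF A(3) o(1,2)] and rn = repM_rst[OF B(3) o(1,3)]
 have p: "pj ?O \<zero>[F,?O] = restrict \<zero>[R,U] ?O"
 proof -
  have "\<zero>[F,?O] : J ?O" using N_zero[OF o(1), of 1] unfolding N_1[OF o(1)] .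
  then have "pj ?O \<zero>[F,?O] = \<zero>[R,?O]" unfolding J_iff by simp
  also have "... = restrict \<zero>[R,U] ?O" using o(4) unfolding R_simps by (auto simp: restrict_def fun_eq_iff)
  finally show ?thesis .
 qed
 have r: "repM (\<zero>[R,U] \<odot>[M,U] m \<oplus>[M,U] n) ?O
   (\<zero>[F,?O] \<otimes>[F,?O] rst F A ?O j \<oplus>[F,?O] rst F B ?O k)"
  by (rule repM_add[OF repM_smult[OF rm o(4) S.zero_closed p] rn o(4)])
 have "\<zero>[F,?O] \<otimes>[F,?O] rst F A ?O j \<oplus>[F,?O] rst F B ?O k = rst F B ?O k"
  using J_in[OF repMD(2)[OF rm]] J_in[OF repMD(2)[OF rn]] by simp
 then show "EX W j k. x : W & repM (\<zero>[R,U] \<odot>[M,U] m \<oplus>[M,U] n) W j & repM n W k & j \<ominus>[F,W] k : N 2 W"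
  using r rn o(5) N_self[OF o(1) J_in[OF repMD(2)[OF rn]]] by metis
qed

end

section \<open>Eigenlifts\<close>

lemma (in ring) eigen_step:
 assumes "e : carrier R" "l : carrier R" "p : carrier R" "q : carrier R"
 shows "((e \<oplus> l) \<ominus> p) \<ominus> (l \<ominus> q) = \<ominus> (p \<ominus> (e \<oplus> q))"
proof -
 have "((e \<oplus> l) \<ominus> p) \<ominus> (l \<ominus> q) = ((e \<oplus> q) \<ominus> p) \<oplus> (l \<oplus> \<ominus> l)"
  using assms by (simp add: a_minus_def minus_add a_ac)
 also have "... = (e \<oplus> q) \<ominus> p" using assms by (simp add: r_neg)
 finally show ?thesis using assms by (simp add: diff_swap)
qed

lemma (in even_derivation) D_ppart:
 assumes "s : carrier A"
 shows "D (ppart A p s) = ppart A p (D s)"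
proof -
 have "D s = D (ppart A False s) \<oplus> D (ppart A True s)"
  using D_add[of "ppart A False s" "ppart A True s"] ppart_decompose(1)[OF assms] assms by simp
 then show ?thesis
  using ppart_eqI[OF D_part[OF ppart_in[OF assms]] D_part[OF ppart_in[OF assms]]] by (cases p) simp_all
qed

lemma (in superalgebra) sm_diff: "s : carrier A ==> a \<odot> s \<ominus> b \<odot> s = (a - b) \<odot> s"
 using sm_plus[of s a "- b"] sm_neg[of s b] by (simp add: a_minus_def)

context supermanifold
begin

definition nilpotent_on :: "nat => 'x set => bool" where
 "nilpotent_on K U \<longleftrightarrow> (ALL V t. openin X V & V <= U & t : N K V --> t = \<zero>[F,V])"

lemma nilpotent_onD: "[| nilpotent_on K U; openin X V; V <= U; t : N K V |] ==> t = \<zero>[F,V]"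
 unfolding nilpotent_on_def by blast

lemma locally_nilpotent_on:
 assumes "x : topspace X"
 obtains U K where "openin X U" "x : U" "nilpotent_on K U"
proof (rule locally_nilpotent[OF assms])
 fix U K assume U: "openin X U" "x : U" "!!V t. [| openin X V; V <= U; t : N K V |] ==> t = \<zero>[F,V]"
 show thesis by (rule that[OF U(1,2)]) (unfold nilpotent_on_def, use U(3) in blast)
qed

text \<open>On the power \<open>m\<close> the derivation acts as \<open>m\<close> modulo the next
  power. For an eigenvector of eigenvalue \<open>l < m\<close> the difference \<open>l - m\<close>
  is invertible, so the vector lies in the next power as well. It thus lies in every power, and some
  power vanishes near each point.\<close>

lemma euler_zero:
 assumes EL: "euler_lift U D" and V: "openin X V" "V <= U" and s: "s : N (Suc l) V"
  and eig: "D V s = of_nat l \<odot>[F,V] s"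
 shows "s = \<zero>[F,V]"
proof -
 interpret even_derivation "sec F V" "D V" by (rule eulerD(6)[OF EL V])
 have sc: "s : Sec F V" by (rule N_in[OF s])
 have Nm: "s : N (Suc l + k) V" for k
 proof (induction k)
  case 0
  then show ?case using s by simp
 next
  case (Suc k)
  define d :: complex where "d = of_nat l - of_nat (Suc l + k)"
  have d: "d ~= 0" unfolding d_def by (simp only: right_minus_eq of_nat_eq_iff)
  have "D V s \<ominus>[F,V] of_nat (Suc l + k) \<odot>[F,V] s : N (Suc (Suc l + k)) V" by (rule euler_grade[OF EL V Suc])
  then have "d \<odot>[F,V] s : N (Suc (Suc l + k)) V" unfolding eig sm_diff[OF sc] d_def .
  from N_smult[OF V(1) this, of "1 / d"] have "s : N (Suc (Suc l + k)) V"
   using d by (simp add: sm_times[OF sc] sm_1[OF sc])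
  then show ?case by simp
 qed
 show ?thesis
 proof (rule F.separated[OF V(1) sc zero_closed])
  fix x assume x: "x : V"
  then have "x : topspace X" using openin_subset[OF V(1)] by auto
  then obtain U' K where U': "openin X U'" "x : U'" and nil: "nilpotent_on K U'"
   by (rule locally_nilpotent_on)
  let ?O = "V \<inter> U'"
  have o: "openin X ?O" "?O <= V" "?O <= U'" "x : ?O" using V U' x by auto
  have "s : N K V" using N_mono[OF V(1) _ Nm[of K], of K] by simp
  then have "rst F V ?O s = \<zero>[F,?O]" using nilpotent_onD[OF nil o(1,3) N_rst[OF V(1) o(1,2)]] by simp
  then show "EX W. openin X W & x : W & W <= V & rst F V W s = rst F V W \<zero>[F,V]"
   using o F.F_rst_zero[OF V(1) o(1,2)] by (intro exI[of _ ?O]) simp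
 qed
qed

text \<open>Successive approximation to an eigenvector. If the error \<open>e = D u - l u\<close>
  lies in the power \<open>m\<close>, subtracting \<open>e / (m - l)\<close> from \<open>u\<close>
  replaces the error by a multiple of \<open>D e - m e\<close>, which lies in the next power. After
  \<open>K\<close> steps the error is zero.\<close>

lemma euler_correct:
 assumes EL: "euler_lift U D" and V: "openin X V" "V <= U" and s: "s : N l V"
  and nil: "!!t. t : N K V ==> t = \<zero>[F,V]"
 shows "EX s':N l V. s' \<ominus>[F,V] s : N (Suc l) V & D V s' = of_nat l \<odot>[F,V] s'"
proof -
 interpret even_derivation "sec F V" "D V" by (rule eulerD(6)[OF EL V])
 have "EX u:N l V. u \<ominus>[F,V] s : N (Suc l) V & D V u \<ominus>[F,V] of_nat l \<odot>[F,V] u : N (Suc l + k) V" for k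
 proof (induction k)
  case 0
  show ?case using s euler_grade[OF EL V s] N_self[OF V(1) N_in[OF s]] by (intro bexI[of _ s]) simp_all
 next
  case (Suc k)
  let ?m = "Suc l + k"
  \<comment> \<open>\<open>a\<close> is the eigenvalue sought and \<open>b\<close> the one with
    which \<open>D\<close> acts on the error; \<open>c\<close> is chosen so that
    \<open>c * b = 1 + c * a\<close>.\<close>
  define a b c :: complex where "a = of_nat l" and "b = of_nat ?m" and "c = 1 / (b - a)"
  have "b - a ~= 0" unfolding a_def b_def by (simp only: right_minus_eq of_nat_eq_iff)
  then have "c * (b - a) = 1" unfolding c_def by simp
  then have cm: "c * b = 1 + c * a" by (simp add: algebra_simps)
  obtain u where u: "u : N l V" "u \<ominus>[F,V] s : N (Suc l) V"
   "D V u \<ominus>[F,V] of_nat l \<odot>[F,V] u : N ?m V" using Suc.IH by blast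
  define e where "e = D V u \<ominus>[F,V] a \<odot>[F,V] u"
  have e: "e : N ?m V" using u(3) unfolding e_def a_def .
  have cc: "s : Sec F V" "u : Sec F V" "e : Sec F V"
   using N_in s u(1) e by blast+
  have Du: "D V u = e \<oplus>[F,V] a \<odot>[F,V] u"
   unfolding e_def using cc by (simp add: a_minus_def a_assoc l_neg)
  have ce: "c \<odot>[F,V] e : N ?m V" by (rule N_smult[OF V(1) e])
  let ?u = "u \<ominus>[F,V] c \<odot>[F,V] e"
  have 1: "?u : N l V" using N_diff[OF V(1) u(1) N_mono[OF V(1) _ ce]] by simp
  have "?u \<ominus>[F,V] s = (u \<ominus>[F,V] s) \<ominus>[F,V] c \<odot>[F,V] e"
   using cc by (simp add: a_minus_def a_ac)
  then have 2: "?u \<ominus>[F,V] s : N (Suc l) V" using N_diff[OF V(1) u(2) N_mono[OF V(1) _ ce, of "Suc l"]] by simp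
  have "c \<odot>[F,V] (b \<odot>[F,V] e) = e \<oplus>[F,V] c \<odot>[F,V] (a \<odot>[F,V] e)"
   using cc(3) cm sm_times[OF cc(3)] sm_plus[OF cc(3), of 1 "c * a"] by simp
  then have "c \<odot>[F,V] (D V e \<ominus>[F,V] b \<odot>[F,V] e) =
    c \<odot>[F,V] D V e \<ominus>[F,V] (e \<oplus>[F,V] c \<odot>[F,V] (a \<odot>[F,V] e))"
   using cc by (simp add: a_minus_def sm_add sm_minus)
  moreover have "a \<odot>[F,V] ?u = a \<odot>[F,V] u \<ominus>[F,V] c \<odot>[F,V] (a \<odot>[F,V] e)"
   using cc by (simp add: a_minus_def sm_add sm_minus sm_times mult.commute)
  moreover have "D V ?u = (e \<oplus>[F,V] a \<odot>[F,V] u) \<ominus>[F,V] c \<odot>[F,V] D V e"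
   using cc by (simp only: D_diff D_smult Du sm_closed)
  ultimately have "D V ?u \<ominus>[F,V] a \<odot>[F,V] ?u =
    \<ominus>[F,V] (c \<odot>[F,V] (D V e \<ominus>[F,V] b \<odot>[F,V] e))"
   using cc eigen_step[of e "a \<odot>[F,V] u" "c \<odot>[F,V] D V e" "c \<odot>[F,V] (a \<odot>[F,V] e)"]
   by (simp only: sm_closed D_closed)
  then have 3: "D V ?u \<ominus>[F,V] of_nat l \<odot>[F,V] ?u : N (Suc ?m) V"
   using N_neg[OF V(1) N_smult[OF V(1) euler_grade[OF EL V e]], of c] unfolding a_def b_def by (simp only:)
  show ?case using 1 2 3 by (intro bexI[of _ ?u]) simp_all
 qed
 from this[of K] obtain u where u: "u : N l V" "u \<ominus>[F,V] s : N (Suc l) V"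
  "D V u \<ominus>[F,V] of_nat l \<odot>[F,V] u : N (Suc l + K) V" by blast
 have uc: "u : Sec F V" by (rule N_in[OF u(1)])
 have "D V u \<ominus>[F,V] of_nat l \<odot>[F,V] u = \<zero>[F,V]"
  by (rule nil[OF N_mono[OF V(1) _ u(3)]]) simp
 then have "D V u = of_nat l \<odot>[F,V] u" using uc by (simp add: diff_zero_iff)
 then show ?thesis using u by blast
qed

lemma repM_class:
 assumes "repM t V j" "k : J V" "k \<ominus>[F,V] j : N 2 V"
 shows "repM t V k"
proof -
 have "cs V k = cs V j" using cs_eq_iff[OF repMD(1)[OF assms(1)]] J_in repMD(2) assms by metis
 then show ?thesis using assms unfolding repM_def by simp
qed

lemma repM_local:
 assumes V: "openin X V" and j: "j : J V"
  and h: "!!x. x : V ==> EX W. openin X W & x : W & W <= V & repM t W (rst F V W j)"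
 shows "repM t V j"
 unfolding repM_def represents_def
proof (intro conjI ballI V j)
 show "cs V j : Sec C V" using j unfolding C_carrier by simp
 fix x assume x: "x : V"
 from h[OF this] obtain W where W: "openin X W" "x : W" "W <= V" "repM t W (rst F V W j)" by metis
 have "t x = germ X C x W (cs W (rst F V W j))" using repMD(3)[OF W(4)] W(2) unfolding represents_def by simp
 also have "... = germ X C x V (cs V j)"
  using C.germ_rst[OF V W(1,3,2), of "cs V j"] j unfolding C_rst[OF V W(1,3) J_in[OF j], symmetric]
  by (simp add: C_carrier)
 finally show "t x = germ X C x V (cs V j)" .
qed

text \<open>Two lifts of \<open>h\<close> differ by an element of \<open>J\<close>, so
  \<open>euler_zero\<close> with eigenvalue 0 gives uniqueness. Locally any lift is corrected by
  \<open>euler_correct\<close>, and uniqueness makes the corrected lifts glue.\<close>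

lemma sig_ex1:
 assumes EL: "euler_lift U D" and V: "openin X V" "V <= U" and h: "h : Sec R V"
 shows "EX! s. s : Sec F V & D V s = \<zero>[F,V] & pj V s = h"
proof -
 have un: "s = s'" if W: "openin X W" "W <= V" and s: "s : Sec F W" "s' : Sec F W"
   "D W s = \<zero>[F,W]" "D W s' = \<zero>[F,W]" "pj W s = pj W s'" for W s s'
 proof -
  have WU: "W <= U" using W V by auto
  interpret even_derivation "sec F W" "D W" by (rule eulerD(6)[OF EL W(1) WU])
  have "s \<ominus>[F,W] s' : N (Suc 0) W" using pj_diff_J[OF W(1) s(1,2)] s(5) N_1[OF W(1)] by simp
  moreover have "D W (s \<ominus>[F,W] s') = of_nat 0 \<odot>[F,W] (s \<ominus>[F,W] s')"
   using s by (simp add: D_diff) (simp add: a_minus_def)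
  ultimately have "s \<ominus>[F,W] s' = \<zero>[F,W]" by (rule euler_zero[OF EL W(1) WU])
  then show ?thesis using diff_zero_iff[OF s(1,2)] by simp
 qed
 have ex: "EX W s. openin X W & x : W & W <= V & s : Sec F W &
   (D W s = \<zero>[F,W] & pj W s = restrict h W)" if x: "x : V" for x
 proof -
  obtain A s where A: "openin X A" "x : A" "A <= V" "s : Sec F A" "pj A s = restrict h A"
   using pj_lift[OF V(1) h x] .
  have "x : topspace X" using openin_subset[OF V(1)] x by auto
  then obtain U' K where U': "openin X U'" "x : U'" and nil: "nilpotent_on K U'"
   by (rule locally_nilpotent_on)
  let ?O = "A \<inter> U'"
  have o: "openin X ?O" "?O <= A" "?O <= U'" "x : ?O" "?O <= V" "?O <= U" using V A U' x by auto
  interpret S: superalgebra "sec F ?O" by (rule F.F_super[OF o(1)])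
  have s: "rst F A ?O s : Sec F ?O" by (rule F.rst_closed[OF A(1) o(1,2) A(4)])
  then obtain s' where s': "s' : N 0 ?O" "s' \<ominus>[F,?O] rst F A ?O s : N (Suc 0) ?O" "D ?O s' = of_nat 0 \<odot>[F,?O] s'"
   using euler_correct[OF EL o(1,6) _ nilpotent_onD[OF nil o(1,3)], of "rst F A ?O s" 0] N_0[OF o(1)] by blast
  have s'c: "s' : Sec F ?O" by (rule N_in[OF s'(1)])
  have "pj ?O s' = pj ?O (rst F A ?O s)" using s'(2) pj_diff_J[OF o(1) s'c s] N_1[OF o(1)] by simp
  also have "... = restrict h ?O"
   unfolding pj_rst[OF A(1) o(1,2) A(4)] A(5) using o(2) by (simp add: restrict_restrict Int_absorb1)
  finally have "pj ?O s' = restrict h ?O" .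
  moreover have "D ?O s' = \<zero>[F,?O]" using s'(3) s'c by simp
  ultimately show ?thesis using o s'c by blast
 qed
 have "EX! t. t : Sec F V & (ALL W s. openin X W & W <= V & s : Sec F W &
   (D W s = \<zero>[F,W] & pj W s = restrict h W) --> rst F V W t = s)"
 proof (rule F.glue_unique[OF V(1) ex])
  fix W W' s assume W: "openin X W" "openin X W'" "W' <= W" "W <= V" "s : Sec F W"
   "D W s = \<zero>[F,W] & pj W s = restrict h W"
  have WU: "W <= U" using W V by auto
  show "D W' (rst F W W' s) = \<zero>[F,W'] & pj W' (rst F W W' s) = restrict h W'"
  proof
   show "D W' (rst F W W' s) = \<zero>[F,W']"
    unfolding eulerD(5)[OF EL W(1-3) WU W(5)] conjunct1[OF W(6)] by (rule F.F_rst_zero[OF W(1-3)])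
   show "pj W' (rst F W W' s) = restrict h W'"
    unfolding pj_rst[OF W(1-3,5)] conjunct2[OF W(6)] restrict_restrict Int_absorb1[OF W(3)] ..
  qed
 next
  fix W s s' assume W: "openin X W" "W <= V" "s : Sec F W" "s' : Sec F W"
   and "D W s = \<zero>[F,W] & pj W s = restrict h W" "D W s' = \<zero>[F,W] & pj W s' = restrict h W"
  then have "D W s = \<zero>[F,W]" "D W s' = \<zero>[F,W]" "pj W s = pj W s'" by (simp_all only:)
  then show "s = s'" by (rule un[OF W])
 qed
 then obtain t where t: "t : Sec F V" "!!W s. [| openin X W; W <= V; s : Sec F W;
   D W s = \<zero>[F,W]; pj W s = restrict h W |] ==> rst F V W t = s" by (elim ex1E conjE) blast
 have loc: "EX W. openin X W & x : W & W <= V & D W (rst F V W t) = \<zero>[F,W] & pj W (rst F V W t) = restrict h W"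
  if x: "x : V" for x
 proof -
  from ex[OF x] obtain W s where W: "openin X W" "x : W" "W <= V" "s : Sec F W"
   "D W s = \<zero>[F,W]" "pj W s = restrict h W" by metis
  have "rst F V W t = s" by (rule t(2)[OF W(1,3-6)])
  then show ?thesis using W by blast
 qed
 interpret S: even_derivation "sec F V" "D V" by (rule eulerD(6)[OF EL V])
 have Dt: "D V t = \<zero>[F,V]"
 proof (rule F.separated[OF V(1)])
  fix x assume "x : V"
  from loc[OF this] obtain W where W: "openin X W" "x : W" "W <= V" "D W (rst F V W t) = \<zero>[F,W]" by metis
  then show "EX W. openin X W & x : W & W <= V & rst F V W (D V t) = rst F V W \<zero>[F,V]"
   using eulerD(5)[OF EL V(1) W(1,3) V(2) t(1)] F.F_rst_zero[OF V(1) W(1,3)] by (intro exI[of _ W]) simp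
 qed (use t in simp_all)
 have pt: "pj V t = h"
 proof (rule extensionalityI[OF pj_ext[OF V(1) t(1)]])
  show "h : extensional V" using h R_carrier by blast
  fix x assume "x : V"
  from loc[OF this] obtain W where W: "openin X W" "x : W" "W <= V" "pj W (rst F V W t) = restrict h W" by metis
  have "restrict (pj V t) W x = restrict h W x" using W(4) unfolding pj_rst[OF V(1) W(1,3) t(1)] by simp
  then show "pj V t x = h x" using W(2) by simp
 qed
 show ?thesis
 proof (rule ex1I[of _ t])
  show "t : Sec F V & D V t = \<zero>[F,V] & pj V t = h" using t(1) Dt pt by simp
  fix s assume "s : Sec F V & D V s = \<zero>[F,V] & pj V s = h"
  then show "s = t" using un[OF V(1) subset_refl, of s t] t(1) Dt pt by simp
 qed
qed

text \<open>As for functions, with eigenvalue 1 one power deeper: representatives of a conormal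
  section differ by the square of the ideal, and the correction stays within the class.\<close>

lemma lam_ex1:
 assumes EL: "euler_lift U D" and V: "openin X V" "V <= U" and m: "m : Sec M V"
 shows "EX! j. j : J V & D V j = j & repM m V j"
proof -
 have un: "j = k" if W: "openin X W" "W <= V" and s: "j : J W" "k : J W"
   "D W j = j" "D W k = k" "repM m W j" "repM m W k" for W j k
 proof -
  have WU: "W <= U" using W V by auto
  interpret even_derivation "sec F W" "D W" by (rule eulerD(6)[OF EL W(1) WU])
  have c: "j : Sec F W" "k : Sec F W" using s J_in by auto
  have "j \<ominus>[F,W] k : N 2 W"
   using repM_unique[OF s(5,6) W(1) subset_refl subset_refl refl] F.rst_id[OF W(1)] c by simp
  then have "j \<ominus>[F,W] k : N (Suc 1) W" by (simp add: numeral_2_eq_2)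
  moreover have "D W (j \<ominus>[F,W] k) = of_nat 1 \<odot>[F,W] (j \<ominus>[F,W] k)"
   using s(3,4) c by (simp add: D_diff)
  ultimately have "j \<ominus>[F,W] k = \<zero>[F,W]" by (rule euler_zero[OF EL W(1) WU])
  then show ?thesis using diff_zero_iff[OF c] by simp
 qed
 have ex: "EX W j. openin X W & x : W & W <= V & j : Sec F W & (j : J W & D W j = j & repM m W j)"
  if x: "x : V" for x
 proof -
  obtain A s where A: "x : A" "A <= V" "repM m A s" using repM_ex[OF m x] .
  have oA: "openin X A" "s : J A" "s : Sec F A" using repMD A(3) J_in by blast+
  have "x : topspace X" using openin_subset[OF V(1)] x by auto
  then obtain U' K where U': "openin X U'" "x : U'" and nil: "nilpotent_on K U'"
   by (rule locally_nilpotent_on)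
  let ?O = "A \<inter> U'"
  have o: "openin X ?O" "?O <= A" "?O <= U'" "x : ?O" "?O <= V" "?O <= U" using V A oA U' x by auto
  interpret S: superalgebra "sec F ?O" by (rule F.F_super[OF o(1)])
  have s: "rst F A ?O s : N 1 ?O" unfolding N_1[OF o(1)] by (rule J_rst[OF oA(1) o(1,2) oA(2)])
  then obtain s' where s': "s' : N 1 ?O" "s' \<ominus>[F,?O] rst F A ?O s : N (Suc 1) ?O" "D ?O s' = of_nat 1 \<odot>[F,?O] s'"
   using euler_correct[OF EL o(1,6) s nilpotent_onD[OF nil o(1,3)]] by blast
  have s'c: "s' : Sec F ?O" by (rule N_in[OF s'(1)])
  have s'J: "s' : J ?O" using s'(1) unfolding N_1[OF o(1)] .
  have "s' \<ominus>[F,?O] rst F A ?O s : N 2 ?O" using s'(2) by (simp add: numeral_2_eq_2)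
  then have "repM m ?O s'" by (rule repM_class[OF repM_rst[OF A(3) o(1,2)] s'J])
  moreover have "D ?O s' = s'" using s'(3) s'c by simp
  ultimately show ?thesis using o s'c s'J by blast
 qed
 have "EX! t. t : Sec F V & (ALL W s. openin X W & W <= V & s : Sec F W &
   (s : J W & D W s = s & repM m W s) --> rst F V W t = s)"
 proof (rule F.glue_unique[OF V(1) ex])
  fix W W' s assume W: "openin X W" "openin X W'" "W' <= W" "W <= V" "s : Sec F W"
   "s : J W & D W s = s & repM m W s"
  have WU: "W <= U" using W V by auto
  show "rst F W W' s : J W' & D W' (rst F W W' s) = rst F W W' s & repM m W' (rst F W W' s)"
  proof (intro conjI)
   show "D W' (rst F W W' s) = rst F W W' s"
    unfolding eulerD(5)[OF EL W(1-3) WU W(5)] using W(6) by simp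
  qed (use J_rst[OF W(1-3)] repM_rst[OF _ W(2,3)] W(6) in blast)+
 next
  fix W s s' assume "openin X W" "W <= V" "s : Sec F W" "s' : Sec F W"
   "s : J W & D W s = s & repM m W s" "s' : J W & D W s' = s' & repM m W s'"
  then show "s = s'" using un by blast
 qed
 then obtain t where t: "t : Sec F V" "!!W s. [| openin X W; W <= V; s : Sec F W;
   s : J W; D W s = s; repM m W s |] ==> rst F V W t = s" by (elim ex1E conjE) blast
 have loc: "EX W. openin X W & x : W & W <= V & rst F V W t : J W & D W (rst F V W t) = rst F V W t & repM m W (rst F V W t)"
  if x: "x : V" for x
 proof -
  from ex[OF x] obtain W j where W: "openin X W" "x : W" "W <= V" "j : Sec F W" "j : J W" "D W j = j" "repM m W j"
   by metis
  have "rst F V W t = j" by (rule t(2)[OF W(1,3-7)])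
  then show ?thesis using W by blast
 qed
 interpret S: even_derivation "sec F V" "D V" by (rule eulerD(6)[OF EL V])
 have tJ: "t : J V" by (rule J_local[OF V(1) t(1)]) (use loc in metis)
 have Dt: "D V t = t"
 proof (rule F.separated[OF V(1)])
  fix x assume "x : V"
  from loc[OF this] obtain W where W: "openin X W" "x : W" "W <= V" "D W (rst F V W t) = rst F V W t" by metis
  then show "EX W. openin X W & x : W & W <= V & rst F V W (D V t) = rst F V W t"
   using eulerD(5)[OF EL V(1) W(1,3) V(2) t(1)] by (intro exI[of _ W]) simp
 qed (use t in simp_all)
 have rt: "repM m V t" by (rule repM_local[OF V(1) tJ]) (use loc in metis)
 show ?thesis
 proof (rule ex1I[of _ t])
  show "t : J V & D V t = t & repM m V t" using tJ Dt rt by simp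
  fix s assume "s : J V & D V s = s & repM m V s"
  then show "s = t" using un[OF V(1) subset_refl, of s t] tJ Dt rt by simp
 qed
qed

section \<open>Eigenlifts as maps of sheaves\<close>

definition sig :: "('x, 'a) derivation => 'x set => ('x => complex) => 'a" where
 "sig D V h = (THE s. s : Sec F V & D V s = \<zero>[F,V] & pj V s = h)"

definition lam :: "('x, 'a) derivation => 'x set => ('x, 'a set) germ_fun => 'a" where
 "lam D V m = (THE j. j : J V & D V j = j & repM m V j)"

context
 fixes U D assumes EL: "euler_lift U D"
begin

context
 fixes V assumes V: "openin X V" "V <= U"
begin

interpretation S: even_derivation "sec F V" "D V" by (rule eulerD(6)[OF EL V])

lemma sig:
 assumes "h : Sec R V"
 shows "sig D V h : Sec F V" "D V (sig D V h) = \<zero>[F,V]" "pj V (sig D V h) = h"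
 using theI'[OF sig_ex1[OF EL V assms]] unfolding sig_def by simp_all

lemma sig_eqI: "[| s : Sec F V; D V s = \<zero>[F,V]; pj V s = h |] ==> sig D V h = s"
 unfolding sig_def using the1_equality[OF sig_ex1[OF EL V, of h]] pj_in[OF V(1), of s] by blast

lemma lam:
 assumes "m : Sec M V"
 shows "lam D V m : J V" "D V (lam D V m) = lam D V m" "repM m V (lam D V m)"
 using theI'[OF lam_ex1[OF EL V assms]] unfolding lam_def by simp_all

lemma lam_eqI: "[| m : Sec M V; j : J V; D V j = j; repM m V j |] ==> lam D V m = j"
 unfolding lam_def using the1_equality[OF lam_ex1[OF EL V, of m]] by blast

lemma sig_hom: "sig D V : ring_hom (sec R V) (sec F V)"
proof (rule ring_hom_memI)
 note h = pj_hom[OF V(1)]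
 fix f assume f: "f : Sec R V"
 show "sig D V f : Sec F V" by (rule sig[OF f])
 fix g assume g: "g : Sec R V"
 show "sig D V (f \<otimes>[R,V] g) = sig D V f \<otimes>[F,V] sig D V g"
  using sig[OF f] sig[OF g] ring_hom_mult[OF h sig(1)[OF f] sig(1)[OF g]]
  by (intro sig_eqI) (simp_all add: S.D_mult)
 show "sig D V (f \<oplus>[R,V] g) = sig D V f \<oplus>[F,V] sig D V g"
  using sig[OF f] sig[OF g] ring_hom_add[OF h sig(1)[OF f] sig(1)[OF g]]
  by (intro sig_eqI) (simp_all add: S.D_add)
next
 show "sig D V \<one>[R,V] = \<one>[F,V]"
  by (intro sig_eqI) (simp_all add: S.D_one ring_hom_one[OF pj_hom[OF V(1)]])
qed

text \<open>The odd part is killed by \<open>D\<close> too, but lies in \<open>J\<close>, so it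
  vanishes by \<open>euler_zero\<close> with eigenvalue 0.\<close>

lemma sig_even: "h : Sec R V ==> sig D V h : Par F V False"
proof -
 assume h: "h : Sec R V"
 note s = sig[OF h]
 let ?u = "ppart (sec F V) True (sig D V h)"
 have uc: "?u : Sec F V" using s(1) by simp
 have "?u : N (Suc 0) V" using J_odd[OF V(1) S.ppart_in[OF s(1)]] N_1[OF V(1)] by simp
 moreover have "D V ?u = of_nat 0 \<odot>[F,V] ?u"
  using S.D_ppart[OF s(1), of True] s(2) S.ppart_homogeneous[OF S.part_zero, of True False] uc by simp
 ultimately have "?u = \<zero>[F,V]" by (rule euler_zero[OF EL V])
 then have "sig D V h = ppart (sec F V) False (sig D V h)" using S.ppart_decompose(1)[OF s(1)] s(1) by simp
 then show ?thesis using S.ppart_in[OF s(1), of False] by simp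
qed

text \<open>The even part is again fixed by \<open>D\<close>, but lies in the square of the ideal by
  \<open>even_J\<close>, so it vanishes by \<open>euler_zero\<close> with eigenvalue 1.\<close>

lemma lam_odd: "m : Sec M V ==> lam D V m : Par F V True"
proof -
 assume m: "m : Sec M V"
 note s = lam[OF m]
 have sc: "lam D V m : Sec F V" by (rule J_in[OF s(1)])
 let ?u = "ppart (sec F V) False (lam D V m)"
 have uc: "?u : Sec F V" using sc by simp
 have "?u : J V" using N_ppart[OF V(1), of "lam D V m" 1 False] s(1) unfolding N_1[OF V(1)] by simp
 then have "?u : N (Suc 1) V" using even_J[OF V(1) _ S.ppart_in[OF sc]] by (simp add: numeral_2_eq_2)
 moreover have "D V ?u = of_nat 1 \<odot>[F,V] ?u" using S.D_ppart[OF sc, of False] s(2) uc by simp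
 ultimately have "?u = \<zero>[F,V]" by (rule euler_zero[OF EL V])
 then have "lam D V m = ppart (sec F V) True (lam D V m)" using S.ppart_decompose(1)[OF sc] sc by simp
 then show ?thesis using S.ppart_in[OF sc, of True] by simp
qed

lemma sig_const: "sig D V (c \<odot>[R,V] \<one>[R,V]) = c \<odot>[F,V] \<one>[F,V]"
 by (intro sig_eqI) (simp_all add: S.D_smult S.D_one pj_smult[OF V(1)] ring_hom_one[OF pj_hom[OF V(1)]])

lemma lam_add: "[| m : Sec M V; n : Sec M V |] ==>
  lam D V (m \<oplus>[M,V] n) = lam D V m \<oplus>[F,V] lam D V n"
 using lam[of m] lam[of n] J_in
 by (intro lam_eqI M_add_in J_add[OF V(1)] repM_add) (simp_all add: S.D_add)

lemma lam_smult:
 assumes h: "h : Sec R V" and m: "m : Sec M V"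
 shows "lam D V (h \<odot>[M,V] m) = sig D V h \<otimes>[F,V] lam D V m"
proof (intro lam_eqI)
 have he: "h : extensional V" using h R_carrier by blast
 show "h \<odot>[M,V] m : Sec M V" by (rule M_smult_in[OF V(1) h m])
 show "sig D V h \<otimes>[F,V] lam D V m : J V" by (rule J_mult[OF V(1) sig(1)[OF h] lam(1)[OF m]])
 show "D V (sig D V h \<otimes>[F,V] lam D V m) = sig D V h \<otimes>[F,V] lam D V m"
  using sig[OF h] lam[OF m] J_in[OF lam(1)[OF m]] by (simp add: S.D_mult)
 show "repM (h \<odot>[M,V] m) V (sig D V h \<otimes>[F,V] lam D V m)"
  by (rule repM_smult[OF lam(3)[OF m] subset_refl sig(1)[OF h]]) (use sig(3)[OF h] extensional_restrict[OF he] in simp)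
qed

lemma sig_rst:
 assumes W: "openin X W" "W <= V" and h: "h : Sec R V"
 shows "sig D W (rst R V W h) = rst F V W (sig D V h)"
proof -
 have WU: "W <= U" using W V by auto
 have ex: "EX! s. s : Sec F W & D W s = \<zero>[F,W] & pj W s = rst R V W h"
  by (rule sig_ex1[OF EL W(1) WU]) (use R_rst_in[OF W h] R_simps(1) in simp)
 show ?thesis
  unfolding sig_def[of D W]
  by (rule the1_equality[OF ex])
   (use F.rst_closed[OF V(1) W sig(1)[OF h]] eulerD(5)[OF EL V(1) W V(2) sig(1)[OF h]] sig(2,3)[OF h]
    F.F_rst_zero[OF V(1) W] pj_rst[OF V(1) W sig(1)[OF h]] R_simps(1) in simp)
qed

lemma lam_rst:
 assumes W: "openin X W" "W <= V" and m: "m : Sec M V"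
 shows "lam D W (rst M V W m) = rst F V W (lam D V m)"
proof -
 have WU: "W <= U" using W V by auto
 have ex: "EX! j. j : J W & D W j = j & repM (rst M V W m) W j"
  by (rule lam_ex1[OF EL W(1) WU]) (use M_rst_in[OF W m] M_simps(5) in simp)
 have "repM (rst M V W m) W (rst F V W (lam D V m))"
  unfolding M_simps(5) by (rule repM_restrict[OF repM_rst[OF lam(3)[OF m] W] subset_refl])
 then show ?thesis
  unfolding lam_def[of D W]
  by (intro the1_equality[OF ex])
   (use J_rst[OF V(1) W lam(1)[OF m]] eulerD(5)[OF EL V(1) W V(2) J_in[OF lam(1)[OF m]]] lam(2)[OF m] in simp)
qed

end

lemma euler_eval: "exterior_eval X R M F U (sig D) (lam D)"
 by (intro exterior_eval.intro M_exterior_base F.superalgebra_sheaf_on_axioms exterior_eval_axioms.intro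
   eulerD(1)[OF EL] sig_hom sig_even sig_const sig_rst lam_odd lam_add lam_smult lam_rst)

end

text \<open>Generators go to \<open>J\<close> and project to zero, while functions are recovered
  from their lifts. The projected evaluation of a term is therefore its augmentation.\<close>

lemma eval_proj:
 assumes "exterior_eval X R E F U \<sigma> l"
  and s: "!!V h. [| openin X V; V <= U; h : Sec R V |] ==> pj V (\<sigma> V h) = h"
  and l: "!!V m. [| openin X V; V <= U; m : Sec E V |] ==> l V m : J V"
  and V: "openin X V" "V <= U" and g: "g : Sec (exterior_sheaf X R E) V"
 shows "pj V (exterior_eval.Phi X R E F \<sigma> l V g) = exterior_projection R V g"
proof -
 interpret EV: exterior_eval X R E F U \<sigma> l by fact
 show ?thesis
 proof (rule extensionalityI[OF pj_ext[OF V(1) EV.Phi_in[OF V g]]])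
  show "exterior_projection R V g : extensional V" unfolding exterior_projection_def by simp
  fix x assume x: "x : V"
  obtain W e where W: "x : W" "W <= V" "EV.rep g W e" using EV.rep_ex[OF g x] .
  have o: "openin X W" "e : EV.trm W" using EV.repD W(3) by blast+
  have WU: "W <= U" using W V by auto
  have "pj W (EV.ev W e) = ext_ev (sec R W) (%r. pj W (\<sigma> W r)) (%m. pj W (l W m)) e"
   by (rule ext_ev_hom[OF F.F_ring[OF o(1)] EV.\<sigma>_in[OF o(1) WU] EV.l_in[OF o(1) WU] pj_hom[OF o(1)] o(2)])
  also have "... = ext_ev (sec R W) (%r. r) (%_. \<zero>[R,W]) e"
   by (rule ext_ev_cong[OF o(2)]) (use s[OF o(1) WU] l[OF o(1) WU] J_iff in auto)
  also have "... = ext_aug (sec R W) e" by (simp add: ext_aug_ev)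
  finally have "pj W (EV.ev W e) = ext_aug (sec R W) e" .
  then have "restrict (pj V (EV.Phi V g)) W = ext_aug (sec R W) e"
   using EV.Phi_rep[OF V g W(3,2)] pj_rst[OF V(1) o(1) W(2) EV.Phi_in[OF V g]] by simp
  then show "pj V (EV.Phi V g) x = exterior_projection R V g x"
   using EV.exterior_projection_rep[OF W(3,2,1)] W(1) by (metis restrict_apply')
 qed
qed

end

section \<open>Eigenlifts generate the structure sheaf\<close>

lemma ext_iso_subset:
 assumes "ext_iso \<XX> E f pre U0 \<psi>" "openin (body \<XX>) U" "U <= U0"
 shows "ext_iso \<XX> E f pre U \<psi>"
proof -
 interpret ext_iso \<XX> E f pre U0 \<psi> by fact
 show ?thesis
  by (intro ext_iso.intro supermanifold_axioms EB.exterior_base_axioms ext_iso_axioms.intro assms(2) f)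
   (use pre_eq \<psi>_hom \<psi>_bij \<psi>_rst \<psi>_pj E_zero_smult order_trans[OF _ assms(3)] in simp_all)
qed

text \<open>A chart inside the domain of an Euler lift on which one power of the nilpotent ideal
  vanishes, so that arguments ascending the filtration end after \<open>K\<close> steps.\<close>

locale euler_chart = ext_iso \<XX> E "%x. x" "%V. V" U0 \<psi>
 for \<XX> :: "('x, 'a) superspace" and E :: "('x, 'x => complex, 'm) module_sheaf" and U0 \<psi> +
 fixes D and K :: nat
 assumes EL: "euler_lift U0 D" and nil: "nilpotent_on K U0"
begin

sublocale EV: exterior_eval "body \<XX>" "body_sheaf \<XX>" "odd_cotangent_sheaf \<XX>" "strsheaf \<XX>" U0 "sig D" "lam D"
 by (rule euler_eval[OF EL])

text \<open>The linear part of the chart: it compares the module of the chart with the odd cotangent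
  sheaf.\<close>

definition \<kappa> :: "'x set => 'm => ('x, 'a set) germ_fun" where
 "\<kappa> V m = cc V (s V (EGen m))"

context
 fixes V assumes V: "openin X V" "V <= U0"
begin

lemma \<kappa>_rep: "m : Sec E V ==> repM (\<kappa> V m) V (s V (EGen m))"
 unfolding \<kappa>_def by (rule cc_repM[OF V(1) s_gen_J[OF V]])

lemma \<kappa>_in: "m : Sec E V ==> \<kappa> V m : Sec M V"
 unfolding \<kappa>_def by (rule cc_in[OF V(1) s_gen_J[OF V]])

lemma \<kappa>_add:
 assumes "m : Sec E V" "n : Sec E V"
 shows "\<kappa> V (m \<oplus>[E,V] n) = \<kappa> V m \<oplus>[M,V] \<kappa> V n"
 unfolding \<kappa>_def[of V "m \<oplus>[E,V] n"] s_gen_add[OF V assms]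
 by (rule cc_eqI[symmetric, OF M_op_ext(1) repM_add[OF \<kappa>_rep \<kappa>_rep]]) (use assms in simp_all)

lemma \<kappa>_smult:
 assumes h: "h : Sec R V" and m: "m : Sec E V"
 shows "\<kappa> V (h \<odot>[E,V] m) = h \<odot>[M,V] \<kappa> V m"
 unfolding \<kappa>_def[of V "h \<odot>[E,V] m"] s_gen_smult[OF V h m]
 by (rule cc_eqI[symmetric, OF M_op_ext(2) repM_smult[OF \<kappa>_rep[OF m] subset_refl s_in[OF V]]])
  (use h s_pj[OF V, of "EScal h"] in simp_all)

lemma \<kappa>_rst:
 assumes W: "openin X W" "W <= V" and m: "m : Sec E V"
 shows "\<kappa> W (rst E V W m) = rst M V W (\<kappa> V m)"
proof -
 have "rst F V W (s V (EGen m)) = s W (EGen (rst E V W m))" using s_rst[OF V W, of "EGen m"] m by simp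
 then have "repM (restrict (\<kappa> V m) W) W (s W (EGen (rst E V W m)))"
  using repM_restrict[OF repM_rst[OF \<kappa>_rep[OF m] W] subset_refl] by simp
 then show ?thesis unfolding \<kappa>_def[of W] M_simps(5) by (intro cc_eqI[symmetric]) simp_all
qed

lemma \<kappa>_onto:
 assumes m: "m : Sec M V" and x: "x : V"
 obtains W n where "openin X W" "x : W" "W <= V" "n : Sec E W" "restrict m W = \<kappa> W n"
proof -
 obtain A j where A: "x : A" "A <= V" "repM m A j" using repM_ex[OF m x] .
 have AU: "A <= U0" using A V by auto
 obtain W n where W: "openin X W" "x : W" "W <= A" "W <= U0" "n : Sec E W"
  "rst F A W j \<ominus>[F,W] s W (EGen n) : N 2 W"
  using J_linear[OF repMD(1)[OF A(3)] AU repMD(2)[OF A(3)] A(1)] by metis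
 interpret W: superalgebra "sec F W" by (rule F.F_super[OF W(1)])
 have r: "repM m W (rst F A W j)" by (rule repM_rst[OF A(3) W(1,3)])
 have sJ: "s W (EGen n) : J W" by (rule s_gen_J[OF W(1,4,5)])
 have "s W (EGen n) \<ominus>[F,W] rst F A W j : N 2 W"
  using N_neg[OF W(1,6)] W.diff_swap[OF J_in[OF repMD(2)[OF r]] J_in[OF sJ]] by simp
 then have "repM (restrict m W) W (s W (EGen n))"
  by (intro repM_restrict repM_class[OF r sJ] subset_refl)
 then have "restrict m W = \<kappa> W n" unfolding \<kappa>_def by (intro cc_eqI) simp_all
 then show thesis using that[OF W(1,2) order_trans[OF W(3) A(2)] W(5)] by simp
qed

abbreviation "\<kappa>t == map_ext_term (%r. r) (\<kappa> V)"

lemma \<kappa>t_trm: "e : EB.trm V ==> \<kappa>t e : MB.trm V"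
 by (rule map_ext_terms) (use \<kappa>_in in simp_all)

lemma \<kappa>t_eq: "EB.eeq V a b ==> MB.eeq V (\<kappa>t a) (\<kappa>t b)"
 by (rule ext_module.ext_eq_map[OF EB.EM[OF V(1)] _ MB.EM[OF V(1)]])
  (use \<kappa>_in \<kappa>_add \<kappa>_smult in \<open>simp_all add: ring_hom_def\<close>)

end

lemma \<kappa>t_tr:
 assumes "openin X V" "openin X W" "W <= V" "V <= U0" "e : EB.trm V"
 shows "MB.tr V W (\<kappa>t V e) = \<kappa>t W (EB.tr V W e)"
 unfolding ext_term.map_comp
 by (rule map_ext_cong[OF assms(5)]) (use \<kappa>_rst[OF assms(1,4,2,3)] in simp_all)

text \<open>Every generator is locally in the image of \<open>\<kappa>\<close>; a term contains
  finitely many, so one neighbourhood serves for all of them.\<close>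

lemma \<kappa>t_onto:
 "[| openin X V; V <= U0; x : V; e : MB.trm V |] ==>
  EX W a. openin X W & x : W & W <= V & a : EB.trm W & MB.tr V W e = \<kappa>t W a"
proof (induction e)
 case (EScal r)
 then show ?case using MB.tr_id[of V "EScal r"] by (intro exI[of _ V] exI[of _ "EScal r"]) simp
next
 case (EGen m)
 then have "m : Sec M V" by simp
 from \<kappa>_onto[OF EGen(1,2) this EGen(3)]
 obtain W n where W: "openin X W" "x : W" "W <= V" "n : Sec E W" "restrict m W = \<kappa> W n" .
 have "rst M V W m = \<kappa> W n" using W(5) unfolding M_simps(5) .
 then show ?case using W by (intro exI[of _ W] exI[of _ "EGen n"]) simp
next
 have bin: "EX W a' b'. openin X W & x : W & W <= V & a' : EB.trm W & b' : EB.trm W &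
   MB.tr V W a = \<kappa>t W a' & MB.tr V W b = \<kappa>t W b'"
  if V: "openin X V" "V <= U0" and ab: "a : MB.trm V" "b : MB.trm V"
   and a: "EX W a'. openin X W & x : W & W <= V & a' : EB.trm W & MB.tr V W a = \<kappa>t W a'"
   and b: "EX W a'. openin X W & x : W & W <= V & a' : EB.trm W & MB.tr V W b = \<kappa>t W a'" for a b
 proof -
  obtain A a' where A: "openin X A" "x : A" "A <= V" "a' : EB.trm A" "MB.tr V A a = \<kappa>t A a'" using a by metis
  obtain B b' where B: "openin X B" "x : B" "B <= V" "b' : EB.trm B" "MB.tr V B b = \<kappa>t B b'" using b by metis
  let ?W = "A \<inter> B"
  have W: "openin X ?W" "?W <= A" "?W <= B" "A <= U0" "B <= U0" using A B V by auto
  have "MB.tr V ?W a = \<kappa>t ?W (EB.tr A ?W a')"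
   using MB.tr_tr[OF V(1) A(1) W(1,2) A(3) ab(1)] \<kappa>t_tr[OF A(1) W(1,2,4) A(4)] A(5) by simp
  moreover have "MB.tr V ?W b = \<kappa>t ?W (EB.tr B ?W b')"
   using MB.tr_tr[OF V(1) B(1) W(1,3) B(3) ab(2)] \<kappa>t_tr[OF B(1) W(1,3,5) B(4)] B(5) by simp
  ultimately show ?thesis
   using W A B EB.tr_trm[OF A(1) W(1,2) A(4)] EB.tr_trm[OF B(1) W(1,3) B(4)]
   by (intro exI[of _ ?W] exI[of _ "EB.tr A ?W a'"] exI[of _ "EB.tr B ?W b'"]) auto
 qed
 {
  case (ESum a b)
  have "a : MB.trm V" "b : MB.trm V" using ESum.prems by simp_all
  from bin[OF ESum.prems(1,2) this ESum.IH(1)[OF ESum.prems(1-3) this(1)] ESum.IH(2)[OF ESum.prems(1-3) this(2)]]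
  obtain W a' b' where "openin X W" "x : W" "W <= V" "a' : EB.trm W" "b' : EB.trm W"
   "MB.tr V W a = \<kappa>t W a'" "MB.tr V W b = \<kappa>t W b'" by (elim exE conjE)
  then show ?case by (intro exI[of _ W] exI[of _ "ESum a' b'"]) simp
 next
  case (EProd a b)
  have "a : MB.trm V" "b : MB.trm V" using EProd.prems by simp_all
  from bin[OF EProd.prems(1,2) this EProd.IH(1)[OF EProd.prems(1-3) this(1)] EProd.IH(2)[OF EProd.prems(1-3) this(2)]]
  obtain W a' b' where "openin X W" "x : W" "W <= V" "a' : EB.trm W" "b' : EB.trm W"
   "MB.tr V W a = \<kappa>t W a'" "MB.tr V W b = \<kappa>t W b'" by (elim exE conjE)
  then show ?case by (intro exI[of _ W] exI[of _ "EProd a' b'"]) simp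
 }
qed

sublocale EE: exterior_eval "body \<XX>" "body_sheaf \<XX>" E "strsheaf \<XX>" U0 "sig D" "%V m. lam D V (\<kappa> V m)"
proof (intro exterior_eval.intro EB.exterior_base_axioms F.superalgebra_sheaf_on_axioms exterior_eval_axioms.intro)
 fix V assume V: "openin X V" "V <= U0"
 fix m assume m: "m : Sec E V"
 show "lam D V (\<kappa> V m) : Par F V True" by (rule EV.l_odd[OF V \<kappa>_in[OF V m]])
 show "lam D V (\<kappa> V (h \<odot>[E,V] m)) = sig D V h \<otimes>[F,V] lam D V (\<kappa> V m)"
  if h: "h : Sec R V" for h
  unfolding \<kappa>_smult[OF V h m] by (rule EV.l_smult[OF V h \<kappa>_in[OF V m]])
 show "lam D V (\<kappa> V (m \<oplus>[E,V] n)) = lam D V (\<kappa> V m) \<oplus>[F,V] lam D V (\<kappa> V n)"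
  if n: "n : Sec E V" for n
  unfolding \<kappa>_add[OF V m n] by (rule EV.l_add[OF V \<kappa>_in[OF V m] \<kappa>_in[OF V n]])
 fix W assume W: "openin X W" "W <= V"
 show "lam D W (\<kappa> W (rst E V W m)) = rst F V W (lam D V (\<kappa> V m))"
  unfolding \<kappa>_rst[OF V W m] by (rule EV.l_rst[OF V(1) W V(2) \<kappa>_in[OF V m]])
qed (use EV.U0 EV.\<sigma>_hom EV.\<sigma>_even EV.\<sigma>_smult EV.\<sigma>_rst in simp_all)

lemma EE_ev: "EE.ev V e = EV.ev V (\<kappa>t V e)"
 by (simp add: ext_ev_map)

text \<open>The inverse of the chart followed by evaluation at the eigenlifts. Being a map of the
  structure sheaf to itself, it can be compared with the identity along the filtration.\<close>

definition T :: "'x set => 'a => 'a" where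
 "T V t = EE.Phi V (inv_into (Sec EB.B V) (\<psi> V) t)"

context
 fixes V assumes V: "openin X V" "V <= U0"
begin

interpretation V: superalgebra "sec F V" by (rule F.F_super[OF V(1)])

abbreviation "iv == inv_into (Sec EB.B V) (\<psi> V)"

lemma iv:
 assumes "t : Sec F V"
 shows "iv t : Sec EB.B V" "\<psi> V (iv t) = t"
 using assms bij_betw_imp_surj_on[OF \<psi>_bij[OF V]] by (metis inv_into_into, metis f_inv_into_f)

lemma iv_\<psi>: "g : Sec EB.B V ==> iv (\<psi> V g) = g"
 by (rule inv_into_f_f[OF bij_betw_imp_inj_on[OF \<psi>_bij[OF V]]])

lemma T_\<psi>: "g : Sec EB.B V ==> T V (\<psi> V g) = EE.Phi V g"
 unfolding T_def by (simp add: iv_\<psi>)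

lemma T_in [simp]: "t : Sec F V ==> T V t : Sec F V"
 unfolding T_def by (rule EE.Phi_in[OF V iv(1)])

lemma T_add: "[| t : Sec F V; u : Sec F V |] ==> T V (t \<oplus>[F,V] u) = T V t \<oplus>[F,V] T V u"
 and T_mult: "[| t : Sec F V; u : Sec F V |] ==> T V (t \<otimes>[F,V] u) = T V t \<otimes>[F,V] T V u"
proof -
 assume tu: "t : Sec F V" "u : Sec F V"
 note it = iv[OF tu(1)] and iu = iv[OF tu(2)]
 have h: "EE.Phi V : ring_hom (sec EB.B V) (sec F V)" using EE.Phi_hom[OF V] unfolding superalgebra_hom_def by simp
 have "iv (t \<oplus>[F,V] u) = iv t \<oplus>[EB.B,V] iv u"
  using iv_\<psi>[OF EB.B_add_in[OF it(1) iu(1)]] ring_hom_add[OF \<psi>_ring_hom[OF V] it(1) iu(1)] it iu by simp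
 then show "T V (t \<oplus>[F,V] u) = T V t \<oplus>[F,V] T V u"
  unfolding T_def using ring_hom_add[OF h it(1) iu(1)] by simp
 have "iv (t \<otimes>[F,V] u) = iv t \<otimes>[EB.B,V] iv u"
  using iv_\<psi>[OF EB.B_mult_in[OF it(1) iu(1)]] ring_hom_mult[OF \<psi>_ring_hom[OF V] it(1) iu(1)] it iu by simp
 then show "T V (t \<otimes>[F,V] u) = T V t \<otimes>[F,V] T V u"
  unfolding T_def using ring_hom_mult[OF h it(1) iu(1)] by simp
qed

lemma T_diff:
 assumes "t : Sec F V" "u : Sec F V"
 shows "T V (t \<ominus>[F,V] u) = T V t \<ominus>[F,V] T V u"
proof -
 have "T V (t \<ominus>[F,V] u) \<oplus>[F,V] T V u = T V t"
  using T_add[of "t \<ominus>[F,V] u" u] assms by (simp add: a_minus_def V.a_assoc V.l_neg)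
 then have "T V t \<ominus>[F,V] T V u = (T V u \<oplus>[F,V] T V (t \<ominus>[F,V] u)) \<ominus>[F,V] T V u"
  using assms by (simp add: V.a_comm)
 also have "... = T V (t \<ominus>[F,V] u)" using assms by (intro V.plus_diff_cancel) simp_all
 finally show ?thesis ..
qed

lemma T_pj: "t : Sec F V ==> pj V (T V t) = pj V t"
proof -
 assume t: "t : Sec F V"
 have "pj V (T V t) = exterior_projection R V (iv t)"
  unfolding T_def
  by (rule eval_proj[OF EE.exterior_eval_axioms sig(3)[OF EL] lam(1)[OF EL] V iv(1)[OF t]]) (use \<kappa>_in in simp_all)
 also have "... = restrict (exterior_projection R V (iv t)) V"
  by (rule extensional_restrict[symmetric]) (simp add: exterior_projection_def)
 also have "... = pj V t" using \<psi>_pj[OF V iv(1)[OF t]] unfolding iv(2)[OF t] by simp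
 finally show ?thesis .
qed

lemma T_J: "j : J V ==> T V j : J V"
 using T_pj J_iff by simp

lemma T_rst:
 assumes W: "openin X W" "W <= V" and t: "t : Sec F V"
 shows "rst F V W (T V t) = T W (rst F V W t)"
proof -
 have WU: "W <= U0" using W V by auto
 have b: "rst EB.B V W (iv t) : Sec EB.B W" by (rule EB.B_restrict[OF iv(1)[OF t] W])
 have "rst F V W t = \<psi> W (rst EB.B V W (iv t))" using \<psi>_rst[OF V(1) W V(2) iv(1)[OF t]] iv(2)[OF t] by simp
 then have "T W (rst F V W t) = EE.Phi W (rst EB.B V W (iv t))"
  unfolding T_def using inv_into_f_f[OF bij_betw_imp_inj_on[OF \<psi>_bij[OF W(1) WU]] b] by simp
 then show ?thesis unfolding T_def EE.Phi_rst[OF V W iv(1)[OF t]] by simp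
qed

end

section \<open>The comparison map is unipotent\<close>

lemma T_N: "[| openin X V; V <= U0; t : N l V |] ==> T V t : N l V"
proof -
 have I: "T V t : N l V" if V: "openin X V" "V <= U0" and t: "t : I l V" for V t l
  using t
 proof (induction l arbitrary: t)
  case 0
  then show ?case using T_in[OF V] N_0[OF V(1)] by simp
 next
  case (Suc l)
  from V(1) Suc.prems show ?case
  proof (induction t rule: I_induct)
   case (prod i j)
   have "T V j : N 1 V" using T_J[OF V prod(2)] unfolding N_1[OF V(1)] .
   then show ?case using N_mult[OF V(1) Suc.IH[OF prod(1)]] T_mult[OF V prod(3,4)] by fastforce
  next
   case (sum t u)
   then show ?case using N_add[OF V(1)] T_add[OF V sum(3,4)] by simp
  qed
 qed
 show "[| openin X V; V <= U0; t : N l V |] ==> T V t : N l V"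
  by (rule N_transfer[of U0 l T l V t, OF I]) (use T_in T_rst in simp_all)
qed

text \<open>Modulo the square a section of \<open>J\<close> is locally a chart generator.
  \<open>T\<close> sends that to the eigenlift of its conormal class, which represents the same
  class and hence differs from it by the square.\<close>

lemma T_1:
 assumes V: "openin X V" "V <= U0" and j: "j : J V"
 shows "T V j \<ominus>[F,V] j : N 2 V"
proof -
 interpret V: superalgebra "sec F V" by (rule F.F_super[OF V(1)])
 have jc: "j : Sec F V" by (rule J_in[OF j])
 show ?thesis
 proof (rule N_local[OF V(1)])
  show "T V j \<ominus>[F,V] j : Sec F V" using jc T_in[OF V jc] by simp
  fix x assume "x : V"
  from J_linear[OF V j this] obtain W n where W: "openin X W" "x : W" "W <= V" "W <= U0" "n : Sec E W"
   "rst F V W j \<ominus>[F,W] s W (EGen n) : N 2 W" by metis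
  interpret W: superalgebra "sec F W" by (rule F.F_super[OF W(1)])
  note Wo = W(1,4)
  let ?j = "rst F V W j" and ?g = "s W (EGen n)"
  have c: "?j : Sec F W" "?g : Sec F W"
   using F.rst_closed[OF V(1) W(1,3) jc] J_in[OF s_gen_J[OF Wo W(5)]] by simp_all
  have e: "EGen n : EB.trm W" using W(5) by simp
  have Tg: "T W ?g = lam D W (\<kappa> W n)"
   unfolding s_def T_\<psi>[OF Wo EB.sect_in[OF W(1) e]] EE.Phi_sect[OF Wo e] by simp
  have "repM (\<kappa> W n) W (T W ?g)" unfolding Tg by (rule lam(3)[OF EL Wo \<kappa>_in[OF Wo W(5)]])
  from repM_unique[OF this \<kappa>_rep[OF Wo W(5)] W(1) subset_refl subset_refl refl]
  have 1: "T W ?g \<ominus>[F,W] ?g : N 2 W" using F.rst_id[OF W(1)] c T_in[OF Wo c(2)] by simp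
  have 2: "T W ?j \<ominus>[F,W] T W ?g : N 2 W" using T_N[OF Wo W(6)] T_diff[OF Wo c] by simp
  have 3: "?g \<ominus>[F,W] ?j : N 2 W" using N_neg[OF W(1,6)] W.diff_swap[OF c] by simp
  have "T W ?j \<ominus>[F,W] ?j : N 2 W"
   by (rule N_eq_diff[OF W(1) _ _ _ N_eq_diff[OF W(1) _ _ _ 2 1] 3]) (use c T_in[OF Wo] in simp_all)
  then have "rst F V W (T V j \<ominus>[F,V] j) : N 2 W"
   using F.F_rst_diff[OF V(1) W(1,3) T_in[OF V jc] jc] T_rst[OF V W(1,3) jc] by simp
  then show "EX W. openin X W & x : W & W <= V & rst F V W (T V j \<ominus>[F,V] j) : N 2 W" using W(1-3) by blast
 qed
qed

lemma (in ring) prod_diff: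
 assumes "a : carrier R" "b : carrier R" "c : carrier R" "d : carrier R"
 shows "a \<otimes> b \<ominus> c \<otimes> d = (a \<ominus> c) \<otimes> b \<oplus> c \<otimes> (b \<ominus> d)"
proof -
 have "(a \<ominus> c) \<otimes> b \<oplus> c \<otimes> (b \<ominus> d) = (a \<otimes> b \<ominus> c \<otimes> b) \<oplus> (c \<otimes> b \<ominus> c \<otimes> d)"
  using assms by (simp add: a_minus_def l_distr r_distr l_minus r_minus)
 also have "... = a \<otimes> b \<ominus> c \<otimes> d" using assms by (intro diff_add_diff) simp_all
 finally show ?thesis ..
qed

text \<open>Functions are fixed modulo \<open>J\<close> by \<open>T_pj\<close> and elements of
  \<open>J\<close> modulo the square by \<open>T_1\<close>. Multiplicativity of \<open>T\<close>
  carries this to products, and so to every power.\<close>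

lemma T_grade: "[| openin X V; V <= U0; t : N l V |] ==> T V t \<ominus>[F,V] t : N (Suc l) V"
proof -
 have I: "T V t \<ominus>[F,V] t : N (Suc l) V" if V: "openin X V" "V <= U0" and t: "t : I l V" for V t l
  using t
 proof (induction l arbitrary: t)
  case 0
  then have "t : Sec F V" by simp
  then show ?case using pj_diff_J[OF V(1) T_in[OF V]] T_pj[OF V] N_1[OF V(1)] by simp
 next
  case (Suc l)
  interpret V: superalgebra "sec F V" by (rule F.F_super[OF V(1)])
  from V(1) Suc.prems show ?case
  proof (induction t rule: I_induct)
   case (prod i j)
   have "T V j : N 1 V" using T_J[OF V prod(2)] unfolding N_1[OF V(1)] .
   from N_mult[OF V(1) Suc.IH[OF prod(1)] this]
   have 1: "(T V i \<ominus>[F,V] i) \<otimes>[F,V] T V j : N (Suc (Suc l)) V" by simp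
   have 2: "i \<otimes>[F,V] (T V j \<ominus>[F,V] j) : N (Suc (Suc l)) V"
    using N_mult[OF V(1) I_N[OF V(1) prod(1)] T_1[OF V prod(2)]] by simp
   show ?case
    unfolding T_mult[OF V prod(3,4)] V.prod_diff[OF T_in[OF V prod(3)] T_in[OF V prod(4)] prod(3,4)]
    by (rule N_add[OF V(1) 1 2])
  next
   case (sum t u)
   show ?case
    unfolding T_add[OF V sum(3,4)] V.diff_plus_diff[OF T_in[OF V sum(3)] T_in[OF V sum(4)] sum(3,4)]
    by (rule N_add[OF V(1) sum(5,6)])
  qed
 qed
 show "[| openin X V; V <= U0; t : N l V |] ==> T V t \<ominus>[F,V] t : N (Suc l) V"
 proof (rule N_transfer[of U0 l "%V t. T V t \<ominus>[F,V] t", OF I])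
  show "T V t \<ominus>[F,V] t : Sec F V" if h: "openin X V" "V <= U0" "t : Sec F V" for V t
  proof -
   interpret V: superalgebra "sec F V" by (rule F.F_super[OF h(1)])
   show ?thesis using T_in[OF h] h(3) by simp
  qed
  show "rst F V W (T V t \<ominus>[F,V] t) = T W (rst F V W t) \<ominus>[F,W] rst F V W t"
   if h: "openin X V" "openin X W" "W <= V" "V <= U0" "t : Sec F V" for V W t
   using F.F_rst_diff[OF h(1-3) T_in[OF h(1,4,5)] h(5)] T_rst[OF h(1,4,2,3,5)] by simp
 qed
qed

context
 fixes V assumes V: "openin X V" "V <= U0"
begin

interpretation V: superalgebra "sec F V" by (rule F.F_super[OF V(1)])

lemma T_kernel:
 assumes t: "t : Sec F V" and z: "T V t = \<zero>[F,V]"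
 shows "t = \<zero>[F,V]"
proof -
 have "t : N l V" for l
 proof (induction l)
  case 0
  then show ?case using t N_0[OF V(1)] by simp
 next
  case (Suc l)
  have "\<ominus>[F,V] t : N (Suc l) V" using T_grade[OF V Suc] t unfolding z by (simp add: a_minus_def)
  from N_neg[OF V(1) this] show ?case using t by simp
 qed
 then show ?thesis using nilpotent_onD[OF nil V] by blast
qed

lemma T_inj:
 assumes "t : Sec F V" "u : Sec F V" "T V t = T V u"
 shows "t = u"
 using T_kernel[of "t \<ominus>[F,V] u"] T_diff[OF V assms(1,2)] V.diff_zero_iff assms T_in[OF V] by simp

text \<open>If \<open>T u\<close> misses \<open>t\<close> by \<open>d\<close> in the power
  \<open>k\<close>, then \<open>T (u + d)\<close> misses it by \<open>d - T d\<close>, which lies in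
  the next power. The approximation is exact at power \<open>K\<close>.\<close>

lemma T_onto:
 assumes t: "t : Sec F V"
 obtains u where "u : Sec F V" "T V u = t"
proof -
 have "EX u:Sec F V. t \<ominus>[F,V] T V u : N k V" for k
 proof (induction k)
  case 0
  show ?case using t T_in[OF V] N_0[OF V(1)] by (intro bexI[of _ t]) simp_all
 next
  case (Suc k)
  then obtain u where u: "u : Sec F V" "t \<ominus>[F,V] T V u : N k V" by blast
  define d where "d = t \<ominus>[F,V] T V u"
  have d: "d : N k V" "d : Sec F V" using u N_in unfolding d_def by blast+
  have c: "T V u : Sec F V" "T V d : Sec F V" using T_in[OF V] u d by simp_all
  have "t = T V u \<oplus>[F,V] d" unfolding d_def using t c by (simp add: V.diff_add)
  then have "t \<ominus>[F,V] T V (u \<oplus>[F,V] d) = (T V u \<ominus>[F,V] T V u) \<oplus>[F,V] (d \<ominus>[F,V] T V d)"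
   using T_add[OF V u(1) d(2)] V.diff_plus_diff[OF c(1) d(2) c] by simp
  also have "... = \<ominus>[F,V] (T V d \<ominus>[F,V] d)" using c d by (simp add: V.diff_swap V.diff_zero_iff)
  finally have "t \<ominus>[F,V] T V (u \<oplus>[F,V] d) : N (Suc k) V" using N_neg[OF V(1) T_grade[OF V d(1)]] by simp
  then show ?case using u d by (intro bexI[of _ "u \<oplus>[F,V] d"]) simp_all
 qed
 from this[of K] obtain u where u: "u : Sec F V" "t \<ominus>[F,V] T V u : N K V" by blast
 then have "t = T V u" using nilpotent_onD[OF nil V u(2)] V.diff_zero_iff[OF t T_in[OF V u(1)]] by simp
 then show thesis using that u(1) by simp
qed

end

text \<open>Terms over the odd cotangent sheaf are locally images under \<open>\<kappa>t\<close> of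
  terms over the module of the chart. On the latter, evaluation is \<open>T\<close> after
  \<open>\<psi>\<close>, hence injective; the resulting equivalence of chart terms is pushed forward
  by \<open>\<kappa>t\<close>.\<close>

lemma Phi_inj_local:
 assumes V: "openin X V" "V <= U0" and g: "g : Sec MB.B V" "h : Sec MB.B V"
  and eq: "EV.Phi V g = EV.Phi V h"
 shows "g = h"
proof (rule MB.B_eqI[OF MB.B_ext[OF g(1)] MB.B_ext[OF g(2)]])
 fix x assume x: "x : V"
 obtain W a b where W: "x : W" "W <= V" "MB.rep g W a" "MB.rep h W b" using MB.rep_ex2[OF g x] .
 have o: "openin X W" "a : MB.trm W" "b : MB.trm W" "W <= U0" using MB.repD(1,2) W V(2) by blast+
 obtain W1 a' where W1: "openin X W1" "x : W1" "W1 <= W" "a' : EB.trm W1" "MB.tr W W1 a = \<kappa>t W1 a'"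
  using \<kappa>t_onto[OF o(1,4) W(1) o(2)] by metis
 obtain W2 b' where W2: "openin X W2" "x : W2" "W2 <= W" "b' : EB.trm W2" "MB.tr W W2 b = \<kappa>t W2 b'"
  using \<kappa>t_onto[OF o(1,4) W(1) o(3)] by metis
 let ?O = "W1 \<inter> W2"
 have O: "openin X ?O" "x : ?O" "?O <= W1" "?O <= W2" "?O <= W" "?O <= V" "?O <= U0" "W1 <= U0" "W2 <= U0"
  using W1 W2 W V by auto
 let ?a = "EB.tr W1 ?O a'" and ?b = "EB.tr W2 ?O b'"
 have ab: "?a : EB.trm ?O" "?b : EB.trm ?O"
  using EB.tr_trm[OF W1(1) O(1,3) W1(4)] EB.tr_trm[OF W2(1) O(1,4) W2(4)] by simp_all
 have ra: "MB.rep g ?O (\<kappa>t ?O ?a)"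
  using MB.rep_rst[OF W(3) O(1,5)] MB.tr_tr[OF o(1) W1(1) O(1,3) W1(3) o(2)] \<kappa>t_tr[OF W1(1) O(1,3,8) W1(4)] W1(5) by simp
 have rb: "MB.rep h ?O (\<kappa>t ?O ?b)"
  using MB.rep_rst[OF W(4) O(1,5)] MB.tr_tr[OF o(1) W2(1) O(1,4) W2(3) o(3)] \<kappa>t_tr[OF W2(1) O(1,4,9) W2(4)] W2(5) by simp
 have "EE.ev ?O ?a = EE.ev ?O ?b"
  unfolding EE_ev using EV.Phi_rep[OF V g(1) ra O(6)] EV.Phi_rep[OF V g(2) rb O(6)] eq by simp
 then have "T ?O (\<psi> ?O (EB.sect ?O ?a)) = T ?O (\<psi> ?O (EB.sect ?O ?b))"
  unfolding T_\<psi>[OF O(1,7) EB.sect_in[OF O(1) ab(1)]] T_\<psi>[OF O(1,7) EB.sect_in[OF O(1) ab(2)]]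
   EE.Phi_sect[OF O(1,7) ab(1)] EE.Phi_sect[OF O(1,7) ab(2)] .
 then have "\<psi> ?O (EB.sect ?O ?a) = \<psi> ?O (EB.sect ?O ?b)"
  by (rule T_inj[OF O(1,7) \<psi>_in[OF O(1,7) EB.sect_in[OF O(1) ab(1)]] \<psi>_in[OF O(1,7) EB.sect_in[OF O(1) ab(2)]]])
 then have "EB.sect ?O ?a = EB.sect ?O ?b"
  by (rule \<psi>_inj[OF O(1,7) EB.sect_in[OF O(1) ab(1)] EB.sect_in[OF O(1) ab(2)]])
 then have "EB.sect ?O ?a x = EB.sect ?O ?b x" by simp
 from EB.rep_eqD[OF EB.rep_sect[OF O(1) ab(1)] EB.rep_sect[OF O(1) ab(2)] O(2,2) this]
 obtain Q where Q: "openin X Q" "x : Q" "Q <= ?O" "EB.eeq Q (EB.tr ?O Q ?a) (EB.tr ?O Q ?b)" by metis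
 have QU: "Q <= U0" using Q O by auto
 have "MB.eeq Q (MB.tr ?O Q (\<kappa>t ?O ?a)) (MB.tr ?O Q (\<kappa>t ?O ?b))"
  unfolding \<kappa>t_tr[OF O(1) Q(1,3) O(7) ab(1)] \<kappa>t_tr[OF O(1) Q(1,3) O(7) ab(2)] by (rule \<kappa>t_eq[OF Q(1) QU Q(4)])
 then show "EX W e e'. x : W & MB.rep g W e & MB.rep h W e' & MB.eeq W e e'"
  using MB.rep_rst[OF ra Q(1,3)] MB.rep_rst[OF rb Q(1,3)] Q(2) by blast
qed

lemma Phi_onto_local:
 assumes V: "openin X V" "V <= U0" and t: "t : Sec F V" and x: "x : V"
 shows "EX W e. openin X W & x : W & W <= V & e : MB.trm W & rst F V W t = EV.ev W e"
proof -
 obtain u where u: "u : Sec F V" "T V u = t" using T_onto[OF V t] .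
 note g = iv(1)[OF V u(1)]
 obtain W e where W: "x : W" "W <= V" "EB.rep (iv V u) W e" using EB.rep_ex[OF g x] .
 have o: "openin X W" "e : EB.trm W" "W <= U0" using EB.repD(1,2) W V(2) by blast+
 have "rst F V W t = EV.ev W (\<kappa>t W e)"
  using EE.Phi_rep[OF V g W(3,2)] u(2) unfolding T_def EE_ev by simp
 then show ?thesis using W o \<kappa>t_trm[OF o(1,3,2)] by blast
qed

end

lemma (in supermanifold) euler_chart:
 assumes EL: "euler_lift U D" and x: "x : U"
 obtains E :: "('x, 'x => complex, ('x, 'a set) germ_fun) module_sheaf" and V \<psi> K
 where "x : V" "V <= U" "euler_chart \<XX> E V \<psi> D K"
proof -
 have U: "openin X U" by (rule eulerD(1)[OF EL])
 have xX: "x : topspace X" using openin_subset[OF U] x by auto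
 obtain E :: "('x, 'x => complex, ('x, 'a set) germ_fun) module_sheaf" and A \<psi>
  where A: "x : A" "ext_iso \<XX> E (%x. x) (%V. V) A \<psi>" using chart[OF xX] by metis
 obtain B K where B: "openin X B" "x : B" "nilpotent_on K B" using locally_nilpotent_on[OF xX] .
 have oA: "openin X A" using A(2) by (rule ext_iso.U0)
 let ?V = "A \<inter> B \<inter> U"
 have V: "openin X ?V" "?V <= A" "?V <= U" "x : ?V" "?V <= B" using A B U x oA by auto
 have "nilpotent_on K ?V" using B(3) V(5) unfolding nilpotent_on_def by blast
 then have "euler_chart \<XX> E ?V \<psi> D K"
  by (intro euler_chart.intro ext_iso_subset[OF A(2) V(1,2)] euler_chart_axioms.intro euler_subset[OF EL V(1,3)])
 then show thesis by (rule that[OF V(4,3)])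
qed

section \<open>Bijectivity of the evaluation on every open set\<close>

context supermanifold
begin

context
 fixes U D assumes EL: "euler_lift U D"
begin

interpretation EV: exterior_eval X R M F U "sig D" "lam D" by (rule euler_eval[OF EL])

lemma Phi_inj:
 assumes V: "openin X V" "V <= U" and g: "g : Sec MB.B V" "h : Sec MB.B V"
  and eq: "EV.Phi V g = EV.Phi V h"
 shows "g = h"
proof (rule extensionalityI[OF MB.B_ext[OF g(1)] MB.B_ext[OF g(2)]])
 fix x assume x: "x : V"
 then have "x : U" using V by auto
 then obtain E :: "('x, 'x => complex, ('x, 'a set) germ_fun) module_sheaf" and A \<psi> K
  where A: "x : A" "A <= U" "euler_chart \<XX> E A \<psi> D K" by (rule euler_chart[OF EL])
 interpret C: euler_chart \<XX> E A \<psi> D K by (rule A(3))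
 let ?W = "A \<inter> V"
 have W: "openin X ?W" "?W <= V" "?W <= A" using V C.U0 by auto
 have "rst MB.B V ?W g = rst MB.B V ?W h"
  by (rule C.Phi_inj_local[OF W(1,3) MB.B_restrict[OF g(1) W(1,2)] MB.B_restrict[OF g(2) W(1,2)]])
   (simp only: EV.Phi_rst[OF V W(1,2) g(1)] EV.Phi_rst[OF V W(1,2) g(2)] eq)
 then have "restrict g ?W x = restrict h ?W x" unfolding MB.B_rst by simp
 then show "g x = h x" using x A(1) by simp
qed

lemma Phi_onto:
 assumes V: "openin X V" "V <= U" and t: "t : Sec F V"
 shows "EX g:Sec MB.B V. EV.Phi V g = t"
proof -
 have "EX W e. openin X W & x : W & W <= V & e : MB.trm W & rst F V W t = EV.ev W e" if x: "x : V" for x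
 proof -
  have "x : U" using x V by auto
  then obtain E :: "('x, 'x => complex, ('x, 'a set) germ_fun) module_sheaf" and A \<psi> K
   where A: "x : A" "A <= U" "euler_chart \<XX> E A \<psi> D K" by (rule euler_chart[OF EL])
  interpret C: euler_chart \<XX> E A \<psi> D K by (rule A(3))
  let ?W = "A \<inter> V"
  have W: "openin X ?W" "?W <= V" "?W <= A" "x : ?W" using V C.U0 A(1) x by auto
  obtain W' e where W': "openin X W'" "x : W'" "W' <= ?W" "e : MB.trm W'" "rst F ?W W' (rst F V ?W t) = EV.ev W' e"
   using C.Phi_onto_local[OF W(1,3) F.rst_closed[OF V(1) W(1,2) t] W(4)] by metis
  have "rst F V W' t = EV.ev W' e" using F.rst_rst[OF V(1) W(1) W'(1,3) W(2) t] W'(5) by simp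
  then show ?thesis using W' by blast
 qed
 then obtain w e where w: "openin X (w x)" "x : w x" "w x <= V" "e x : MB.trm (w x)" "rst F V (w x) t = EV.ev (w x) (e x)"
  if "x : V" for x by metis
 \<comment> \<open>The preimage is assembled germ by germ, the germ at \<open>x\<close> coming from
   the term chosen for \<open>x\<close>. Injectivity makes the terms chosen at different points
   agree on overlaps, as \<open>val\<close> states.\<close>
 define g where "g = (\<lambda>x\<in>V. MB.sect (w x) (e x) x)"
 have val: "g y = MB.sect (w x) (e x) y" if x: "x : V" and y: "y : w x" for x y
 proof -
  have yV: "y : V" using w(3)[OF x] y by auto
  note wx = w[OF x] and wy = w[OF yV]
  let ?O = "w x \<inter> w y"
  have O: "openin X ?O" "?O <= w x" "?O <= w y" "?O <= V" "?O <= U" "w x <= U" "w y <= U" using wx(1,3) wy(1,3) V by auto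
  have "MB.sect ?O (MB.tr (w x) ?O (e x)) = MB.sect ?O (MB.tr (w y) ?O (e y))"
  proof (rule Phi_inj[OF O(1,5)])
   note tx = MB.tr_trm[OF wx(1) O(1,2) wx(4)] and ty = MB.tr_trm[OF wy(1) O(1,3) wy(4)]
   show "MB.sect ?O (MB.tr (w x) ?O (e x)) : Sec MB.B ?O" by (rule MB.sect_in[OF O(1) tx])
   show "MB.sect ?O (MB.tr (w y) ?O (e y)) : Sec MB.B ?O" by (rule MB.sect_in[OF O(1) ty])
   show "EV.Phi ?O (MB.sect ?O (MB.tr (w x) ?O (e x))) = EV.Phi ?O (MB.sect ?O (MB.tr (w y) ?O (e y)))"
    unfolding EV.Phi_sect[OF O(1,5) tx] EV.Phi_sect[OF O(1,5) ty]
     EV.ev_tr[OF wx(1) O(1,2,6) wx(4)] EV.ev_tr[OF wy(1) O(1,3,7) wy(4)] wx(5)[symmetric] wy(5)[symmetric]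
    using F.rst_rst[OF V(1) wx(1) O(1,2) wx(3) t] F.rst_rst[OF V(1) wy(1) O(1,3) wy(3) t] by simp
  qed
  then have "restrict (MB.sect (w x) (e x)) ?O y = restrict (MB.sect (w y) (e y)) ?O y"
   using MB.sect_rst[OF wx(1) O(1,2) wx(4)] MB.sect_rst[OF wy(1) O(1,3) wy(4)] unfolding MB.B_rst by simp
  then show ?thesis unfolding g_def using y yV wy(2) by simp
 qed
 have rep: "MB.rep g (w x) (e x)" if x: "x : V" for x
  using MB.rep_sect[OF w(1,4)[OF x]] val[OF x] unfolding MB.rep_def represents_def by simp
 have gB: "g : Sec MB.B V"
 proof (rule MB.B_mem)
  show "g : extensional V" unfolding g_def by simp
  show "EX W e. x : W & W <= V & MB.rep g W e" if "x : V" for x using rep[OF that] w(2,3)[OF that] by blast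
 qed
 have "EV.Phi V g = t"
 proof (rule EV.Phi_eqI[OF V gB t])
  show "EX W e. x : W & W <= V & MB.rep g W e & rst F V W t = EV.ev W e" if "x : V" for x
   using rep[OF that] w(2,3,5)[OF that] by blast
 qed
 then show ?thesis using gB by blast
qed

lemma Phi_bij:
 assumes V: "openin X V" "V <= U"
 shows "bij_betw (EV.Phi V) (Sec MB.B V) (Sec F V)"
 unfolding bij_betw_def
proof
 show "inj_on (EV.Phi V) (Sec MB.B V)" by (rule inj_onI) (rule Phi_inj[OF V])
 show "EV.Phi V ` Sec MB.B V = Sec F V"
  using EV.Phi_in[OF V] Phi_onto[OF V] by blast
qed

lemma Phi_pj: "[| openin X V; V <= U; g : Sec MB.B V |] ==> pj V (EV.Phi V g) = exterior_projection R V g"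
 by (rule eval_proj[OF EV.exterior_eval_axioms sig(3)[OF EL] lam(1)[OF EL]])

end

end

section \<open>Derivations of degree zero of the split model\<close>

context exterior_base
begin

lemma B_eq_by_rep:
 assumes U: "openin X U" and g: "g : Sec B U" and hk: "h : extensional U" "k : extensional U"
  and r: "!!W a. [| openin X W; W <= U; a : trm W; rep g W a; rep \<zero>[B,U] W (EScal \<zero>[R,W]) |] ==>
   EX e e'. rep h W e & rep k W e' & eeq W e e'"
 shows "h = k"
proof (rule B_eqI[OF hk])
 fix x assume x: "x : U"
 obtain W a where W: "x : W" "W <= U" "rep g W a" using rep_ex[OF g x] .
 note o = repD(1)[OF W(3)]
 have "rep \<zero>[B,U] W (EScal \<zero>[R,W])" using rep_rst[OF rep_zero[OF U] o W(2)] R_zero[OF U o W(2)] by simp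
 from r[OF o W(2) repD(2)[OF W(3)] W(3) this] W(1) show "EX W e e'. x : W & rep h W e & rep k W e' & eeq W e e'" by blast
qed

lemma B_zero_carrier: "openin X U ==> \<zero>[B,U] : Sec B U"
 by (rule B_parity_carrier[OF B_zero_in])

lemma B_zero_laws:
 assumes U: "openin X U" and g: "g : Sec B U"
 shows "g \<oplus>[B,U] \<zero>[B,U] = g" "\<zero>[B,U] \<oplus>[B,U] g = g"
  "g \<otimes>[B,U] \<zero>[B,U] = \<zero>[B,U]" "\<zero>[B,U] \<otimes>[B,U] g = \<zero>[B,U]" "c \<odot>[B,U] \<zero>[B,U] = \<zero>[B,U]"
proof -
 have z: "EScal \<zero>[R,W] : trm W" if "openin X W" for W using zero_in[OF that] by simp
 have sz: "eeq W (ESum a (EScal \<zero>[R,W])) a" if "openin X W" "a : trm W" for W a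
  by (rule ext_trans[OF ext_sum_comm[OF that(2) z[OF that(1)]] ext_sum_zero[OF that(2)]])
 have pz: "eeq W (EProd a (EScal \<zero>[R,W])) (EScal \<zero>[R,W])" if "openin X W" "a : trm W" for W a
  by (rule ext_trans[OF ext_scal_central[OF zero_in[OF that(1)] that(2)] ext_prod_zero[OF that(2)]])
 note e = B_eq_by_rep[OF U g]
 show "g \<oplus>[B,U] \<zero>[B,U] = g"
  by (rule e[OF B_op_ext(1) B_ext[OF g]]) (blast intro: rep_add sz)
 show "\<zero>[B,U] \<oplus>[B,U] g = g"
  by (rule e[OF B_op_ext(1) B_ext[OF g]]) (blast intro: rep_add ext_sum_zero)
 show "g \<otimes>[B,U] \<zero>[B,U] = \<zero>[B,U]"
  by (rule e[OF B_op_ext(2,4)]) (blast intro: rep_mult pz)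
 show "\<zero>[B,U] \<otimes>[B,U] g = \<zero>[B,U]"
  by (rule e[OF B_op_ext(2,4)]) (blast intro: rep_mult ext_prod_zero)
 have s: "EScal (c \<odot>[R,W] \<one>[R,W]) : trm W" if "openin X W" for W using R_smult[OF that] by simp
 show "c \<odot>[B,U] \<zero>[B,U] = \<zero>[B,U]"
  by (rule e[OF B_op_ext(3,4)]) (blast intro: rep_smult pz s)
qed

text \<open>The sign in the odd Leibniz rule is an additive inverse in \<open>sec B U\<close>. For
  zero it is computed from its definition, using only the laws in
  \<open>B_zero_laws\<close>.\<close>

lemma B_minus_zero:
 assumes U: "openin X U"
 shows "\<ominus>[B,U] \<zero>[B,U] = \<zero>[B,U]"
 unfolding a_inv_def m_inv_def
 by (rule the_equality) (use B_zero_laws(1,2)[OF U] B_zero_carrier[OF U] in auto)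

text \<open>Sections of the sheaf of superderivations are sums of an even and an odd derivation, so
  an even derivation is given zero as its odd partner.\<close>

lemma zero_superderivation: "sheaf_superderivation X B U p (%V g. \<zero>[B,V])"
proof (rule sheaf_derI)
 fix V assume V: "openin X V" "V <= U"
 note z = B_zero_carrier[OF V(1)]
 show "homogeneous_superderivation (sec B V) p (%g. \<zero>[B,V])"
  unfolding homogeneous_superderivation_def signed_def
  using B_zero_laws[OF V(1)] B_zero_in[OF V(1)] B_minus_zero[OF V(1)] z B_parity_carrier
  by (auto simp: image_subset_iff)
 fix W assume W: "openin X W" "W <= V"
 show "\<zero>[B,W] = rst B V W \<zero>[B,V]"
  unfolding sect_zero[OF V(1)] sect_zero[OF W(1)]
  using sect_rst[OF V(1) W, of "EScal \<zero>[R,V]"] zero_in[OF V(1)] R_zero[OF V(1) W] by simp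
qed

lemma even_superderivations:
 assumes D: "sheaf_superderivation X B U False D"
 shows "on_open_subsets X B U D : superderivations X B U"
proof -
 have "on_open_subsets X B U D = on_open_subsets X B U (%V g. D V g \<oplus>[B,V] \<zero>[B,V])"
  unfolding on_open_subsets_def
  by (intro restrict_ext) (use superderivationD(1)[OF sheaf_derD(1)[OF D]] B_zero_laws(1) in auto)
 moreover have "EX D\<^sub>0 D\<^sub>1. on_open_subsets X B U (%V g. D V g \<oplus>[B,V] \<zero>[B,V]) =
   on_open_subsets X B U (%V g. D\<^sub>0 V g \<oplus>[B,V] D\<^sub>1 V g) &
   sheaf_superderivation X B U False D\<^sub>0 & sheaf_superderivation X B U True D\<^sub>1"
  by (intro exI[of _ D] exI[of _ "%V g. \<zero>[B,V]"] conjI refl D zero_superderivation)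
 ultimately show ?thesis unfolding superderivations_def by simp
qed

lemma power_sections_subset: "exterior_power_sections X R E k V <= Sec B V"
proof
 fix g assume "g : exterior_power_sections X R E k V"
 moreover have "ext_grade (sec R W) (sec E W) k <= Sec P W" if "openin X W" for W
  unfolding P_carrier[OF that] ext_grade_def by blast
 ultimately show "g : Sec B V"
  unfolding exterior_power_sections_def B_carrier germ_sections_def by blast
qed

end

lemma on_apply:
 "[| openin X V; V <= U; s : Sec F V |] ==> on_open_subsets X F U D V s = D V s"
 unfolding on_open_subsets_def by simp

section \<open>Uniqueness of derivations of the split model\<close>

context supermanifold
begin

abbreviation "BM == exterior_sheaf X R M"
abbreviation "scal == scalar_section X R M"
abbreviation "gen == generator_section X R M"

text \<open>In general functions and conormal sections lift only locally. Over the domain of an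
  Euler lift the eigenlift is a lift on the whole set.\<close>

lemma cc_lift:
 assumes EL: "euler_lift V D"
 shows "f : Sec R V ==> EX s:Sec F V. pj V s = f"
  and "t : Sec M V ==> EX j:J V. t = cc V j"
proof -
 note V = eulerD(1)[OF EL] subset_refl
 show "f : Sec R V ==> EX s:Sec F V. pj V s = f" using sig(1,3)[OF EL V] by blast
 show "t : Sec M V ==> EX j:J V. t = cc V j"
  using lam(1)[OF EL V] cc_eqI[OF M_ext lam(3)[OF EL V]] by blast
qed

text \<open>Uniqueness of parity decompositions holds in the structure sheaf. Evaluation at the
  eigenlifts is injective and respects parity, so it carries the property over to the exterior
  sheaf.\<close>

lemma B_parity_unique:
 assumes EL: "euler_lift V D" and u: "u : Par BM V p" "u' : Par BM V p"
  and v: "v : Par BM V (~ p)" "v' : Par BM V (~ p)"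
  and eq: "u \<oplus>[BM,V] v = u' \<oplus>[BM,V] v'"
 shows "u = u' & v = v'"
proof -
 interpret EV: exterior_eval X R M F V "sig D" "lam D" by (rule euler_eval[OF EL])
 note V = eulerD(1)[OF EL] subset_refl
 interpret A: superalgebra "sec F V" by (rule F.F_super[OF V(1)])
 note h = EV.Phi_hom[OF V]
 have c: "u : Sec BM V" "u' : Sec BM V" "v : Sec BM V" "v' : Sec BM V"
  using u v MB.B_parity_carrier by blast+
 have P: "EV.Phi V g : Par F V q" if "g : Par BM V q" for g q
  using h that unfolding superalgebra_hom_def by blast
 have r: "EV.Phi V : ring_hom (sec BM V) (sec F V)" using h unfolding superalgebra_hom_def by simp
 have e: "EV.Phi V u \<oplus>[F,V] EV.Phi V v = EV.Phi V u' \<oplus>[F,V] EV.Phi V v'"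
  using ring_hom_add[OF r c(1,3)] ring_hom_add[OF r c(2,4)] eq by simp
 have "EV.Phi V u = EV.Phi V u' & EV.Phi V v = EV.Phi V v'"
 proof (cases p)
  case True
  have e': "EV.Phi V v \<oplus>[F,V] EV.Phi V u = EV.Phi V v' \<oplus>[F,V] EV.Phi V u'"
   using e A.a_comm EV.Phi_in[OF V] c by simp
  show ?thesis
   using A.part_unique[OF _ _ _ _ e'] P[OF u(1)] P[OF u(2)] P[OF v(1)] P[OF v(2)] True by simp
 next
  case False
  show ?thesis
   using A.part_unique[OF _ _ _ _ e] P[OF u(1)] P[OF u(2)] P[OF v(1)] P[OF v(2)] False by simp
 qed
 then show ?thesis using Phi_inj[OF EL V] c by blast
qed

text \<open>The signed Leibniz rule belongs to the homogeneous components, so agreement on functions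
  and generators is first separated by parity and then extended by induction to homogeneous terms.
  This takes place over domains of Euler lifts, where every function is some \<open>pj V s\<close>
  and every conormal section some \<open>cc V j\<close>; the general case is local.\<close>

lemma split_derivation_unique:
 assumes D: "D : superderivations X BM U" "D' : superderivations X BM U"
  and sc: "!!V s. [| openin X V; V <= U; s : Sec F V |] ==> D V (scal V (pj V s)) = D' V (scal V (pj V s))"
  and ge: "!!V j. [| openin X V; V <= U; j : J V |] ==> D V (gen V (cc V j)) = D' V (gen V (cc V j))"
 shows "D = D'"
proof -
 obtain A where A: "D = on_open_subsets X BM U (%V s. A False V s \<oplus>[BM,V] A True V s)"
  "!!p. sheaf_superderivation X BM U p (A p)"
 proof -
  from D(1) obtain A0 A1 where a: "D = on_open_subsets X BM U (%V s. A0 V s \<oplus>[BM,V] A1 V s)"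
   "sheaf_superderivation X BM U False A0" "sheaf_superderivation X BM U True A1" unfolding superderivations_def by blast
  show thesis by (rule that[of "%p. if p then A1 else A0"]) (use a in simp_all)
 qed
 obtain B where B: "D' = on_open_subsets X BM U (%V s. B False V s \<oplus>[BM,V] B True V s)"
  "!!p. sheaf_superderivation X BM U p (B p)"
 proof -
  from D(2) obtain A0 A1 where a: "D' = on_open_subsets X BM U (%V s. A0 V s \<oplus>[BM,V] A1 V s)"
   "sheaf_superderivation X BM U False A0" "sheaf_superderivation X BM U True A1" unfolding superderivations_def by blast
  show thesis by (rule that[of "%p. if p then A1 else A0"]) (use a in simp_all)
 qed
 \<comment> \<open>\<open>D\<close> and \<open>D'\<close> only provide sums of an even and an odd
   derivation. On a homogeneous section the two values have different parities, so equal sums have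
   equal summands.\<close>
 have par: "A False V g = B False V g & A True V g = B True V g"
  if EL: "euler_lift V L" and VU: "V <= U" and g: "g : Par BM V q" and eq: "D V g = D' V g" for V L g q
 proof -
  have V: "openin X V" by (rule eulerD(1)[OF EL])
  note a = superderivationD(4)[OF sheaf_derD(1)[OF A(2) V VU] g]
  note b = superderivationD(4)[OF sheaf_derD(1)[OF B(2) V VU] g]
  have "A False V g \<oplus>[BM,V] A True V g = B False V g \<oplus>[BM,V] B True V g"
   using eq on_apply[OF V VU MB.B_parity_carrier[OF g]] unfolding A(1) B(1) by simp
  then show ?thesis using B_parity_unique[OF EL, of _ q] a[of False] b[of False] a[of True] b[of True] by simp
 qed
 have hom: "A p V (MB.sect V e) = B p V (MB.sect V e)"
  if EL: "euler_lift V L" and VU: "V <= U" and q: "ext_parity q e" and e: "e : MB.trm V" for V L q e p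
  using q e
 proof (induction arbitrary: p rule: ext_parity.induct)
  note V = eulerD(1)[OF EL]
  {
   case (1 r)
   then obtain s where s: "s : Sec F V" "pj V s = r" using cc_lift(1)[OF EL] by auto
   have "D V (MB.sect V (EScal r)) = D' V (MB.sect V (EScal r))"
    using sc[OF V VU s(1)] s(2) unfolding MB.scalar_section_sect by simp
   from par[OF EL VU MB.sect_parity[OF V 1 ext_parity.intros(1)] this] show ?case by (cases p) simp_all
  next
   case (2 m)
   then obtain j where j: "j : J V" "m = cc V j" using cc_lift(2)[OF EL] by auto
   have "D V (MB.sect V (EGen m)) = D' V (MB.sect V (EGen m))"
    using ge[OF V VU j(1)] j(2) unfolding MB.generator_section_sect by simp
   from par[OF EL VU MB.sect_parity[OF V 2 ext_parity.intros(2)] this] show ?case by (cases p) simp_all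
  next
   case (3 q a b)
   then have ab: "a : MB.trm V" "b : MB.trm V" by simp_all
   note c = MB.sect_in[OF V ab(1)] MB.sect_in[OF V ab(2)]
   show ?case
    unfolding MB.sect_sum[OF V ab] superderivationD(2)[OF sheaf_derD(1)[OF A(2) V VU] c]
     superderivationD(2)[OF sheaf_derD(1)[OF B(2) V VU] c]
    using 3 ab by simp
  next
   case (4 q a q' b)
   then have ab: "a : MB.trm V" "b : MB.trm V" by simp_all
   note c = MB.sect_parity[OF V ab(1) 4(1)] MB.sect_in[OF V ab(2)]
   show ?case
    unfolding MB.sect_prod[OF V ab] superderivationD(5)[OF sheaf_derD(1)[OF A(2) V VU] c]
     superderivationD(5)[OF sheaf_derD(1)[OF B(2) V VU] c]
    using 4 ab by simp
  }
 qed
 have sect: "A p V (MB.sect V e) = B p V (MB.sect V e)"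
  if EL: "euler_lift V L" and VU: "V <= U" and e: "e : MB.trm V" for V L e p
 proof -
  note V = eulerD(1)[OF EL]
  obtain a b where ab: "a : MB.trm V" "b : MB.trm V" "ext_parity False a" "ext_parity True b" "MB.eeq V e (ESum a b)"
   using MB.trm_parity_decompose[OF V e] by blast
  note c = MB.sect_in[OF V ab(1)] MB.sect_in[OF V ab(2)]
  show ?thesis
   unfolding MB.sect_eq[OF V ab(5)] MB.sect_sum[OF V ab(1,2)]
    superderivationD(2)[OF sheaf_derD(1)[OF A(2) V VU] c]
    superderivationD(2)[OF sheaf_derD(1)[OF B(2) V VU] c]
    hom[OF EL VU ab(3,1)] hom[OF EL VU ab(4,2)] ..
 qed
 have "A p V g = B p V g" if V: "openin X V" "V <= U" and g: "g : Sec BM V" for V g p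
 proof (rule extensionalityI)
  note dA = sheaf_derD[OF A(2)] and dB = sheaf_derD[OF B(2)]
  show "A p V g : extensional V" "B p V g : extensional V"
   using MB.B_ext superderivationD(1)[OF dA(1)[OF V] g] superderivationD(1)[OF dB(1)[OF V] g] by blast+
  fix x assume x: "x : V"
  then have "x : topspace X" using openin_subset[OF V(1)] by auto
  then obtain U' L where L: "x : U'" "euler_lift U' L" by (rule local_euler_lift)
  obtain W e where W: "x : W" "W <= V" "MB.rep g W e" using MB.rep_ex[OF g x] .
  have Wo: "openin X W" by (rule MB.repD(1)[OF W(3)])
  let ?O = "W \<inter> U'"
  have O: "openin X ?O" "?O <= W" "?O <= U'" "x : ?O" "?O <= V" "?O <= U" using Wo eulerD(1)[OF L(2)] L(1) W V by auto
  let ?e = "MB.tr W ?O e"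
  have r: "MB.rep g ?O ?e" by (rule MB.rep_rst[OF W(3) O(1,2)])
  have g': "rst BM V ?O g = MB.sect ?O ?e"
   unfolding MB.B_rst by (rule MB.sect_eqI[OF _ MB.rep_restrict[OF r subset_refl]]) simp
  have "rst BM V ?O (A p V g) = rst BM V ?O (B p V g)"
   unfolding dA(2)[OF V(1) O(1,5) V(2) g, symmetric] dB(2)[OF V(1) O(1,5) V(2) g, symmetric] g'
   by (rule sect[OF euler_subset[OF L(2) O(1,3)] O(6) MB.repD(2)[OF r]])
  then have "restrict (A p V g) ?O x = restrict (B p V g) ?O x" unfolding MB.B_rst by simp
  then show "A p V g x = B p V g x" using O(4) by simp
 qed
 then show ?thesis unfolding A(1) B(1) on_open_subsets_def by (intro restrict_ext) auto
qed

lemma split_tangent_iff: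
 "D : Sec (split_tangent_degree \<XX> 0) U \<longleftrightarrow> D : superderivations X BM U &
  (ALL V. openin X V & V <= U --> (ALL k. D V ` exterior_power_sections X R M k V <= exterior_power_sections X R M k V))"
 unfolding split_tangent_degree_def superderivation_subsheaf_def additive_group_def split_model_def Let_def by simp

lemma split_tangent_rst: "rst (split_tangent_degree \<XX> m) U V D = on_open_subsets X BM V D"
 unfolding split_tangent_degree_def superderivation_subsheaf_def split_model_def Let_def by simp

lemma Der_split_tangent:
 assumes "exterior_der X R M U Bs d \<delta>"
 shows "on_open_subsets X BM U (exterior_der.Der X R M Bs d \<delta>) : Sec (split_tangent_degree \<XX> 0) U"
proof -
 interpret ED: exterior_der X R M U Bs d \<delta> by fact
 show ?thesis
  unfolding split_tangent_iff
 proof (intro conjI allI impI image_subsetI MB.even_superderivations ED.Der_superderivation)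
  fix V k g assume V: "openin X V & V <= U" and g: "g : exterior_power_sections X R M k V"
  have "g : Sec BM V" using MB.power_sections_subset g by blast
  then show "on_open_subsets X BM U ED.Der V g : exterior_power_sections X R M k V"
   using on_apply[of X V U g BM ED.Der] ED.Der_grade[OF _ g] V by simp
 qed
qed

text \<open>The definite description is proper: the derivation built from zero on functions and the
  identity on conormal sections satisfies it, and \<open>split_derivation_unique\<close> excludes
  any other.\<close>

lemma euler_field:
 shows "euler_field \<XX> : Sec (split_tangent_degree \<XX> 0) (topspace X)"
  and "[| openin X V; f : Sec R V |] ==> euler_field \<XX> V (scal V f) = \<zero>[BM,V]"
  and "[| openin X V; t : Sec M V |] ==> euler_field \<XX> V (gen V t) = gen V t"
proof -
 let ?P = "%D. D : Sec (split_tangent_degree \<XX> 0) (topspace X) & (ALL V. openin X V & V <= topspace X -->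
   (ALL f:Sec R V. D V (scal V f) = \<zero>[BM,V]) & (ALL t:Sec M V. D V (gen V t) = gen V t))"
 interpret ED: exterior_der X R M "topspace X" "{V. openin X V & V <= topspace X}" "%V f. \<zero>[R,V]" "%V m. m"
  by (rule MB.euler_exterior_der[OF openin_topspace M_zero_smult])
 have ex: "?P (on_open_subsets X BM (topspace X) ED.Der)"
 proof (intro conjI allI impI ballI Der_split_tangent ED.exterior_der_axioms)
  fix V assume V: "openin X V & V <= topspace X"
  then have Vo: "openin X V" "V <= topspace X" "V : {V. openin X V & V <= topspace X}" by simp_all
  show "on_open_subsets X BM (topspace X) ED.Der V (scal V f) = \<zero>[BM,V]" if f: "f : Sec R V" for f
  proof -
   have e: "EScal f : MB.trm V" using f by simp
   show ?thesis
    unfolding MB.scalar_section_sect on_apply[OF Vo(1,2) MB.sect_in[OF Vo(1) e]] ED.Der_sect[OF Vo(3) e]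
     MB.sect_zero[OF Vo(1)] by simp
  qed
  show "on_open_subsets X BM (topspace X) ED.Der V (gen V t) = gen V t" if t: "t : Sec M V" for t
  proof -
   have e: "EGen t : MB.trm V" using t by simp
   show ?thesis
    unfolding MB.generator_section_sect on_apply[OF Vo(1,2) MB.sect_in[OF Vo(1) e]] ED.Der_sect[OF Vo(3) e] by simp
  qed
 qed
 have un: "D = D'" if D: "?P D" "?P D'" for D D'
 proof (rule split_derivation_unique[of _ "topspace X"])
  show "D : superderivations X BM (topspace X)" "D' : superderivations X BM (topspace X)"
   by (rule split_tangent_iff[THEN iffD1, THEN conjunct1, OF conjunct1[OF D(1)]],
     rule split_tangent_iff[THEN iffD1, THEN conjunct1, OF conjunct1[OF D(2)]])
  fix V assume V: "openin X V" "V <= topspace X"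
  note d = conjunct2[OF D(1), rule_format, OF conjI[OF V]] and d' = conjunct2[OF D(2), rule_format, OF conjI[OF V]]
  show "D V (scal V (pj V s)) = D' V (scal V (pj V s))" if "s : Sec F V" for s
   unfolding bspec[OF conjunct1[OF d] pj_in[OF V(1) that]] bspec[OF conjunct1[OF d'] pj_in[OF V(1) that]] ..
  show "D V (gen V (cc V j)) = D' V (gen V (cc V j))" if "j : J V" for j
   unfolding bspec[OF conjunct2[OF d] cc_in[OF V(1) that]] bspec[OF conjunct2[OF d'] cc_in[OF V(1) that]] ..
 qed
 have "EX! D. ?P D" by (rule ex1I[of ?P, OF ex]) (rule un[OF _ ex])
 from theI'[OF this] have P: "?P (euler_field \<XX>)"
  unfolding euler_field_def endomorphism_derivation_def Let_def split_model_def by simp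
 show "euler_field \<XX> : Sec (split_tangent_degree \<XX> 0) (topspace X)" using P by (rule conjunct1)
 show "[| openin X V; f : Sec R V |] ==> euler_field \<XX> V (scal V f) = \<zero>[BM,V]"
  using conjunct2[OF P, rule_format, OF conjI[OF _ openin_subset], THEN conjunct1] by simp
 show "[| openin X V; t : Sec M V |] ==> euler_field \<XX> V (gen V t) = gen V t"
  using conjunct2[OF P, rule_format, OF conjI[OF _ openin_subset], THEN conjunct2] by simp
qed

end

section \<open>The symbol map\<close>

lemma (in superalgebra) ppart_sum:
 assumes "u : parity_part A q" "v : parity_part A (~ q)"
 shows "ppart A q (u \<oplus> v) = u" "ppart A (~ q) (u \<oplus> v) = v"
proof -
 have "ppart A q (u \<oplus> v) = u & ppart A (~ q) (u \<oplus> v) = v"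
 proof (cases q)
  case True
  then show ?thesis using assms ppart_eqI[of v u] a_comm[of u v] by simp
 next
  case False
  then show ?thesis using assms ppart_eqI[of u v] by simp
 qed
 then show "ppart A q (u \<oplus> v) = u" "ppart A (~ q) (u \<oplus> v) = v" by simp_all
qed

context supermanifold
begin

lemma tangent_iff:
 "D : Sec (tangent_filtration \<XX> m) U \<longleftrightarrow> D : superderivations X F U &
  (ALL V. openin X V & V <= U --> (ALL l. D V ` N l V <= N (l + m) V))"
 unfolding tangent_filtration_def superderivation_subsheaf_def additive_group_def by simp

definition join :: "'x set => (bool => ('x, 'a) derivation) => ('x, 'a) derivation" where
 "join U A = on_open_subsets X F U (%V s. A False V s \<oplus>[F,V] A True V s)"

definition parts :: "nat => 'x set => (bool => ('x, 'a) derivation) => bool" where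
 "parts m U A \<longleftrightarrow> (ALL p. sheaf_superderivation X F U p (A p) &
  (ALL V l. openin X V & V <= U --> (ALL s:N l V. A p V s : N (l + m) V)))"

lemma partsD:
 assumes "parts m U A"
 shows "sheaf_superderivation X F U p (A p)"
  and "[| openin X V; V <= U; s : N l V |] ==> A p V s : N (l + m) V"
  and "[| openin X V; V <= U; s : Sec F V |] ==> A p V s : Sec F V"
proof -
 show d: "sheaf_superderivation X F U p (A p)" and "[| openin X V; V <= U; s : N l V |] ==> A p V s : N (l + m) V"
  using assms unfolding parts_def by simp_all
 show "[| openin X V; V <= U; s : Sec F V |] ==> A p V s : Sec F V"
  by (rule superderivationD(1)[OF sheaf_derD(1)[OF d]])
qed

lemma join_apply: "[| openin X V; V <= U; s : Sec F V |] ==> join U A V s = A False V s \<oplus>[F,V] A True V s"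
 unfolding join_def by (rule on_apply)

lemma join_tangent:
 assumes A: "parts m U A"
 shows "join U A : Sec (tangent_filtration \<XX> m) U"
 unfolding tangent_iff
proof (intro conjI allI impI image_subsetI)
 show "join U A : superderivations X F U"
  unfolding superderivations_def join_def using partsD(1)[OF A] by blast
 fix V l s assume V: "openin X V & V <= U" and s: "s : N l V"
 show "join U A V s : N (l + m) V"
  using join_apply[of V U s A] N_add[of V] partsD(2)[OF A _ _ s] N_in[OF s] V by simp
qed

lemma superderivation_parts:
 assumes A: "!!p. sheaf_superderivation X F U p (A p)" and V: "openin X V" "V <= U"
  and s: "s : Par F V q"
 shows "A p V s = ppart (sec F V) (p ~= q) (join U A V s)"
proof -
 interpret V: superalgebra "sec F V" by (rule F.F_super[OF V(1)])
 have a: "A False V s : Par F V q" "A True V s : Par F V (~ q)"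
  using superderivationD(4)[OF sheaf_derD(1)[OF A[of False] V] s]
   superderivationD(4)[OF sheaf_derD(1)[OF A[of True] V] s] by simp_all
 show ?thesis unfolding join_apply[OF V V.part_carrier[OF s]]
  by (cases p) (simp_all add: V.ppart_sum[OF a])
qed

text \<open>The homogeneous parts of a derivation can be recovered from their sum, by applying it to
  the parity components of the argument and taking parity components of the values. Hence they are
  determined by the sum and inherit its estimates.\<close>

lemma parts_sum:
 assumes A: "!!p. sheaf_superderivation X F U p (A p)" and V: "openin X V" "V <= U" and s: "s : Sec F V"
 shows "A p V s = ppart (sec F V) p (join U A V (ppart (sec F V) False s)) \<oplus>[F,V]
  ppart (sec F V) (~ p) (join U A V (ppart (sec F V) True s))"
proof -
 interpret V: superalgebra "sec F V" by (rule F.F_super[OF V(1)])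
 have "A p V s = A p V (ppart (sec F V) False s) \<oplus>[F,V] A p V (ppart (sec F V) True s)"
  using superderivationD(2)[OF sheaf_derD(1)[OF A V], of "ppart (sec F V) False s" "ppart (sec F V) True s"]
   V.ppart_decompose(1)[OF s] s by simp
 then show ?thesis
  using superderivation_parts[OF A V V.ppart_in[OF s, of False], of p] superderivation_parts[OF A V V.ppart_in[OF s, of True], of p]
  by simp
qed

lemma parts_N:
 assumes A: "!!p. sheaf_superderivation X F U p (A p)" and V: "openin X V" "V <= U" and s: "s : Sec F V"
  and h: "!!q. join U A V (ppart (sec F V) q s) : N l V"
 shows "A p V s : N l V"
 unfolding parts_sum[OF A V s] by (intro N_add N_ppart V(1) h)

lemma tangent_join:
 assumes D: "D : Sec (tangent_filtration \<XX> m) U"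
 obtains A where "parts m U A" "D = join U A"
proof -
 from conjunct1[OF iffD1[OF tangent_iff D]] obtain A0 A1 where a: "D = on_open_subsets X F U (%V s. A0 V s \<oplus>[F,V] A1 V s)"
  "sheaf_superderivation X F U False A0" "sheaf_superderivation X F U True A1"
  unfolding superderivations_def by blast
 define A where "A p = (if p then A1 else A0)" for p
 have d: "sheaf_superderivation X F U p (A p)" for p unfolding A_def using a(2,3) by simp
 have DA: "D = join U A" unfolding a(1) join_def A_def by simp
 have "A p V s : N (l + m) V" if V: "openin X V" "V <= U" and s: "s : N l V" for p V l s
  by (rule parts_N[OF d V N_in[OF s]])
   (use conjunct2[OF iffD1[OF tangent_iff D], rule_format, OF conjI[OF V], of l] N_ppart[OF V(1) s] DA in blast)
 then have "parts m U A" unfolding parts_def using d by simp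
 then show thesis using that DA by blast
qed

text \<open>An odd derivation of filtration degree 0 is already of degree 1 on these levels. Even
  sections go to odd ones, which are in \<open>J\<close>. Even elements of \<open>J\<close> are in
  the square and stay there; odd elements of \<open>J\<close> go to even elements of
  \<open>J\<close>, hence to the square by \<open>even_J\<close>.\<close>

lemma odd_part_J:
 assumes A: "parts 0 U A" and V: "openin X V" "V <= U"
 shows "s : Sec F V ==> A True V s : J V" and "s : J V ==> A True V s : N 2 V"
proof -
 interpret V: superalgebra "sec F V" by (rule F.F_super[OF V(1)])
 note d = superderivationD[OF sheaf_derD(1)[OF partsD(1)[OF A, of True] V]]
 have dec: "A True V s = A True V (ppart (sec F V) False s) \<oplus>[F,V] A True V (ppart (sec F V) True s)"
  if "s : Sec F V" for s
  using d(2)[of "ppart (sec F V) False s" "ppart (sec F V) True s"] V.ppart_decompose(1)[OF that] that by simp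
 have NJ: "A True V s : J V" if "s : J V" for s
  using partsD(2)[OF A V, of s 1 True] that N_1[OF V(1)] by simp
 show "A True V s : J V" if s: "s : Sec F V"
  unfolding dec[OF s]
 proof (rule J_add[OF V(1)])
  show "A True V (ppart (sec F V) False s) : J V"
   using J_odd[OF V(1)] d(4)[OF V.ppart_in[OF s, of False]] by simp
  show "A True V (ppart (sec F V) True s) : J V" by (rule NJ[OF J_odd[OF V(1) V.ppart_in[OF s]]])
 qed
 show "A True V s : N 2 V" if s: "s : J V"
 proof -
  have sc: "s : Sec F V" by (rule J_in[OF s])
  have sJ: "ppart (sec F V) q s : J V" for q
   using N_ppart[OF V(1), of s 1 q] s unfolding N_1[OF V(1)] by simp
  have "A True V (ppart (sec F V) False s) : N 2 V"
   using partsD(2)[OF A V even_J[OF V(1) sJ V.ppart_in[OF sc]], of True] by simp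
  moreover have "A True V (ppart (sec F V) True s) : N 2 V"
   by (rule even_J[OF V(1) NJ[OF sJ]]) (use d(4)[OF V.ppart_in[OF sc, of True]] in simp)
  ultimately show ?thesis unfolding dec[OF sc] by (rule N_add[OF V(1)])
 qed
qed

lemma cc_eq_iff:
 assumes "openin X V" "j : J V" "k : J V"
 shows "cc V j = cc V k \<longleftrightarrow> j \<ominus>[F,V] k : N 2 V"
proof
 assume "cc V j = cc V k"
 then show "j \<ominus>[F,V] k : N 2 V"
  using repM_unique[OF cc_repM[OF assms(1,2)] cc_repM[OF assms(1,3)] assms(1) subset_refl subset_refl]
   F.rst_id[OF assms(1)] J_in assms(2,3) by simp
next
 assume "j \<ominus>[F,V] k : N 2 V"
 then have "repM (cc V k) V j" by (rule repM_class[OF cc_repM[OF assms(1,3)] assms(2)])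
 then show "cc V j = cc V k"
  using cc_eqI[OF cc_ext] by simp
qed

lemma cc_add:
 assumes "openin X V" "j : J V" "k : J V"
 shows "cc V (j \<oplus>[F,V] k) = cc V j \<oplus>[M,V] cc V k"
 by (rule cc_eqI[symmetric, OF M_op_ext(1)
  repM_add[OF cc_repM[OF assms(1,2)] cc_repM[OF assms(1,3)] subset_refl]])

lemma cc_smult:
 assumes V: "openin X V" and s: "s : Sec F V" and j: "j : J V"
 shows "cc V (s \<otimes>[F,V] j) = pj V s \<odot>[M,V] cc V j"
 by (rule cc_eqI[symmetric, OF M_op_ext(2) repM_smult[OF cc_repM[OF V j] subset_refl s]])
  (rule extensional_restrict[symmetric, OF pj_ext[OF V s]])

lemma cc_rst:
 assumes "openin X V" "openin X W" "W <= V" "j : J V"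
 shows "rst M V W (cc V j) = cc W (rst F V W j)"
 unfolding M_simps(5)
 by (rule cc_eqI[OF _ repM_restrict[OF repM_rst[OF cc_repM[OF assms(1,4)] assms(2,3)] subset_refl]]) simp

section \<open>Existence of the symbol of an even derivation\<close>

context
 fixes U D assumes U: "openin X U" and D: "sheaf_superderivation X F U False D"
  and DN: "!!V l s. [| openin X V; V <= U; s : N l V |] ==> D V s : N l V"
begin

definition sym_d :: "'x set => ('x => complex) => 'x => complex" where
 "sym_d V f = pj V (D V (SOME s. s : Sec F V & pj V s = f))"

definition sym_\<delta> :: "'x set => ('x, 'a set) germ_fun => ('x, 'a set) germ_fun" where
 "sym_\<delta> V t = cc V (D V (SOME j. j : J V & cc V j = t))"

text \<open>The sets on which the lifts chosen in \<open>sym_d\<close> and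
  \<open>sym_\<delta>\<close> are sure to exist, by \<open>cc_lift\<close>. They cover
  \<open>U\<close> and are closed under passing to open subsets.\<close>

definition "sym_base = {V. V <= U & (EX E. euler_lift V E)}"

context
 fixes V assumes V: "openin X V" "V <= U"
begin

interpretation V: even_derivation "sec F V" "D V"
 by (intro even_derivation.intro even_derivation_axioms.intro F.F_super V sheaf_derD(1)[OF D])

lemma DJ: "j : J V ==> D V j : J V"
 using DN[OF V, of j 1] unfolding N_1[OF V(1)] .

lemma sym_d_pj:
 assumes s: "s : Sec F V"
 shows "sym_d V (pj V s) = pj V (D V s)"
proof -
 obtain u where u: "u : Sec F V" "pj V u = pj V s" "sym_d V (pj V s) = pj V (D V u)"
  using someI[of "%u. u : Sec F V & pj V u = pj V s"] s unfolding sym_d_def by blast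
 have "u \<ominus>[F,V] s : J V" using pj_diff_J[OF V(1) u(1) s] u(2) by simp
 from DJ[OF this] have "D V u \<ominus>[F,V] D V s : J V" unfolding V.D_diff[OF u(1) s] .
 then show ?thesis using pj_diff_J[OF V(1), of "D V u" "D V s"] u s by simp
qed

lemma sym_\<delta>_class:
 assumes j: "j : J V"
 shows "sym_\<delta> V (cc V j) = cc V (D V j)"
proof -
 obtain k where k: "k : J V" "cc V k = cc V j"
  "sym_\<delta> V (cc V j) = cc V (D V k)"
  using someI[of "%k. k : J V & cc V k = cc V j"] j unfolding sym_\<delta>_def by blast
 have "k \<ominus>[F,V] j : N 2 V" using cc_eq_iff[OF V(1) k(1) j] k(2) by simp
 from DN[OF V this] have "D V k \<ominus>[F,V] D V j : N 2 V" unfolding V.D_diff[OF J_in[OF k(1)] J_in[OF j]] .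
 then show ?thesis unfolding k(3) using cc_eq_iff[OF V(1) DJ[OF k(1)] DJ[OF j]] by simp
qed

end

lemma D_rst: "[| openin X V; openin X W; W <= V; V <= U; s : Sec F V |] ==> D W (rst F V W s) = rst F V W (D V s)"
 by (rule sheaf_derD(2)[OF D])

lemma sym_exterior_der: "exterior_der X R M U sym_base sym_d sym_\<delta>"
proof (intro exterior_der.intro M_exterior_base exterior_der_axioms.intro)
 fix V assume "V : sym_base"
 then obtain E where E: "euler_lift V E" and VU: "V <= U" unfolding sym_base_def by blast
 note V = eulerD(1)[OF E] VU
 note fl = cc_lift(1)[OF E] and ml = cc_lift(2)[OF E]
 note ph = pj_hom[OF V(1)]
 interpret V: even_derivation "sec F V" "D V"
  by (intro even_derivation.intro even_derivation_axioms.intro F.F_super V sheaf_derD(1)[OF D])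
 note dp = sym_d_pj[OF V] and dc = sym_\<delta>_class[OF V]
 show "openin X V" by (rule V(1))
 show "W : sym_base" if "openin X W" "W <= V" for W
  using euler_subset[OF E that] that V unfolding sym_base_def by blast
 show "sym_d V (c \<odot>[R,V] \<one>[R,V]) = \<zero>[R,V]" for c
 proof -
  have "c \<odot>[R,V] \<one>[R,V] = pj V (c \<odot>[F,V] \<one>[F,V])"
   using pj_smult[OF V(1) V.one_closed] ring_hom_one[OF ph] by simp
  moreover have "pj V \<zero>[F,V] = \<zero>[R,V]" using N_zero[OF V(1), of 1] J_iff unfolding N_1[OF V(1)] by simp
  ultimately show ?thesis using dp[of "c \<odot>[F,V] \<one>[F,V]"] by (simp add: V.D_smult V.D_one)
 qed
 fix f assume "f : Sec R V"
 then obtain s where s: "s : Sec F V" "f = pj V s" using fl by blast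
 show "sym_d V f : Sec R V" unfolding s(2) dp[OF s(1)] by (rule pj_in[OF V(1) V.D_closed[OF s(1)]])
 show "sym_d W (rst R V W f) = rst R V W (sym_d V f)" if W: "openin X W" "W <= V" for W
 proof -
  have WU: "W <= U" using W V by auto
  show ?thesis
   unfolding s(2) dp[OF s(1)] R_simps(1) pj_rst[OF V(1) W s(1), symmetric] pj_rst[OF V(1) W V.D_closed[OF s(1)], symmetric]
    sym_d_pj[OF W(1) WU F.rst_closed[OF V(1) W s(1)]] D_rst[OF V(1) W V(2) s(1)] ..
 qed
 show "sym_\<delta> V (f \<odot>[M,V] m) = sym_d V f \<odot>[M,V] m \<oplus>[M,V] f \<odot>[M,V] sym_\<delta> V m"
  if "m : Sec M V" for m
 proof -
  obtain j where j: "j : J V" "m = cc V j" using ml[OF \<open>m : Sec M V\<close>] by blast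
  note jc = J_in[OF j(1)] and DjJ = DJ[OF V j(1)]
  show ?thesis
   unfolding s(2) j(2) dp[OF s(1)] dc[OF j(1)] cc_smult[OF V(1) s(1) j(1), symmetric]
    cc_smult[OF V(1) V.D_closed[OF s(1)] j(1), symmetric] cc_smult[OF V(1) s(1) DjJ, symmetric]
    dc[OF J_mult[OF V(1) s(1) j(1)]] V.D_mult[OF s(1) jc]
   by (rule cc_add[OF V(1) J_mult[OF V(1) V.D_closed[OF s(1)] j(1)] J_mult[OF V(1) s(1) DjJ]])
 qed
 fix g assume "g : Sec R V"
 then obtain u where u: "u : Sec F V" "g = pj V u" using fl by blast
 show "sym_d V (f \<oplus>[R,V] g) = sym_d V f \<oplus>[R,V] sym_d V g"
  using ring_hom_add[OF ph s(1) u(1)] ring_hom_add[OF ph V.D_closed[OF s(1)] V.D_closed[OF u(1)]]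
   dp[OF s(1)] dp[OF u(1)] dp[OF V.a_closed[OF s(1) u(1)]] V.D_add[OF s(1) u(1)] unfolding s(2) u(2) by simp
 show "sym_d V (f \<otimes>[R,V] g) = sym_d V f \<otimes>[R,V] g \<oplus>[R,V] f \<otimes>[R,V] sym_d V g"
  using ring_hom_mult[OF ph s(1) u(1)] ring_hom_mult[OF ph V.D_closed[OF s(1)] u(1)] ring_hom_mult[OF ph s(1) V.D_closed[OF u(1)]]
   ring_hom_add[OF ph V.m_closed[OF V.D_closed[OF s(1)] u(1)] V.m_closed[OF s(1) V.D_closed[OF u(1)]]]
   dp[OF s(1)] dp[OF u(1)] dp[OF V.m_closed[OF s(1) u(1)]] V.D_mult[OF s(1) u(1)] unfolding s(2) u(2) by simp
next
 fix V m assume "V : sym_base" and m: "m : Sec M V"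
 then obtain E where E: "euler_lift V E" and VU: "V <= U" unfolding sym_base_def by blast
 note V = eulerD(1)[OF E] VU
 interpret V: even_derivation "sec F V" "D V"
  by (intro even_derivation.intro even_derivation_axioms.intro F.F_super V sheaf_derD(1)[OF D])
 note ml = cc_lift(2)[OF E] and dc = sym_\<delta>_class[OF V]
 obtain j where j: "j : J V" "m = cc V j" using ml[OF m] by blast
 note jc = J_in[OF j(1)] and DjJ = DJ[OF V j(1)]
 show "sym_\<delta> V m : Sec M V" unfolding j(2) dc[OF j(1)] by (rule cc_in[OF V(1) DjJ])
 show "sym_\<delta> W (rst M V W m) = rst M V W (sym_\<delta> V m)" if W: "openin X W" "W <= V" for W
 proof -
  have WU: "W <= U" using W V by auto
  show ?thesis
   unfolding j(2) dc[OF j(1)] cc_rst[OF V(1) W j(1)] cc_rst[OF V(1) W DjJ]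
    sym_\<delta>_class[OF W(1) WU J_rst[OF V(1) W j(1)]] D_rst[OF V(1) W V(2) jc] ..
 qed
 fix n assume n: "n : Sec M V"
 obtain k where k: "k : J V" "n = cc V k" using ml[OF n] by blast
 note kc = J_in[OF k(1)] and DkJ = DJ[OF V k(1)]
 show "sym_\<delta> V (m \<oplus>[M,V] n) = sym_\<delta> V m \<oplus>[M,V] sym_\<delta> V n"
  unfolding j(2) k(2) dc[OF j(1)] dc[OF k(1)] cc_add[OF V(1) j(1) k(1), symmetric]
   cc_add[OF V(1) DjJ DkJ, symmetric] dc[OF J_add[OF V(1) j(1) k(1)]] V.D_add[OF jc kc] ..
next
 fix x assume x: "x : U"
 then have "x : topspace X" using openin_subset[OF U] by auto
 then obtain U' L where L: "x : U'" "euler_lift U' L" by (rule local_euler_lift)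
 have "euler_lift (U' \<inter> U) L" using euler_subset[OF L(2), of "U' \<inter> U"] eulerD(1)[OF L(2)] U by auto
 then show "EX V:sym_base. x : V" using L(1) x unfolding sym_base_def by (intro bexI[of _ "U' \<inter> U"]) auto
qed

interpretation ED: exterior_der X R M U sym_base sym_d sym_\<delta> by (rule sym_exterior_der)

text \<open>\<open>Der_sect\<close> computes the derivation on base sets only. For other
  \<open>V\<close> the two sides are compared on a base neighbourhood of each point.\<close>

lemma sym_Der_sect:
 assumes V: "openin X V" "V <= U" and e: "e : MB.trm V" "e' : MB.trm V"
  and h: "!!W. [| openin X W; W <= V |] ==> ED.der W (MB.tr V W e) = MB.tr V W e'"
 shows "on_open_subsets X BM U ED.Der V (MB.sect V e) = MB.sect V e'"
proof (rule extensionalityI[of _ V])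
 note g = MB.sect_in[OF V(1) e(1)]
 show "on_open_subsets X BM U ED.Der V (MB.sect V e) : extensional V"
  unfolding on_apply[OF V g] by (rule ED.Der_ext)
 show "MB.sect V e' : extensional V" by (rule MB.sect_ext)
 fix x assume x: "x : V"
 then obtain A where A: "A : sym_base" "x : A" using ED.Bs_cover V by blast
 let ?W = "A \<inter> V"
 have W: "openin X ?W" "?W <= V" "x : ?W" using ED.Bs_open[OF A(1)] V x A(2) by auto
 have Wb: "?W : sym_base" by (rule ED.Bs_down[OF A(1) W(1)]) simp
 have "rst BM V ?W (ED.Der V (MB.sect V e)) = rst BM V ?W (MB.sect V e')"
  unfolding ED.Der_rst[OF V(1) W(1,2) V(2) g, symmetric] MB.sect_rst[OF V(1) W(1,2) e(1)] MB.sect_rst[OF V(1) W(1,2) e(2)]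
   ED.Der_sect[OF Wb MB.tr_trm[OF V(1) W(1,2) e(1)]] h[OF W(1,2)] ..
 then have "restrict (ED.Der V (MB.sect V e)) ?W x = restrict (MB.sect V e') ?W x" unfolding MB.B_rst by simp
 then show "on_open_subsets X BM U ED.Der V (MB.sect V e) x = MB.sect V e' x"
  unfolding on_apply[OF V g] using W(3) by simp
qed

lemma sym_exists:
 "EX D'. D' : Sec (split_tangent_degree \<XX> 0) U & (ALL V. openin X V & V <= U -->
  (ALL s:Sec F V. D' V (scal V (pj V s)) = scal V (pj V (D V s))) &
  (ALL j:J V. D' V (gen V (cc V j)) = gen V (cc V (D V j))))"
proof (intro exI conjI allI impI ballI)
 show "on_open_subsets X BM U ED.Der : Sec (split_tangent_degree \<XX> 0) U"
  by (rule Der_split_tangent[OF sym_exterior_der])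
 fix V assume V': "openin X V & V <= U"
 then have V: "openin X V" "V <= U" by simp_all
 have c: "s : Sec F V ==> D V s : Sec F V" for s
  by (rule superderivationD(1)[OF sheaf_derD(1)[OF D V]])
 show "on_open_subsets X BM U ED.Der V (scal V (pj V s)) = scal V (pj V (D V s))" if s: "s : Sec F V" for s
  unfolding MB.scalar_section_sect
 proof (rule sym_Der_sect[OF V])
  show "EScal (pj V s) : MB.trm V" "EScal (pj V (D V s)) : MB.trm V" using pj_in[OF V(1)] s c by simp_all
  fix W assume W: "openin X W" "W <= V"
  have WU: "W <= U" using W V by auto
  show "ED.der W (MB.tr V W (EScal (pj V s))) = MB.tr V W (EScal (pj V (D V s)))"
   using sym_d_pj[OF W(1) WU F.rst_closed[OF V(1) W s]] pj_rst[OF V(1) W s] pj_rst[OF V(1) W c[OF s]] D_rst[OF V(1) W V(2) s]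
   by (simp add: R_simps(1))
 qed
 show "on_open_subsets X BM U ED.Der V (gen V (cc V j)) = gen V (cc V (D V j))" if j: "j : J V" for j
  unfolding MB.generator_section_sect
 proof (rule sym_Der_sect[OF V])
  show "EGen (cc V j) : MB.trm V" "EGen (cc V (D V j)) : MB.trm V"
   using cc_in[OF V(1)] j DJ[OF V j] by simp_all
  fix W assume W: "openin X W" "W <= V"
  have WU: "W <= U" using W V by auto
  show "ED.der W (MB.tr V W (EGen (cc V j))) = MB.tr V W (EGen (cc V (D V j)))"
   using sym_\<delta>_class[OF W(1) WU J_rst[OF V(1) W j]] cc_rst[OF V(1) W j] cc_rst[OF V(1) W DJ[OF V j]]
    D_rst[OF V(1) W V(2) J_in[OF j]] by simp
 qed
qed

end

lemma split_tangent_restrict: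
 assumes D: "D : Sec (split_tangent_degree \<XX> 0) U" and V: "openin X V" "V <= U"
 shows "on_open_subsets X BM V D : Sec (split_tangent_degree \<XX> 0) V"
proof -
 note d = iffD1[OF split_tangent_iff D]
 from conjunct1[OF d] obtain A0 A1 where a: "D = on_open_subsets X BM U (%V s. A0 V s \<oplus>[BM,V] A1 V s)"
  "sheaf_superderivation X BM U False A0" "sheaf_superderivation X BM U True A1"
  unfolding superderivations_def by blast
 have "on_open_subsets X BM V D = on_open_subsets X BM V (%V s. A0 V s \<oplus>[BM,V] A1 V s)"
  unfolding a(1) on_open_subsets_def using V(2) by (intro restrict_ext) auto
 moreover have "EX D\<^sub>0 D\<^sub>1. on_open_subsets X BM V (%V s. A0 V s \<oplus>[BM,V] A1 V s) =
   on_open_subsets X BM V (%V s. D\<^sub>0 V s \<oplus>[BM,V] D\<^sub>1 V s) &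
   sheaf_superderivation X BM V False D\<^sub>0 & sheaf_superderivation X BM V True D\<^sub>1"
  by (intro exI[of _ A0] exI[of _ A1] conjI refl sheaf_der_subset[OF _ V(2)] a(2,3))
 ultimately have 1: "on_open_subsets X BM V D : superderivations X BM V" unfolding superderivations_def by simp
 show ?thesis
  unfolding split_tangent_iff
 proof (intro conjI allI impI image_subsetI 1)
  fix W k g assume W: "openin X W & W <= V" and g: "g : exterior_power_sections X R M k W"
  have "g : Sec BM W" using MB.power_sections_subset g by blast
  moreover have "D W g : exterior_power_sections X R M k W"
   using conjunct2[OF d, rule_format, of W k] W V(2) g by blast
  ultimately show "on_open_subsets X BM V D W g : exterior_power_sections X R M k W"
   using on_apply[of X W V g BM D] W by simp
 qed
qed

text \<open>The conditions of \<open>euler_lift\<close> for sections of the tangent sheaf that may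
  have an odd component.\<close>

definition lifts_euler :: "'x set => ('x, 'a) derivation => bool" where
 "lifts_euler U D \<longleftrightarrow> (ALL V. openin X V & V <= U --> (ALL s:Sec F V. D V s : J V) &
  (ALL j:J V. D V j \<ominus>[F,V] j : N 2 V))"

lemma join_mod_J:
 assumes A: "parts 0 U A" and V: "openin X V" "V <= U"
 shows "s : Sec F V ==> join U A V s \<ominus>[F,V] A False V s : J V"
  and "s : J V ==> join U A V s \<ominus>[F,V] A False V s : N 2 V"
proof -
 interpret V: superalgebra "sec F V" by (rule F.F_super[OF V(1)])
 have e: "join U A V s \<ominus>[F,V] A False V s = A True V s" if s: "s : Sec F V" for s
  unfolding join_apply[OF V s] by (rule V.plus_diff_cancel[OF partsD(3)[OF A V s] partsD(3)[OF A V s]])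
 show "join U A V s \<ominus>[F,V] A False V s : J V" if "s : Sec F V"
  unfolding e[OF that] by (rule odd_part_J(1)[OF A V that])
 show "join U A V s \<ominus>[F,V] A False V s : N 2 V" if "s : J V"
  unfolding e[OF J_in[OF that]] by (rule odd_part_J(2)[OF A V that])
qed

text \<open>The derivation constructed from the even part serves for the whole section, since by
  \<open>join_mod_J\<close> the odd part changes values by \<open>J\<close> on functions and by its
  square on \<open>J\<close>.\<close>

lemma symbol:
 assumes U: "openin X U" and D: "D : Sec (tangent_filtration \<XX> 0) U"
 shows "EX! D'. D' : Sec (split_tangent_degree \<XX> 0) U & (ALL V. openin X V & V <= U -->
  (ALL s:Sec F V. D' V (scal V (pj V s)) = scal V (pj V (D V s))) &
  (ALL j:J V. D' V (gen V (cc V j)) = gen V (cc V (D V j))))" (is "EX! D'. ?P D'")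
proof -
 obtain A where A: "parts 0 U A" "D = join U A" using tangent_join[OF D] .
 have AN: "A False V s : N l V" if "openin X V" "V <= U" "s : N l V" for V l s
  using partsD(2)[OF A(1) that, of False] by simp
 from sym_exists[OF U partsD(1)[OF A(1), of False] AN] obtain D' where
  D0: "D' : Sec (split_tangent_degree \<XX> 0) U & (ALL V. openin X V & V <= U -->
   (ALL s:Sec F V. D' V (scal V (pj V s)) = scal V (pj V (A False V s))) &
   (ALL j:J V. D' V (gen V (cc V j)) = gen V (cc V (A False V j))))" by (rule exE)
 note D' = conjunct1[OF D0] conjunct2[OF D0, rule_format, OF conjI]
 have ex: "?P D'"
 proof (intro conjI allI impI ballI D'(1))
  fix V assume "openin X V & V <= U"
  then have V: "openin X V" "V <= U" by simp_all
  interpret V: superalgebra "sec F V" by (rule F.F_super[OF V(1)])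
  show "D' V (scal V (pj V s)) = scal V (pj V (D V s))" if s: "s : Sec F V" for s
  proof -
   have "join U A V s : Sec F V" using join_apply[OF V s] partsD(3)[OF A(1) V s] by simp
   then show ?thesis
    using bspec[OF conjunct1[OF D'(2)[OF V]] s] pj_diff_J[OF V(1) _ partsD(3)[OF A(1) V s], of "join U A V s"]
     join_mod_J(1)[OF A(1) V s] unfolding A(2) by simp
  qed
  show "D' V (gen V (cc V j)) = gen V (cc V (D V j))" if j: "j : J V" for j
  proof -
   have c: "join U A V j : J V" "A False V j : J V"
    using partsD(2)[OF A(1) V, of j 1] J_add[OF V(1)] join_apply[OF V J_in[OF j]] j N_1[OF V(1)] by simp_all
   show ?thesis
    using bspec[OF conjunct2[OF D'(2)[OF V]] j] cc_eq_iff[OF V(1) c] join_mod_J(2)[OF A(1) V j]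
    unfolding A(2) by simp
  qed
 qed
 show ?thesis
 proof (rule ex1I[of ?P, OF ex])
  fix D'' assume D'': "?P D''"
  show "D'' = D'"
  proof (rule split_derivation_unique[of _ U])
   show "D'' : superderivations X BM U" "D' : superderivations X BM U"
    by (rule split_tangent_iff[THEN iffD1, THEN conjunct1, OF conjunct1[OF D'']],
      rule split_tangent_iff[THEN iffD1, THEN conjunct1, OF conjunct1[OF ex]])
   fix V assume V: "openin X V" "V <= U"
   note d = conjunct2[OF D'', rule_format, OF conjI[OF V]] and d' = conjunct2[OF ex, rule_format, OF conjI[OF V]]
   show "D'' V (scal V (pj V s)) = D' V (scal V (pj V s))" if "s : Sec F V" for s
    unfolding bspec[OF conjunct1[OF d] that] bspec[OF conjunct1[OF d'] that] ..
   show "D'' V (gen V (cc V j)) = D' V (gen V (cc V j))" if "j : J V" for j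
    unfolding bspec[OF conjunct2[OF d] that] bspec[OF conjunct2[OF d'] that] ..
  qed
 qed
qed

lemma scal_inj:
 assumes V: "openin X V" and f: "f : Sec R V" "g : Sec R V" and eq: "scal V f = scal V g"
 shows "f = g"
proof -
 have "exterior_projection R V (scal V h) = h" if "h : Sec R V" for h
  unfolding MB.scalar_section_sect
  by (rule trans[OF MB.exterior_projection_sect[OF V] ext_aug.simps(1)]) (simp add: that)
 from this[OF f(1)] this[OF f(2)] show ?thesis unfolding eq by (rule trans[OF sym])
qed

text \<open>Evaluation sends \<open>gen V t\<close> to the eigenlift of \<open>t\<close>, and the
  conormal class of that is \<open>t\<close> again.\<close>

lemma gen_inj:
 assumes E: "euler_lift V E" and t: "t : Sec M V" "u : Sec M V" and eq: "gen V t = gen V u"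
 shows "t = u"
proof -
 interpret EV: exterior_eval X R M F V "sig E" "lam E" by (rule euler_eval[OF E])
 note V = eulerD(1)[OF E] subset_refl
 have e: "EGen t : MB.trm V" "EGen u : MB.trm V" using t by simp_all
 have "lam E V t = lam E V u"
  using EV.Phi_sect[OF V e(1)] EV.Phi_sect[OF V e(2)] eq unfolding MB.generator_section_sect by simp
 then show ?thesis
  using cc_eqI[OF M_ext[OF t(1)] lam(3)[OF E V t(1)]] cc_eqI[OF M_ext[OF t(2)] lam(3)[OF E V t(2)]] by simp
qed

text \<open>Translates the lifting condition of the connecting map, which concerns derivations of
  the split model, into conditions on the structure sheaf alone.\<close>

lemma symbol_euler_iff:
 assumes U: "openin X U" and D: "D : Sec (tangent_filtration \<XX> 0) U"
 shows "symbol \<XX> U D = rst (split_tangent_degree \<XX> 0) (topspace X) U (euler_field \<XX>) \<longleftrightarrow> lifts_euler U D"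
proof -
 let ?P = "%D'. D' : Sec (split_tangent_degree \<XX> 0) U & (ALL V. openin X V & V <= U -->
  (ALL s:Sec F V. D' V (scal V (pj V s)) = scal V (pj V (D V s))) &
  (ALL j:J V. D' V (gen V (cc V j)) = gen V (cc V (D V j))))"
 let ?E = "on_open_subsets X BM U (euler_field \<XX>)"
 have sy: "symbol \<XX> U D = (THE D'. ?P D')" unfolding symbol_def Let_def split_model_def by simp
 have Ux: "U <= topspace X" by (rule openin_subset[OF U])
 obtain A where A: "parts 0 U A" "D = join U A" using tangent_join[OF D] .
 have Dc: "D V s : Sec F V" if V: "openin X V" "V <= U" and s: "s : Sec F V" for V s
 proof -
  interpret V: superalgebra "sec F V" by (rule F.F_super[OF V(1)])
  show ?thesis using join_apply[OF V s] partsD(3)[OF A(1) V s] unfolding A(2) by simp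
 qed
 have DJ: "D V j : J V" if V: "openin X V" "V <= U" and j: "j : J V" for V j
  using partsD(2)[OF A(1) V, of j 1] J_add[OF V(1)] join_apply[OF V J_in[OF j]] j N_1[OF V(1)] unfolding A(2) by simp
 have Es: "?E V (scal V f) = scal V \<zero>[R,V]" if V: "openin X V" "V <= U" and f: "f : Sec R V" for V f
  using on_apply[OF V, of "scal V f" BM] euler_field(2)[OF V(1) f] MB.sect_in[OF V(1), of "EScal f"] f
   MB.sect_zero[OF V(1)] unfolding MB.scalar_section_sect by simp
 have Eg: "?E V (gen V t) = gen V t" if V: "openin X V" "V <= U" and t: "t : Sec M V" for V t
  using on_apply[OF V, of "gen V t" BM] euler_field(3)[OF V(1) t] MB.sect_in[OF V(1), of "EGen t"] t
  unfolding MB.generator_section_sect by simp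
 have "symbol \<XX> U D = ?E \<longleftrightarrow> ?P ?E"
 proof
  assume "symbol \<XX> U D = ?E"
  then show "?P ?E" using theI'[OF symbol[OF U D]] unfolding sy by simp
 next
  assume "?P ?E"
  then show "symbol \<XX> U D = ?E" unfolding sy by (rule the1_equality[OF symbol[OF U D]])
 qed
 also have "... \<longleftrightarrow> lifts_euler U D"
 proof
  assume P: "?P ?E"
  show "lifts_euler U D"
   unfolding lifts_euler_def
  proof (intro allI impI conjI ballI)
   fix V assume "openin X V & V <= U"
   then have V: "openin X V" "V <= U" by simp_all
   note d = conjunct2[OF P, rule_format, OF conjI[OF V]]
   show "D V s : J V" if s: "s : Sec F V" for s
   proof -
    have "scal V (pj V (D V s)) = scal V \<zero>[R,V]"
     using bspec[OF conjunct1[OF d] s] Es[OF V pj_in[OF V(1) s]] by simp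
    then show ?thesis using scal_inj[OF V(1) pj_in[OF V(1) Dc[OF V s]] MB.zero_in[OF V(1)]] J_iff Dc[OF V s] by simp
   qed
   fix j assume j: "j : J V"
   interpret V: superalgebra "sec F V" by (rule F.F_super[OF V(1)])
   note c = Dc[OF V J_in[OF j]]
   show "D V j \<ominus>[F,V] j : N 2 V"
   proof (rule N_local[OF V(1)])
    show "D V j \<ominus>[F,V] j : Sec F V" using c J_in[OF j] by simp
    fix x assume x: "x : V"
    then have "x : topspace X" using V Ux by auto
    \<comment> \<open>\<open>gen_inj\<close> applies over the domain of an Euler lift, so the second
      condition is tested near each point.\<close>
    then obtain U' E where E: "x : U'" "euler_lift U' E" by (rule local_euler_lift)
    let ?W = "U' \<inter> V"
    have W: "openin X ?W" "?W <= U'" "?W <= V" "x : ?W" "?W <= U" using eulerD(1)[OF E(2)] V E(1) x by auto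
    note jW = J_rst[OF V(1) W(1,3) j]
    have r: "D ?W (rst F V ?W j) = rst F V ?W (D V j)"
     unfolding A(2) join_apply[OF W(1,5) J_in[OF jW]] join_apply[OF V J_in[OF j]]
      F.F_rst_add[OF V(1) W(1,3) partsD(3)[OF A(1) V J_in[OF j]] partsD(3)[OF A(1) V J_in[OF j]]]
      sheaf_derD(2)[OF partsD(1)[OF A(1)] V(1) W(1,3) V(2) J_in[OF j]] ..
    note dW = conjunct2[OF P, rule_format, OF conjI[OF W(1,5)]]
    have "gen ?W (cc ?W (D ?W (rst F V ?W j))) = gen ?W (cc ?W (rst F V ?W j))"
     using bspec[OF conjunct2[OF dW] jW] Eg[OF W(1,5) cc_in[OF W(1) jW]] by simp
    from gen_inj[OF euler_subset[OF E(2) W(1,2)] _ _ this]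
    have "D ?W (rst F V ?W j) \<ominus>[F,?W] rst F V ?W j : N 2 ?W"
     using cc_eq_iff[OF W(1) DJ[OF W(1,5) jW] jW] cc_in[OF W(1)] DJ[OF W(1,5) jW] jW by simp
    then have "rst F V ?W (D V j \<ominus>[F,V] j) : N 2 ?W"
     unfolding r F.F_rst_diff[OF V(1) W(1,3) c J_in[OF j]] .
    then show "EX W. openin X W & x : W & W <= V & rst F V W (D V j \<ominus>[F,V] j) : N 2 W"
     using W by blast
   qed
  qed
 next
  assume L: "lifts_euler U D"
  show "?P ?E"
  proof (intro conjI allI impI ballI)
   show "?E : Sec (split_tangent_degree \<XX> 0) U" by (rule split_tangent_restrict[OF euler_field(1) U Ux])
   fix V assume "openin X V & V <= U"
   then have V: "openin X V" "V <= U" by simp_all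
   note l = L[unfolded lifts_euler_def, rule_format, OF conjI[OF V]]
   show "?E V (scal V (pj V s)) = scal V (pj V (D V s))" if s: "s : Sec F V" for s
    using Es[OF V pj_in[OF V(1) s]] bspec[OF conjunct1[OF l] s] J_iff by simp
   show "?E V (gen V (cc V j)) = gen V (cc V (D V j))" if j: "j : J V" for j
    using Eg[OF V cc_in[OF V(1) j]] cc_eq_iff[OF V(1) DJ[OF V j] j] bspec[OF conjunct2[OF l] j] by simp
  qed
 qed
 finally show ?thesis unfolding split_tangent_rst .
qed

end

section \<open>The tangent sheaf and its first cohomology\<close>

lemma (in ring) diff_exchange:
 "[| a : carrier R; b : carrier R; c : carrier R; d : carrier R |] ==> (a \<ominus> b) \<ominus> (c \<ominus> d) = (a \<ominus> c) \<ominus> (b \<ominus> d)"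
 by (simp add: a_minus_def minus_add a_ac)

lemma (in superalgebra) homogeneous_diff:
 assumes D: "homogeneous_superderivation A p D" and D': "homogeneous_superderivation A p D'"
 shows "homogeneous_superderivation A p (%s. D s \<ominus> D' s)"
 unfolding homogeneous_superderivation_def
proof (intro conjI allI ballI funcsetI image_subsetI)
 note d = superderivationD[OF D] and d' = superderivationD[OF D']
 fix s assume s: "s : carrier A"
 show "D s \<ominus> D' s : carrier A" using d(1) d'(1) s by simp
 show "D (c \<odot> s) \<ominus> D' (c \<odot> s) = c \<odot> (D s \<ominus> D' s)" for c
  using d(1,3)[OF s] d'(1,3)[OF s] by (simp add: a_minus_def sm_add sm_minus)
 show "D (s \<oplus> t) \<ominus> D' (s \<oplus> t) = (D s \<ominus> D' s) \<oplus> (D t \<ominus> D' t)" if t: "t : carrier A" for t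
  unfolding d(2)[OF s t] d'(2)[OF s t] using d(1) d'(1) s t by (intro diff_plus_diff) simp_all
next
 note d = superderivationD[OF D] and d' = superderivationD[OF D']
 fix q s assume s: "s : parity_part A q"
 show "D s \<ominus> D' s : parity_part A (p ~= q)" by (rule part_diff[OF d(4)[OF s] d'(4)[OF s]])
 fix t assume t: "t : carrier A"
 have c: "D s : carrier A" "D' s : carrier A" "D t : carrier A" "D' t : carrier A" "s : carrier A"
  using d(1) d'(1) s t by simp_all
 have "D (s \<otimes> t) \<ominus> D' (s \<otimes> t) = (D s \<otimes> t \<ominus> D' s \<otimes> t) \<oplus> (signed A (p & q) (s \<otimes> D t) \<ominus> signed A (p & q) (s \<otimes> D' t))"
  unfolding d(5)[OF s t] d'(5)[OF s t] using c t by (intro diff_plus_diff) (simp_all add: signed_def)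
 also have "D s \<otimes> t \<ominus> D' s \<otimes> t = (D s \<ominus> D' s) \<otimes> t" using c t by (simp add: a_minus_def l_distr l_minus)
 also have "signed A (p & q) (s \<otimes> D t) \<ominus> signed A (p & q) (s \<otimes> D' t) = signed A (p & q) (s \<otimes> (D t \<ominus> D' t))"
  using c by (simp add: signed_def a_minus_def r_distr r_minus minus_add)
 finally show "D (s \<otimes> t) \<ominus> D' (s \<otimes> t) = (D s \<ominus> D' s) \<otimes> t \<oplus> signed A (p & q) (s \<otimes> (D t \<ominus> D' t))" .
qed

lemma (in superalgebra) homogeneous_zero: "homogeneous_superderivation A p (%s. \<zero>)"
 unfolding homogeneous_superderivation_def by (auto simp: signed_def)

text \<open>The groups of derivations are bare records, so the additive inverse in them is
  determined directly from its defining description.\<close>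

lemma a_inv_unique:
 assumes "n : carrier G" "x \<oplus>\<^bsub>G\<^esub> n = \<zero>\<^bsub>G\<^esub>" "n \<oplus>\<^bsub>G\<^esub> x = \<zero>\<^bsub>G\<^esub>"
  "!!y. [| y : carrier G; y \<oplus>\<^bsub>G\<^esub> x = \<zero>\<^bsub>G\<^esub> |] ==> y = n"
 shows "\<ominus>\<^bsub>G\<^esub> x = n"
 unfolding a_inv_def m_inv_def
proof (rule the_equality, goal_cases)
 case 1
 show ?case using assms(1-3) by simp
next
 case (2 y)
 then have "y : carrier G" "y \<oplus>\<^bsub>G\<^esub> x = \<zero>\<^bsub>G\<^esub>" by simp_all
 then show ?case by (rule assms(4))
qed

context supermanifold
begin

abbreviation "TT == tangent_filtration \<XX>"
abbreviation "on == on_open_subsets X F"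

lemma on_eq_iff: "on U D = on U D' \<longleftrightarrow> (ALL V s. openin X V & V <= U & s : Sec F V --> D V s = D' V s)"
proof
 assume e: "on U D = on U D'"
 show "ALL V s. openin X V & V <= U & s : Sec F V --> D V s = D' V s"
 proof (intro allI impI)
  fix V s assume h: "openin X V & V <= U & s : Sec F V"
  have "on U D V s = on U D' V s" unfolding e ..
  then show "D V s = D' V s" using on_apply[of X V U s F D] on_apply[of X V U s F D'] h by simp
 qed
qed (auto simp: on_open_subsets_def intro!: restrict_ext)

lemma on_cong: "(!!V s. [| openin X V; V <= U; s : Sec F V |] ==> D V s = D' V s) ==> on U D = on U D'"
 unfolding on_eq_iff by blast

lemma T_ops:
 "rst (TT m) U V = on V" "\<zero>[TT m,U] = on U (%V s. \<zero>[F,V])"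
 "D \<oplus>[TT m,U] D' = on U (%V s. D V s \<oplus>[F,V] D' V s)"
 unfolding tangent_filtration_def superderivation_subsheaf_def additive_group_def by simp_all

lemma tangent_on: "D : Sec (TT m) U ==> on U D = D"
proof -
 assume "D : Sec (TT m) U"
 then obtain A where A: "D = join U A" by (rule tangent_join)
 show "on U D = D" unfolding A by (subst (2) join_def) (rule on_cong, rule join_apply)
qed

lemma tangent_closed:
 assumes D: "D : Sec (TT m) U" and V: "openin X V" "V <= U" and s: "s : Sec F V"
 shows "D V s : Sec F V"
proof -
 interpret V: superalgebra "sec F V" by (rule F.F_super[OF V(1)])
 obtain A where A: "parts m U A" "D = join U A" using tangent_join[OF D] .
 show ?thesis unfolding A(2) join_apply[OF V s] using partsD(3)[OF A(1) V s] by simp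
qed

lemma tangent_N: "[| D : Sec (TT m) U; openin X V; V <= U; s : N l V |] ==> D V s : N (l + m) V"
 using conjunct2[OF iffD1[OF tangent_iff[of D m U]], rule_format, of V l] by blast

lemma join_diff:
 assumes "!!p. sheaf_superderivation X F U p (A p)" "!!p. sheaf_superderivation X F U p (B p)"
 shows "sheaf_superderivation X F U p (%V s. A p V s \<ominus>[F,V] B p V s)"
  and "join U (%p V s. A p V s \<ominus>[F,V] B p V s) = on U (%V s. join U A V s \<ominus>[F,V] join U B V s)"
proof -
 note a = sheaf_derD[OF assms(1)] and b = sheaf_derD[OF assms(2)]
 have c: "A p V s : Sec F V" "B p V s : Sec F V" if "openin X V" "V <= U" "s : Sec F V" for p V s
  using superderivationD(1)[OF a(1)[OF that(1,2)] that(3)]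
   superderivationD(1)[OF b(1)[OF that(1,2)] that(3)] by simp_all
 show "sheaf_superderivation X F U p (%V s. A p V s \<ominus>[F,V] B p V s)"
 proof (rule sheaf_derI)
  fix V assume V: "openin X V" "V <= U"
  show "homogeneous_superderivation (sec F V) p (%s. A p V s \<ominus>[F,V] B p V s)"
   by (rule superalgebra.homogeneous_diff[OF F.F_super[OF V(1)] a(1)[OF V] b(1)[OF V]])
  fix W s assume W: "openin X W" "W <= V" and s: "s : Sec F V"
  show "A p W (rst F V W s) \<ominus>[F,W] B p W (rst F V W s) = rst F V W (A p V s \<ominus>[F,V] B p V s)"
   unfolding F.F_rst_diff[OF V(1) W c[OF V s]] a(2)[OF V(1) W V(2) s] b(2)[OF V(1) W V(2) s] ..
 qed
 show "join U (%p V s. A p V s \<ominus>[F,V] B p V s) = on U (%V s. join U A V s \<ominus>[F,V] join U B V s)"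
  unfolding join_def[of U "%p V s. A p V s \<ominus>[F,V] B p V s"]
 proof (rule on_cong)
  fix V s assume V: "openin X V" "V <= U" and s: "s : Sec F V"
  interpret V: superalgebra "sec F V" by (rule F.F_super[OF V(1)])
  show "(A False V s \<ominus>[F,V] B False V s) \<oplus>[F,V] (A True V s \<ominus>[F,V] B True V s) =
    join U A V s \<ominus>[F,V] join U B V s"
   unfolding join_apply[OF V s] by (rule V.diff_plus_diff[symmetric]) (use c[OF V s] in simp_all)
 qed
qed

lemma tangent_diff:
 assumes "D : Sec (TT m) U" "D' : Sec (TT m) U"
 shows "on U (%V s. D V s \<ominus>[F,V] D' V s) : Sec (TT m) U"
proof -
 obtain A where A: "parts m U A" "D = join U A" using tangent_join[OF assms(1)] .
 obtain B where B: "parts m U B" "D' = join U B" using tangent_join[OF assms(2)] .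
 note j = join_diff[OF partsD(1)[OF A(1)] partsD(1)[OF B(1)]]
 have "parts m U (%p V s. A p V s \<ominus>[F,V] B p V s)"
  unfolding parts_def using j(1) N_diff partsD(2)[OF A(1)] partsD(2)[OF B(1)] by simp
 from join_tangent[OF this] show ?thesis unfolding A(2) B(2) j(2) .
qed

lemma tangent_zero: "on U (%V s. \<zero>[F,V]) : Sec (TT m) U"
proof -
 have "parts m U (%p V s. \<zero>[F,V])"
  unfolding parts_def
  by (intro allI conjI ballI impI sheaf_derI superalgebra.homogeneous_zero F.F_super)
   (simp_all add: F.F_rst_zero N_zero)
 moreover have "join U (%p V s. \<zero>[F,V]) = on U (%V s. \<zero>[F,V])"
  unfolding join_def
 proof (rule on_cong)
  fix V assume "openin X V"
  then interpret V: superalgebra "sec F V" by (rule F.F_super)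
  show "\<zero>[F,V] \<oplus>[F,V] \<zero>[F,V] = \<zero>[F,V]" by simp
 qed
 ultimately show ?thesis using join_tangent by metis
qed

lemma tangent_restrict:
 assumes D: "D : Sec (TT m) U" and V: "V <= U"
 shows "on V D : Sec (TT m) V"
proof -
 obtain A where A: "parts m U A" "D = join U A" using tangent_join[OF D] .
 have "parts m V A"
  unfolding parts_def using sheaf_der_subset[OF partsD(1)[OF A(1)] V] partsD(2)[OF A(1)] order_trans[OF _ V] by simp
 moreover have "on V D = join V A"
  unfolding A(2) join_def[of V] by (rule on_cong) (use join_apply order_trans[OF _ V] in simp)
 ultimately show ?thesis using join_tangent by simp
qed

lemma tangent_minus:
 assumes D: "!!V s. [| openin X V; V <= U; s : Sec F V |] ==> D V s : Sec F V"
  and D': "D' : Sec (TT m) U"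
 shows "D \<ominus>[TT m,U] D' = on U (%V s. D V s \<ominus>[F,V] D' V s)"
proof -
 let ?n = "on U (%V s. \<ominus>[F,V] D' V s)" and ?z = "on U (%V s. \<zero>[F,V])"
 have "on U (%V s. ?z V s \<ominus>[F,V] D' V s) = ?n"
 proof (rule on_cong)
  fix V s assume V: "openin X V" "V <= U" and s: "s : Sec F V"
  interpret V: superalgebra "sec F V" by (rule F.F_super[OF V(1)])
  show "?z V s \<ominus>[F,V] D' V s = \<ominus>[F,V] D' V s"
   unfolding on_apply[OF V s] using tangent_closed[OF D' V s] by (simp add: a_minus_def)
 qed
 then have n: "?n : Sec (TT m) U" using tangent_diff[OF tangent_zero D'] by simp
 have v: "D' V s \<oplus>[F,V] ?n V s = \<zero>[F,V] & ?n V s \<oplus>[F,V] D' V s = \<zero>[F,V]"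
  if V: "openin X V" "V <= U" and s: "s : Sec F V" for V s
 proof -
  interpret V: superalgebra "sec F V" by (rule F.F_super[OF V(1)])
  show ?thesis unfolding on_apply[OF V s] using tangent_closed[OF D' V s] by (simp add: V.r_neg V.l_neg)
 qed
 have n1: "D' \<oplus>[TT m,U] ?n = \<zero>[TT m,U]" "?n \<oplus>[TT m,U] D' = \<zero>[TT m,U]"
  unfolding T_ops by (rule on_cong, rule conjunct1[OF v], assumption+, rule on_cong, rule conjunct2[OF v])
 have n2: "y = ?n" if y: "y : Sec (TT m) U" "y \<oplus>[TT m,U] D' = \<zero>[TT m,U]" for y
 proof -
  have "on U y = ?n"
  proof (rule on_cong)
   fix V s assume V: "openin X V" "V <= U" and s: "s : Sec F V"
   interpret V: superalgebra "sec F V" by (rule F.F_super[OF V(1)])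
   have "y V s \<oplus>[F,V] D' V s = \<zero>[F,V]" using y(2) V s unfolding T_ops on_eq_iff by blast
   from V.minus_equality[OF this tangent_closed[OF D' V s] tangent_closed[OF y(1) V s]]
   show "y V s = \<ominus>[F,V] D' V s" ..
  qed
  then show ?thesis unfolding tangent_on[OF y(1)] .
 qed
 have "\<ominus>[TT m,U] D' = ?n"
  by (rule a_inv_unique[OF n n1 n2])
 then have "D \<ominus>[TT m,U] D' = on U (%V s. D V s \<oplus>[F,V] ?n V s)" unfolding a_minus_def T_ops(3) by simp
 also have "... = on U (%V s. D V s \<ominus>[F,V] D' V s)"
  by (rule on_cong) (simp add: on_apply a_minus_def)
 finally show ?thesis .
qed

section \<open>Differences of lifts of the Euler field\<close>

definition "Lift U b \<longleftrightarrow> b : Sec (TT 0) U & lifts_euler U b"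

lemma Lift_closed: "[| Lift U b; openin X V; V <= U; s : Sec F V |] ==> b V s : Sec F V"
 unfolding Lift_def by (blast intro: tangent_closed)

lemma lifts_eulerD:
 assumes "lifts_euler U D" "openin X V" "V <= U"
 shows "s : Sec F V ==> D V s : J V" "j : J V ==> D V j \<ominus>[F,V] j : N 2 V"
 using assms(1)[unfolded lifts_euler_def, rule_format, OF conjI[OF assms(2,3)]] by blast+

lemma lifts_eulerI:
 assumes "!!V s. [| openin X V; V <= U; s : Sec F V |] ==> D V s : J V"
  "!!V j. [| openin X V; V <= U; j : J V |] ==> D V j \<ominus>[F,V] j : N 2 V"
 shows "lifts_euler U D"
 unfolding lifts_euler_def using assms by simp

lemma Lift_restrict:
 assumes b: "Lift U b" and V: "V <= U"
 shows "Lift V (on V b)"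
 unfolding Lift_def
proof
 show "on V b : Sec (TT 0) V" using b tangent_restrict[OF _ V] unfolding Lift_def by blast
 have l: "lifts_euler U b" using b unfolding Lift_def by blast
 show "lifts_euler V (on V b)"
 proof (rule lifts_eulerI)
  fix W assume W: "openin X W" "W <= V"
  have WU: "W <= U" using W V by auto
  show "on V b W s : J W" if "s : Sec F W" for s
   unfolding on_apply[OF W that] by (rule lifts_eulerD(1)[OF l W(1) WU that])
  show "on V b W j \<ominus>[F,W] j : N 2 W" if "j : J W" for j
   unfolding on_apply[OF W J_in[OF that]] by (rule lifts_eulerD(2)[OF l W(1) WU that])
 qed
qed

text \<open>Two lifts differ by \<open>J\<close> on functions. On \<open>j\<close> in
  \<open>J\<close> they differ by \<open>(b j - j) - (b' j - j)\<close>, which is in the square.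
  \<open>der_filtration\<close> with \<open>m = 1\<close>, applied to the homogeneous parts, extends
  this to all powers.\<close>

lemma Lift_diff:
 assumes b: "Lift U b" "Lift U b'"
 shows "on U (%V s. b V s \<ominus>[F,V] b' V s) : Sec (TT 1) U"
proof -
 note bT = b[unfolded Lift_def, THEN conjunct1] and bl = b[unfolded Lift_def, THEN conjunct2]
 obtain A where A: "parts 0 U A" "b = join U A" using tangent_join[OF bT(1)] .
 obtain B where B: "parts 0 U B" "b' = join U B" using tangent_join[OF bT(2)] .
 note j = join_diff[OF partsD(1)[OF A(1)] partsD(1)[OF B(1)]]
 let ?C = "%p V s. A p V s \<ominus>[F,V] B p V s"
 have v: "join U ?C V s = b V s \<ominus>[F,V] b' V s" if "openin X V" "V <= U" "s : Sec F V" for V s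
  unfolding j(2) A(2) B(2) by (rule on_apply[OF that])
 have "parts 1 U ?C"
  unfolding parts_def
 proof (intro allI conjI j(1) impI ballI)
  fix p V l s assume V: "openin X V & V <= U" and s: "s : N l V"
  show "A p V s \<ominus>[F,V] B p V s : N (l + 1) V"
  proof (rule der_filtration[where m = 1, OF j(1)])
   fix V s assume V: "openin X V" "V <= U"
   interpret V: superalgebra "sec F V" by (rule F.F_super[OF V(1)])
   show "A p V s \<ominus>[F,V] B p V s : N 1 V" if s: "s : Sec F V"
   proof (rule parts_N[OF j(1) V s])
    fix q
    have c: "ppart (sec F V) q s : Sec F V" using s by simp
    show "join U ?C V (ppart (sec F V) q s) : N 1 V"
     unfolding v[OF V c] by (rule N_diff[OF V(1)]) (use lifts_eulerD(1)[OF bl(1) V c] lifts_eulerD(1)[OF bl(2) V c] N_1[OF V(1)] in simp_all)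
   qed
   show "A p V s \<ominus>[F,V] B p V s : N (Suc 1) V" if s: "s : J V"
   proof (rule parts_N[OF j(1) V J_in[OF s]])
    fix q
    have c: "ppart (sec F V) q s : J V" using N_ppart[OF V(1), of s 1 q] s N_1[OF V(1)] by simp
    note cc = Lift_closed[OF b(1) V J_in[OF c]] Lift_closed[OF b(2) V J_in[OF c]]
    show "join U ?C V (ppart (sec F V) q s) : N (Suc 1) V"
     unfolding v[OF V J_in[OF c]] V.diff_diff_diff[OF cc J_in[OF c], symmetric] Suc_1
     by (rule N_diff[OF V(1) lifts_eulerD(2)[OF bl(1) V c] lifts_eulerD(2)[OF bl(2) V c]])
   qed
  qed (use V s in simp_all)
 qed
 from join_tangent[OF this] show ?thesis unfolding j(2) A(2) B(2) .
qed

text \<open>The converse of \<open>Lift_diff\<close>: a section of filtration degree 1 maps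
  functions to \<open>J\<close> and \<open>J\<close> to its square, so both lifting conditions
  survive.\<close>

lemma Lift_minus:
 assumes b: "Lift U b" and h: "h : Sec (TT 1) U"
 shows "Lift U (on U (%V s. b V s \<ominus>[F,V] h V s))"
 unfolding Lift_def
proof
 note bT = b[unfolded Lift_def, THEN conjunct1] and bl = b[unfolded Lift_def, THEN conjunct2]
 have "h : Sec (TT 0) U"
  unfolding tangent_iff
 proof (intro conjI allI impI image_subsetI)
  show "h : superderivations X F U" by (rule conjunct1[OF iffD1[OF tangent_iff h]])
  fix V l s assume V: "openin X V & V <= U" and s: "s : N l V"
  show "h V s : N (l + 0) V" by (rule N_mono[OF _ _ tangent_N[OF h _ _ s]]) (use V in simp_all)
 qed
 then show "on U (%V s. b V s \<ominus>[F,V] h V s) : Sec (TT 0) U" by (rule tangent_diff[OF bT])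
 show "lifts_euler U (on U (%V s. b V s \<ominus>[F,V] h V s))"
 proof (rule lifts_eulerI)
  fix V s assume V: "openin X V" "V <= U"
  interpret V: superalgebra "sec F V" by (rule F.F_super[OF V(1)])
  show "on U (%V s. b V s \<ominus>[F,V] h V s) V s : J V" if s: "s : Sec F V"
   unfolding on_apply[OF V s] N_1[OF V(1), symmetric]
   by (rule N_diff[OF V(1)]) (use lifts_eulerD(1)[OF bl V s] N_1[OF V(1)] tangent_N[OF h V, of s 0] N_0[OF V(1)] s in simp_all)
  show "on U (%V s. b V s \<ominus>[F,V] h V s) V s \<ominus>[F,V] s : N 2 V" if s: "s : J V"
  proof -
   note sc = J_in[OF s]
   have "(b V s \<ominus>[F,V] h V s) \<ominus>[F,V] s = (b V s \<ominus>[F,V] s) \<ominus>[F,V] h V s"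
    using Lift_closed[OF b V sc] tangent_closed[OF h V sc] sc by (simp add: a_minus_def V.a_ac)
   moreover have "h V s : N 2 V" using tangent_N[OF h V, of s 1] s N_1[OF V(1)] by (simp add: numeral_2_eq_2)
   ultimately show ?thesis
    unfolding on_apply[OF V sc] using N_diff[OF V(1) lifts_eulerD(2)[OF bl V s]] by simp
  qed
 qed
qed

text \<open>
 The representatives of the class of the differences of local lifts, described without reference
 to a choice of lifts.
\<close>

definition euler_cocycles :: "('x, ('x, 'a) derivation) cochain set" where
 "euler_cocycles = {(V, d). (V, d) : cocycles X (TT 1) & (EX W k. point_cover X W &
  (ALL x:topspace X. W x <= V x & Lift (W x) (k x)) &
  (ALL x:topspace X. ALL y:topspace X. ALL O' s. openin X O' & O' <= W x \<inter> W y & s : Sec F O' -->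
   d x y O' s = k y O' s \<ominus>[F,O'] k x O' s))}"

context
 fixes U b c
 assumes U: "point_cover X U" and b: "!!x. x : topspace X ==> Lift (U x) (b x)"
  and c: "!!x y. [| x : topspace X; y : topspace X |] ==>
   c x y = on (U x \<inter> U y) (%V s. b y V s \<ominus>[F,V] b x V s)"
begin

lemma c_apply: "[| x : topspace X; y : topspace X; openin X V; V <= U x \<inter> U y; s : Sec F V |] ==>
  c x y V s = b y V s \<ominus>[F,V] b x V s"
 using c on_apply[of X V "U x \<inter> U y" s F] by simp

lemma lift_cocycle: "(U, c) : cocycles X (TT 1)"
 unfolding cocycles_def
proof (intro CollectI case_prodI conjI ballI U)
 fix x y assume xy: "x : topspace X" "y : topspace X"
 have "on (U x \<inter> U y) (%V s. on (U x \<inter> U y) (b y) V s \<ominus>[F,V] on (U x \<inter> U y) (b x) V s) = c x y"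
  unfolding c[OF xy] by (rule on_cong) (simp add: on_apply)
 then show "c x y : Sec (TT 1) (U x \<inter> U y)"
  using Lift_diff[OF Lift_restrict[OF b[OF xy(2)]] Lift_restrict[OF b[OF xy(1)]], of "U x \<inter> U y"] by simp
 fix z assume z: "z : topspace X"
 let ?W = "U x \<inter> U y \<inter> U z"
 have "on ?W (c x z) = on ?W (%V s. on ?W (c x y) V s \<oplus>[F,V] on ?W (c y z) V s)"
 proof (rule on_cong)
  fix V s assume V: "openin X V" "V <= ?W" and s: "s : Sec F V"
  interpret V: superalgebra "sec F V" by (rule F.F_super[OF V(1)])
  have V': "V <= U x" "V <= U y" "V <= U z" "V <= U x \<inter> U y" "V <= U y \<inter> U z" "V <= U x \<inter> U z" using V(2) by auto
  note cl = Lift_closed[OF b[OF xy(1)] V(1) V'(1) s] Lift_closed[OF b[OF xy(2)] V(1) V'(2) s] Lift_closed[OF b[OF z] V(1) V'(3) s]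
  show "c x z V s = on ?W (c x y) V s \<oplus>[F,V] on ?W (c y z) V s"
   unfolding on_apply[OF V s] c_apply[OF xy(1) z V(1) V'(6) s] c_apply[OF xy V(1) V'(4) s] c_apply[OF xy(2) z V(1) V'(5) s]
   using V.diff_add_diff[OF cl(3,2,1)] cl by (simp add: V.a_comm)
 qed
 then show "let W = ?W in rst (TT 1) (U x \<inter> U z) W (c x z) =
   rst (TT 1) (U x \<inter> U y) W (c x y) \<oplus>[TT 1,W] rst (TT 1) (U y \<inter> U z) W (c y z)"
  unfolding Let_def T_ops .
qed

text \<open>With \<open>c = b y - b x\<close>, the relation \<open>c = d + (h y - h x)\<close> is
  rearranged to \<open>d = (b y - h y) - (b x - h x)\<close>, in which the corrected lifts
  \<open>b x - h x\<close> are visible.\<close>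

lemma cohomologous_eq:
 assumes hW: "ALL x:topspace X. W x <= U x \<inter> V x & h x : Sec (TT 1) (W x)"
  and dc: "(V, d) : cocycles X (TT 1)" and xy: "x : topspace X" "y : topspace X"
 shows "(let O' = W x \<inter> W y in rst (TT 1) (U x \<inter> U y) O' (c x y) = rst (TT 1) (V x \<inter> V y) O' (d x y) \<oplus>[TT 1,O']
   (rst (TT 1) (W y) O' (h y) \<ominus>[TT 1,O'] rst (TT 1) (W x) O' (h x))) \<longleftrightarrow>
  (ALL O' s. openin X O' & O' <= W x \<inter> W y & s : Sec F O' -->
   d x y O' s = (b y O' s \<ominus>[F,O'] h y O' s) \<ominus>[F,O'] (b x O' s \<ominus>[F,O'] h x O' s))"
proof -
 have h: "h x : Sec (TT 1) (W x)" and WV: "W x <= U x \<inter> V x" if "x : topspace X" for x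
  using hW that by blast+
 have d: "d x y : Sec (TT 1) (V x \<inter> V y)" if "x : topspace X" "y : topspace X" for x y
  using dc that unfolding cocycles_def by blast
 let ?O = "W x \<inter> W y"
 have hr: "on ?O (h z) : Sec (TT 1) ?O" if "z = x | z = y" for z
  by (rule tangent_restrict[OF h]) (use that xy in auto)
 have "on ?O (h y) \<ominus>[TT 1,?O] on ?O (h x) = on ?O (%V s. on ?O (h y) V s \<ominus>[F,V] on ?O (h x) V s)"
  by (rule tangent_minus) (use hr tangent_closed[OF hr] in simp_all)
 then have e: "on ?O (d x y) \<oplus>[TT 1,?O] (on ?O (h y) \<ominus>[TT 1,?O] on ?O (h x)) =
   on ?O (%V s. d x y V s \<oplus>[F,V] (h y V s \<ominus>[F,V] h x V s))"
  unfolding T_ops(3) by (simp only:) (rule on_cong, simp add: on_apply)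
 have key: "c x y O' s = d x y O' s \<oplus>[F,O'] (h y O' s \<ominus>[F,O'] h x O' s) \<longleftrightarrow>
   d x y O' s = (b y O' s \<ominus>[F,O'] h y O' s) \<ominus>[F,O'] (b x O' s \<ominus>[F,O'] h x O' s)"
  if O: "openin X O'" "O' <= ?O" "s : Sec F O'" for O' s
 proof -
  interpret V: superalgebra "sec F O'" by (rule F.F_super[OF O(1)])
  have s: "O' <= U x" "O' <= U y" "O' <= W x" "O' <= W y" "O' <= V x \<inter> V y" "O' <= U x \<inter> U y"
   using O(2) WV[OF xy(1)] WV[OF xy(2)] by auto
  have cl: "b y O' s : Sec F O'" "b x O' s : Sec F O'" "h y O' s : Sec F O'" "h x O' s : Sec F O'"
   "d x y O' s : Sec F O'"
   using Lift_closed[OF b] tangent_closed[OF h] tangent_closed[OF d] xy O s by simp_all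
  have i: "(b y O' s \<ominus>[F,O'] h y O' s) \<ominus>[F,O'] (b x O' s \<ominus>[F,O'] h x O' s) =
    c x y O' s \<ominus>[F,O'] (h y O' s \<ominus>[F,O'] h x O' s)"
   unfolding c_apply[OF xy O(1) s(6) O(3)] by (rule V.diff_exchange) (use cl in simp_all)
  have cc: "c x y O' s : Sec F O'" unfolding c_apply[OF xy O(1) s(6) O(3)] using cl by simp
  show ?thesis unfolding i
  proof
   assume e: "c x y O' s = d x y O' s \<oplus>[F,O'] (h y O' s \<ominus>[F,O'] h x O' s)"
   show "d x y O' s = c x y O' s \<ominus>[F,O'] (h y O' s \<ominus>[F,O'] h x O' s)"
    unfolding e V.a_comm[OF cl(5) V.minus_closed[OF cl(3,4)]] by (rule V.plus_diff_cancel[symmetric]) (use cl in simp_all)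
  next
   assume e: "d x y O' s = c x y O' s \<ominus>[F,O'] (h y O' s \<ominus>[F,O'] h x O' s)"
   show "c x y O' s = d x y O' s \<oplus>[F,O'] (h y O' s \<ominus>[F,O'] h x O' s)"
    unfolding V.a_comm[OF cl(5) V.minus_closed[OF cl(3,4)]] unfolding e
    by (rule V.diff_add[symmetric]) (use cl cc in simp_all)
  qed
 qed
 show ?thesis unfolding Let_def T_ops(1) e on_eq_iff
  by (intro iff_allI imp_cong refl, elim conjE, rule key)
qed

text \<open>A cochain \<open>h\<close> relating \<open>c\<close> to \<open>d\<close> turns the lifts
  \<open>b x\<close> into lifts \<open>b x - h x\<close> with differences \<open>d\<close>.
  Conversely, if \<open>d\<close> consists of differences of lifts \<open>k x\<close>, then
  \<open>b x - k x\<close> has filtration degree 1 and relates \<open>c\<close> to \<open>d\<close>.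
  The right-hand side does not mention \<open>b\<close>, so all choices of lifts give the same
  class.\<close>

lemma lift_class: "cohomology_class X (TT 1) (U, c) = euler_cocycles"
proof (intro subset_antisym subsetI)
 fix e assume "e : cohomology_class X (TT 1) (U, c)"
 then obtain V d where e: "e = (V, d)" and m: "((U, c), (V, d)) : cohomologous X (TT 1)"
  unfolding cohomology_class_def by (cases e) simp
 from m obtain W h where W: "(V, d) : cocycles X (TT 1)" "point_cover X W"
  "ALL x:topspace X. W x <= U x \<inter> V x & h x : Sec (TT 1) (W x)"
  "ALL x:topspace X. ALL y:topspace X. let O' = W x \<inter> W y in rst (TT 1) (U x \<inter> U y) O' (c x y) =
   rst (TT 1) (V x \<inter> V y) O' (d x y) \<oplus>[TT 1,O'] (rst (TT 1) (W y) O' (h y) \<ominus>[TT 1,O'] rst (TT 1) (W x) O' (h x))"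
  unfolding cohomologous_def by blast
 have hW: "h x : Sec (TT 1) (W x)" "W x <= U x \<inter> V x" if "x : topspace X" for x using W(3) that by blast+
 let ?k = "%x. on (W x) (%V s. on (W x) (b x) V s \<ominus>[F,V] h x V s)"
 have k: "Lift (W x) (?k x)" if x: "x : topspace X" for x
  by (rule Lift_minus[OF Lift_restrict[OF b[OF x]] hW(1)[OF x]]) (use hW(2)[OF x] in simp)
 have ka: "?k x O' s = b x O' s \<ominus>[F,O'] h x O' s" if "openin X O'" "O' <= W x" "s : Sec F O'" for x O' s
  unfolding on_apply[OF that] ..
 have eqs: "d x y O' s = ?k y O' s \<ominus>[F,O'] ?k x O' s"
  if xy: "x : topspace X" "y : topspace X" and O: "openin X O' & O' <= W x \<inter> W y & s : Sec F O'" for x y O' s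
 proof -
  have O': "O' <= W x" "O' <= W y" "openin X O'" "s : Sec F O'" using O by auto
  show ?thesis
   unfolding ka[OF O'(3,1,4)] ka[OF O'(3,2,4)]
   by (rule iffD1[OF cohomologous_eq[OF W(3,1) xy] bspec[OF bspec[OF W(4) xy(1)] xy(2)], rule_format, OF O])
 qed
 show "e : euler_cocycles"
  unfolding e euler_cocycles_def
  by (intro CollectI case_prodI conjI W(1) exI[of _ W] exI[of _ ?k] ballI allI impI W(2) k eqs) (use hW(2) in auto)
next
 fix e assume e': "e : euler_cocycles"
 obtain V d where e: "e = (V, d)" by (cases e)
 from e'[unfolded e euler_cocycles_def] obtain W k where W: "(V, d) : cocycles X (TT 1)" "point_cover X W"
  "ALL x:topspace X. W x <= V x & Lift (W x) (k x)"
  "ALL x:topspace X. ALL y:topspace X. ALL O' s. openin X O' & O' <= W x \<inter> W y & s : Sec F O' -->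
   d x y O' s = k y O' s \<ominus>[F,O'] k x O' s" by auto
 let ?W = "%x. W x \<inter> U x"
 let ?h = "%x. on (?W x) (%V s. on (?W x) (b x) V s \<ominus>[F,V] on (?W x) (k x) V s)"
 have k: "Lift (W x) (k x)" "W x <= V x" if "x : topspace X" for x using W(3) that by blast+
 have h: "?h x : Sec (TT 1) (?W x)" if x: "x : topspace X" for x
  by (rule Lift_diff[OF Lift_restrict[OF b[OF x]] Lift_restrict[OF k(1)[OF x]]]) simp_all
 have WV: "?W x <= U x \<inter> V x" if "x : topspace X" for x using k(2)[OF that] by auto
 have hWV: "ALL x:topspace X. ?W x <= U x \<inter> V x & ?h x : Sec (TT 1) (?W x)" using h WV by blast
 have pc: "point_cover X ?W" using W(2) U unfolding point_cover_def by auto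
 have bh: "b x O' s \<ominus>[F,O'] ?h x O' s = k x O' s"
  if x: "x : topspace X" and O: "openin X O'" "O' <= ?W x" "s : Sec F O'" for x O' s
 proof -
  interpret V: superalgebra "sec F O'" by (rule F.F_super[OF O(1)])
  have s: "O' <= W x" "O' <= U x" using O(2) by auto
  show ?thesis
   unfolding on_apply[OF O]
   by (rule V.diff_cancel[OF Lift_closed[OF b[OF x] O(1) s(2) O(3)] Lift_closed[OF k(1)[OF x] O(1) s(1) O(3)]])
 qed
 have "let O' = ?W x \<inter> ?W y in rst (TT 1) (U x \<inter> U y) O' (c x y) = rst (TT 1) (V x \<inter> V y) O' (d x y) \<oplus>[TT 1,O']
   (rst (TT 1) (?W y) O' (?h y) \<ominus>[TT 1,O'] rst (TT 1) (?W x) O' (?h x))"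
  if xy: "x : topspace X" "y : topspace X" for x y
 proof (rule iffD2[OF cohomologous_eq[OF hWV W(1) xy]], intro allI impI)
  fix O' s assume O: "openin X O' & O' <= ?W x \<inter> ?W y & s : Sec F O'"
  have O': "openin X O'" "O' <= ?W x" "O' <= ?W y" "s : Sec F O'" using O by auto
  show "d x y O' s = (b y O' s \<ominus>[F,O'] ?h y O' s) \<ominus>[F,O'] (b x O' s \<ominus>[F,O'] ?h x O' s)"
   unfolding bh[OF xy(1) O'(1,2,4)] bh[OF xy(2) O'(1,3,4)]
   by (rule bspec[OF bspec[OF W(4) xy(1)] xy(2), rule_format]) (use O in auto)
 qed
 then have "((U, c), (V, d)) : cohomologous X (TT 1)"
  unfolding cohomologous_def mem_Collect_eq prod.case
  by (intro conjI lift_cocycle W(1) exI[of _ ?W] exI[of _ ?h] pc hWV ballI)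
 then show "e : cohomology_class X (TT 1) (U, c)" unfolding cohomology_class_def e by simp
qed

end

section \<open>The Euler differential as a set of cocycles\<close>

lemma euler_lift_Lift:
 assumes E: "euler_lift U D"
 shows "Lift U (on U D)"
 unfolding Lift_def
proof
 let ?A = "%p. if p then (%V s. \<zero>[F,V]) else D"
 have DN: "D V s : N (l + 0) V" if "openin X V" "V <= U" "s : N l V" for V l s
 proof (rule der_filtration[where m = 0, OF eulerD(2)[OF E] _ _ that])
  show "D V s : N 0 V" if "openin X V" "V <= U" "s : Sec F V" for V s
   using N_0 that J_in eulerD(3)[OF E that] by simp
  show "D V s : N (Suc 0) V" if "openin X V" "V <= U" "s : J V" for V s
   using N_1 that eulerD(3)[OF E that(1,2) J_in[OF that(3)]] by simp
 qed
 have z: "sheaf_superderivation X F U True (%V s. \<zero>[F,V])"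
  by (intro sheaf_derI superalgebra.homogeneous_zero F.F_super) (simp_all add: F.F_rst_zero)
 have "parts 0 U ?A"
  unfolding parts_def all_bool_eq if_True if_False using DN z eulerD(2)[OF E] N_zero by simp
 moreover have "join U ?A = on U D"
  unfolding join_def if_True if_False
 proof (rule on_cong)
  fix V s assume V: "openin X V" "V <= U" and s: "s : Sec F V"
  interpret V: even_derivation "sec F V" "D V" by (rule eulerD(6)[OF E V])
  show "D V s \<oplus>[F,V] \<zero>[F,V] = D V s" using s by simp
 qed
 ultimately show "on U D : Sec (TT 0) U" using join_tangent by metis
 show "lifts_euler U (on U D)"
  by (rule lifts_eulerI) (simp_all add: on_apply J_in eulerD(3,4)[OF E])
qed

text \<open>The definite description in \<open>connecting_map\<close> is proper: local Euler lifts
  provide one choice of lifts, and by \<open>lift_class\<close> every choice yields the same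
  set.\<close>

lemma euler_differential_eq: "euler_differential \<XX> = euler_cocycles"
proof -
 let ?Q = "%H U b. point_cover X U & (ALL x:topspace X. b x : Sec (TT 0) (U x) &
   symbol \<XX> (U x) (b x) = rst (split_tangent_degree \<XX> 0) (topspace X) (U x) (euler_field \<XX>)) &
   H = cohomology_class X (TT 1) (U, %x y. let W = U x \<inter> U y in
    rst (TT 0) (U y) W (b y) \<ominus>[TT 0,W] rst (TT 0) (U x) W (b x))"
 have cl: "cohomology_class X (TT 1) (U, %x y. let W = U x \<inter> U y in
    rst (TT 0) (U y) W (b y) \<ominus>[TT 0,W] rst (TT 0) (U x) W (b x)) = euler_cocycles"
  if U: "point_cover X U" and b: "!!x. x : topspace X ==> Lift (U x) (b x)" for U b
 proof (rule lift_class[OF U b])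
  fix x y assume xy: "x : topspace X" "y : topspace X"
  let ?W = "U x \<inter> U y"
  note r = Lift_restrict[OF b[OF xy(1)], of ?W] Lift_restrict[OF b[OF xy(2)], of ?W]
  have "on ?W (b y) \<ominus>[TT 0,?W] on ?W (b x) = on ?W (%V s. on ?W (b y) V s \<ominus>[F,V] on ?W (b x) V s)"
   by (rule tangent_minus) (use r Lift_closed[OF r(2)] in \<open>simp_all add: Lift_def\<close>)
  also have "... = on ?W (%V s. b y V s \<ominus>[F,V] b x V s)" by (rule on_cong) (simp add: on_apply)
  finally show "(let W = ?W in rst (TT 0) (U y) W (b y) \<ominus>[TT 0,W] rst (TT 0) (U x) W (b x)) =
    on ?W (%V s. b y V s \<ominus>[F,V] b x V s)" unfolding Let_def T_ops .
 qed
 have "ALL x:topspace X. EX U D. x : U & euler_lift U D" using local_euler_lift by metis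
 then obtain U D where UD: "!!x. x : topspace X ==> x : U x" "!!x. x : topspace X ==> euler_lift (U x) (D x)" by metis
 have pc: "point_cover X U" unfolding point_cover_def using UD(1) eulerD(1)[OF UD(2)] by blast
 let ?b = "%x. on (U x) (D x)"
 have L: "Lift (U x) (?b x)" if "x : topspace X" for x by (rule euler_lift_Lift[OF UD(2)[OF that]])
 have ex: "?Q euler_cocycles U ?b"
 proof (intro conjI pc ballI cl[OF pc L, symmetric])
  fix x assume x: "x : topspace X"
  have l: "?b x : Sec (TT 0) (U x)" "lifts_euler (U x) (?b x)" using L[OF x] unfolding Lift_def by blast+
  show "?b x : Sec (TT 0) (U x)" by (rule l(1))
  show "symbol \<XX> (U x) (?b x) = rst (split_tangent_degree \<XX> 0) (topspace X) (U x) (euler_field \<XX>)"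
   by (rule iffD2[OF symbol_euler_iff[OF eulerD(1)[OF UD(2)[OF x]] l(1)] l(2)])
 qed
 have un: "H = euler_cocycles" if Q: "?Q H U b" for H U b
 proof -
  have U: "point_cover X U" by (rule conjunct1[OF Q])
  have "Lift (U x) (b x)" if x: "x : topspace X" for x
  proof -
   have o: "openin X (U x)" using U x unfolding point_cover_def by blast
   note q = bspec[OF conjunct1[OF conjunct2[OF Q]] x]
   show ?thesis unfolding Lift_def
    by (rule conjI[OF conjunct1[OF q] iffD1[OF symbol_euler_iff[OF o conjunct1[OF q]] conjunct2[OF q]]])
  qed
  from cl[OF U this] conjunct2[OF conjunct2[OF Q]] show ?thesis by simp
 qed
 have "(THE H. EX U b. ?Q H U b) = euler_cocycles"
 proof (rule the_equality)
  show "EX U b. ?Q euler_cocycles U b" by (rule exI, rule exI, rule ex)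
  fix H assume "EX U b. ?Q H U b"
  then show "H = euler_cocycles" by (elim exE) (rule un)
 qed
 then show ?thesis unfolding euler_differential_def connecting_map_def .
qed

lemma H1_zero: "\<zero>\<^bsub>H1 X (TT 1)\<^esub> = cohomology_class X (TT 1) (%x. topspace X, %x y. on (topspace X) (%V s. \<zero>[F,V]))"
 unfolding H1_def additive_group_def T_ops by simp

text \<open>A global lift may be used at every point of the constant cover; all differences are then
  zero.\<close>

lemma global_lift_zero:
 assumes E: "euler_lift (topspace X) D"
 shows "euler_differential \<XX> = \<zero>\<^bsub>H1 X (TT 1)\<^esub>"
 unfolding euler_differential_eq H1_zero
proof (rule lift_class[symmetric, of _ "%x. on (topspace X) D"])
 show "point_cover X (%x. topspace X)" unfolding point_cover_def by simp
 show "Lift (topspace X) (on (topspace X) D)" by (rule euler_lift_Lift[OF E])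
 show "on (topspace X) (%V s. \<zero>[F,V]) =
   on (topspace X \<inter> topspace X) (%V s. on (topspace X) D V s \<ominus>[F,V] on (topspace X) D V s)"
  unfolding Int_absorb
 proof (rule on_cong)
  fix V s assume V: "openin X V" "V <= topspace X" and s: "s : Sec F V"
  interpret V: superalgebra "sec F V" by (rule F.F_super[OF V(1)])
  have c: "on (topspace X) D V s : Sec F V" by (rule Lift_closed[OF euler_lift_Lift[OF E] V s])
  show "\<zero>[F,V] = on (topspace X) D V s \<ominus>[F,V] on (topspace X) D V s" using V.diff_zero_iff[OF c c] by simp
 qed
qed

text \<open>If the class is zero, the zero cocycle is one of its members. By the description of
  \<open>euler_cocycles\<close> it then consists of differences of lifts on some cover, so these
  lifts agree on overlaps.\<close>

lemma zero_lifts: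
 assumes "euler_differential \<XX> = \<zero>\<^bsub>H1 X (TT 1)\<^esub>"
 obtains W k where "point_cover X W" "!!x. x : topspace X ==> Lift (W x) (k x)"
  "!!x y O' s. [| x : topspace X; y : topspace X; openin X O'; O' <= W x; O' <= W y; s : Sec F O' |] ==>
   k x O' s = k y O' s"
proof -
 let ?z = "%U. on U (%V s. \<zero>[F,V])" and ?T = "topspace X"
 have zz: "on U (%V s. ?z U V s \<oplus>[F,V] ?z U V s) = ?z U" "on U (%V s. ?z U V s \<ominus>[F,V] ?z U V s) = ?z U" for U
 proof -
  have "?z U V s \<oplus>[F,V] ?z U V s = \<zero>[F,V] & ?z U V s \<ominus>[F,V] ?z U V s = \<zero>[F,V]"
   if V: "openin X V" "V <= U" "s : Sec F V" for V s
  proof -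
   interpret V: superalgebra "sec F V" by (rule F.F_super[OF V(1)])
   show ?thesis unfolding on_apply[OF V] by (simp add: a_minus_def)
  qed
  then show "on U (%V s. ?z U V s \<oplus>[F,V] ?z U V s) = ?z U" "on U (%V s. ?z U V s \<ominus>[F,V] ?z U V s) = ?z U"
   by (auto intro!: on_cong)
 qed
 have zr: "on ?T (?z ?T) = ?z ?T" by (rule on_cong) (simp add: on_apply)
 have zm: "?z ?T \<ominus>[TT 1,?T] ?z ?T = ?z ?T"
  using tangent_minus[of ?T "?z ?T" "?z ?T" 1] tangent_closed[OF tangent_zero] tangent_zero zz(2) by simp
 have pc: "point_cover X (%x. ?T)" unfolding point_cover_def by simp
 have c: "(%x. ?T, %x y. ?z ?T) : cocycles X (TT 1)"
  unfolding cocycles_def mem_Collect_eq prod.case Int_absorb Let_def T_ops zr zz(1) using pc tangent_zero by simp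
 \<comment> \<open>The zero cocycle is cohomologous to itself by the zero cochain, and so belongs to
   its own class.\<close>
 have "((%x. ?T, %x y. ?z ?T), (%x. ?T, %x y. ?z ?T)) : cohomologous X (TT 1)"
  unfolding cohomologous_def mem_Collect_eq prod.case
 proof (intro conjI c exI[of _ "%x. ?T"] exI[of _ "%x. ?z ?T"] pc ballI)
  show "let O' = ?T \<inter> ?T in rst (TT 1) (?T \<inter> ?T) O' (?z ?T) = rst (TT 1) (?T \<inter> ?T) O' (?z ?T) \<oplus>[TT 1,O']
    (rst (TT 1) ?T O' (?z ?T) \<ominus>[TT 1,O'] rst (TT 1) ?T O' (?z ?T))"
   unfolding Let_def Int_absorb T_ops(1) zr zm unfolding T_ops(3) zz(1) ..
 qed (simp_all add: tangent_zero)
 then have "(%x. ?T, %x y. ?z ?T) : euler_cocycles"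
  using assms unfolding euler_differential_eq H1_zero cohomology_class_def by simp
 then obtain W k where W: "point_cover X W" "ALL x:?T. W x <= ?T & Lift (W x) (k x)"
  "ALL x:?T. ALL y:?T. ALL O' s. openin X O' & O' <= W x \<inter> W y & s : Sec F O' -->
   ?z ?T O' s = k y O' s \<ominus>[F,O'] k x O' s"
  unfolding euler_cocycles_def by auto
 show thesis
 proof (rule that[OF W(1)])
  show L: "Lift (W x) (k x)" if "x : ?T" for x using W(2) that by blast
  fix x y O' s assume h: "x : ?T" "y : ?T" "openin X O'" "O' <= W x" "O' <= W y" "s : Sec F O'"
  interpret V: superalgebra "sec F O'" by (rule F.F_super[OF h(3)])
  have "?z ?T O' s = k y O' s \<ominus>[F,O'] k x O' s" using bspec[OF bspec[OF W(3) h(1)] h(2)] h by blast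
  then have "k y O' s \<ominus>[F,O'] k x O' s = \<zero>[F,O']"
   unfolding on_apply[OF h(3) openin_subset[OF h(3)] h(6)] by simp
  then show "k x O' s = k y O' s"
   using V.diff_zero_iff[OF Lift_closed[OF L[OF h(2)] h(3,5,6)] Lift_closed[OF L[OF h(1)] h(3,4,6)]] by simp
 qed
qed

end

section \<open>Splitting by a global Euler vector field\<close>

context supermanifold
begin

text \<open>\<open>E x\<close> acts on sections over subsets of \<open>W x\<close> only. Over a
  general open set the value is glued from the values of all \<open>E x\<close> on smaller sets, and
  every identity for \<open>D\<close> is checked after restriction to these.\<close>

lemma glue_euler:
 assumes pc: "point_cover X W" and E: "!!x. x : topspace X ==> euler_lift (W x) (E x)"
  and agree: "!!x y O' s. [| x : topspace X; y : topspace X; openin X O'; O' <= W x; O' <= W y; s : Sec F O' |] ==>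
   E x O' s = E y O' s"
 shows "EX D. euler_lift (topspace X) D"
proof -
 \<comment> \<open>The prescribed local value: over a set contained in some \<open>W x\<close>,
   apply \<open>E x\<close> to the restriction of \<open>s\<close>. By \<open>agree\<close> it does
   not depend on \<open>x\<close>.\<close>
 let ?Q = "%V s O' t. EX x:topspace X. O' <= W x & t = E x O' (rst F V O' s)"
 have ex1: "EX! t. t : Sec F V &
   (ALL O' u. openin X O' & O' <= V & u : Sec F O' & ?Q V s O' u --> rst F V O' t = u)"
  if V: "openin X V" and s: "s : Sec F V" for V s
 proof (rule F.glue_unique[OF V])
  fix x assume x: "x : V"
  then have xX: "x : topspace X" using openin_subset[OF V] by auto
  let ?O = "V \<inter> W x"
  have O: "openin X ?O" "?O <= V" "?O <= W x" "x : ?O" using V x xX pc unfolding point_cover_def by auto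
  have "E x ?O (rst F V ?O s) : Sec F ?O"
   by (rule J_in[OF eulerD(3)[OF E[OF xX] O(1,3) F.rst_closed[OF V O(1,2) s]]])
  then show "EX O' t. openin X O' & x : O' & O' <= V & t : Sec F O' & ?Q V s O' t" using O xX by blast
 next
  fix A A' t assume A: "openin X A" "openin X A'" "A' <= A" "A <= V" "t : Sec F A" "?Q V s A t"
  then obtain x where x: "x : topspace X" "A <= W x" "t = E x A (rst F V A s)" by blast
  have "rst F A A' t = E x A' (rst F V A' s)"
   unfolding x(3) eulerD(5)[OF E[OF x(1)] A(1,2,3) x(2) F.rst_closed[OF V A(1,4) s], symmetric]
    F.rst_rst[OF V A(1,2,3,4) s] ..
  then show "?Q V s A' (rst F A A' t)" using x(1,2) A(3) by blast
 next
  fix A t t' assume A: "openin X A" "A <= V" and t: "?Q V s A t" "?Q V s A t'"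
  from t(1) obtain x where x: "x : topspace X" "A <= W x" "t = E x A (rst F V A s)" by blast
  from t(2) obtain y where y: "y : topspace X" "A <= W y" "t' = E y A (rst F V A s)" by blast
  show "t = t'" unfolding x(3) y(3) by (rule agree[OF x(1) y(1) A(1) x(2) y(2) F.rst_closed[OF V A s]])
 qed
 define D where "D = (%V s. THE t. t : Sec F V &
   (ALL O' u. openin X O' & O' <= V & u : Sec F O' & ?Q V s O' u --> rst F V O' t = u))"
 have D0: "D V s : Sec F V &
   (ALL O' u. openin X O' & O' <= V & u : Sec F O' & ?Q V s O' u --> rst F V O' (D V s) = u)"
  if V: "openin X V" and s: "s : Sec F V" for V s
  unfolding D_def by (rule theI'[OF ex1[OF V s]])
 note Din = D0[THEN conjunct1]
 have Drst: "rst F V O' (D V s) = E x O' (rst F V O' s)"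
  if V: "openin X V" and s: "s : Sec F V" and O: "openin X O'" "O' <= V" "O' <= W x" and x: "x : topspace X" for V s O' x
 proof -
  have "E x O' (rst F V O' s) : Sec F O'"
   by (rule J_in[OF eulerD(3)[OF E[OF x] O(1,3) F.rst_closed[OF V O(1,2) s]]])
  then show ?thesis using conjunct2[OF D0[OF V s], rule_format, of O' "E x O' (rst F V O' s)"] O x by blast
 qed
 have nbh: "EX O'. openin X O' & x : O' & O' <= V & P O'"
  if V: "openin X V" "x : V" and P: "!!O'. [| openin X O'; x : O'; O' <= V; O' <= W x; x : topspace X |] ==> P O'" for V x P
 proof -
  have xX: "x : topspace X" using openin_subset[OF V(1)] V(2) by auto
  then have "openin X (V \<inter> W x)" "x : V \<inter> W x" using pc V unfolding point_cover_def by auto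
  then show ?thesis using P[of "V \<inter> W x"] xX by blast
 qed
 have "euler_lift (topspace X) D"
  unfolding euler_lift_def
 proof (intro conjI openin_topspace sheaf_derI allI impI ballI)
  fix V assume V: "openin X V" "V <= topspace X"
  interpret V: superalgebra "sec F V" by (rule F.F_super[OF V(1)])
  have der: "even_derivation (sec F O') (E x O')" if "openin X O'" "O' <= W x" "x : topspace X" for x O'
   by (rule eulerD(6)[OF E[OF that(3)] that(1,2)])
  show "homogeneous_superderivation (sec F V) False (D V)"
   unfolding homogeneous_superderivation_def
  proof (intro conjI ballI allI funcsetI image_subsetI)
   fix s assume s: "s : Sec F V"
   show "D V s : Sec F V" by (rule Din[OF V(1) s])
   show "D V (s \<oplus>[F,V] t) = D V s \<oplus>[F,V] D V t" if t: "t : Sec F V" for t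
   proof (rule F.separated[OF V(1) Din[OF V(1) V.a_closed[OF s t]] V.a_closed[OF Din[OF V(1) s] Din[OF V(1) t]]], rule nbh[OF V(1)])
    fix x O' assume O: "openin X O'" "x : O'" "O' <= V" "O' <= W x" "x : topspace X"
    interpret O: even_derivation "sec F O'" "E x O'" by (rule der[OF O(1,4,5)])
    show "rst F V O' (D V (s \<oplus>[F,V] t)) = rst F V O' (D V s \<oplus>[F,V] D V t)"
     unfolding Drst[OF V(1) V.a_closed[OF s t] O(1,3,4,5)] F.F_rst_add[OF V(1) O(1,3) s t]
      F.F_rst_add[OF V(1) O(1,3) Din[OF V(1) s] Din[OF V(1) t]] Drst[OF V(1) s O(1,3,4,5)] Drst[OF V(1) t O(1,3,4,5)]
     by (rule O.D_add[OF F.rst_closed[OF V(1) O(1,3) s] F.rst_closed[OF V(1) O(1,3) t]])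
   qed
   show "D V (c \<odot>[F,V] s) = c \<odot>[F,V] D V s" for c
   proof (rule F.separated[OF V(1) Din[OF V(1) V.sm_closed[OF s]] V.sm_closed[OF Din[OF V(1) s]]], rule nbh[OF V(1)])
    fix x O' assume O: "openin X O'" "x : O'" "O' <= V" "O' <= W x" "x : topspace X"
    interpret O: even_derivation "sec F O'" "E x O'" by (rule der[OF O(1,4,5)])
    show "rst F V O' (D V (c \<odot>[F,V] s)) = rst F V O' (c \<odot>[F,V] D V s)"
     unfolding Drst[OF V(1) V.sm_closed[OF s] O(1,3,4,5)] F.F_rst_smult[OF V(1) O(1,3) s]
      F.F_rst_smult[OF V(1) O(1,3) Din[OF V(1) s]] Drst[OF V(1) s O(1,3,4,5)]
     by (rule O.D_smult[OF F.rst_closed[OF V(1) O(1,3) s]])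
   qed
  next
   fix q s assume s: "s : Par F V q"
   note sc = V.part_carrier[OF s]
   show "D V s : Par F V (False ~= q)"
   proof (rule F.part_local[OF V(1) Din[OF V(1) sc]], rule nbh[OF V(1)])
    fix x O' assume O: "openin X O'" "x : O'" "O' <= V" "O' <= W x" "x : topspace X"
    interpret O: even_derivation "sec F O'" "E x O'" by (rule der[OF O(1,4,5)])
    show "rst F V O' (D V s) : Par F O' (False ~= q)"
     unfolding Drst[OF V(1) sc O(1,3,4,5)] using O.D_part[OF F.F_rst_part[OF V(1) O(1,3) s]] by simp
   qed
   fix t assume t: "t : Sec F V"
   have "D V (s \<otimes>[F,V] t) = D V s \<otimes>[F,V] t \<oplus>[F,V] s \<otimes>[F,V] D V t"
   proof (rule F.separated[OF V(1) Din[OF V(1) V.m_closed[OF sc t]]], goal_cases)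
    case 1
    then show ?case using Din[OF V(1) sc] Din[OF V(1) t] sc t by simp
   next
    case (2 x)
    show ?case
    proof (rule nbh[OF V(1) 2])
     fix O' assume O: "openin X O'" "x : O'" "O' <= V" "O' <= W x" "x : topspace X"
     interpret O: even_derivation "sec F O'" "E x O'" by (rule der[OF O(1,4,5)])
     note r = V(1) O(1,3)
     note D = Din[OF V(1) sc] Din[OF V(1) t]
     show "rst F V O' (D V (s \<otimes>[F,V] t)) = rst F V O' (D V s \<otimes>[F,V] t \<oplus>[F,V] s \<otimes>[F,V] D V t)"
      unfolding Drst[OF V(1) V.m_closed[OF sc t] O(1,3,4,5)] F.F_rst_mult[OF r sc t]
       F.F_rst_add[OF r V.m_closed[OF D(1) t] V.m_closed[OF sc D(2)]] F.F_rst_mult[OF r D(1) t] F.F_rst_mult[OF r sc D(2)]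
       Drst[OF V(1) sc O(1,3,4,5)] Drst[OF V(1) t O(1,3,4,5)]
      by (rule O.D_mult[OF F.rst_closed[OF r sc] F.rst_closed[OF r t]])
    qed
   qed
   then show "D V (s \<otimes>[F,V] t) = D V s \<otimes>[F,V] t \<oplus>[F,V] signed (sec F V) (False & q) (s \<otimes>[F,V] D V t)"
    by (simp add: signed_def)
  qed
  fix V' s assume V': "openin X V'" "V' <= V" and s: "s : Sec F V"
  note sr = F.rst_closed[OF V(1) V' s]
  show "D V' (rst F V V' s) = rst F V V' (D V s)"
  proof (rule F.separated[OF V'(1) Din[OF V'(1) sr] F.rst_closed[OF V(1) V' Din[OF V(1) s]]], rule nbh[OF V'(1)])
   fix x O' assume O: "openin X O'" "x : O'" "O' <= V'" "O' <= W x" "x : topspace X"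
   have OV: "O' <= V" using O V' by auto
   show "rst F V' O' (D V' (rst F V V' s)) = rst F V' O' (rst F V V' (D V s))"
    unfolding Drst[OF V'(1) sr O(1,3,4,5)] F.rst_rst[OF V(1) V'(1) O(1,3) V'(2) s]
     F.rst_rst[OF V(1) V'(1) O(1,3) V'(2) Din[OF V(1) s]] Drst[OF V(1) s O(1) OV O(4,5)] ..
  qed
 next
  fix V s assume V: "openin X V & V <= topspace X" and s: "s : Sec F V"
  then have Vo: "openin X V" by simp
  show "D V s : J V"
  proof (rule J_local[OF Vo Din[OF Vo s]], rule nbh[OF Vo])
   fix x O' assume O: "openin X O'" "x : O'" "O' <= V" "O' <= W x" "x : topspace X"
   show "rst F V O' (D V s) : J O'"
    unfolding Drst[OF Vo s O(1,3,4,5)] by (rule eulerD(3)[OF E[OF O(5)] O(1,4) F.rst_closed[OF Vo O(1,3) s]])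
  qed
 next
  fix V j assume V: "openin X V & V <= topspace X" and j: "j : J V"
  then have Vo: "openin X V" by simp
  interpret V: superalgebra "sec F V" by (rule F.F_super[OF Vo])
  note jc = J_in[OF j]
  show "D V j \<ominus>[F,V] j : N 2 V"
  proof (rule N_local[OF Vo V.minus_closed[OF Din[OF Vo jc] jc]], rule nbh[OF Vo])
   fix x O' assume O: "openin X O'" "x : O'" "O' <= V" "O' <= W x" "x : topspace X"
   show "rst F V O' (D V j \<ominus>[F,V] j) : N 2 O'"
    unfolding F.F_rst_diff[OF Vo O(1,3) Din[OF Vo jc] jc] Drst[OF Vo jc O(1,3,4,5)]
    by (rule eulerD(4)[OF E[OF O(5)] O(1,4) J_rst[OF Vo O(1,3) j]])
  qed
 qed
 then show ?thesis by blast
qed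

text \<open>The agreeing lifts may have odd parts. Their even parts are Euler lifts, since
  \<open>join_mod_J\<close> bounds the contribution of the odd parts, and they agree on overlaps
  because \<open>parts_sum\<close> expresses them through the full lifts.\<close>

lemma zero_global_lift:
 assumes "euler_differential \<XX> = \<zero>\<^bsub>H1 X (TT 1)\<^esub>"
 shows "EX D. euler_lift (topspace X) D"
proof -
 obtain W k where W: "point_cover X W" and L: "!!x. x : topspace X ==> Lift (W x) (k x)"
  and agree: "!!x y O' s. [| x : topspace X; y : topspace X; openin X O'; O' <= W x; O' <= W y; s : Sec F O' |] ==>
   k x O' s = k y O' s" by (rule zero_lifts[OF assms], rule that)
 have "ALL x:topspace X. EX A. parts 0 (W x) A & k x = join (W x) A"
  using tangent_join L unfolding Lift_def by metis
 then obtain A where A: "!!x. x : topspace X ==> parts 0 (W x) (A x)" "!!x. x : topspace X ==> k x = join (W x) (A x)"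
  by metis
 show ?thesis
 proof (rule glue_euler[OF W, of "%x. A x False"])
  fix x assume x: "x : topspace X"
  have l: "lifts_euler (W x) (k x)" using L[OF x] unfolding Lift_def by blast
  show "euler_lift (W x) (A x False)"
   unfolding euler_lift_def
  proof (intro conjI partsD(1)[OF A(1)[OF x], of False] allI impI ballI)
   show "openin X (W x)" using W x unfolding point_cover_def by blast
   fix V assume "openin X V & V <= W x"
   then have V: "openin X V" "V <= W x" by simp_all
   interpret V: superalgebra "sec F V" by (rule F.F_super[OF V(1)])
   have c: "k x V s : Sec F V" "A x False V s : Sec F V" if "s : Sec F V" for s
    by (rule Lift_closed[OF L[OF x] V that], rule partsD(3)[OF A(1)[OF x] V that])
   show "A x False V s : J V" if s: "s : Sec F V" for s
   proof -
    have "k x V s \<ominus>[F,V] A x False V s : N 1 V" "k x V s : N 1 V"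
     using join_mod_J(1)[OF A(1)[OF x] V s] lifts_eulerD(1)[OF l V s] N_1[OF V(1)] A(2)[OF x] by simp_all
    from N_diff[OF V(1) this(2,1)] show ?thesis unfolding V.diff_cancel[OF c[OF s]] N_1[OF V(1)] .
   qed
   show "A x False V j \<ominus>[F,V] j : N 2 V" if j: "j : J V" for j
   proof (rule N_eq_diff[OF V(1) c(2)[OF J_in[OF j]] c(1)[OF J_in[OF j]] J_in[OF j] _ lifts_eulerD(2)[OF l V j]])
    have "k x V j \<ominus>[F,V] A x False V j : N 2 V" using join_mod_J(2)[OF A(1)[OF x] V j] A(2)[OF x] by simp
    from N_neg[OF V(1) this] show "A x False V j \<ominus>[F,V] k x V j : N 2 V"
     unfolding V.diff_swap[OF c[OF J_in[OF j]]] .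
   qed
  qed
 next
  fix x y O' s assume h: "x : topspace X" "y : topspace X" "openin X O'" "O' <= W x" "O' <= W y" "s : Sec F O'"
  interpret V: superalgebra "sec F O'" by (rule F.F_super[OF h(3)])
  show "A x False O' s = A y False O' s"
   unfolding parts_sum[OF partsD(1)[OF A(1)[OF h(1)]] h(3,4,6)] parts_sum[OF partsD(1)[OF A(1)[OF h(2)]] h(3,5,6)]
    A(2)[OF h(1), symmetric] A(2)[OF h(2), symmetric]
    agree[OF h(1-5) V.ppart_carrier[OF h(6), of False]] agree[OF h(1-5) V.ppart_carrier[OF h(6), of True]] ..
 qed
qed

text \<open>The evaluation at the eigenlifts is itself the isomorphism with the split model, over
  the identity of the body.\<close>

lemma global_lift_split:
 assumes E: "euler_lift (topspace X) D"
 shows "split_supermanifold \<XX>"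
proof -
 interpret EV: exterior_eval X R M F "topspace X" "sig D" "lam D" by (rule euler_eval[OF E])
 have pre: "{x : topspace X. x : V} = V" if "openin X V" for V using openin_subset[OF that] by auto
 note sub = openin_subset[of X]
 have "superspace_isomorphism \<XX> (split_model \<XX>) (%x. x) EV.Phi"
  unfolding superspace_isomorphism_def Let_def split_model_def superspace.simps
 proof (intro conjI allI impI ballI)
  show "homeomorphic_map X X (%x. x)" using homeomorphic_map_id[of X X] unfolding id_def by simp
  fix V assume V: "openin X V"
  note p = pre[OF V]
  show "holomorphic_function (cdim \<XX>) (atlas \<XX>) V g =
    holomorphic_function (cdim \<XX>) (atlas \<XX>) {x : topspace X. x : V} (g \<circ> (%x. x))" for g
   unfolding p by (simp add: comp_def)
  show "superalgebra_hom (sec BM V) (sec F {x : topspace X. x : V}) (EV.Phi V)"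
   unfolding p by (rule EV.Phi_hom[OF V sub[OF V]])
  show "bij_betw (EV.Phi V) (Sec BM V) (carrier (sec F {x : topspace X. x : V}))"
   unfolding p by (rule Phi_bij[OF E V sub[OF V]])
  show "pj {x : topspace X. x : V} (EV.Phi V g) = (\<lambda>x\<in>{x : topspace X. x : V}. exterior_projection R V g x)"
   if g: "g : Sec BM V" for g
  proof -
   have "restrict (exterior_projection R V g) V = exterior_projection R V g"
    by (rule extensional_restrict) (simp add: exterior_projection_def)
   then show ?thesis unfolding p Phi_pj[OF E V sub[OF V] g] ..
  qed
 next
  fix V W g assume h: "openin X V & openin X W & W <= V" and g: "g : Sec BM V"
  then show "EV.Phi W (rst BM V W g) = rst F {x : topspace X. x : V} {x : topspace X. x : W} (EV.Phi V g)"
   using EV.Phi_rst[OF _ sub _ _ g] pre[of V] pre[of W] by simp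
 qed
 then show ?thesis unfolding split_supermanifold_def isomorphic_superspaces_def by blast
qed

text \<open>The given isomorphism may move the points of the body. \<open>transport_euler\<close>
  allows for this through the map \<open>f\<close>, and the preimage of the whole space is the whole
  space.\<close>

lemma split_global_lift:
 assumes "split_supermanifold \<XX>"
 shows "EX D. euler_lift (topspace X) D"
proof -
 obtain f \<phi> where iso: "superspace_isomorphism \<XX> (split_model \<XX>) f \<phi>"
  using assms unfolding split_supermanifold_def isomorphic_superspaces_def by blast
 let ?pre = "%V. {x : topspace X. f x : V}"
 note i = iso[unfolded superspace_isomorphism_def Let_def split_model_def superspace.simps]
 have f: "homeomorphic_map X X f" using i by (rule conjunct1)
 note i1 = conjunct1[OF conjunct2[OF i], rule_format] and i2 = conjunct2[OF conjunct2[OF i], rule_format]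
 have "ext_iso \<XX> M f ?pre (topspace X) \<phi>"
 proof (intro ext_iso.intro supermanifold_axioms M_exterior_base ext_iso_axioms.intro openin_topspace f refl)
  fix V assume V: "openin X V" "V <= topspace X"
  note j = conjunct2[OF i1[OF V(1)]]
  show "superalgebra_hom (sec BM V) (sec F (?pre V)) (\<phi> V)" by (rule conjunct1[OF j])
  show "bij_betw (\<phi> V) (Sec BM V) (Sec F (?pre V))" by (rule conjunct1[OF conjunct2[OF j]])
  show "pj (?pre V) (\<phi> V g) = (\<lambda>x\<in>?pre V. exterior_projection R V g (f x))" if "g : Sec BM V" for g
   by (rule bspec[OF conjunct2[OF conjunct2[OF j]] that])
 next
  fix V W g assume "openin X V" "openin X W" "W <= V" "g : Sec BM V"
  then show "\<phi> W (rst BM V W g) = rst F (?pre V) (?pre W) (\<phi> V g)" by (intro i2 conjI)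
 next
  fix V m n assume "openin X V" "m : Sec M V" "n : Sec M V"
  then show "\<zero>[R,V] \<odot>[M,V] m \<oplus>[M,V] n = n" by (rule M_zero_smult)
 qed
 from ext_iso.transport_euler[OF this] obtain D where D: "euler_lift (?pre (topspace X)) D" by blast
 have "?pre (topspace X) = topspace X" using homeomorphic_imp_surjective_map[OF f] by auto
 then show ?thesis using D by auto
qed

end

theorem theorem2p2p5:
  fixes \<XX> :: "('x, 'a) superspace"
  assumes "complex_supermanifold \<XX>"
  shows "split_supermanifold \<XX> \<longleftrightarrow>
    euler_differential \<XX> = \<zero>\<^bsub>H1 (body \<XX>) (tangent_filtration \<XX> 1)\<^esub>"
proof -
  interpret supermanifold \<XX> by unfold_locales (rule assms)
  show ?thesis
    using split_global_lift global_lift_zero zero_global_lift global_lift_split by blast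
qed

end
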